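(* Let $S$ be a finite set of endomorphisms of an algebraic variety $V$ over $\overline{\mathbb{Q}}$. There is an algorithm to decide, given $x\in V(\overline{\mathbb{Q}})$, whether or not $x$ is $S$-periodic.
   Context: An algebraic variety over a field is a reduced separated scheme of finite type over that field. $\overline{\mathbb{Q}}$ is an algebraic closure of $\mathbb{Q}$. Endomorphisms of $V$ are morphisms $V\to V$ over $\overline{\mathbb{Q}}$, acting on $V(\overline{\mathbb{Q}})$. Let $\langle S\rangle$ be the monoid under composition (including the identity) generated by $S$. For $x\in V(\overline{\mathbb{Q}})$, the $S$-orbit is $\mathcal{O}_S(x)=\{f(x):f\in\langle S\rangle\}$. The point $x$ is $S$-periodic if $\mathcal{O}_S(x)$ is a finite set and $\langle S\rangle$ acts on $\mathcal{O}_S(x)$ by permutations. The variety $V$, the endomorphisms in $S$, and the point $x$ are understood to be explicitly given (by finitely many affine charts, with affine overlaps, presented by finitely many polynomials with coefficients in $\overline{\mathbb{Q}}$, explicit gluing maps, and explicit polynomial descriptions of the morphisms and points). *)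

theory Defs
  imports
    "HOL-Analysis.Abstract_Topology"
    "HOL-Algebra.Ideal"
    "HOL-Library.Poly_Mapping"
    "HOL-Library.Nat_Bijection"
    "HOL-Computational_Algebra.Polynomial"
begin

section \<open>Varieties over the algebraic numbers\<close>

text \<open>The algebraic closure of the rationals inside the complex numbers.\<close>

definition Qbar :: "complex ring" where
  "Qbar = \<lparr>carrier = {z. algebraic z}, monoid.mult = (*), one = 1, zero = 0, add = (+)\<rparr>"

subsection \<open>Locally ringed spaces over Qbar\<close>

text \<open>A topological space with a presheaf of Qbar-algebras: \<open>res X U W\<close> is the restriction
  from \<open>U\<close> to \<open>W\<close>, and \<open>cst X U\<close> is the structure map from Qbar to the sections over \<open>U\<close>;
  together the latter are the structure morphism to Spec Qbar.\<close>

record ('p, 's) space =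
  topo :: "'p topology"
  sect :: "'p set \<Rightarrow> 's ring"
  res :: "'p set \<Rightarrow> 'p set \<Rightarrow> 's \<Rightarrow> 's"
  cst :: "'p set \<Rightarrow> complex \<Rightarrow> 's"

definition presheaf :: "('p, 's) space \<Rightarrow> bool" where
  "presheaf X \<longleftrightarrow>
     (\<forall>U. openin (topo X) U \<longrightarrow>
        cring (sect X U) \<and> cst X U \<in> ring_hom Qbar (sect X U)
        \<and> (\<forall>s \<in> carrier (sect X U). res X U U s = s)) \<and>
     (\<forall>U W. openin (topo X) U \<longrightarrow> openin (topo X) W \<longrightarrow> W \<subseteq> U \<longrightarrow>
        res X U W \<in> ring_hom (sect X U) (sect X W)
        \<and> (\<forall>c \<in> carrier Qbar. res X U W (cst X U c) = cst X W c)) \<and>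
     (\<forall>U W T. openin (topo X) U \<longrightarrow> openin (topo X) W \<longrightarrow> openin (topo X) T \<longrightarrow>
        W \<subseteq> U \<longrightarrow> T \<subseteq> W \<longrightarrow>
        (\<forall>s \<in> carrier (sect X U). res X W T (res X U W s) = res X U T s))"

definition sheaf :: "('p, 's) space \<Rightarrow> bool" where
  "sheaf X \<longleftrightarrow> presheaf X \<and>
     (\<forall>\<C>. (\<forall>W \<in> \<C>. openin (topo X) W) \<longrightarrow>
        (\<forall>s \<in> carrier (sect X (\<Union>\<C>)). \<forall>t \<in> carrier (sect X (\<Union>\<C>)).
           (\<forall>W \<in> \<C>. res X (\<Union>\<C>) W s = res X (\<Union>\<C>) W t) \<longrightarrow> s = t) \<and>
        (\<forall>\<sigma>. (\<forall>W \<in> \<C>. \<sigma> W \<in> carrier (sect X W)) \<longrightarrow>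
           (\<forall>W \<in> \<C>. \<forall>W' \<in> \<C>. res X W (W \<inter> W') (\<sigma> W) = res X W' (W \<inter> W') (\<sigma> W')) \<longrightarrow>
           (\<exists>s \<in> carrier (sect X (\<Union>\<C>)). \<forall>W \<in> \<C>. res X (\<Union>\<C>) W s = \<sigma> W)))"

text \<open>The germ of \<open>s\<close> at \<open>p\<close> is not invertible in the stalk; for a local stalk this says that
  it lies in the maximal ideal.\<close>

definition vanishes :: "('p, 's) space \<Rightarrow> 'p set \<Rightarrow> 'p \<Rightarrow> 's \<Rightarrow> bool" where
  "vanishes X U p s \<longleftrightarrow>
     \<not> (\<exists>W. openin (topo X) W \<and> p \<in> W \<and> W \<subseteq> U \<and> res X U W s \<in> Units (sect X W))"

text \<open>The stalk at \<open>p\<close> is local: it is nonzero and its non-units are closed under addition.\<close>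

definition locally_ringed_space :: "('p, 's) space \<Rightarrow> bool" where
  "locally_ringed_space X \<longleftrightarrow> sheaf X \<and>
     (\<forall>U p. openin (topo X) U \<longrightarrow> p \<in> U \<longrightarrow>
        vanishes X U p \<zero>\<^bsub>sect X U\<^esub> \<and>
        (\<forall>s \<in> carrier (sect X U). \<forall>t \<in> carrier (sect X U).
           vanishes X U p s \<longrightarrow> vanishes X U p t \<longrightarrow> vanishes X U p (s \<oplus>\<^bsub>sect X U\<^esub> t)))"

subsection \<open>Schemes\<close>

definition Spec :: "'s ring \<Rightarrow> 's set set" where
  "Spec R = {P. primeideal P R}"

definition zariski :: "'s ring \<Rightarrow> 's set topology" where
  "zariski R = topology_generated_by ((\<lambda>f. {P \<in> Spec R. f \<notin> P}) ` carrier R)"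

definition nonvanishing :: "('p, 's) space \<Rightarrow> 'p set \<Rightarrow> 's \<Rightarrow> 'p set" where
  "nonvanishing X U s = {p \<in> U. \<not> vanishes X U p s}"

text \<open>\<open>h : R \<rightarrow> R'\<close> exhibits \<open>R'\<close> as the localization of \<open>R\<close> at the powers of \<open>f\<close>.\<close>

definition localization_at :: "'s ring \<Rightarrow> 's \<Rightarrow> 's ring \<Rightarrow> ('s \<Rightarrow> 's) \<Rightarrow> bool" where
  "localization_at R f R' h \<longleftrightarrow>
     h \<in> ring_hom R R' \<and> h f \<in> Units R' \<and>
     (\<forall>t \<in> carrier R'. \<exists>a \<in> carrier R. \<exists>n::nat. (h f [^]\<^bsub>R'\<^esub> n) \<otimes>\<^bsub>R'\<^esub> t = h a) \<and>
     (\<forall>a \<in> carrier R. h a = \<zero>\<^bsub>R'\<^esub> \<longrightarrow> (\<exists>n::nat. (f [^]\<^bsub>R\<^esub> n) \<otimes>\<^bsub>R\<^esub> a = \<zero>\<^bsub>R\<^esub>))"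

text \<open>The canonical morphism from \<open>U\<close> to the spectrum of its ring \<open>R\<close> of global sections is an
  isomorphism: a homeomorphism on spaces, and on structure sheaves an isomorphism over each basic
  open set, the structure sheaf of Spec \<open>R\<close> being determined by its value, the localization of
  \<open>R\<close> at \<open>f\<close>, on the basic open set of \<open>f\<close>.\<close>

definition affine_open :: "('p, 's) space \<Rightarrow> 'p set \<Rightarrow> bool" where
  "affine_open X U \<longleftrightarrow> openin (topo X) U \<and>
     homeomorphic_map (subtopology (topo X) U) (zariski (sect X U))
       (\<lambda>p. {s \<in> carrier (sect X U). vanishes X U p s}) \<and>
     (\<forall>f \<in> carrier (sect X U).
        localization_at (sect X U) f (sect X (nonvanishing X U f)) (res X U (nonvanishing X U f)))"

definition scheme :: "('p, 's) space \<Rightarrow> bool" where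
  "scheme X \<longleftrightarrow> locally_ringed_space X \<and> (\<forall>p \<in> topspace (topo X). \<exists>U. p \<in> U \<and> affine_open X U)"

definition reduced :: "('p, 's) space \<Rightarrow> bool" where
  "reduced X \<longleftrightarrow>
     (\<forall>U. openin (topo X) U \<longrightarrow>
        (\<forall>s \<in> carrier (sect X U). \<forall>n::nat.
           s [^]\<^bsub>sect X U\<^esub> n = \<zero>\<^bsub>sect X U\<^esub> \<longrightarrow> s = \<zero>\<^bsub>sect X U\<^esub>))"

text \<open>The diagonal \<open>X \<rightarrow> X \<times> X\<close> is a closed immersion.  Being a closed immersion is local on the
  target, and \<open>X \<times> X\<close> is covered by the affine schemes \<open>U \<times> W\<close> with \<open>U\<close>, \<open>W\<close> affine open; over
  such a piece the diagonal is \<open>U \<inter> W \<rightarrow> U \<times> W\<close>, which is a closed immersion exactly when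
  \<open>U \<inter> W\<close> is affine and the tensor product of the rings of \<open>U\<close> and \<open>W\<close> surjects onto its ring.\<close>

definition separated :: "('p, 's) space \<Rightarrow> bool" where
  "separated X \<longleftrightarrow>
     (\<forall>U W. affine_open X U \<longrightarrow> affine_open X W \<longrightarrow>
        affine_open X (U \<inter> W) \<and>
        (\<forall>s \<in> carrier (sect X (U \<inter> W)). \<exists>(k::nat) a b.
           (\<forall>i<k. a i \<in> carrier (sect X U) \<and> b i \<in> carrier (sect X W)) \<and>
           s = (\<Oplus>\<^bsub>sect X (U \<inter> W)\<^esub>i\<in>{..<k}.
                  res X U (U \<inter> W) (a i) \<otimes>\<^bsub>sect X (U \<inter> W)\<^esub> res X W (U \<inter> W) (b i))))"

text \<open>A multivariate polynomial is a finitely supported map from exponent vectors to coefficients;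
  \<open>polys n\<close> is the polynomial ring over Qbar in the variables numbered \<open>0, \<dots>, n - 1\<close>.\<close>

type_synonym mpoly = "(nat \<Rightarrow>\<^sub>0 nat) \<Rightarrow>\<^sub>0 complex"

definition polys :: "nat \<Rightarrow> mpoly set" where
  "polys n = {P. \<forall>m \<in> Poly_Mapping.keys P.
     Poly_Mapping.keys m \<subseteq> {..<n} \<and> algebraic (Poly_Mapping.lookup P m)}"

definition poly_at ::
    "('p, 's) space \<Rightarrow> 'p set \<Rightarrow> nat \<Rightarrow> (nat \<Rightarrow> 's) \<Rightarrow> mpoly \<Rightarrow> 's" where
  "poly_at X U n y P =
     (\<Oplus>\<^bsub>sect X U\<^esub>m\<in>Poly_Mapping.keys P.
        cst X U (Poly_Mapping.lookup P m) \<otimes>\<^bsub>sect X U\<^esub>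
        (\<Otimes>\<^bsub>sect X U\<^esub>l\<in>{..<n}. y l [^]\<^bsub>sect X U\<^esub> Poly_Mapping.lookup m l))"

definition algebra_generators :: "('p, 's) space \<Rightarrow> 'p set \<Rightarrow> nat \<Rightarrow> (nat \<Rightarrow> 's) \<Rightarrow> bool" where
  "algebra_generators X U n y \<longleftrightarrow>
     (\<forall>l<n. y l \<in> carrier (sect X U)) \<and>
     (\<forall>s \<in> carrier (sect X U). \<exists>P \<in> polys n. s = poly_at X U n y P)"

definition finite_type :: "('p, 's) space \<Rightarrow> bool" where
  "finite_type X \<longleftrightarrow>
     (\<exists>\<C>. finite \<C> \<and> \<Union>\<C> = topspace (topo X) \<and>
        (\<forall>U \<in> \<C>. affine_open X U \<and> (\<exists>n y. algebra_generators X U n y)))"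

definition variety :: "('p, 's) space \<Rightarrow> bool" where
  "variety X \<longleftrightarrow> scheme X \<and> reduced X \<and> separated X \<and> finite_type X"

subsection \<open>Rational points and endomorphisms\<close>

text \<open>\<open>X(Qbar)\<close>: a morphism Spec Qbar \<open>\<rightarrow> X\<close> over Qbar is a point whose residue field is Qbar,
  that is, a point at which every germ is congruent to a constant modulo the maximal ideal.\<close>

definition rational_points :: "('p, 's) space \<Rightarrow> 'p set" where
  "rational_points X =
     {p \<in> topspace (topo X). \<forall>U. openin (topo X) U \<longrightarrow> p \<in> U \<longrightarrow>
        (\<forall>s \<in> carrier (sect X U). \<exists>c \<in> carrier Qbar.
           vanishes X U p (s \<ominus>\<^bsub>sect X U\<^esub> cst X U c))}"

text \<open>A morphism consists of a map on points and, for each open \<open>U\<close>, a map from the sections over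
  \<open>U\<close> to the sections over the preimage of \<open>U\<close>.\<close>

type_synonym ('p, 's) mor = "('p \<Rightarrow> 'p) \<times> ('p set \<Rightarrow> 's \<Rightarrow> 's)"

definition preim :: "('p, 's) space \<Rightarrow> ('p, 's) mor \<Rightarrow> 'p set \<Rightarrow> 'p set" where
  "preim X f U = {p \<in> topspace (topo X). fst f p \<in> U}"

definition endomorphism :: "('p, 's) space \<Rightarrow> ('p, 's) mor \<Rightarrow> bool" where
  "endomorphism X f \<longleftrightarrow>
     continuous_map (topo X) (topo X) (fst f) \<and>
     (\<forall>U. openin (topo X) U \<longrightarrow>
        snd f U \<in> ring_hom (sect X U) (sect X (preim X f U)) \<and>
        (\<forall>c \<in> carrier Qbar. snd f U (cst X U c) = cst X (preim X f U) c)) \<and>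
     (\<forall>U W. openin (topo X) U \<longrightarrow> openin (topo X) W \<longrightarrow> W \<subseteq> U \<longrightarrow>
        (\<forall>s \<in> carrier (sect X U).
           res X (preim X f U) (preim X f W) (snd f U s) = snd f W (res X U W s))) \<and>
     (\<forall>U p. openin (topo X) U \<longrightarrow> p \<in> preim X f U \<longrightarrow>
        (\<forall>s \<in> carrier (sect X U).
           vanishes X U (fst f p) s \<longrightarrow> vanishes X (preim X f U) p (snd f U s)))"

definition id_mor :: "('p, 's) mor" where
  "id_mor = (\<lambda>p. p, \<lambda>U s. s)"

definition comp_mor :: "('p, 's) space \<Rightarrow> ('p, 's) mor \<Rightarrow> ('p, 's) mor \<Rightarrow> ('p, 's) mor" where
  "comp_mor X f g = (\<lambda>p. fst f (fst g p), \<lambda>U s. snd g (preim X f U) (snd f U s))"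

inductive_set generated_monoid :: "('p, 's) space \<Rightarrow> ('p, 's) mor set \<Rightarrow> ('p, 's) mor set"
  for X :: "('p, 's) space" and S :: "('p, 's) mor set" where
  one: "id_mor \<in> generated_monoid X S"
| gen: "f \<in> S \<Longrightarrow> f \<in> generated_monoid X S"
| comp: "f \<in> generated_monoid X S \<Longrightarrow> g \<in> generated_monoid X S \<Longrightarrow>
    comp_mor X f g \<in> generated_monoid X S"

definition orbit :: "('p, 's) space \<Rightarrow> ('p, 's) mor set \<Rightarrow> 'p \<Rightarrow> 'p set" where
  "orbit X S x = {fst f x | f. f \<in> generated_monoid X S}"

definition periodic :: "('p, 's) space \<Rightarrow> ('p, 's) mor set \<Rightarrow> 'p \<Rightarrow> bool" where
  "periodic X S x \<longleftrightarrow>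
     finite (orbit X S x) \<and>
     (\<forall>f \<in> generated_monoid X S. bij_betw (fst f) (orbit X S x) (orbit X S x))"

section \<open>Explicit presentations\<close>

text \<open>An algebraic number is given by an integer polynomial together with the centre and the radius
  of a rational open disc that contains exactly one complex root of it.\<close>

type_synonym alg_num = "int poly \<times> rat \<times> rat \<times> rat"

fun isolates :: "alg_num \<Rightarrow> complex \<Rightarrow> bool" where
  "isolates (p, a, b, r) z \<longleftrightarrow>
     p \<noteq> 0 \<and>
     {w. poly (map_poly of_int p) w = 0 \<and> cmod (w - Complex (of_rat a) (of_rat b)) < of_rat r} = {z}"

definition num_value :: "alg_num \<Rightarrow> complex" where
  "num_value c = (THE z. isolates c z)"

text \<open>A polynomial is given as a list of terms, each with its coefficient and its exponents.\<close>

type_synonym alg_poly = "(alg_num \<times> nat list) list"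

definition well_formed_poly :: "nat \<Rightarrow> alg_poly \<Rightarrow> bool" where
  "well_formed_poly n P \<longleftrightarrow> (\<forall>(c, e) \<in> set P. (\<exists>z. isolates c z) \<and> length e = n)"

definition poly_value :: "alg_poly \<Rightarrow> mpoly" where
  "poly_value P = (\<Sum>(c, e)\<leftarrow>P. Poly_Mapping.single (Poly_Mapping.nth e) (num_value c))"

text \<open>
  \<^item> \<open>Chart n F\<close>: the closed subscheme of affine \<open>n\<close>-space cut out by the ideal generated by \<open>F\<close>.
  \<^item> \<open>Overlap C G H\<close>: the overlap of two charts is the affine scheme \<open>C\<close>, included in
    the first and in the second chart by the polynomial maps \<open>G\<close> and \<open>H\<close>.
  \<^item> \<open>Piece h j P\<close>: a part of a morphism, given where \<open>h \<noteq> 0\<close> by the functions \<open>P / h\<close>,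
    with values in chart \<open>j\<close>.
  \<^item> \<open>Problem Cs Os Fs i a\<close>: the charts, the matrix of their overlaps, for each endomorphism and
    each chart the list of pieces of the endomorphism on this chart, and a point, by its
    coordinates \<open>a\<close> in chart \<open>i\<close>.
\<close>

datatype chart = Chart nat "alg_poly list"
datatype overlap = Overlap chart "alg_poly list" "alg_poly list"
datatype piece = Piece alg_poly nat "alg_poly list"
datatype problem =
  Problem "chart list" "overlap list list" "piece list list list" nat "alg_num list"

fun dim :: "chart \<Rightarrow> nat" where
  "dim (Chart n F) = n"

definition poly_ideal :: "nat \<Rightarrow> mpoly list \<Rightarrow> mpoly set" where
  "poly_ideal n F = {(\<Sum>i<length F. q i * F ! i) | q. \<forall>i<length F. q i \<in> polys n}"

text \<open>The functions \<open>y\<close> induce an isomorphism from the polynomial ring modulo the ideal generated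
  by \<open>F\<close> to the ring of \<open>U\<close>.\<close>

fun presents_chart :: "('p, 's) space \<Rightarrow> 'p set \<Rightarrow> (nat \<Rightarrow> 's) \<Rightarrow> chart \<Rightarrow> bool" where
  "presents_chart X U y (Chart n F) \<longleftrightarrow>
     affine_open X U \<and> algebra_generators X U n y \<and>
     (\<forall>P \<in> set F. well_formed_poly n P) \<and>
     (\<forall>P \<in> polys n.
        poly_at X U n y P = \<zero>\<^bsub>sect X U\<^esub> \<longleftrightarrow> P \<in> poly_ideal n (map poly_value F))"

text \<open>Here \<open>(U, y, n)\<close> and \<open>(U', y', n')\<close> are the two charts, with their coordinate functions.\<close>

fun presents_overlap :: "('p, 's) space \<Rightarrow> 'p set \<times> (nat \<Rightarrow> 's) \<times> nat \<Rightarrow>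
    'p set \<times> (nat \<Rightarrow> 's) \<times> nat \<Rightarrow> overlap \<Rightarrow> bool" where
  "presents_overlap X (U, y, n) (U', y', n') (Overlap C G H) \<longleftrightarrow>
     (\<exists>z. presents_chart X (U \<inter> U') z C \<and>
        length G = n \<and> length H = n' \<and>
        (\<forall>P \<in> set G \<union> set H. well_formed_poly (dim C) P) \<and>
        (\<forall>l<n. res X U (U \<inter> U') (y l) = poly_at X (U \<inter> U') (dim C) z (poly_value (G ! l))) \<and>
        (\<forall>l<n'. res X U' (U \<inter> U') (y' l) = poly_at X (U \<inter> U') (dim C) z (poly_value (H ! l))))"

definition presents_variety :: "('p, 's) space \<Rightarrow> (nat \<Rightarrow> 'p set) \<Rightarrow> (nat \<Rightarrow> nat \<Rightarrow> 's) \<Rightarrow>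
    chart list \<Rightarrow> overlap list list \<Rightarrow> bool" where
  "presents_variety X U y Cs Os \<longleftrightarrow>
     (\<Union>i<length Cs. U i) = topspace (topo X) \<and>
     (\<forall>i<length Cs. presents_chart X (U i) (y i) (Cs ! i)) \<and>
     length Os = length Cs \<and>
     (\<forall>i<length Cs. length (Os ! i) = length Cs \<and>
        (\<forall>j<length Cs.
           presents_overlap X (U i, y i, dim (Cs ! i)) (U j, y j, dim (Cs ! j)) (Os ! i ! j)))"

definition presents_endomorphism :: "('p, 's) space \<Rightarrow> (nat \<Rightarrow> 'p set) \<Rightarrow>
    (nat \<Rightarrow> nat \<Rightarrow> 's) \<Rightarrow> chart list \<Rightarrow> piece list list \<Rightarrow> ('p, 's) mor \<Rightarrow> bool" where
  "presents_endomorphism X U y Cs Ps f \<longleftrightarrow>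
     length Ps = length Cs \<and>
     (\<forall>i<length Cs.
        let n = dim (Cs ! i);
            val = (\<lambda>P. poly_at X (U i) n (y i) (poly_value P));
            D = (\<lambda>h. nonvanishing X (U i) (val h))
        in (\<Union>Q \<in> set (Ps ! i). case Q of Piece h j P \<Rightarrow> D h) = U i \<and>
           (\<forall>h j P. Piece h j P \<in> set (Ps ! i) \<longrightarrow>
              j < length Cs \<and> length P = dim (Cs ! j) \<and>
              well_formed_poly n h \<and> (\<forall>g \<in> set P. well_formed_poly n g) \<and>
              D h \<subseteq> preim X f (U j) \<and>
              (\<forall>l<length P.
                 res X (U i) (D h) (val h) \<otimes>\<^bsub>sect X (D h)\<^esub>
                   res X (preim X f (U j)) (D h) (snd f (U j) (y j l))
                 = res X (U i) (D h) (val (P ! l)))))"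

definition presents_point :: "('p, 's) space \<Rightarrow> (nat \<Rightarrow> 'p set) \<Rightarrow> (nat \<Rightarrow> nat \<Rightarrow> 's) \<Rightarrow>
    chart list \<Rightarrow> nat \<Rightarrow> alg_num list \<Rightarrow> 'p \<Rightarrow> bool" where
  "presents_point X U y Cs i a x \<longleftrightarrow>
     i < length Cs \<and> x \<in> U i \<and> length a = dim (Cs ! i) \<and>
     (\<forall>l<length a. (\<exists>z. isolates (a ! l) z) \<and>
        vanishes X (U i) x (y i l \<ominus>\<^bsub>sect X (U i)\<^esub> cst X (U i) (num_value (a ! l))))"

fun presents :: "problem \<Rightarrow> ('p, 's) space \<Rightarrow> ('p, 's) mor set \<Rightarrow> 'p \<Rightarrow> bool" where
  "presents (Problem Cs Os Fs i a) X S x \<longleftrightarrow>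
     (\<exists>U y fs.
        presents_variety X U y Cs Os \<and>
        S = set fs \<and> list_all2 (presents_endomorphism X U y Cs) Fs fs \<and>
        presents_point X U y Cs i a x)"

section \<open>Algorithms\<close>

subsection \<open>Inputs as natural numbers\<close>

definition encode_list :: "('a \<Rightarrow> nat) \<Rightarrow> 'a list \<Rightarrow> nat" where
  "encode_list enc xs = list_encode (map enc xs)"

definition encode_rat :: "rat \<Rightarrow> nat" where
  "encode_rat r = prod_encode (int_encode (fst (quotient_of r)), nat (snd (quotient_of r)))"

fun encode_num :: "alg_num \<Rightarrow> nat" where
  "encode_num (p, a, b, r) = list_encode
     [encode_list int_encode (coeffs p), encode_rat a, encode_rat b, encode_rat r]"

definition encode_poly :: "alg_poly \<Rightarrow> nat" where
  "encode_poly = encode_list (\<lambda>(c, e). prod_encode (encode_num c, list_encode e))"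

fun encode_chart :: "chart \<Rightarrow> nat" where
  "encode_chart (Chart n F) = prod_encode (n, encode_list encode_poly F)"

fun encode_overlap :: "overlap \<Rightarrow> nat" where
  "encode_overlap (Overlap C G H) = list_encode
     [encode_chart C, encode_list encode_poly G, encode_list encode_poly H]"

fun encode_piece :: "piece \<Rightarrow> nat" where
  "encode_piece (Piece h j P) = list_encode [encode_poly h, j, encode_list encode_poly P]"

fun encode_problem :: "problem \<Rightarrow> nat" where
  "encode_problem (Problem Cs Os Fs i a) = list_encode
     [encode_list encode_chart Cs,
      encode_list (encode_list encode_overlap) Os,
      encode_list (encode_list (encode_list encode_piece)) Fs,
      i,
      encode_list encode_num a]"

subsection \<open>Partial recursive functions\<close>

text \<open>Kleene's schemes: zero, successor, projections, composition, primitive recursion on the first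
  argument, and unbounded minimization over the first argument.\<close>

datatype recf = Zero | Succ | Proj nat | Comp recf "recf list" | Prim recf recf | Mu recf

text \<open>\<open>computes f xs y\<close>: on arguments \<open>xs\<close> the program \<open>f\<close> halts with result \<open>y\<close>.\<close>

inductive computes :: "recf \<Rightarrow> nat list \<Rightarrow> nat \<Rightarrow> bool" where
  zero: "computes Zero xs 0"
| succ: "computes Succ (x # xs) (Suc x)"
| proj: "i < length xs \<Longrightarrow> computes (Proj i) xs (xs ! i)"
| comp: "list_all2 (\<lambda>g y. computes g xs y) gs ys \<Longrightarrow> computes f ys z \<Longrightarrow>
    computes (Comp f gs) xs z"
| prim_0: "computes f xs z \<Longrightarrow> computes (Prim f g) (0 # xs) z"
| prim_Suc: "computes (Prim f g) (n # xs) y \<Longrightarrow> computes g (n # y # xs) z \<Longrightarrow>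
    computes (Prim f g) (Suc n # xs) z"
| mu: "computes f (n # xs) 0 \<Longrightarrow> (\<And>m. m < n \<Longrightarrow> \<exists>y. computes f (m # xs) (Suc y)) \<Longrightarrow>
    computes (Mu f) xs n"

end

theory Submission
 imports Defs "HOL-Computational_Algebra.Fundamental_Theorem_Algebra" "HOL-Computational_Algebra.Primes"
begin

text \<open>
 Two searches run in parallel, one for a certificate that the point is periodic and one for a
 certificate that it is not; exactly one of them ends.  So it suffices that both properties are
 recursively enumerable on the codes of presentations (\<open>decide_by_parallel_search\<close>).

 A certificate contains elements of a number field \<open>K = Q(th)\<close>.  They are polynomial expressions in
 \<open>th\<close>, and that such an expression vanishes is certified by an identity with a multiple of a
 polynomial \<open>f\<close> with root \<open>th\<close>.  This is sound for every root and complete if \<open>f\<close> is minimal, so that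
 irreducibility of \<open>f\<close> is never tested.  An approximation to \<open>th\<close> ties the algebraic numbers of the
 presentation, which are isolated by discs, to elements of \<open>K\<close>.  By the theorem of the primitive
 element some \<open>th\<close> serves for any finite set of numbers that a proof needs.

 The scheme is used through coordinates of rational points only.  Coordinates in a chart determine
 the point, and the pieces of an endomorphism map coordinates to coordinates.  Two points in two
 charts are equal if a point of the overlap has both lists of coordinates; if they are different,
 the equations of such a point generate the unit ideal, since otherwise a maximal ideal above them
 would be a point of the overlap.  Hence equality and inequality of points both have finite
 certificates.

 The point is periodic if and only if its orbit is finite and every generator is injective on it.
 The first certificate is therefore a finite list of states that is closed under the generators, with
 a proof that they act injectively.  The second one is either a pair of different points of
 the orbit with the same image, or a proof that the orbit has more points than any finite orbit with
 injective generators can have.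

 That there is a computable bound for such orbits is the heart of the matter (\<open>kbound_sound\<close>).
 Let the prime \<open>p\<close> divide no denominator that occurs, and extend the localization of the
 integers at \<open>p\<close> to a valuation ring of the complex numbers.  All points of the orbit have integral
 coordinates, and the generators act on their residues and on tangent vectors at the residues.  If
 two words act in the same way on tangent vectors, then on the orbit they differ by a permutation
 that is the identity modulo \<open>p\<close> to first order, and the order of such a permutation is a power of \<open>p\<close>, as in the
 kernel of the reduction of \<open>GL_n\<close> modulo \<open>p\<close>.  With two primes the order is a power of
 both, so that the permutation is trivial.  Hence the orbit has at most as many points as there are
 pairs of actions on the two finite sets of tangent vectors.
\<close>

section \<open>Partial recursive programs\<close>

lemma computes_deterministic: "computes f xs y ==> computes f xs z ==> y = z"
proof (induction f xs y arbitrary: z rule: computes.induct)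
 case (comp xs gs ys f v)
 from comp.prems obtain ys' where ys': "list_all2 (%g y. computes g xs y) gs ys'" "computes f ys' z"
  by (cases rule: computes.cases) auto
 have "ys = ys'"
 proof (rule nth_equalityI)
  show "length ys = length ys'" using list_all2_lengthD[OF comp.IH(1)] list_all2_lengthD[OF ys'(1)] by simp
  show "ys ! i = ys' ! i" if "i < length ys" for i
  proof -
  have "i < length gs" using that list_all2_lengthD[OF comp.IH(1)] by simp
  then show ?thesis using comp.IH(1) ys'(1) that by (auto simp: list_all2_conv_all_nth)
  qed
 qed
 then show ?case using comp.IH(2) ys'(2) by simp
next
 case (prim_0 f xs v g)
 from prim_0.prems show ?case by (cases rule: computes.cases) (auto intro: prim_0.IH)
next
 case (prim_Suc f g n xs y v)
 from prim_Suc.prems obtain y' where "computes (Prim f g) (n # xs) y'" "computes g (n # y' # xs) z"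
  by (cases rule: computes.cases) auto
 then show ?case using prim_Suc.IH by metis
next
 case (mu f n xs)
 from mu.prems have z: "computes f (z # xs) 0" "!!m. m < z ==> EX y. computes f (m # xs) (Suc y)"
  by (cases rule: computes.cases; auto)+
 have "~ n < z" using z(2)[of n] mu.IH(1) by fastforce
 moreover have "~ z < n" using mu.IH(2)[of z] z(1) by fastforce
 ultimately show ?case by simp
qed (auto elim: computes.cases)

text \<open>Total functions of \<open>k\<close> arguments.\<close>

definition crec :: "nat => (nat list => nat) => bool" where
 "crec k F \<longleftrightarrow> (EX f. ALL xs. length xs = k --> computes f xs (F xs))"

lemma crec_cong: "crec k F ==> (!!xs. length xs = k ==> F xs = G xs) ==> crec k G"
 unfolding crec_def by metis

lemma crec_nth: "i < k ==> crec k (%xs. xs ! i)"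
 unfolding crec_def using computes.proj by blast

lemma crec_Suc: "crec k F ==> crec k (%xs. Suc (F xs))"
proof -
 assume "crec k F"
 then obtain f where f: "!!xs. length xs = k ==> computes f xs (F xs)" unfolding crec_def by auto
 have "computes (Comp Succ [f]) xs (Suc (F xs))" if "length xs = k" for xs
  by (rule computes.comp[of _ _ "[F xs]"]) (auto simp: f that intro: computes.succ)
 then show ?thesis unfolding crec_def by blast
qed

lemma crec_const: "crec k (%xs. c)"
proof (induction c)
 case 0
 then show ?case unfolding crec_def using computes.zero by blast
qed (rule crec_Suc)

lemma crec_comp:
 assumes "crec (length Fs) G" "!!F. F : set Fs ==> crec k F"
 shows "crec k (%xs. G (map (%F. F xs) Fs))"
proof -
 from assms(1) obtain g where g: "!!xs. length xs = length Fs ==> computes g xs (G xs)"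
  unfolding crec_def by auto
 have "ALL F:set Fs. EX f. ALL xs. length xs = k --> computes f xs (F xs)"
  using assms(2) unfolding crec_def by auto
 then obtain f where f: "!!F xs. F : set Fs ==> length xs = k ==> computes (f F) xs (F xs)" by metis
 have "computes (Comp g (map f Fs)) xs (G (map (%F. F xs) Fs))" if "length xs = k" for xs
  by (rule computes.comp[of _ _ "map (%F. F xs) Fs"])
  (auto simp: list_all2_conv_all_nth f that g)
 then show ?thesis unfolding crec_def by blast
qed

definition C1 :: "(nat => nat) => bool" where "C1 f \<longleftrightarrow> crec 1 (%xs. f (xs ! 0))"
definition C2 :: "(nat => nat => nat) => bool" where
 "C2 f \<longleftrightarrow> crec 2 (%xs. f (xs ! 0) (xs ! 1))"
definition C3 :: "(nat => nat => nat => nat) => bool" where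
 "C3 f \<longleftrightarrow> crec 3 (%xs. f (xs ! 0) (xs ! 1) (xs ! 2))"

lemma crec_C1: "C1 f ==> crec k F ==> crec k (%xs. f (F xs))"
 unfolding C1_def using crec_comp[of "[F]" "%xs. f (xs ! 0)" k] by simp

lemma crec_C2: "C2 f ==> crec k F ==> crec k G ==> crec k (%xs. f (F xs) (G xs))"
 unfolding C2_def using crec_comp[of "[F, G]" "%xs. f (xs ! 0) (xs ! 1)" k] by (auto simp: numeral_2_eq_2)

lemma crec_C3: "C3 f ==> crec k F ==> crec k G ==> crec k H ==>
  crec k (%xs. f (F xs) (G xs) (H xs))"
 unfolding C3_def using crec_comp[of "[F, G, H]" "%xs. f (xs ! 0) (xs ! 1) (xs ! 2)" k] by (auto simp: numeral_3_eq_3 numeral_2_eq_2)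

lemma crec_prim:
 assumes "crec k F" "crec (Suc (Suc k)) G"
 shows "crec (Suc k) (%xs. rec_nat (F (tl xs)) (%n y. G (n # y # tl xs)) (hd xs))"
proof -
 from assms obtain f g where f: "!!xs. length xs = k ==> computes f xs (F xs)"
  and g: "!!xs. length xs = Suc (Suc k) ==> computes g xs (G xs)" unfolding crec_def by auto
 have *: "computes (Prim f g) (n # xs) (rec_nat (F xs) (%n y. G (n # y # xs)) n)"
  if "length xs = k" for n xs
  by (induction n) (auto intro!: computes.prim_0 f that computes.prim_Suc g)
 have "computes (Prim f g) xs (rec_nat (F (tl xs)) (%n y. G (n # y # tl xs)) (hd xs))"
  if "length xs = Suc k" for xs
  using *[of "tl xs" "hd xs"] that by (cases xs) auto
 then show ?thesis unfolding crec_def by blast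
qed

lemma C1_rec: "C2 g ==> C1 (rec_nat c g)"
proof -
 assume g: "C2 g"
 have "crec (Suc (Suc 0)) (%xs. g (xs ! 0) (xs ! 1))" using g unfolding C2_def by (simp add: numeral_2_eq_2)
 from crec_prim[OF crec_const this, of c] show ?thesis
  unfolding C1_def by (auto elim!: crec_cong simp: length_Suc_conv hd_conv_nth)
qed

lemma C2_rec: "C1 f ==> C3 g ==> C2 (%n x. rec_nat (f x) (%m y. g m y x) n)"
proof -
 assume f: "C1 f" and g: "C3 g"
 have "crec (Suc (Suc 1)) (%xs. g (xs ! 0) (xs ! 1) (xs ! 2))" using g unfolding C3_def
  by (simp add: numeral_3_eq_3)
 moreover have "crec 1 (%xs. f (xs ! 0))" using f unfolding C1_def .
 ultimately have "crec (Suc 1) (%xs. rec_nat (f (tl xs ! 0)) (%n y. g n y (tl xs ! 0)) (hd xs))"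
  using crec_prim[of 1 "%xs. f (xs ! 0)" "%xs. g (xs ! 0) (xs ! 1) (xs ! 2)"] by simp
 then show ?thesis
  unfolding C2_def numeral_2_eq_2 by (auto elim!: crec_cong simp: length_Suc_conv hd_conv_nth)
qed

lemma C1I: "crec 1 (%xs. f (xs ! 0)) ==> C1 f" unfolding C1_def .
lemma C2I: "crec 2 (%xs. f (xs ! 0) (xs ! 1)) ==> C2 f" unfolding C2_def .
lemma C3I: "crec 3 (%xs. f (xs ! 0) (xs ! 1) (xs ! 2)) ==> C3 f" unfolding C3_def .

lemma C1_eq: "C1 f ==> (!!x. f x = g x) ==> C1 g" by (metis ext)
lemmas crec_rules = crec_const crec_nth crec_Suc

lemma C2_add: "C2 (+)"
proof -
 have "C2 (%n x. rec_nat x (%m y. Suc y) n)"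
  by (rule C2_rec) (auto intro!: C1I C3I crec_rules)
 moreover have "rec_nat x (%m y. Suc y) n = n + x" for n x by (induction n) auto
 ultimately show ?thesis by simp
qed

lemma C1_pred: "C1 (%x. x - 1)"
proof -
 have "C1 (rec_nat 0 (%n y. n))" by (rule C1_rec) (auto intro!: C2I crec_rules)
 moreover have "rec_nat 0 (%n y. n) n = n - 1" for n by (induction n) auto
 ultimately show ?thesis by (rule C1_eq)
qed

lemma C2_diff: "C2 (%x y. x - y)"
proof -
 have "C2 (%n x. rec_nat x (%m y. y - 1) n)"
  by (rule C2_rec) (auto intro!: C1I C3I crec_rules crec_C1[OF C1_pred, simplified])
 moreover have "rec_nat x (%m y. y - 1) n = x - n" for n x by (induction n) auto
 ultimately have "C2 (%n x. x - n)" by simp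
 then have "crec 2 (%xs. (xs ! 0) - (xs ! 1))"
  by (rule crec_C2[where F = "%xs. xs ! 1" and G = "%xs. xs ! 0"]) (auto intro!: crec_rules)
 then show ?thesis by (rule C2I)
qed

lemma C2_mult: "C2 (*)"
proof -
 have "C2 (%n x. rec_nat 0 (%m y. y + x) n)"
  by (rule C2_rec) (auto intro!: C1I C3I crec_rules crec_C2[OF C2_add])
 moreover have "rec_nat 0 (%m y. y + x) n = n * x" for n x by (induction n) auto
 ultimately show ?thesis by simp
qed

lemma C3_cond: "C3 (%c x y. if c = 0 then x else y)"
proof -
 have "crec (Suc 2) (%xs. rec_nat (tl xs ! 0) (%n y. (n # y # tl xs) ! 3) (hd xs))"
  by (rule crec_prim[where F = "%xs. xs ! 0" and G = "%xs. xs ! 3"]) (auto intro!: crec_rules)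
 then show ?thesis unfolding C3_def numeral_3_eq_3 numeral_2_eq_2
  apply (rule crec_cong)
  subgoal for xs by (cases "xs ! 0") (auto simp: length_Suc_conv hd_conv_nth)
  done
qed

lemma C2_eq01: "C2 (%x y. if x = y then 1 else 0)"
proof -
 have "crec 2 (%xs. if (xs!0 - xs!1) + (xs!1 - xs!0) = 0 then (1::nat) else 0)"
  by (intro crec_C3[OF C3_cond] crec_C2[OF C2_add] crec_C2[OF C2_diff] crec_rules) auto
 then show ?thesis by (intro C2I) (auto elim!: crec_cong)
qed

lemma C1_triangle: "C1 triangle"
proof -
 have "C1 (rec_nat 0 (%n y. y + Suc n))"
  by (rule C1_rec) (auto intro!: C2I crec_rules crec_C2[OF C2_add] simp del: add_Suc_right)
 moreover have "rec_nat 0 (%n y. y + Suc n) n = triangle n" for n by (induction n) auto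
 ultimately show ?thesis by (rule C1_eq)
qed

lemma C2_pair: "C2 (%x y. prod_encode (x, y))"
 unfolding prod_encode_def
 by (auto intro!: C2I crec_C2[OF C2_add] crec_C1[OF C1_triangle] crec_rules)

definition troot :: "nat => nat" where
 "troot = rec_nat 0 (%n y. y + (if triangle (Suc y) = Suc n then 1 else 0))"

lemma troot_bounds: "triangle (troot n) <= n & n < triangle (Suc (troot n))"
proof (induction n)
 case 0
 then show ?case by (simp add: troot_def)
next
 case (Suc n)
 have "troot (Suc n) = troot n + (if triangle (Suc (troot n)) = Suc n then 1 else 0)"
  by (simp add: troot_def)
 then show ?case using Suc by auto
qed

lemma C1_troot: "C1 troot"
 unfolding troot_def
 by (rule C1_rec, intro C2I crec_C2[OF C2_add] crec_C2[OF C2_eq01] crec_C1[OF C1_triangle] crec_rules)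
  simp_all

lemma triangle_mono: "m <= n ==> triangle m <= triangle n"
 by (rule lift_Suc_mono_le) auto

lemma troot_prod_encode: "troot (prod_encode (a, b)) = a + b"
proof -
 let ?n = "prod_encode (a, b)"
 have 1: "triangle (a + b) <= ?n" "?n < triangle (Suc (a + b))" by (auto simp: prod_encode_def)
 have "~ Suc (troot ?n) <= a + b" "~ Suc (a + b) <= troot ?n"
  using triangle_mono[of "Suc (troot ?n)" "a + b"] triangle_mono[of "Suc (a + b)" "troot ?n"]
  1 troot_bounds[of ?n] by linarith+
 then show ?thesis by simp
qed

definition pfst :: "nat => nat" where "pfst n = fst (prod_decode n)"
definition psnd :: "nat => nat" where "psnd n = snd (prod_decode n)"

lemma pfst_encode[simp]: "pfst (prod_encode (a, b)) = a" by (simp add: pfst_def)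
lemma psnd_encode[simp]: "psnd (prod_encode (a, b)) = b" by (simp add: psnd_def)
lemma pair_pfst_psnd[simp]: "prod_encode (pfst n, psnd n) = n" by (simp add: pfst_def psnd_def)

lemma C1_pfst: "C1 pfst"
proof -
 have "C1 (%n. n - triangle (troot n))"
  by (intro C1I crec_C2[OF C2_diff] crec_C1[OF C1_triangle] crec_C1[OF C1_troot] crec_rules) simp_all
 moreover have "n - triangle (troot n) = pfst n" for n
 proof -
  obtain a b where n: "n = prod_encode (a, b)" by (metis pair_pfst_psnd)
  then show ?thesis by (simp add: troot_prod_encode) (simp add: prod_encode_def)
 qed
 ultimately show ?thesis by (rule C1_eq)
qed

lemma C1_psnd: "C1 psnd"
proof -
 have "C1 (%n. troot n - pfst n)"
  by (intro C1I crec_C2[OF C2_diff] crec_C1[OF C1_pfst] crec_C1[OF C1_troot] crec_rules) simp_all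
 moreover have "troot n - pfst n = psnd n" for n
 proof -
  obtain a b where n: "n = prod_encode (a, b)" by (metis pair_pfst_psnd)
  then show ?thesis by (simp add: troot_prod_encode)
 qed
 ultimately show ?thesis by (rule C1_eq)
qed

lemma C1_id: "C1 (%x. x)" by (intro C1I crec_rules) simp
lemma C1_const: "C1 (%x. c)" by (intro C1I crec_rules)
lemma C1_comp: "C1 f ==> C1 g ==> C1 (%x. f (g x))"
 by (rule C1I, erule crec_C1, simp add: C1_def)
lemma C1_comp2: "C2 f ==> C1 g ==> C1 h ==> C1 (%x. f (g x) (h x))"
 by (rule C1I, erule crec_C2) (simp_all add: C1_def)
lemma C1_Suc: "C1 f ==> C1 (%x. Suc (f x))"
 by (rule C1I, rule crec_Suc) (simp_all add: C1_def)
lemmas C1_pair = C1_comp2[OF C2_pair]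
lemma C1_cond: "C1 f ==> C1 g ==> C1 h ==> C1 (%x. if f x = 0 then g x else h x)"
 by (rule C1I, rule crec_C3[OF C3_cond]) (simp_all add: C1_def)

lemma C1_iterate: "C1 f ==> C1 g ==> C1 h ==> C1 (%x. (f ^^ g x) (h x))"
proof (rule C1_comp2[of "%n x. (f ^^ n) x"])
 assume f: "C1 f"
 have "C2 (%n x. rec_nat x (%m y. f y) n)"
  by (rule C2_rec) (auto intro!: C1I C3I crec_rules crec_C1[OF f])
 moreover have "rec_nat x (%m y. f y) n = (f ^^ n) x" for n x by (induction n) auto
 ultimately show "C2 (%n x. (f ^^ n) x)" by simp
qed

lemmas C1_rules = C1_id C1_const C1_Suc C1_pair C1_comp[OF C1_pfst] C1_comp[OF C1_psnd] C1_cond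
 C1_comp2[OF C2_add] C1_comp2[OF C2_diff] C1_comp2[OF C2_mult] C1_comp2[OF C2_eq01]

section \<open>Typed computable functions\<close>

text \<open>The coding is required to be bijective: every number is then the code of a witness of any type,
 and the search for a witness is unbounded minimization without a test for well-formedness.\<close>

class enc =
 fixes enc :: "'a => nat"
 assumes bij_enc: "bij enc"

lemma enc_eq[simp]: "enc x = enc y \<longleftrightarrow> x = y" for x :: "'a::enc"
 using bij_enc by (auto simp: bij_def inj_on_def)

lemma enc_surj: "\<exists>x::'a::enc. enc x = n"
 using bij_enc[where 'a = 'a] by (metis bij_pointE)

instantiation nat :: enc begin
definition "enc_nat = (%n::nat. n)"
instance by standard (auto simp: enc_nat_def bij_def)
end

instantiation int :: enc begin
definition "enc_int = int_encode"
instance by standard (auto simp: enc_int_def bij_int_encode)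
end

instantiation prod :: (enc, enc) enc begin
definition "enc_prod = (%(x::'a, y::'b). prod_encode (enc x, enc y))"
instance
proof
 have "inj (enc :: 'a \<times> 'b => nat)" by (auto simp: enc_prod_def inj_on_def)
 moreover have "surj (enc :: 'a \<times> 'b => nat)"
 unfolding surj_def proof
  fix n
  obtain x :: 'a and y :: 'b where "enc x = pfst n" "enc y = psnd n" using enc_surj by metis
  then show "\<exists>z :: 'a \<times> 'b. n = enc z" by (intro exI[of _ "(x, y)"]) (simp add: enc_prod_def)
 qed
 ultimately show "bij (enc :: 'a \<times> 'b => nat)" by (simp add: bij_def)
qed
end

instantiation list :: (enc) enc begin
definition "enc_list = (%xs::'a list. list_encode (map enc xs))"
instance
proof
 have "inj (enc :: 'a list => nat)"
  by (auto simp: enc_list_def inj_on_def list_encode_eq dest!: map_injective[OF _ bij_is_inj[OF bij_enc]])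
 moreover have "surj (enc :: 'a list => nat)"
 unfolding surj_def proof
  fix n
  obtain f :: "nat => 'a" where "!!n. enc (f n) = n" using enc_surj by metis
  then show "\<exists>z :: 'a list. n = enc z"
  by (intro exI[of _ "map f (list_decode n)"]) (simp add: enc_list_def comp_def)
 qed
 ultimately show "bij (enc :: 'a list => nat)" by (simp add: bij_def)
qed
end

lemma enc_list_simps[simp]: "enc [] = 0" "enc (x # xs) = Suc (prod_encode (enc x, enc xs))"
 by (simp_all add: enc_list_def)
lemma enc_prod_simps[simp]: "enc (x, y) = prod_encode (enc x, enc y)"
 by (simp add: enc_prod_def)
lemma enc_nat_simps[simp]: "enc (n::nat) = n" by (simp add: enc_nat_def)

lemma pfst_enc[simp]: "pfst (enc z) = enc (fst z)" by (cases z) simp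
lemma psnd_enc[simp]: "psnd (enc z) = enc (snd z)" by (cases z) simp

text \<open>A typed function is computable if a program computes it on codes; the closure rules below
 build such programs by resolution, following the shape of a definition.\<close>

definition cf :: "('a::enc => 'b::enc) => bool" where
 "cf F \<longleftrightarrow> (EX ph. C1 ph & (ALL x. enc (F x) = ph (enc x)))"

definition dc :: "('a::enc => bool) => bool" where
 "dc P \<longleftrightarrow> cf (%x. if P x then 1 else 0 :: nat)"

lemma cfI: "C1 ph ==> (!!x. enc (F x) = ph (enc x)) ==> cf F" unfolding cf_def by auto

lemma cf_id: "cf (%x. x)" by (rule cfI[OF C1_id]) simp
lemma cf_const: "cf (%x. c)" by (rule cfI[OF C1_const]) simp
lemma cf_comp: "cf f ==> cf g ==> cf (%x. f (g x))"
 unfolding cf_def by (metis C1_comp)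
lemma cf_pair: "cf f ==> cf g ==> cf (%x. (f x, g x))"
 unfolding cf_def using C1_pair by fastforce
lemma cf_comp2: "cf (%z. f (fst z) (snd z)) ==> cf g ==> cf h ==> cf (%x. f (g x) (h x))"
 using cf_comp[of "%z. f (fst z) (snd z)" "%x. (g x, h x)"] cf_pair by auto
lemma cf_fst: "cf f ==> cf (%x. fst (f x))"
 by (rule cf_comp[of fst]) (rule cfI[OF C1_pfst], simp)
lemma cf_snd: "cf f ==> cf (%x. snd (f x))"
 by (rule cf_comp[of snd]) (rule cfI[OF C1_psnd], simp)

lemma cf_cons: "cf f ==> cf g ==> cf (%x. f x # g x)"
 by (rule cf_comp2[of "(#)"]) (rule cfI[OF C1_Suc[OF C1_id]], simp add: enc_prod_def split: prod.split)

lemma cf_natI2: "C2 ph ==> cf f ==> cf g ==> cf (%x. ph (f x) (g x))" for f :: "'a::enc => nat"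
 by (rule cf_comp2[of ph]) (rule cfI[OF C1_comp2[OF _ C1_pfst C1_psnd]], assumption, simp)

lemmas cf_add = cf_natI2[OF C2_add] and cf_diff = cf_natI2[OF C2_diff]
 and cf_mult = cf_natI2[OF C2_mult]

lemma cf_Suc: "cf f ==> cf (%x. Suc (f x))"
 by (rule cf_comp[of Suc]) (rule cfI[OF C1_Suc[OF C1_id]], simp split: prod.split)

lemma cf_if: "dc P ==> cf f ==> cf g ==> cf (%x. if P x then f x else g x)"
proof -
 assume "dc P" "cf f" "cf g"
 then obtain p u v where "C1 p" "C1 u" "C1 v" "!!x. enc (f x) = u (enc x)" "!!x. enc (g x) = v (enc x)"
  "!!x. (if P x then 1 else 0) = p (enc x)" unfolding dc_def cf_def by auto
 moreover from this(6) have "p (enc x) = 0 \<longleftrightarrow> ~ P x" for x by (metis zero_neq_one)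
 ultimately show ?thesis by (intro cfI[of "%n. if p n = 0 then v n else u n"] C1_cond) auto
qed

lemma dc_comp: "dc P ==> cf f ==> dc (%x. P (f x))"
 unfolding dc_def by (rule cf_comp)
lemma dc_not:
 assumes "dc P" shows "dc (%x. ~ P x)"
proof -
 have "(%x. if ~ P x then 1 else 0 :: nat) = (%x. if P x then 0 else 1)" by auto
 then show ?thesis unfolding dc_def using cf_if[OF assms cf_const cf_const, of "0::nat" 1] by simp
qed

lemma dc_and:
 assumes "dc P" "dc Q" shows "dc (%x. P x & Q x)"
proof -
 have "(%x. if P x & Q x then 1 else 0 :: nat) = (%x. if P x then (if Q x then 1 else 0) else 0)"
  by auto
 then show ?thesis unfolding dc_def
  using cf_if[OF assms(1) _ cf_const, of _ "0::nat"] assms(2)[unfolded dc_def] by simp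
qed

lemma dc_or:
 assumes "dc P" "dc Q" shows "dc (%x. P x \<or> Q x)"
 using dc_not[OF dc_and[OF dc_not[OF assms(1)] dc_not[OF assms(2)]]] by simp
lemma dc_eq: assumes "cf f" "cf g" shows "dc (%x. f x = g x)"
proof -
 from assms obtain u v where "C1 u" "C1 v" "!!x. enc (f x) = u (enc x)" "!!x. enc (g x) = v (enc x)"
  unfolding cf_def by auto
 then show ?thesis unfolding dc_def
  by (intro cfI[of "%n. if u n = v n then 1 else 0"] C1_comp2[OF C2_eq01]) (simp_all, metis enc_eq)
qed

lemma dc_le: "cf f ==> cf g ==> dc (%x. f x <= (g x :: nat))"
 using dc_eq[OF cf_diff cf_const, of f g 0] by simp
lemma dc_less: "cf f ==> cf g ==> dc (%x. f x < (g x :: nat))"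
 using dc_le[OF cf_Suc, of f g] by (simp add: Suc_le_eq)

text \<open>The fold is computed by iterating a step on triples (parameter, remaining list,
 accumulator); the code of a list bounds its length, hence the number of steps.\<close>

lemma length_le_enc: "length xs <= enc xs"
proof (induction xs)
 case (Cons x xs)
 then show ?case using le_prod_encode_2[of "enc xs" "enc x"] by simp
qed simp

lemma cf_fold:
 assumes F: "cf (%z. F (fst z) (fst (snd z)) (snd (snd z)))" and l: "cf l" and i: "cf i"
 shows "cf (%x. fold (F x) (l x) (i x))"
proof -
 from F obtain ph where ph: "C1 ph" and
  ph_z: "!!z. enc (F (fst z) (fst (snd z)) (snd (snd z))) = ph (enc z)"
  unfolding cf_def by auto
 have ph_F: "enc (F x a b) = ph (prod_encode (enc x, prod_encode (enc a, enc b)))" for x a b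
  using ph_z[of "(x, a, b)"] by simp
 from l i obtain u v where uv: "C1 u" "C1 v" "!!x. enc (l x) = u (enc x)" "!!x. enc (i x) = v (enc x)"
  unfolding cf_def by auto
 define st where "st = (%s. if pfst (psnd s) = 0 then s else
  prod_encode (pfst s, prod_encode (psnd (pfst (psnd s) - 1),
  ph (prod_encode (pfst s, prod_encode (pfst (pfst (psnd s) - 1), psnd (psnd s)))))))"
 have st: "C1 st" unfolding st_def by (intro C1_rules C1_comp[OF ph])
 have *: "(st ^^ n) (prod_encode (enc x, prod_encode (enc xs, enc b))) =
  prod_encode (enc x, prod_encode (0, enc (fold (F x) xs b)))" if "length xs <= n" for x xs b n
  using that
 proof (induction n arbitrary: xs b)
  case (Suc n)
  then show ?case
  proof (cases xs)
  case Nil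
  have "st (prod_encode (enc x, prod_encode (0, enc b))) = prod_encode (enc x, prod_encode (0, enc b))"
  by (simp add: st_def)
  then show ?thesis using Suc.IH[of "[]" b] Nil by (simp add: funpow_swap1)
  next
  case (Cons y ys)
  have "st (prod_encode (enc x, prod_encode (enc xs, enc b))) =
  prod_encode (enc x, prod_encode (enc ys, enc (F x y b)))"
  by (simp add: st_def Cons ph_F)
  then show ?thesis using Suc.IH[of ys "F x y b"] Suc.prems Cons by (simp add: funpow_swap1)
  qed
 qed simp
 show ?thesis
 proof (rule cfI)
  show "C1 (%n. psnd (psnd ((st ^^ u n) (prod_encode (n, prod_encode (u n, v n))))))"
  by (intro C1_rules C1_iterate st C1_comp[OF uv(1)] C1_comp[OF uv(2)])
  show "enc (fold (F x) (l x) (i x)) =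
  psnd (psnd ((st ^^ u (enc x)) (prod_encode (enc x, prod_encode (u (enc x), v (enc x))))))" for x
  using *[of "l x" "u (enc x)" x "i x"] length_le_enc[of "l x"] uv by simp
 qed
qed

lemma cf_rev: "cf l ==> cf (%x. rev (l x))"
proof -
 assume "cf l"
 then have "cf (%x. fold (#) (l x) [])"
  by (intro cf_fold cf_cons cf_fst cf_snd cf_id cf_const)
 then show ?thesis by (simp add: rev_conv_fold)
qed

lemma cf_map:
 assumes F: "cf (%z. F (fst z) (snd z))" and l: "cf l"
 shows "cf (%x. map (F x) (l x))"
proof -
 have "cf (%z. F (fst z) (fst (snd z)))"
  using cf_comp[OF F, of "%z. (fst z, fst (snd z))"] by (simp add: cf_pair cf_fst cf_snd cf_id)
 then have "cf (%x. rev (fold (%a acc. F x a # acc) (l x) []))"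
  by (intro cf_rev cf_fold cf_cons cf_fst cf_snd cf_id cf_const l)
 moreover have "rev (fold (%a acc. F x a # acc) xs ys) = rev ys @ map (F x) xs" for x xs ys
  by (induction xs arbitrary: ys) auto
 ultimately show ?thesis by simp
qed

lemma cf_append: "cf f ==> cf g ==> cf (%x. f x @ g x)"
proof -
 assume "cf f" "cf g"
 then have "cf (%x. fold (#) (rev (f x)) (g x))"
  by (intro cf_fold cf_rev cf_cons cf_fst cf_snd cf_id cf_const)
 then show ?thesis by (simp add: fold_Cons_rev)
qed

lemma cf_concat: "cf f ==> cf (%x. concat (f x))"
proof -
 assume "cf f"
 then have "cf (%x. fold (%a acc. a @ acc) (rev (f x)) [])"
  by (intro cf_fold cf_rev cf_append cf_fst cf_snd cf_id cf_const)
 moreover have "fold (%a acc. a @ acc) (rev xs) [] = concat xs" for xs :: "'b list list"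
  by (induction xs) auto
 ultimately show ?thesis by (simp only:)
qed

lemma cf_filter:
 assumes P: "dc (%z. P (fst z) (snd z))" and l: "cf l"
 shows "cf (%x. filter (P x) (l x))"
proof -
 have "dc (%z. P (fst z) (fst (snd z)))"
  using dc_comp[OF P, of "%z. (fst z, fst (snd z))"] by (simp add: cf_pair cf_fst cf_snd cf_id)
 then have "cf (%x. rev (fold (%a acc. if P x a then a # acc else acc) (l x) []))"
  by (intro cf_rev cf_fold cf_cons cf_fst cf_snd cf_id cf_const cf_if l)
 moreover have "rev (fold (%a acc. if P x a then a # acc else acc) xs ys) = rev ys @ filter (P x) xs"
  for x xs ys by (induction xs arbitrary: ys) auto
 ultimately show ?thesis by simp
qed

lemma dc_ball:
 assumes P: "dc (%z. P (fst z) (snd z))" and l: "cf l"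
 shows "dc (%x. ALL a:set (l x). P x a)"
proof -
 have "dc (%x. filter (%a. ~ P x a) (l x) = [])"
  by (intro dc_eq cf_filter dc_not P l cf_const)
 then show ?thesis by (simp add: filter_empty_conv)
qed

lemma dc_bex: "dc (%z. P (fst z) (snd z)) ==> cf l ==> dc (%x. EX a:set (l x). P x a)"
 using dc_not[OF dc_ball[OF dc_not, of P l]] by simp

lemma dc_mem: "cf f ==> cf l ==> dc (%x. f x : set (l x))"
proof -
 assume f: "cf f" and l: "cf l"
 have "dc (%x. EX a:set (l x). a = f x)"
  by (intro dc_bex dc_eq cf_comp[OF f] cf_fst cf_snd cf_id l)
 then show ?thesis by (simp add: Bex_def)
qed

lemma cf_length: "cf l ==> cf (%x. length (l x))"
proof -
 assume "cf l"
 then have "cf (%x. fold (%a n. Suc n) (l x) 0)"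
  by (intro cf_fold cf_Suc cf_fst cf_snd cf_id cf_const)
 moreover have "fold (%a n. Suc n) xs m = length xs + m" for xs :: "'b list" and m
  by (induction xs arbitrary: m) auto
 ultimately show ?thesis by simp
qed

lemma cf_list_case:
 assumes l: "cf l" and f: "cf f" and F: "cf (%z. F (fst z) (fst (snd z)) (snd (snd z)))"
 shows "cf (%x. case l x of [] => f x | a # as => F x a as)"
proof -
 from F obtain ph where ph: "C1 ph" and
  ph_z: "!!z. enc (F (fst z) (fst (snd z)) (snd (snd z))) = ph (enc z)"
  unfolding cf_def by auto
 from l f obtain u v where uv: "C1 u" "C1 v" "!!x. enc (l x) = u (enc x)" "!!x. enc (f x) = v (enc x)"
  unfolding cf_def by auto
 show ?thesis
 proof (rule cfI)
  show "C1 (%n. if u n = 0 then v n else ph (prod_encode (n, u n - 1)))"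
  by (intro C1_rules C1_comp[OF ph] uv)
  show "enc (case l x of [] => f x | a # as => F x a as) =
  (if u (enc x) = 0 then v (enc x) else ph (prod_encode (enc x, u (enc x) - 1)))" for x
  using ph_z[of "(x, hd (l x), tl (l x))"]
  by (cases "l x") (simp_all add: uv(3)[symmetric] uv(4)[symmetric])
 qed
qed

lemma cf_zip:
 assumes "cf f" "cf g"
 shows "cf (%x. zip (f x) (g x))"
proof -
 define st where "st = (%(a::'b) s::'c list \<times> ('b \<times> 'c) list.
  case fst s of [] => s | b # bs => (bs, (a, b) # snd s))"
 have "cf (%x. rev (snd (fold (%a s. case fst s of [] => s | b # bs => (bs, (a, b) # snd s)) (f x) (g x, []))))"
  by (intro cf_rev cf_snd cf_fold cf_list_case cf_pair cf_cons cf_fst cf_id cf_const assms)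
 moreover have "rev (snd (fold (%a s. case fst s of [] => s | b # bs => (bs, (a, b) # snd s)) xs (ys, zs)))
  = rev zs @ zip xs ys" for xs :: "'b list" and ys :: "'c list" and zs
 proof (induction xs arbitrary: ys zs)
  case (Cons x xs)
  then show ?case by (cases ys) auto
 qed simp
 ultimately show ?thesis by simp
qed

lemma cf_funpow:
 fixes F :: "'a::enc => 'b::enc => 'b"
 assumes F: "cf (%z. F (fst z) (snd z))" and n: "cf n" and i: "cf i"
 shows "cf (%x. (F x ^^ n x) (i x))"
proof -
 from F obtain ph where ph: "C1 ph" and ph_z: "!!z. enc (F (fst z) (snd z)) = ph (enc z)"
  unfolding cf_def by auto
 from n i obtain u v where uv: "C1 u" "C1 v" "!!x. n x = u (enc x)" "!!x. enc (i x) = v (enc x)"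
  unfolding cf_def by auto
 define st where "st = (%s. prod_encode (pfst s, ph s))"
 have st: "C1 st" unfolding st_def by (intro C1_rules ph)
 have ph_F: "ph (prod_encode (enc x, enc b)) = enc (F x b)" for x b
  using ph_z[of "(x, b)"] by simp
 have *: "(st ^^ k) (prod_encode (enc x, enc b)) = prod_encode (enc x, enc ((F x ^^ k) b))" for k x b
  by (induction k) (simp_all add: st_def ph_F)
 show ?thesis
 proof (rule cfI)
  show "C1 (%k. psnd ((st ^^ u k) (prod_encode (k, v k))))"
  by (intro C1_rules C1_iterate st uv)
  show "enc ((F x ^^ n x) (i x)) = psnd ((st ^^ u (enc x)) (prod_encode (enc x, v (enc x))))" for x
  using *[of "u (enc x)" x "i x"] by (simp add: uv)
 qed
qed

lemma cf_replicate:
 assumes "cf f" "cf g"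
 shows "cf (%x. replicate (f x) (g x))"
proof -
 have "cf (%x. ((%xs. g x # xs) ^^ f x) [])"
  by (intro cf_funpow cf_cons cf_comp[OF assms(2)] cf_fst cf_snd cf_id cf_const assms)
 moreover have "((%xs. a # xs) ^^ n) [] = replicate n a" for n and a :: 'b by (induction n) auto
 ultimately show ?thesis by simp
qed

lemma cf_power:
 assumes "cf f" "cf g"
 shows "cf (%x. (f x :: nat) ^ g x)"
proof -
 have "cf (%x. ((*) (f x) ^^ g x) 1)"
  by (intro cf_funpow cf_mult cf_comp[OF assms(1)] cf_fst cf_snd cf_id cf_const assms)
 moreover have "((*) a ^^ n) 1 = a ^ n" for a n :: nat by (induction n) auto
 ultimately show ?thesis by simp
qed

subsection \<open>Integers\<close>

lemma C1_odd: "C1 (%n. if odd n then 1 else 0)"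
proof -
 have "C1 (rec_nat 0 (%n y. 1 - y))"
  by (rule C1_rec, rule C2I, intro crec_C2[OF C2_diff] crec_rules) simp
 moreover have "rec_nat (0::nat) (%n y. 1 - y) n = (if odd n then 1 else 0)" for n by (induction n) auto
 ultimately show ?thesis by (rule C1_eq)
qed

lemma C1_half: "C1 (%n. n div 2)"
proof -
 have "C1 (rec_nat 0 (%n y. y + (if odd n then 1 else 0)))"
  by (rule C1_rec, rule C2I, intro crec_C2[OF C2_add] crec_C1[OF C1_odd] crec_rules) simp_all
 moreover have "rec_nat (0::nat) (%n y. y + (if odd n then 1 else 0)) n = n div 2" for n
  by (induction n) (auto elim: oddE evenE)
 ultimately show ?thesis by (rule C1_eq)
qed

lemma enc_int: "enc (i::int) = (if 0 <= i then 2 * nat i else 2 * nat (- i) - 1)"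
 by (auto simp: enc_int_def int_encode_def sum_encode_def nat_diff_distrib)

lemma cf_nat: "cf f ==> cf (%x. nat (f x))"
 by (rule cf_comp[of nat], rule cfI[of "%n. if (if odd n then 1 else 0) = (0::nat) then n div 2 else 0"],
  intro C1_rules C1_odd C1_half) (auto simp: enc_int)

lemma cf_nat_neg: "cf f ==> cf (%x. nat (- f x))"
 by (rule cf_comp[of "%i. nat (- i)"],
  rule cfI[of "%n. if (if odd n then 1 else 0) = (0::nat) then 0 else (n + 1) div 2"],
  intro C1_rules C1_odd C1_comp[OF C1_half]) (auto simp: enc_int)

lemma cf_int_diff: "cf f ==> cf g ==> cf (%x. int (f x) - int (g x))"
 by (rule cf_comp2[of "%a b. int a - int b"], rule cfI[of "%n. if psnd n - pfst n = 0
  then 2 * (pfst n - psnd n) else 2 * (psnd n - pfst n) - 1"], intro C1_rules)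
  (auto simp: enc_int nat_diff_distrib)

lemma cf_int: "cf f ==> cf (%x. int (f x))"
 using cf_int_diff[OF _ cf_const, of f 0] by simp

lemma cf_int_ops:
 assumes "cf f" "cf g"
 shows cf_int_add: "cf (%x. f x + g x :: int)" and cf_int_mult: "cf (%x. f x * g x :: int)"
  and cf_int_uminus: "cf (%x. - f x :: int)"
proof -
 have i: "i = int (nat i) - int (nat (- i))" for i by simp
 have add: "i + j = int (nat i + nat j) - int (nat (- i) + nat (- j))" for i j
  using i[of i] i[of j] by linarith
 have mult: "i * j = int (nat i * nat j + nat (- i) * nat (- j))
  - int (nat i * nat (- j) + nat (- i) * nat j)" for i j
  by (subst i[of i], subst i[of j]) (simp only: of_nat_add of_nat_mult, simp only: algebra_simps)
 have um: "- i = int (nat (- i)) - int (nat i)" for i by simp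
 show "cf (%x. f x + g x)" by (subst add) (intro cf_int_diff cf_add cf_nat cf_nat_neg assms)
 show "cf (%x. f x * g x)" by (subst mult) (intro cf_int_diff cf_add cf_mult cf_nat cf_nat_neg assms)
 show "cf (%x. - f x)" by (subst um) (intro cf_int_diff cf_nat cf_nat_neg assms)
qed

lemma dc_int_less: "cf f ==> cf g ==> dc (%x. f x < (g x :: int))"
proof -
 assume fg: "cf f" "cf g"
 have "dc (%x. ~ nat (f x) + nat (- g x) \<ge> nat (g x) + nat (- f x))"
  by (intro dc_not dc_le cf_add cf_nat cf_nat_neg fg)
 moreover have "(~ nat i + nat (- j) \<ge> nat j + nat (- i)) = (i < j)" for i j by linarith
 ultimately show ?thesis by simp
qed

lemma dc_int_le: "cf f ==> cf g ==> dc (%x. f x <= (g x :: int))"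
 using dc_not[OF dc_int_less[of g f]] by (simp add: linorder_not_less)

section \<open>Recursively enumerable predicates\<close>

definition RE :: "('a::enc => bool) => bool" where
 "RE P \<longleftrightarrow> (\<exists>Q :: 'a \<times> nat => bool. dc Q & (ALL x. P x \<longleftrightarrow> (EX w. Q (x, w))))"

lemma RE_ex_dc:
 assumes "dc (%z :: 'a::enc \<times> 'b::enc. Q (fst z) (snd z))"
 shows "RE (%x. EX y. Q x y)"
proof -
 obtain f :: "nat => 'b" where f: "!!n. enc (f n) = n" using enc_surj by metis
 have f': "f (enc y) = y" for y using f[of "enc y"] by simp
 have "cf f" by (rule cfI[OF C1_id]) (simp add: f)
 then have "dc (%z. Q (fst z) (f (snd z)))"
  using dc_comp[OF assms, of "%z. (fst z, f (snd z))"]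
  by (simp add: cf_pair cf_fst cf_snd cf_id cf_comp[of f])
 moreover have "(EX y. Q x y) \<longleftrightarrow> (EX w. Q (fst (x, w)) (f (snd (x, w))))" for x
  using f' by auto metis
 ultimately show ?thesis unfolding RE_def
  by (intro exI[of _ "%z. Q (fst z) (f (snd z))"]) simp
qed

lemma RE_dc: "dc P ==> RE P"
 using RE_ex_dc[of "%x (w::nat). P x"] dc_comp[of P fst] by (simp add: cf_fst cf_id)

lemma RE_comp: assumes "RE P" "cf f" shows "RE (%x. P (f x))"
proof -
 from assms obtain Q :: "'a \<times> nat => bool" where Q: "dc Q" "!!x. P x \<longleftrightarrow> (EX w. Q (x, w))"
  unfolding RE_def by auto
 have "dc (%z. Q (f (fst z), snd z))"
  by (intro dc_comp[OF Q(1)] cf_pair cf_comp[OF assms(2)] cf_fst cf_snd cf_id)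
 then show ?thesis using RE_ex_dc[of "%x w. Q (f x, w)"] Q(2) by simp
qed

lemma RE_ex:
 assumes "RE (%z :: 'a::enc \<times> 'b::enc. P (fst z) (snd z))"
 shows "RE (%x. EX y. P x y)"
proof -
 from assms obtain Q :: "('a \<times> 'b) \<times> nat => bool" where Q: "dc Q"
  "!!x. P (fst x) (snd x) \<longleftrightarrow> (EX w. Q (x, w))"
  unfolding RE_def by auto
 have "dc (%z. Q ((fst z, fst (snd z)), snd (snd z)))"
  by (intro dc_comp[OF Q(1)] cf_pair cf_fst cf_snd cf_id)
 then have "RE (%x. \<exists>y::'b \<times> nat. Q ((x, fst y), snd y))"
  using RE_ex_dc[of "%x y. Q ((x, fst y), snd y)"] by simp
 moreover have "(\<exists>y::'b \<times> nat. Q ((x, fst y), snd y)) \<longleftrightarrow> (EX y. P x y)" for x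
  using Q(2)[of "(x, _)"] by fastforce
 ultimately show ?thesis by simp
qed

lemma RE_conj: assumes "RE P" "RE Q" shows "RE (%x. P x & Q x)"
proof -
 from assms obtain A B :: "'a \<times> nat => bool" where A: "dc A" "!!x. P x \<longleftrightarrow> (EX w. A (x, w))"
  and B: "dc B" "!!x. Q x \<longleftrightarrow> (EX w. B (x, w))"
  unfolding RE_def by auto
 have "RE (%x. \<exists>w::nat \<times> nat. A (x, fst w) & B (x, snd w))"
  by (intro RE_ex_dc dc_and dc_comp[OF A(1)] dc_comp[OF B(1)] cf_pair cf_fst cf_snd cf_id)
 then show ?thesis using A(2) B(2) by simp
qed

lemma RE_disj: assumes "RE P" "RE Q" shows "RE (%x. P x \<or> Q x)"
proof -
 from assms obtain A B :: "'a \<times> nat => bool" where A: "dc A" "!!x. P x \<longleftrightarrow> (EX w. A (x, w))"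
  and B: "dc B" "!!x. Q x \<longleftrightarrow> (EX w. B (x, w))"
  unfolding RE_def by auto
 have "RE (%x. \<exists>w::nat. A (x, w) \<or> B (x, w))"
  by (intro RE_ex_dc dc_or dc_comp[OF A(1)] dc_comp[OF B(1)] cf_pair cf_fst cf_snd cf_id)
 then show ?thesis using A(2) B(2) by (simp add: ex_disj_distrib)
qed

text \<open>The witnesses for the finitely many elements of a list are collected in one list of pairs.\<close>

lemma RE_ball:
 assumes P: "RE (%z. P (fst z) (snd z))" and l: "cf l"
 shows "RE (%x. ALL a:set (l x). P x a)"
proof -
 from P obtain Q :: "('a \<times> 'b) \<times> nat => bool" where Q: "dc Q"
  "!!x. P (fst x) (snd x) \<longleftrightarrow> (EX w. Q (x, w))"
  unfolding RE_def by auto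
 have "RE (%x. \<exists>ws :: ('b \<times> nat) list. map fst ws = l x & (ALL v:set ws. Q ((x, fst v), snd v)))"
  by (intro RE_ex_dc dc_and dc_eq dc_ball dc_comp[OF Q(1)] cf_comp[OF l] cf_map cf_pair cf_fst cf_snd cf_id)
 moreover have "(\<exists>ws :: ('b \<times> nat) list. map fst ws = l x & (ALL v:set ws. Q ((x, fst v), snd v)))
   \<longleftrightarrow> (ALL a:set (l x). P x a)" (is "?L \<longleftrightarrow> ?R") for x
 proof
  assume ?L
  then obtain ws where ws: "map fst ws = l x" "ALL v:set ws. Q ((x, fst v), snd v)" by auto
  show ?R unfolding ws(1)[symmetric] using ws(2) Q(2)[of "(x, _)"] by fastforce
 next
  assume ?R
  then have "ALL a:set (l x). EX w. Q ((x, a), w)" using Q(2)[of "(x, _)"] by fastforce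
  then obtain w where "ALL a:set (l x). Q ((x, a), w a)" by metis
  then show ?L by (intro exI[of _ "map (%a. (a, w a)) (l x)"]) (auto simp: comp_def)
 qed
 ultimately show ?thesis by simp
qed

lemma RE_bex:
 assumes P: "RE (%z. P (fst z) (snd z))" and l: "cf l"
 shows "RE (%x. EX a:set (l x). P x a)"
 unfolding Bex_def by (intro RE_ex RE_conj RE_dc[OF dc_mem] P cf_comp[OF l] cf_fst cf_snd cf_id)

lemma RE_list_all2:
 assumes R: "RE (%z. R (fst z) (fst (snd z)) (snd (snd z)))" and f: "cf f" and g: "cf g"
 shows "RE (%x. list_all2 (R x) (f x) (g x))"
proof -
 have "RE (%x. length (f x) = length (g x) & (ALL p:set (zip (f x) (g x)). R x (fst p) (snd p)))"
  by (intro RE_conj RE_dc[OF dc_eq] RE_ball R cf_length cf_zip f g)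
 then show ?thesis by (simp add: list_all2_iff split_def)
qed

text \<open>Two recursively enumerable sets are separated, on the inputs that lie in exactly one of them,
 by searching for a witness of either.\<close>

lemma decide_by_parallel_search:
 fixes P Q :: "nat => bool"
 assumes "RE P" "RE Q"
 shows "EX A. ALL n. P n ~= Q n --> (ALL r. computes A [n] r \<longleftrightarrow> r = (if P n then 1 else 0))"
proof -
 from assms obtain A B :: "nat \<times> nat => bool" where A: "dc A" "!!x. P x \<longleftrightarrow> (EX w. A (x, w))"
  and B: "dc B" "!!x. Q x \<longleftrightarrow> (EX w. B (x, w))"
  unfolding RE_def by auto
 have "cf (%z. if A z \<or> B z then 0 else 1 :: nat)" by (intro cf_if dc_or A B cf_const)
 then obtain u where u: "C1 u" "!!n w. (if A (n, w) \<or> B (n, w) then 0 else 1) = u (prod_encode (n, w))"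
  unfolding cf_def by fastforce
 from A(1) obtain v where v: "C1 v" "!!n w. (if A (n, w) then 1 else 0) = v (prod_encode (n, w))"
  unfolding cf_def dc_def by fastforce
 have "crec 2 (%xs. u (prod_encode (xs ! 1, xs ! 0)))" "crec 2 (%xs. v (prod_encode (xs ! 1, xs ! 0)))"
  by (intro crec_C1[OF u(1)] crec_C1[OF v(1)] crec_C2[OF C2_pair] crec_nth; simp)+
 then obtain f g where "!!xs. length xs = 2 ==> computes f xs (u (prod_encode (xs ! 1, xs ! 0)))"
  "!!xs. length xs = 2 ==> computes g xs (v (prod_encode (xs ! 1, xs ! 0)))"
  unfolding crec_def by auto
 from this[of "[_, _]"] have fg: "!!w n. computes f [w, n] (u (prod_encode (n, w)))"
  "!!w n. computes g [w, n] (v (prod_encode (n, w)))" by simp_all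
 show ?thesis
 proof (intro exI[of _ "Comp g [Mu f, Proj 0]"] allI impI)
  fix n r assume PQ: "P n ~= Q n"
  define w where "w = (LEAST w. A (n, w) \<or> B (n, w))"
  have "EX w. A (n, w) \<or> B (n, w)" using PQ A(2) B(2) by auto
  then have w: "A (n, w) \<or> B (n, w)" unfolding w_def by (rule LeastI_ex)
  have less: "~ (A (n, m) \<or> B (n, m))" if "m < w" for m using not_less_Least that unfolding w_def by blast
  have "computes (Mu f) [n] w"
  proof (rule computes.mu)
  show "computes f (w # [n]) 0" using fg(1)[of w n] u(2)[of n w] w by simp
  show "EX y. computes f (m # [n]) (Suc y)" if "m < w" for m
  using fg(1)[of m n] u(2)[of n m] less[OF that] by (intro exI[of _ 0]) simp
  qed
  moreover have "computes (Proj 0) [n] n" using computes.proj[of 0 "[n]"] by simp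
  ultimately have "computes (Comp g [Mu f, Proj 0]) [n] (v (prod_encode (n, w)))"
  by (intro computes.comp[where ys = "[w, n]"] fg) simp
  moreover have "v (prod_encode (n, w)) = (if P n then 1 else 0)"
  using v(2)[of n w] w PQ A(2)[of n] B(2)[of n] by auto
  ultimately show "computes (Comp g [Mu f, Proj 0]) [n] r \<longleftrightarrow> r = (if P n then 1 else 0)"
  using computes_deterministic by auto
 qed
qed

section \<open>Algebraic numbers\<close>

interpretation rat: vector_space "%q (z::complex). of_rat q * z"
 by standard (auto simp: algebra_simps of_rat_add of_rat_mult)

definition finite_algebra :: "complex set => bool" where
 "finite_algebra B \<longleftrightarrow> finite B & 1 : rat.span B & (ALL b:B. ALL c:B. b * c : rat.span B)"

lemma span_mult_closed:
 assumes "!!b c. b : B ==> c : C ==> b * c : rat.span D" "x : rat.span B" "y : rat.span C"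
 shows "x * y : rat.span D"
 using assms(2)
proof (induction rule: rat.span_induct_alt)
 case base
 then show ?case using rat.span_zero by simp
next
 case (step q b x)
 have "b * y : rat.span D"
  using assms(3)
 proof (induction rule: rat.span_induct_alt)
  case base
  then show ?case using rat.span_zero by simp
 next
  case (step r c y)
  have "b * (of_rat r * c + y) = of_rat r * (b * c) + b * y" by (simp add: algebra_simps)
  moreover have "of_rat r * (b * c) : rat.span D"
  by (rule rat.span_scale[OF assms(1)[OF \<open>b : B\<close> step.hyps(1)]])
  ultimately show ?case using step.IH rat.span_add by simp
 qed
 moreover have "(of_rat q * b + x) * y = of_rat q * (b * y) + x * y" by (simp add: algebra_simps)
 moreover have "of_rat q * (b * y) : rat.span D" by (rule rat.span_scale) fact
 ultimately show ?case using step.IH rat.span_add by simp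
qed

lemma finite_algebra_mult:
 "finite_algebra B ==> x : rat.span B ==> y : rat.span B ==> x * y : rat.span B"
 using span_mult_closed[of B B B] unfolding finite_algebra_def by blast

lemma finite_algebra_power: "finite_algebra B ==> x : rat.span B ==> x ^ k : rat.span B"
 by (induction k) (auto intro: finite_algebra_mult simp: finite_algebra_def)

lemma dependent_sequence:
 assumes "finite B" "!!i. i <= card B ==> v i : rat.span B"
 shows "EX q. (\<exists>i\<le>card B. q i ~= 0) & (\<Sum>i\<le>card B. of_rat (q i) * v i) = 0"
proof (cases "inj_on v {..card B}")
 case True
 let ?S = "v ` {..card B}"
 have "card ?S = Suc (card B)" using card_image[OF True] by simp
 moreover have "?S <= rat.span B" using assms(2) by auto
 ultimately have "rat.dependent ?S" using rat.independent_span_bound[OF assms(1), of ?S] by auto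
 then obtain u where u: "(\<Sum>x\<in>?S. of_rat (u x) * x) = 0" "EX x:?S. u x ~= 0"
  using rat.dependent_finite[of ?S] by auto
 have "(\<Sum>i\<le>card B. of_rat (u (v i)) * v i) = 0"
  using u(1) by (simp add: sum.reindex[OF True])
 with u(2) show ?thesis by (intro exI[of _ "%i. u (v i)"]) auto
next
 case False
 then obtain i j where ij: "i <= card B" "j <= card B" "i ~= j" "v i = v j"
  unfolding inj_on_def by auto
 let ?q = "%k. if k = i then 1 else if k = j then -1 else 0 :: rat"
 have "(\<Sum>k\<le>card B. of_rat (?q k) * v k) = (\<Sum>k\<in>{i,j}. of_rat (?q k) * v k)"
  using ij by (intro sum.mono_neutral_right) auto
 also have "... = 0" using ij by simp
 finally show ?thesis using ij(1) by (intro exI[of _ ?q]) auto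
qed

lemma rat_relation_imp_int_relation:
 assumes "finite I" "EX i:I. q i ~= (0::rat)" "(\<Sum>i\<in>I. of_rat (q i) * v i) = (0::complex)"
 shows "EX b. (EX i:I. b i ~= (0::int)) & (\<Sum>i\<in>I. of_int (b i) * v i) = 0"
proof -
 define D where "D = (\<Prod>i\<in>I. snd (quotient_of (q i)))"
 have D: "D ~= 0" unfolding D_def using quotient_of_denom_pos' assms(1) by (auto simp: less_le)
 have "EX b. of_int b = of_int D * q i" if "i : I" for i
 proof -
  have dvd: "snd (quotient_of (q i)) dvd D" unfolding D_def by (rule dvd_prodI[OF assms(1) that])
  then obtain e where e: "D = snd (quotient_of (q i)) * e" by auto
  have "q i = of_int (fst (quotient_of (q i))) / of_int (snd (quotient_of (q i)))"
  by (metis quotient_of_div prod.collapse)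
  moreover have "of_int (snd (quotient_of (q i))) ~= (0::rat)" using quotient_of_denom_pos'[of "q i"] by simp
  ultimately have "of_int (fst (quotient_of (q i)) * e) = of_int D * q i"
  by (simp add: e field_simps)
  then show ?thesis by blast
 qed
 then obtain b where b: "!!i. i : I ==> of_int (b i) = of_int D * q i" by metis
 have b': "of_int (b i) = (of_int D * of_rat (q i) :: complex)" if "i : I" for i
  using arg_cong[OF b[OF that], of of_rat] by (simp add: of_rat_mult)
 have "(\<Sum>i\<in>I. of_int (b i) * v i) = of_int D * (\<Sum>i\<in>I. of_rat (q i) * v i)"
  by (simp add: sum_distrib_left b' mult.assoc)
 moreover obtain i where i: "i : I" "q i ~= 0" using assms(2) by blast
 then have "b i ~= 0" using b[OF i(1)] D by auto
 ultimately show ?thesis using assms(3) i(1) by (intro exI[of _ b]) auto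
qed

lemma finite_algebra_relation:
 assumes "finite_algebra B" "z : rat.span B"
 shows "EX b. (\<exists>i\<le>card B. b i ~= (0::int)) & (\<Sum>i\<le>card B. of_int (b i) * z ^ i) = 0"
proof -
 have "finite B" using assms(1) unfolding finite_algebra_def by simp
 then obtain q where q: "\<exists>i\<le>card B. q i ~= 0" "(\<Sum>i\<le>card B. of_rat (q i) * z ^ i) = 0"
  using dependent_sequence[of B "%i. z ^ i"] finite_algebra_power[OF assms] by auto
 then show ?thesis
  using rat_relation_imp_int_relation[of "{..card B}" q "%i. z ^ i"] by auto
qed

lemma algebraic_if_relation:
 assumes "(\<Sum>i\<le>n. of_int (b i) * z ^ i) = (0::complex)" "i <= n" "b i ~= (0::int)"
 shows "algebraic z"
proof (rule algebraicI)
 let ?p = "\<Sum>i\<le>n. monom (of_int (b i)) i :: complex poly"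
 have c: "coeff ?p k = (if k <= n then of_int (b k) else 0)" for k by (simp add: coeff_sum)
 show "coeff ?p k : \<int>" for k by (simp add: c)
 show "?p ~= 0" using c[of i] assms(2,3) by (metis coeff_0 of_int_eq_0_iff)
 show "poly ?p z = 0" using assms(1) by (simp add: poly_sum poly_monom)
qed

lemma finite_algebra_algebraic: "finite_algebra B ==> z : rat.span B ==> algebraic z"
 using finite_algebra_relation[of B z] algebraic_if_relation[of _ z "card B"] by auto

text \<open>Dividing a relation of a nonzero \<open>z\<close> by the lowest power that occurs in it expresses
 the inverse of \<open>z\<close>.\<close>

text \<open>An algebra of finite dimension without zero divisors is closed under inverses.\<close>

lemma finite_algebra_inverse:
 assumes B: "finite_algebra B" and z: "z : rat.span B"
 shows "inverse z : rat.span B"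
proof (cases "z = 0")
 case False
 obtain b i where b: "i <= card B" "b i ~= (0::int)" "(\<Sum>i\<le>card B. of_int (b i) * z ^ i) = 0"
  using finite_algebra_relation[OF B z] by auto
 define m where "m = (LEAST i. b i ~= 0)"
 have m: "b m ~= 0" "m <= i" "!!k. k < m ==> b k = 0"
  using LeastI[of "%i. b i ~= 0" i] Least_le[of "%i. b i ~= 0" i] not_less_Least b(2)
  unfolding m_def by auto
 define n where "n = card B"
 have "m <= n" using m(2) b(1) n_def by simp
 have "0 = (\<Sum>k\<in>{m..n}. of_int (b k) * z ^ k)"
  using b(3) unfolding n_def[symmetric]
  by (subst sum.mono_neutral_right[of "{..n}" "{m..n}", symmetric]) (auto simp: m(3))
 also have "... = z ^ m * (of_int (b m) + z * (\<Sum>k\<in>{Suc m..n}. of_int (b k) * z ^ (k - Suc m)))"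
  using \<open>m <= n\<close>
  by (subst sum.atLeast_Suc_atMost) (auto simp: algebra_simps sum_distrib_left power_add[symmetric]
  power_Suc[symmetric] simp del: power_Suc intro!: sum.cong)
 finally have "of_int (b m) = - z * (\<Sum>k\<in>{Suc m..n}. of_int (b k) * z ^ (k - Suc m))"
  using False by (simp add: eq_neg_iff_add_eq_0)
 then have "inverse z = - (\<Sum>k\<in>{Suc m..n}. of_int (b k) * z ^ (k - Suc m)) / of_int (b m)"
 proof -
  assume *: "of_int (b m) = - z * (\<Sum>k\<in>{Suc m..n}. of_int (b k) * z ^ (k - Suc m))"
  have "(\<Sum>k\<in>{Suc m..n}. of_int (b k) * z ^ (k - Suc m)) ~= 0"
  using * m(1) by (metis mult_zero_right of_int_eq_0_iff)
  then show ?thesis unfolding * using False by (simp add: field_simps)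
 qed
 also have "... = (\<Sum>k\<in>{Suc m..n}. of_rat (- of_int (b k) / of_int (b m)) * z ^ (k - Suc m))"
  by (simp add: sum_divide_distrib sum_negf of_rat_divide of_rat_minus)
 also have "... : rat.span B"
  by (intro rat.span_sum rat.span_scale finite_algebra_power[OF B z])
 finally show ?thesis .
qed (use rat.span_zero in simp)

lemma finite_algebra_powers:
 assumes "algebraic z"
 shows "EX n. finite_algebra ((%i. z ^ i) ` {..<n}) & range (%i. z ^ i) <= rat.span ((%i. z ^ i) ` {..<n})"
proof -
 obtain p where p: "p ~= 0" "poly (map_poly of_int p) z = 0" using assms by (rule algebraicE')
 define n where "n = degree p"
 define a where "a i = (of_int (coeff p i) :: complex)" for i
 have an: "a n ~= 0" using p(1) unfolding a_def n_def by simp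
 have "(\<Sum>i\<le>n. a i * z ^ i) = 0"
  using p(2) unfolding a_def n_def
  by (simp add: poly_altdef degree_map_poly coeff_map_poly)
 then have "a n * z ^ n = - (\<Sum>i<n. a i * z ^ i)"
  by (simp add: lessThan_Suc_atMost[symmetric] eq_neg_iff_add_eq_0 add.commute)
 then have zn: "z ^ n = (\<Sum>i<n. of_rat (- of_int (coeff p i) / of_int (coeff p n)) * z ^ i)"
  using an unfolding a_def
  by (simp add: field_simps sum_divide_distrib[symmetric] sum_negf of_rat_divide of_rat_minus)
 let ?B = "(%i. z ^ i) ` {..<n}"
 have n0: "n > 0"
 proof (rule ccontr)
  assume "~ n > 0"
  then show False using zn by simp
 qed
 have pow: "z ^ k : rat.span ?B" for k
 proof (induction k rule: less_induct)
  case (less k)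
  show ?case
  proof (cases "k < n")
  case True
  then show ?thesis by (intro rat.span_base) auto
  next
  case False
  then have "z ^ k = z ^ (k - n) * z ^ n" by (simp add: power_add[symmetric])
  also have "... = (\<Sum>i<n. of_rat (- of_int (coeff p i) / of_int (coeff p n)) * z ^ (k - n + i))"
  unfolding zn by (simp add: sum_distrib_left power_add algebra_simps)
  also have "... : rat.span ?B"
  by (intro rat.span_sum rat.span_scale less.IH) (use False in auto)
  finally show ?thesis .
  qed
 qed
 have "finite_algebra ?B" unfolding finite_algebra_def
  using pow[of 0] pow by (auto simp: power_add[symmetric])
 then show ?thesis using pow by auto
qed

lemma finite_algebra_product:
 assumes B: "finite_algebra B" and C: "finite_algebra C"
 obtains D where "finite_algebra D" "rat.span B <= rat.span D" "rat.span C <= rat.span D"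
proof -
 let ?D = "(%(b, c). b * c) ` (B \<times> C)"
 have BC: "x * y : rat.span ?D" if "x : rat.span B" "y : rat.span C" for x y
  by (rule span_mult_closed[OF _ that]) (auto intro!: rat.span_base)
 have 1: "1 : rat.span B" "1 : rat.span C" "finite B" "finite C"
  using B C unfolding finite_algebra_def by auto
 have "finite_algebra ?D" unfolding finite_algebra_def
 proof (intro conjI ballI)
  show "1 : rat.span ?D" using BC[OF 1(1,2)] by simp
  fix x y assume "x : ?D" "y : ?D"
  then obtain b c b' c' where *: "b : B" "c : C" "b' : B" "c' : C" "x = b * c" "y = b' * c'" by auto
  have "(b * b') * (c * c') : rat.span ?D"
  using * by (intro BC finite_algebra_mult[OF B] finite_algebra_mult[OF C] rat.span_base)
  then show "x * y : rat.span ?D" by (simp add: * algebra_simps)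
 qed (use 1 in auto)
 moreover have "rat.span B <= rat.span ?D" "rat.span C <= rat.span ?D"
  using BC[OF _ 1(2)] BC[OF 1(1)] by auto
 ultimately show ?thesis by (rule that)
qed

lemma algebraic_common_algebra:
 assumes "algebraic x" "algebraic y"
 obtains D where "finite_algebra D" "x : rat.span D" "y : rat.span D"
proof -
 obtain n m where nm: "finite_algebra ((%i. x ^ i) ` {..<n})" "range (%i. x ^ i) <= rat.span ((%i. x ^ i) ` {..<n})"
  "finite_algebra ((%i. y ^ i) ` {..<m})" "range (%i. y ^ i) <= rat.span ((%i. y ^ i) ` {..<m})"
  using finite_algebra_powers assms by metis
 then have "x ^ 1 : rat.span ((%i. x ^ i) ` {..<n})" "y ^ 1 : rat.span ((%i. y ^ i) ` {..<m})" by blast+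
 then have xy: "x : rat.span ((%i. x ^ i) ` {..<n})" "y : rat.span ((%i. y ^ i) ` {..<m})" by simp_all
 obtain D where "finite_algebra D" "rat.span ((%i. x ^ i) ` {..<n}) <= rat.span D"
  "rat.span ((%i. y ^ i) ` {..<m}) <= rat.span D" using finite_algebra_product[OF nm(1,3)] .
 then show ?thesis using that xy by blast
qed

lemma algebraic_add: "algebraic x ==> algebraic y ==> algebraic (x + y)" for x :: complex
 by (rule algebraic_common_algebra, assumption+) (rule finite_algebra_algebraic[OF _ rat.span_add])

lemma algebraic_mult: "algebraic x ==> algebraic y ==> algebraic (x * y)" for x :: complex
 by (rule algebraic_common_algebra, assumption+) (rule finite_algebra_algebraic[OF _ finite_algebra_mult])

lemma algebraic_1: "algebraic (1::complex)" by (rule rat_imp_algebraic) simp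

subsection \<open>Primitive elements\<close>

definition adjoin :: "complex => complex set" where
 "adjoin th = rat.span (range (%i. th ^ i))"

lemma adjoin_eq_span:
 assumes "algebraic th"
 obtains B where "finite_algebra B" "adjoin th = rat.span B"
proof -
 obtain n where n: "finite_algebra ((%i. th ^ i) ` {..<n})"
  "range (%i. th ^ i) <= rat.span ((%i. th ^ i) ` {..<n})" using finite_algebra_powers[OF assms] by auto
 have "rat.span (range (%i. th ^ i)) = rat.span ((%i. th ^ i) ` {..<n})"
 proof
  show "rat.span (range (%i. th ^ i)) <= rat.span ((%i. th ^ i) ` {..<n})"
  by (rule rat.span_minimal[OF n(2) rat.subspace_span])
  show "rat.span ((%i. th ^ i) ` {..<n}) <= rat.span (range (%i. th ^ i))"
  by (rule rat.span_mono) auto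
 qed
 then show ?thesis using that n(1) unfolding adjoin_def by blast
qed

lemma
 assumes "algebraic th"
 shows adjoin_add: "x : adjoin th ==> y : adjoin th ==> x + y : adjoin th"
  and adjoin_mult: "x : adjoin th ==> y : adjoin th ==> x * y : adjoin th"
  and adjoin_inverse: "x : adjoin th ==> inverse x : adjoin th"
  and adjoin_self: "th : adjoin th"
  and adjoin_rat: "of_rat q : adjoin th"
  and adjoin_algebraic: "x : adjoin th ==> algebraic x"
proof -
 obtain B where B: "finite_algebra B" "adjoin th = rat.span B" using adjoin_eq_span[OF assms] .
 show "x : adjoin th ==> y : adjoin th ==> x + y : adjoin th" unfolding B(2) by (rule rat.span_add)
 show "x : adjoin th ==> y : adjoin th ==> x * y : adjoin th" unfolding B(2) by (rule finite_algebra_mult[OF B(1)])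
 show "x : adjoin th ==> inverse x : adjoin th" unfolding B(2) by (rule finite_algebra_inverse[OF B(1)])
 show "x : adjoin th ==> algebraic x" unfolding B(2) by (rule finite_algebra_algebraic[OF B(1)])
 show "th : adjoin th" unfolding adjoin_def by (rule rat.span_base) (auto intro: range_eqI[of _ _ 1])
 have "1 : adjoin th" using B unfolding finite_algebra_def by simp
 then show "of_rat q : adjoin th" unfolding adjoin_def using rat.span_scale[of 1 _ q] by simp
qed

lemma adjoin_minus: "algebraic th ==> x : adjoin th ==> - x : adjoin th"
 using adjoin_mult[OF _ adjoin_rat[of th "-1"], of x] by simp

lemma adjoin_diff: "algebraic th ==> x : adjoin th ==> y : adjoin th ==> x - y : adjoin th"
 using adjoin_add[of th x "- y"] adjoin_minus by simp

lemma adjoin_divide: "algebraic th ==> x : adjoin th ==> y : adjoin th ==> x / y : adjoin th"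
 using adjoin_mult[of th x "inverse y"] adjoin_inverse by (simp add: divide_inverse)

lemma adjoin_mono:
 assumes "algebraic th" "ph : adjoin th"
 shows "adjoin ph <= adjoin th"
proof -
 have "ph ^ i : adjoin th" for i
  using adjoin_rat[OF assms(1), of 1] by (induction i) (auto intro: adjoin_mult assms)
 then show ?thesis
  unfolding adjoin_def by (intro rat.span_minimal rat.subspace_span) (auto simp: adjoin_def)
qed

definition polys_over :: "complex set => complex poly set" where
 "polys_over F = {p. ALL i. coeff p i : F}"

lemma minimal_poly_dvd:
 assumes th: "algebraic th" and d: "d : polys_over (adjoin th)" "d ~= 0" "poly d \<beta> = 0"
  and min: "!!p. p : polys_over (adjoin th) ==> p ~= 0 ==> poly p \<beta> = 0 ==> degree d <= degree p"
 shows "p : polys_over (adjoin th) ==> poly p \<beta> = 0 ==> d dvd p"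
proof (induction "degree p" arbitrary: p rule: less_induct)
 case less
 show ?case
 proof (cases "p = 0")
  case False
  then have le: "degree d <= degree p" using min less.prems by blast
  define c where "c = lead_coeff p / lead_coeff d"
  have c: "c : adjoin th" unfolding c_def using less.prems(1) d(1)
  by (intro adjoin_divide th) (auto simp: polys_over_def)
  define p' where "p' = p - monom c (degree p - degree d) * d"
  have coeff: "coeff p' i : adjoin th" for i
  using less.prems(1) d(1) c adjoin_rat[OF th, of 0] unfolding p'_def polys_over_def coeff_diff coeff_monom_mult
  by (auto intro!: adjoin_diff adjoin_mult th)
  then have "p' : polys_over (adjoin th)" by (simp add: polys_over_def)
  moreover have "poly p' \<beta> = 0" unfolding p'_def using less.prems(2) d(3) by simp
  moreover have "d dvd p'" if "p' ~= 0"
  proof (rule less.hyps)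
  have "coeff p' (degree p) = 0" unfolding p'_def coeff_diff coeff_monom_mult using le d(2)
  by (simp add: c_def)
  moreover have "degree p' <= degree p" unfolding p'_def
  using le degree_mult_le[of "monom c (degree p - degree d)" d] degree_monom_le[of c "degree p - degree d"]
  by (intro degree_diff_le) auto
  ultimately show "degree p' < degree p" using that leading_coeff_0_iff[of p']
  by (cases "degree p' = degree p") auto
  qed fact+
  ultimately have "d dvd p'" by (cases "p' = 0") auto
  then have "d dvd p' + monom c (degree p - degree d) * d" by (rule dvd_add) simp
  then show ?thesis unfolding p'_def by simp
 qed simp
qed

lemma exists_minimal_poly:
 assumes "p : polys_over F" "p ~= 0" "poly p \<beta> = 0"
 obtains d where "d : polys_over F" "d ~= 0" "poly d \<beta> = 0"
  "!!p. p : polys_over F ==> p ~= 0 ==> poly p \<beta> = 0 ==> degree d <= degree p"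
proof -
 let ?P = "%d. d : polys_over F & d ~= 0 & poly d \<beta> = 0"
 have "?P (arg_min degree ?P)" using assms by (intro arg_min_natI[of ?P p]) auto
 moreover have "degree (arg_min degree ?P) <= degree q" if "?P q" for q
  using that by (rule arg_min_nat_le)
 ultimately show ?thesis using that[of "arg_min degree ?P"] by blast
qed

lemma polys_over_mono: "F <= G ==> polys_over F <= polys_over G" by (auto simp: polys_over_def)

lemma polys_over_pCons_iff: "pCons a p : polys_over F \<longleftrightarrow> a : F & p : polys_over F"
 unfolding polys_over_def by (auto simp: coeff_pCons split: nat.splits)

text \<open>With \<open>th = \<alpha> + k \<beta>\<close> for a suitable integer \<open>k\<close>, the only common root of the minimal
 polynomial of \<open>\<beta>\<close> and of \<open>A (th - k x)\<close>, where \<open>A\<close> annihilates \<open>\<alpha>\<close>, is \<open>\<beta>\<close>, and it is a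
 simple root; hence the minimal polynomial of \<open>\<beta>\<close> over the field of \<open>th\<close> is linear.\<close>

lemma primitive_element_two:
 assumes \<alpha>: "algebraic \<alpha>" and \<beta>: "algebraic \<beta>"
 obtains th where "algebraic th" "\<alpha> : adjoin th" "\<beta> : adjoin th"
proof -
 obtain A where A: "A : polys_over \<rat>" "A ~= 0" "poly A \<alpha> = 0"
  using \<alpha> unfolding algebraic_altdef polys_over_def by auto
 obtain B0 where B0: "B0 : polys_over \<rat>" "B0 ~= 0" "poly B0 \<beta> = 0"
  using \<beta> unfolding algebraic_altdef polys_over_def by auto
 obtain B where B: "B : polys_over \<rat>" "B ~= 0" "poly B \<beta> = 0"
  "!!p. p : polys_over \<rat> ==> p ~= 0 ==> poly p \<beta> = 0 ==> degree B <= degree p"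
  using exists_minimal_poly[OF B0] by metis
 have "degree B ~= 0"
 proof
  assume "degree B = 0"
  then obtain c where "B = [:c:]" by (metis degree_eq_zeroE)
  then show False using B(2,3) by simp
 qed
 have B': "poly (pderiv B) \<beta> ~= 0"
 proof
  assume 0: "poly (pderiv B) \<beta> = 0"
  have "pderiv B : polys_over \<rat>" using B(1) unfolding polys_over_def
  by (auto simp: coeff_pderiv intro!: Rats_mult Rats_add simp del: of_nat_Suc)
  moreover have "pderiv B ~= 0" using \<open>degree B ~= 0\<close> pderiv_eq_0_iff[of B] by simp
  ultimately have "degree B <= degree (pderiv B)" using B(4) 0 by blast
  then show False using \<open>degree B ~= 0\<close> by (simp add: degree_pderiv)
 qed
 define bad where "bad = (%(a, b). (a - \<alpha>) / (\<beta> - b)) ` ({a. poly A a = 0} \<times> {b. poly B b = 0})"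
 have "finite bad" unfolding bad_def using A(2) B(2) by (auto intro!: poly_roots_finite)
 moreover have "infinite (range (of_nat :: nat => complex))" using infinite_UNIV_nat
  by (simp add: finite_image_iff inj_of_nat)
 ultimately have "~ range (of_nat :: nat => complex) <= bad" using finite_subset by blast
 then obtain k :: nat where k: "of_nat k ~: bad" by blast
 define th where "th = \<alpha> + of_nat k * \<beta>"
 have kr: "of_nat k = (of_rat (of_nat k) :: complex)" by simp
 have th: "algebraic th" unfolding th_def
  by (intro algebraic_add algebraic_mult \<alpha> \<beta> rat_imp_algebraic) simp
 let ?F = "adjoin th"
 have Rats: "\<rat> <= ?F" using adjoin_rat[OF th] by (auto elim!: Rats_cases)
 have kF: "of_nat k : ?F" using Rats by auto
 have "pcompose p [:th, - of_nat k:] : polys_over ?F" if "p : polys_over \<rat>" for p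
  using that
 proof (induction p)
  case (pCons a p)
  then have p: "pcompose p [:th, - of_nat k:] : polys_over ?F" and a: "a : ?F"
  using Rats by (auto simp: polys_over_pCons_iff)
  have "coeff ([:th, - of_nat k:] * q) i : ?F" if "q : polys_over ?F" for q i
  using that kF unfolding polys_over_def
  by (cases i) (auto intro!: adjoin_diff adjoin_mult adjoin_self th)
  with p have "coeff ([:th, - of_nat k:] * pcompose p [:th, - of_nat k:]) i : ?F" for i by blast
  then show ?case unfolding pcompose_pCons using a Rats unfolding polys_over_def
  by (auto intro!: adjoin_add th simp: coeff_pCons simp del: mult_pCons_left split: nat.splits)
 qed (use Rats in \<open>auto simp: polys_over_def\<close>)
 then have A': "pcompose A [:th, - of_nat k:] : polys_over ?F" using A(1) by blast
 have BF: "B : polys_over ?F" using B(1) polys_over_mono[OF Rats] by blast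
 obtain d where d: "d : polys_over ?F" "d ~= 0" "poly d \<beta> = 0"
  "!!p. p : polys_over ?F ==> p ~= 0 ==> poly p \<beta> = 0 ==> degree d <= degree p"
  using exists_minimal_poly[OF BF B(2,3)] by metis
 have dB: "d dvd B" by (rule minimal_poly_dvd[OF th d BF B(3)])
 have dA: "d dvd pcompose A [:th, - of_nat k:]"
 proof (rule minimal_poly_dvd[OF th d A'])
  have "poly [:th, - of_nat k:] \<beta> = \<alpha>" unfolding th_def by simp
  then show "poly (pcompose A [:th, - of_nat k:]) \<beta> = 0" unfolding poly_pcompose by (simp only: A(3))
 qed
 have root: "\<gamma> = \<beta>" if "poly d \<gamma> = 0" for \<gamma>
 proof (rule ccontr)
  assume ne: "\<gamma> ~= \<beta>"
  have "poly B \<gamma> = 0" using dB that by (auto elim!: dvdE)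
  moreover have "poly (pcompose A [:th, - of_nat k:]) \<gamma> = 0" using dA that by (auto elim!: dvdE)
  then have "poly A (th - of_nat k * \<gamma>) = 0" by (simp add: poly_pcompose mult.commute)
  ultimately have "(th - of_nat k * \<gamma> - \<alpha>) / (\<beta> - \<gamma>) : bad" unfolding bad_def by force
  moreover have "(th - of_nat k * \<gamma> - \<alpha>) / (\<beta> - \<gamma>) = of_nat k"
  using ne by (simp add: th_def field_simps)
  ultimately show False using k by simp
 qed
 obtain e where e: "d = [:- \<beta>, 1:] * e" using d(3) by (metis poly_eq_0_iff_dvd dvdE)
 have "degree e = 0"
 proof (rule ccontr)
  assume "degree e ~= 0"
  then obtain \<gamma> where "poly e \<gamma> = 0"
  using fundamental_theorem_of_algebra[of e] by (auto simp: constant_degree)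
  then have "poly e \<beta> = 0" using root[of \<gamma>] e by simp
  then obtain e' where "e = [:- \<beta>, 1:] * e'" by (metis poly_eq_0_iff_dvd dvdE)
  moreover obtain k where "B = d * k" using dB by (rule dvdE)
  ultimately have "B = [:- \<beta>, 1:] * ([:- \<beta>, 1:] * (e' * k))" using e by (simp only: mult.assoc)
  then have "poly (pderiv B) \<beta> = 0" by (simp only: pderiv_mult poly_add poly_mult) simp
  then show False using B' by simp
 qed
 then obtain c where c: "e = [:c:]" by (metis degree_eq_zeroE)
 have "c ~= 0" using d(2) e c by auto
 have "coeff d 0 : ?F" "coeff d 1 : ?F" using d(1) unfolding polys_over_def by auto
 moreover have "\<beta> = - coeff d 0 / coeff d 1" using \<open>c ~= 0\<close> by (simp add: e c)
 ultimately have \<beta>F: "\<beta> : ?F" using adjoin_divide[OF th adjoin_minus[OF th]] by simp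
 have "\<alpha> = th - of_nat k * \<beta>" by (simp add: th_def)
 also have "... : ?F" using Rats by (intro adjoin_diff adjoin_mult adjoin_self th \<beta>F) auto
 finally show ?thesis using that th \<beta>F by blast
qed

lemma primitive_element:
 assumes "finite Z" "!!z. z : Z ==> algebraic z"
 shows "EX th. algebraic th & Z <= adjoin th"
 using assms
proof (induction Z rule: finite_induct)
 case empty
 then show ?case using algebraic_1 by blast
next
 case (insert z Z)
 then obtain ph where ph: "algebraic ph" "Z <= adjoin ph" by auto
 obtain th where "algebraic th" "ph : adjoin th" "z : adjoin th"
  using primitive_element_two[OF ph(1)] insert.prems by blast
 then show ?case using adjoin_mono ph(2) by blast
qed

section \<open>Points and coordinates\<close>

lemma ideal_Union_chain:
 assumes R: "cring R" and C: "C ~= {}" "!!I. I : C ==> ideal I R" "!!I J. I : C ==> J : C ==> I <= J \<or> J <= I"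
 shows "ideal (\<Union>C) R"
proof -
 interpret R: cring R by fact
 have sub: "additive_subgroup I R" if "I : C" for I using C(2)[OF that] unfolding ideal_def by simp
 show ?thesis
 proof (rule idealI[OF R.ring_axioms])
  show "subgroup (\<Union>C) (add_monoid R)"
  proof (rule R.add.subgroupI)
  show "\<Union>C <= carrier R" using sub additive_subgroup.a_subset by blast
  show "\<Union>C ~= {}" using C(1) sub additive_subgroup.zero_closed by blast
  show "\<ominus>\<^bsub>R\<^esub> a : \<Union>C" if a: "a : \<Union>C" for a
  proof -
  obtain I where "I : C" "a : I" using a by blast
  then show ?thesis using additive_subgroup.a_inv_closed[OF sub, of I a] R.abelian_group_axioms by blast
  qed
  show "a \<oplus>\<^bsub>R\<^esub> b : \<Union>C" if ab: "a : \<Union>C" "b : \<Union>C" for a b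
  proof -
  obtain I J where IJ: "I : C" "a : I" "J : C" "b : J" using ab by blast
  then obtain L where "L : C" "a : L" "b : L" using C(3)[OF IJ(1,3)] by blast
  then show ?thesis using additive_subgroup.a_closed[OF sub, of L a b] by blast
  qed
  qed
  show "x \<otimes>\<^bsub>R\<^esub> a : \<Union>C" "a \<otimes>\<^bsub>R\<^esub> x : \<Union>C" if ax: "a : \<Union>C" "x : carrier R" for a x
  using ax C(2) ideal.I_l_closed ideal.I_r_closed by (metis UnionE UnionI)+
 qed
qed

lemma unit_of_unit_product:
 assumes R: "cring R" and u: "a \<otimes>\<^bsub>R\<^esub> b : Units R" and ab: "a : carrier R" "b : carrier R"
 shows "a : Units R"
proof -
 interpret R: cring R by fact
 obtain c where c: "c : carrier R" "c \<otimes>\<^bsub>R\<^esub> (a \<otimes>\<^bsub>R\<^esub> b) = \<one>\<^bsub>R\<^esub>" using u unfolding Units_def by blast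
 then have "a \<otimes>\<^bsub>R\<^esub> (c \<otimes>\<^bsub>R\<^esub> b) = \<one>\<^bsub>R\<^esub>" "(c \<otimes>\<^bsub>R\<^esub> b) \<otimes>\<^bsub>R\<^esub> a = \<one>\<^bsub>R\<^esub>" using ab by (simp_all add: R.m_ac)
 then show ?thesis unfolding Units_def using ab c(1) by blast
qed

text \<open>Zorn's lemma, applied to the ideals that do not contain the unit.\<close>

lemma exists_maximalideal:
 assumes "cring R" "ideal I R" "\<one>\<^bsub>R\<^esub> ~: I"
 shows "EX M. maximalideal M R & I <= M"
proof -
 interpret R: cring R by fact
 let ?A = "{J. ideal J R & I <= J & \<one>\<^bsub>R\<^esub> ~: J}"
 have "EX M:?A. ALL J:?A. M <= J --> J = M"
 proof (rule subset_Zorn_nonempty)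
  show "?A ~= {}" using assms by auto
  fix C assume C: "C ~= {}" "subset.chain ?A C"
  have "ideal (\<Union>C) R"
  by (rule ideal_Union_chain[OF assms(1) C(1)]) (use C(2) in \<open>auto simp: subset_chain_def\<close>)
  then show "\<Union>C : ?A" using C unfolding subset_chain_def by auto
 qed
 then obtain M where M: "ideal M R" "I <= M" "\<one>\<^bsub>R\<^esub> ~: M"
  "!!J. ideal J R ==> I <= J ==> \<one>\<^bsub>R\<^esub> ~: J ==> M <= J ==> J = M" by auto
 have "maximalideal M R"
 proof (rule maximalidealI[OF M(1)])
  show "carrier R ~= M" using M(3) R.one_closed by blast
  fix J assume J: "ideal J R" "M <= J" "J <= carrier R"
  show "J = M \<or> J = carrier R"
  using M(2) M(4)[OF J(1)] J(2) ideal.one_imp_carrier[OF J(1)] by blast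
 qed
 then show ?thesis using M(2) by blast
qed

text \<open>The ideal generated by a list.\<close>

fun combinations :: "('a, 'b) ring_scheme => 'a list => 'a set" where
 "combinations R [] = {\<zero>\<^bsub>R\<^esub>}"
| "combinations R (g # gs) = {(a \<otimes>\<^bsub>R\<^esub> g) \<oplus>\<^bsub>R\<^esub> b | a b. a : carrier R & b : combinations R gs}"

lemma combinations_ideal:
 assumes "cring R" "set gs <= carrier R"
 shows "ideal (combinations R gs) R & set gs <= combinations R gs"
 using assms(2)
proof (induction gs)
 interpret R: cring R by fact
 case Nil
 then show ?case using R.zeroideal by simp
next
 interpret R: cring R by fact
 case (Cons g gs)
 then have IH: "ideal (combinations R gs) R" "set gs <= combinations R gs" and g: "g : carrier R" by auto
 interpret J: ideal "combinations R gs" R by (rule IH)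
 have eq: "combinations R (g # gs) = PIdl\<^bsub>R\<^esub> g <+>\<^bsub>R\<^esub> combinations R gs"
  unfolding set_add_def' cgenideal_def by auto
 have "g : combinations R (g # gs)"
 proof -
  have "g = (\<one>\<^bsub>R\<^esub> \<otimes>\<^bsub>R\<^esub> g) \<oplus>\<^bsub>R\<^esub> \<zero>\<^bsub>R\<^esub>" using g by simp
  then show ?thesis using J.zero_closed R.one_closed unfolding combinations.simps by blast
 qed
 moreover have "set gs <= combinations R (g # gs)"
 proof
  fix h assume h: "h : set gs"
  then have "h = (\<zero>\<^bsub>R\<^esub> \<otimes>\<^bsub>R\<^esub> g) \<oplus>\<^bsub>R\<^esub> h" using g IH(2) J.Icarr by auto
  then show "h : combinations R (g # gs)" using h IH(2) by auto
 qed
 moreover have "ideal (combinations R (g # gs)) R"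
  unfolding eq by (intro R.add_ideals R.cgenideal_ideal g IH)
 ultimately show ?case by simp
qed

lemma carrier_Qbar[simp]: "z : carrier Qbar \<longleftrightarrow> algebraic z" by (simp add: Qbar_def)
lemma Qbar_ops[simp]: "x \<oplus>\<^bsub>Qbar\<^esub> y = x + y" "x \<otimes>\<^bsub>Qbar\<^esub> y = x * y" "\<one>\<^bsub>Qbar\<^esub> = 1" "\<zero>\<^bsub>Qbar\<^esub> = 0"
 by (simp_all add: Qbar_def)

lemma cring_Qbar: "cring Qbar"
proof (rule cringI)
 show "abelian_group Qbar"
 proof (rule abelian_groupI)
  show "EX y:carrier Qbar. y \<oplus>\<^bsub>Qbar\<^esub> x = \<zero>\<^bsub>Qbar\<^esub>" if "x : carrier Qbar" for x
  using that by (intro bexI[of _ "- x"]) auto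
 qed (auto intro: algebraic_add)
 show "comm_monoid Qbar"
  by (rule comm_monoidI) (auto intro: algebraic_mult algebraic_1)
qed (auto simp: algebra_simps)

definition value_at :: "('p, 's) space => 'p set => 'p => 's => complex => bool" where
 "value_at X U p s c \<longleftrightarrow> s : carrier (sect X U) & algebraic c &
  vanishes X U p (s \<ominus>\<^bsub>sect X U\<^esub> cst X U c)"

locale lrs =
 fixes X :: "('p, 's) space"
 assumes lrs: "locally_ringed_space X"
begin

abbreviation "op U \<equiv> openin (topo X) U"

lemma pre: "presheaf X" using lrs unfolding locally_ringed_space_def sheaf_def by simp

lemmas presheaf1 = pre[unfolded presheaf_def, THEN conjunct1, rule_format]
lemmas presheaf2 = pre[unfolded presheaf_def, THEN conjunct2, THEN conjunct1, rule_format]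
lemmas presheaf3 = pre[unfolded presheaf_def, THEN conjunct2, THEN conjunct2, rule_format]

lemma cring_sect: "op U ==> cring (sect X U)" using presheaf1[of U] by simp
lemma cst_hom: "op U ==> cst X U : ring_hom Qbar (sect X U)" using presheaf1[of U] by simp
lemma res_id: "op U ==> s : carrier (sect X U) ==> res X U U s = s" using presheaf1[of U] by simp
lemma res_hom: "op U ==> op W ==> W <= U ==> res X U W : ring_hom (sect X U) (sect X W)"
 using presheaf2[of U W] by simp
lemma res_cst: "op U ==> op W ==> W <= U ==> algebraic c ==> res X U W (cst X U c) = cst X W c"
 using presheaf2[of U W] by simp
lemma res_res: "op U ==> op W ==> op T ==> W <= U ==> T <= W ==> s : carrier (sect X U) ==>
  res X W T (res X U W s) = res X U T s"
 using presheaf3[of U W T] by simp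

lemma res_closed: "op U ==> op W ==> W <= U ==> s : carrier (sect X U) ==> res X U W s : carrier (sect X W)"
 by (rule ring_hom_closed[OF res_hom])

lemma cst_closed: "op U ==> algebraic c ==> cst X U c : carrier (sect X U)"
 using ring_hom_closed[OF cst_hom] by simp
lemma cst_add: "op U ==> algebraic c ==> algebraic d ==> cst X U (c + d) = cst X U c \<oplus>\<^bsub>sect X U\<^esub> cst X U d"
 using ring_hom_add[OF cst_hom, of U c d] by simp
lemma cst_mult: "op U ==> algebraic c ==> algebraic d ==> cst X U (c * d) = cst X U c \<otimes>\<^bsub>sect X U\<^esub> cst X U d"
 using ring_hom_mult[OF cst_hom, of U c d] by simp
lemma cst_1: "op U ==> cst X U 1 = \<one>\<^bsub>sect X U\<^esub>"
 using ring_hom_one[OF cst_hom] by simp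
lemma cst_0: "op U ==> cst X U 0 = \<zero>\<^bsub>sect X U\<^esub>"
 using ring_hom_zero[OF cst_hom] cring_Qbar cring_sect by (simp add: cring_def)

lemma hom_Units:
 assumes "cring R" "cring R'" "h : ring_hom R R'" "u : Units R"
 shows "h u : Units R'"
proof -
 interpret R: cring R by fact
 interpret R': cring R' by fact
 have u: "u : carrier R" "inv\<^bsub>R\<^esub> u : carrier R" using assms(4) by auto
 have "h u \<otimes>\<^bsub>R'\<^esub> h (inv\<^bsub>R\<^esub> u) = \<one>\<^bsub>R'\<^esub>"
  using ring_hom_mult[OF assms(3) u] R.Units_r_inv[OF assms(4)] ring_hom_one[OF assms(3)] by simp
 moreover have "h u : carrier R'" "h (inv\<^bsub>R\<^esub> u) : carrier R'" using ring_hom_closed[OF assms(3)] u by auto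
 ultimately show ?thesis using R'.m_comm[of "h u" "h (inv\<^bsub>R\<^esub> u)"] unfolding Units_def by auto
qed

lemma res_Units: "op U ==> op W ==> W <= U ==> u : Units (sect X U) ==> res X U W u : Units (sect X W)"
 by (rule hom_Units[OF cring_sect cring_sect res_hom])

lemma vanishes_res:
 assumes U: "op U" "op W" "W <= U" and p: "p : W" and s: "s : carrier (sect X U)"
 shows "vanishes X W p (res X U W s) \<longleftrightarrow> vanishes X U p s"
proof -
 have "(EX T. op T & p : T & T <= W & res X W T (res X U W s) : Units (sect X T)) \<longleftrightarrow>
  (EX T. op T & p : T & T <= U & res X U T s : Units (sect X T))" (is "?L \<longleftrightarrow> ?R")
 proof
  assume ?L
  then show ?R using U res_res[of U W _ s] s by (metis subset_trans)
 next
  assume ?R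
  then obtain T where T: "op T" "p : T" "T <= U" "res X U T s : Units (sect X T)" by auto
  have o: "op (T \<inter> W)" using T U by blast
  have "res X W (T \<inter> W) (res X U W s) = res X T (T \<inter> W) (res X U T s)"
  using res_res[of U W "T \<inter> W" s] res_res[of U T "T \<inter> W" s] U T o s by simp
  also have "... : Units (sect X (T \<inter> W))" using res_Units[OF T(1) o _ T(4)] by simp
  finally show ?L using o T p by (intro exI[of _ "T \<inter> W"]) auto
 qed
 then show ?thesis unfolding vanishes_def by simp
qed

lemma vanishes_add:
 "op U ==> p : U ==> s : carrier (sect X U) ==> t : carrier (sect X U) ==>
  vanishes X U p s ==> vanishes X U p t ==> vanishes X U p (s \<oplus>\<^bsub>sect X U\<^esub> t)"
 using lrs[unfolded locally_ringed_space_def, THEN conjunct2, rule_format, of U p] by simp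

lemma vanishes_zero: "op U ==> p : U ==> vanishes X U p \<zero>\<^bsub>sect X U\<^esub>"
 using lrs[unfolded locally_ringed_space_def, THEN conjunct2, rule_format, of U p] by simp

lemma vanishes_mult:
 assumes U: "op U" "p : U" and s: "s : carrier (sect X U)" and t: "t : carrier (sect X U)"
 shows "vanishes X U p (s \<otimes>\<^bsub>sect X U\<^esub> t) \<longleftrightarrow> vanishes X U p s \<or> vanishes X U p t"
proof
 assume st: "vanishes X U p (s \<otimes>\<^bsub>sect X U\<^esub> t)"
 show "vanishes X U p s \<or> vanishes X U p t"
 proof (rule ccontr)
  assume "~ ?thesis"
  then obtain A B where A: "op A" "p : A" "A <= U" "res X U A s : Units (sect X A)"
  and B: "op B" "p : B" "B <= U" "res X U B t : Units (sect X B)" unfolding vanishes_def by blast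
  have o: "op (A \<inter> B)" using A B by blast
  interpret R: cring "sect X (A \<inter> B)" by (rule cring_sect[OF o])
  have "res X U (A \<inter> B) s : Units (sect X (A \<inter> B))"
  using res_Units[OF A(1) o _ A(4)] res_res[OF U(1) A(1) o A(3) _ s] by simp
  moreover have "res X U (A \<inter> B) t : Units (sect X (A \<inter> B))"
  using res_Units[OF B(1) o _ B(4)] res_res[OF U(1) B(1) o B(3) _ t] by simp
  moreover have "res X U (A \<inter> B) (s \<otimes>\<^bsub>sect X U\<^esub> t) =
  res X U (A \<inter> B) s \<otimes>\<^bsub>sect X (A \<inter> B)\<^esub> res X U (A \<inter> B) t"
  using A by (intro ring_hom_mult[OF res_hom] U o s t) auto
  ultimately have "res X U (A \<inter> B) (s \<otimes>\<^bsub>sect X U\<^esub> t) : Units (sect X (A \<inter> B))" by simp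
  then show False using st o A B unfolding vanishes_def by blast
 qed
next
 assume v: "vanishes X U p s \<or> vanishes X U p t"
 show "vanishes X U p (s \<otimes>\<^bsub>sect X U\<^esub> t)"
  unfolding vanishes_def
 proof
  assume "EX W. op W & p : W & W <= U & res X U W (s \<otimes>\<^bsub>sect X U\<^esub> t) : Units (sect X W)"
  then obtain W where W: "op W" "p : W" "W <= U" "res X U W (s \<otimes>\<^bsub>sect X U\<^esub> t) : Units (sect X W)" by auto
  interpret R: cring "sect X W" by (rule cring_sect[OF W(1)])
  have c: "res X U W s : carrier (sect X W)" "res X U W t : carrier (sect X W)"
  using res_closed U W s t by auto
  have "res X U W s \<otimes>\<^bsub>sect X W\<^esub> res X U W t : Units (sect X W)"
  using W(4) ring_hom_mult[OF res_hom[OF U(1) W(1,3)] s t] by simp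
  then have "res X U W s : Units (sect X W) & res X U W t : Units (sect X W)"
  using unit_of_unit_product[OF R.is_cring, of "res X U W s" "res X U W t"]
  unit_of_unit_product[OF R.is_cring, of "res X U W t" "res X U W s"] R.m_comm c by auto
  then show False using v W unfolding vanishes_def by blast
 qed
qed

lemma not_vanishes_one: "op U ==> p : U ==> ~ vanishes X U p \<one>\<^bsub>sect X U\<^esub>"
 unfolding vanishes_def using res_id[of U] cring_sect[of U] monoid.Units_one_closed
 by (metis cring.axioms(1) monoid.one_closed ring.is_monoid subset_refl)

lemma vanishes_cst:
 assumes "op U" "p : U" "algebraic c"
 shows "vanishes X U p (cst X U c) \<longleftrightarrow> c = 0"
proof
 assume v: "vanishes X U p (cst X U c)"
 show "c = 0"
 proof (rule ccontr)
  assume "c ~= 0"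
  then have "cst X U c \<otimes>\<^bsub>sect X U\<^esub> cst X U (inverse c) = \<one>\<^bsub>sect X U\<^esub>"
  using cst_mult[OF assms(1,3), of "inverse c"] cst_1[OF assms(1)] assms
  algebraic_inverse[OF assms(3)] by auto
  then show False
  using vanishes_mult[OF assms(1,2) cst_closed[OF assms(1,3)] cst_closed[OF assms(1), of "inverse c"]]
  v algebraic_inverse[OF assms(3)] not_vanishes_one[OF assms(1,2)] by auto
 qed
qed (use assms vanishes_zero cst_0 in auto)

lemma vanishes_minus:
 assumes "op U" "p : U" "s : carrier (sect X U)" "vanishes X U p s"
 shows "vanishes X U p (\<ominus>\<^bsub>sect X U\<^esub> s)"
proof -
 interpret R: cring "sect X U" by (rule cring_sect[OF assms(1)])
 have "\<ominus>\<^bsub>sect X U\<^esub> s = (\<ominus>\<^bsub>sect X U\<^esub> \<one>\<^bsub>sect X U\<^esub>) \<otimes>\<^bsub>sect X U\<^esub> s" using assms(3) by (simp add: R.l_minus)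
 then show ?thesis using vanishes_mult[OF assms(1,2) _ assms(3), of "\<ominus>\<^bsub>sect X U\<^esub> \<one>\<^bsub>sect X U\<^esub>"] assms(4)
  by simp
qed

lemma value_at_cst: "op U ==> p : U ==> algebraic c ==> value_at X U p (cst X U c) c"
proof -
 assume *: "op U" "p : U" "algebraic c"
 interpret R: cring "sect X U" by (rule cring_sect[OF *(1)])
 have "cst X U c \<ominus>\<^bsub>sect X U\<^esub> cst X U c = \<zero>\<^bsub>sect X U\<^esub>"
  using cst_closed[OF *(1,3)] by (simp add: a_minus_def R.r_neg)
 then show ?thesis unfolding value_at_def using * cst_closed[OF *(1,3)] vanishes_zero[OF *(1,2)]
  by (simp only:)
qed

lemma value_at_add:
 assumes U: "op U" "p : U" and s: "value_at X U p s c" and t: "value_at X U p t d"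
 shows "value_at X U p (s \<oplus>\<^bsub>sect X U\<^esub> t) (c + d)"
proof -
 interpret R: cring "sect X U" by (rule cring_sect[OF U(1)])
 have c: "s : carrier (sect X U)" "t : carrier (sect X U)" "algebraic c" "algebraic d"
  and v: "vanishes X U p (s \<ominus>\<^bsub>sect X U\<^esub> cst X U c)" "vanishes X U p (t \<ominus>\<^bsub>sect X U\<^esub> cst X U d)"
  using s t unfolding value_at_def by auto
 note k = cst_closed[OF U(1) c(3)] cst_closed[OF U(1) c(4)]
 have "(s \<oplus>\<^bsub>sect X U\<^esub> t) \<ominus>\<^bsub>sect X U\<^esub> cst X U (c + d) =
  (s \<ominus>\<^bsub>sect X U\<^esub> cst X U c) \<oplus>\<^bsub>sect X U\<^esub> (t \<ominus>\<^bsub>sect X U\<^esub> cst X U d)"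
  unfolding cst_add[OF U(1) c(3,4)] using c(1,2) k by algebra
 then show ?thesis unfolding value_at_def using vanishes_add[OF U _ _ v] c k algebraic_add by auto
qed

lemma value_at_mult:
 assumes U: "op U" "p : U" and s: "value_at X U p s c" and t: "value_at X U p t d"
 shows "value_at X U p (s \<otimes>\<^bsub>sect X U\<^esub> t) (c * d)"
proof -
 interpret R: cring "sect X U" by (rule cring_sect[OF U(1)])
 have c: "s : carrier (sect X U)" "t : carrier (sect X U)" "algebraic c" "algebraic d"
  and v: "vanishes X U p (s \<ominus>\<^bsub>sect X U\<^esub> cst X U c)" "vanishes X U p (t \<ominus>\<^bsub>sect X U\<^esub> cst X U d)"
  using s t unfolding value_at_def by auto
 note k = cst_closed[OF U(1) c(3)] cst_closed[OF U(1) c(4)]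
 have "(s \<otimes>\<^bsub>sect X U\<^esub> t) \<ominus>\<^bsub>sect X U\<^esub> cst X U (c * d) =
  (s \<ominus>\<^bsub>sect X U\<^esub> cst X U c) \<otimes>\<^bsub>sect X U\<^esub> t \<oplus>\<^bsub>sect X U\<^esub> cst X U c \<otimes>\<^bsub>sect X U\<^esub> (t \<ominus>\<^bsub>sect X U\<^esub> cst X U d)"
  unfolding cst_mult[OF U(1) c(3,4)] using c(1,2) k by algebra
 moreover have "vanishes X U p ((s \<ominus>\<^bsub>sect X U\<^esub> cst X U c) \<otimes>\<^bsub>sect X U\<^esub> t)"
  using vanishes_mult[OF U _ c(2)] v(1) c k by simp
 moreover have "vanishes X U p (cst X U c \<otimes>\<^bsub>sect X U\<^esub> (t \<ominus>\<^bsub>sect X U\<^esub> cst X U d))"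
  using vanishes_mult[OF U k(1)] v(2) c k by simp
 ultimately show ?thesis unfolding value_at_def
  using vanishes_add[OF U] c k algebraic_mult by auto
qed

lemma value_at_vanishes:
 assumes U: "op U" "p : U" and s: "value_at X U p s c"
 shows "vanishes X U p s \<longleftrightarrow> c = 0"
proof -
 interpret R: cring "sect X U" by (rule cring_sect[OF U(1)])
 have c: "s : carrier (sect X U)" "algebraic c" and v: "vanishes X U p (s \<ominus>\<^bsub>sect X U\<^esub> cst X U c)"
  using s unfolding value_at_def by auto
 note k = cst_closed[OF U(1) c(2)]
 show ?thesis
 proof
  assume "vanishes X U p s"
  then have "vanishes X U p (s \<oplus>\<^bsub>sect X U\<^esub> (\<ominus>\<^bsub>sect X U\<^esub> (s \<ominus>\<^bsub>sect X U\<^esub> cst X U c)))"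
  using vanishes_add[OF U] vanishes_minus[OF U _ v] c k by simp
  moreover have "s \<oplus>\<^bsub>sect X U\<^esub> (\<ominus>\<^bsub>sect X U\<^esub> (s \<ominus>\<^bsub>sect X U\<^esub> cst X U c)) = cst X U c"
  using c k by algebra
  ultimately show "c = 0" using vanishes_cst[OF U c(2)] by simp
 next
  assume "c = 0"
  then show "vanishes X U p s" using v cst_0[OF U(1)] c by (simp add: a_minus_def)
 qed
qed

lemma value_at_diff:
 assumes U: "op U" "p : U" and s: "value_at X U p s c" and d: "algebraic d"
 shows "value_at X U p (s \<ominus>\<^bsub>sect X U\<^esub> cst X U d) (c - d)"
proof -
 interpret R: cring "sect X U" by (rule cring_sect[OF U(1)])
 have "cst X U d \<oplus>\<^bsub>sect X U\<^esub> cst X U (- d) = \<zero>\<^bsub>sect X U\<^esub>"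
  using cst_add[OF U(1) d, of "- d"] cst_0[OF U(1)] d by simp
 then have "cst X U (- d) = \<ominus>\<^bsub>sect X U\<^esub> cst X U d"
  using R.minus_equality[of "cst X U (- d)" "cst X U d"] cst_closed[OF U(1)] d R.a_comm by auto
 then show ?thesis
  using value_at_add[OF U s value_at_cst[OF U, of "- d"]] d by (simp add: a_minus_def)
qed

lemma value_at_unique:
 assumes U: "op U" "p : U" and "value_at X U p s c" "value_at X U p s d"
 shows "c = d"
proof -
 have d: "algebraic d" "vanishes X U p (s \<ominus>\<^bsub>sect X U\<^esub> cst X U d)" using assms(4) unfolding value_at_def by auto
 show ?thesis
  using value_at_vanishes[OF U value_at_diff[OF U assms(3) d(1)]] d(2) by simp
qed

lemma value_at_res:
 assumes U: "op U" "op W" "W <= U" and p: "p : W" and s: "s : carrier (sect X U)"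
 shows "value_at X W p (res X U W s) c \<longleftrightarrow> value_at X U p s c"
proof (cases "algebraic c")
 case True
 interpret R: cring "sect X U" by (rule cring_sect[OF U(1)])
 interpret S: cring "sect X W" by (rule cring_sect[OF U(2)])
 interpret h: ring_hom_cring "sect X U" "sect X W" "res X U W"
  by unfold_locales (rule res_hom[OF U])
 have k: "cst X U c : carrier (sect X U)" by (rule cst_closed[OF U(1) True])
 have "res X U W (s \<ominus>\<^bsub>sect X U\<^esub> cst X U c) = res X U W s \<ominus>\<^bsub>sect X W\<^esub> cst X W c"
  using s k res_cst[OF U True] by (simp add: a_minus_def)
 then show ?thesis unfolding value_at_def
  using vanishes_res[OF U p, of "s \<ominus>\<^bsub>sect X U\<^esub> cst X U c"] s k res_closed[OF U s] by simp
qed (simp add: value_at_def)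

lemma value_at_finsum:
 assumes U: "op U" "p : U" and "finite I" "!!i. i : I ==> value_at X U p (f i) (c i)"
 shows "value_at X U p (\<Oplus>\<^bsub>sect X U\<^esub>i\<in>I. f i) (\<Sum>i\<in>I. c i)"
 using assms(3,4)
proof (induction I rule: finite_induct)
 interpret R: cring "sect X U" by (rule cring_sect[OF U(1)])
 case empty
 then show ?case using value_at_cst[OF U, of 0] cst_0[OF U(1)] by simp
next
 interpret R: cring "sect X U" by (rule cring_sect[OF U(1)])
 case (insert i I)
 then have "f : I \<rightarrow> carrier (sect X U)" "f i : carrier (sect X U)" by (auto simp: value_at_def)
 then show ?case using insert value_at_add[OF U] by (simp add: R.finsum_insert)
qed

lemma value_at_finprod:
 assumes U: "op U" "p : U" and "finite I" "!!i. i : I ==> value_at X U p (f i) (c i)"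
 shows "value_at X U p (\<Otimes>\<^bsub>sect X U\<^esub>i\<in>I. f i) (\<Prod>i\<in>I. c i)"
 using assms(3,4)
proof (induction I rule: finite_induct)
 interpret R: cring "sect X U" by (rule cring_sect[OF U(1)])
 case empty
 then show ?case using value_at_cst[OF U algebraic_1] cst_1[OF U(1)] by simp
next
 interpret R: cring "sect X U" by (rule cring_sect[OF U(1)])
 case (insert i I)
 then have "f : I \<rightarrow> carrier (sect X U)" "f i : carrier (sect X U)" by (auto simp: value_at_def)
 then show ?case using insert value_at_mult[OF U] by (simp add: R.finprod_insert)
qed

lemma value_at_pow:
 assumes U: "op U" "p : U" and "value_at X U p s c"
 shows "value_at X U p (s [^]\<^bsub>sect X U\<^esub> (k::nat)) (c ^ k)"
proof (induction k)
 interpret R: cring "sect X U" by (rule cring_sect[OF U(1)])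
 case 0
 then show ?case using value_at_cst[OF U algebraic_1] cst_1[OF U(1)] by simp
next
 interpret R: cring "sect X U" by (rule cring_sect[OF U(1)])
 case (Suc k)
 then show ?case using value_at_mult[OF U Suc assms(3)] by (simp add: mult.commute)
qed

end

definition mpoly_value :: "nat => (nat => complex) => mpoly => complex" where
 "mpoly_value n a P = (\<Sum>m\<in>Poly_Mapping.keys P.
  Poly_Mapping.lookup P m * (\<Prod>l<n. a l ^ Poly_Mapping.lookup m l))"

lemma (in lrs) value_at_poly_at:
 assumes U: "op U" "p : U" and P: "P : polys n" and y: "!!l. l < n ==> value_at X U p (y l) (a l)"
 shows "value_at X U p (poly_at X U n y P) (mpoly_value n a P)"
 unfolding poly_at_def mpoly_value_def
 using P unfolding polys_def
 by (intro value_at_finsum value_at_mult value_at_finprod value_at_pow value_at_cst U y) auto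

subsection \<open>Polynomials in sections\<close>

lemma polys_0: "0 : polys n" by (simp add: polys_def)

lemma lookup_polys: "P : polys n ==> algebraic (Poly_Mapping.lookup P m)"
 by (cases "m : Poly_Mapping.keys P") (auto simp: polys_def in_keys_iff)

lemma polys_single: "Poly_Mapping.keys m <= {..<n} ==> algebraic c ==> Poly_Mapping.single m c : polys n"
 by (auto simp: polys_def lookup_single split: if_splits)

lemma polys_add: "P : polys n ==> Q : polys n ==> P + Q : polys n"
 using lookup_polys[of P n] lookup_polys[of Q n] Poly_Mapping.keys_add[of P Q]
 by (fastforce simp: polys_def lookup_add intro: algebraic_add)

lemma polys_induct [consumes 1, case_names zero add]:
 assumes "P : polys n" "H 0"
  "!!m c P. Poly_Mapping.keys m <= {..<n} ==> algebraic c ==> P : polys n ==> H P ==>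
  H (Poly_Mapping.single m c + P)"
 shows "H P"
proof -
 have *: "H P" if "finite K" "Poly_Mapping.keys P = K" "P : polys n" for K P
  using that
 proof (induction K arbitrary: P rule: finite_induct)
  case (insert k K)
  define c where "c = Poly_Mapping.lookup P k"
  define Q where "Q = P - Poly_Mapping.single k c"
  have l: "Poly_Mapping.lookup Q j = (if j = k then 0 else Poly_Mapping.lookup P j)" for j
  by (simp add: Q_def lookup_minus lookup_single c_def)
  have k: "k : Poly_Mapping.keys P" using insert by simp
  have keys: "Poly_Mapping.keys Q = K"
  using insert.hyps insert.prems(1) by (auto simp: in_keys_iff l set_eq_iff split: if_splits)
  have "Q : polys n" using insert.prems keys unfolding polys_def by (auto simp: l)
  moreover have "Poly_Mapping.keys k <= {..<n}" "algebraic c" using k insert.prems unfolding polys_def c_def by auto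
  ultimately have "H (Poly_Mapping.single k c + Q)" using assms(3) insert.IH[OF keys] by blast
  then show ?case by (simp add: Q_def)
 qed (use assms(2) in auto)
 show ?thesis by (rule *[OF finite_keys refl assms(1)])
qed

lemma polys_mult: "P : polys n ==> Q : polys n ==> P * Q : polys n"
proof (induction P rule: polys_induct)
 case (add m c P)
 have "Poly_Mapping.single m c * Q : polys n" using add.prems
 proof (induction Q rule: polys_induct)
  case (add m' c' Q)
  have "Poly_Mapping.single (m + m') (c * c') : polys n"
  using \<open>Poly_Mapping.keys m <= {..<n}\<close> add.hyps \<open>algebraic c\<close> Poly_Mapping.keys_add[of m m']
  by (intro polys_single algebraic_mult) auto
  then show ?case using add.IH by (simp add: distrib_left mult_single polys_add)
 qed (simp add: polys_0)
 then show ?case using add by (simp add: distrib_right polys_add)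
qed (simp add: polys_0)

lemma polys_1: "1 : polys n"
 using polys_single[of 0 n 1] algebraic_1 by simp

lemma polys_sum_list: "(!!P. P : set Ps ==> P : polys n) ==> sum_list Ps : polys n"
 by (induction Ps) (auto intro: polys_add polys_0)

lemma mpoly_value_superset:
 assumes "finite K" "Poly_Mapping.keys P <= K"
 shows "mpoly_value n a P = (\<Sum>m\<in>K. Poly_Mapping.lookup P m * (\<Prod>l<n. a l ^ Poly_Mapping.lookup m l))"
 unfolding mpoly_value_def by (rule sum.mono_neutral_left[OF assms]) (auto simp: in_keys_iff)

lemma mpoly_value_add: "mpoly_value n a (P + Q) = mpoly_value n a P + mpoly_value n a Q"
proof -
 let ?K = "Poly_Mapping.keys P \<union> Poly_Mapping.keys Q"
 have K: "finite ?K" "Poly_Mapping.keys (P + Q) <= ?K" "Poly_Mapping.keys P <= ?K" "Poly_Mapping.keys Q <= ?K"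
  using Poly_Mapping.keys_add[of P Q] by auto
 show ?thesis
  unfolding mpoly_value_superset[OF K(1,2)] mpoly_value_superset[OF K(1,3)] mpoly_value_superset[OF K(1,4)]
  by (simp add: lookup_add sum.distrib distrib_right)
qed

lemma mpoly_value_single:
 "mpoly_value n a (Poly_Mapping.single m c) = c * (\<Prod>l<n. a l ^ Poly_Mapping.lookup m l)"
 using mpoly_value_superset[of "{m}" "Poly_Mapping.single m c" n a] by simp

locale sections = lrs +
 fixes U and n :: nat and y
 assumes U: "op U" and y: "!!l. l < n ==> y l : carrier (sect X U)"
begin

interpretation R: cring "sect X U" by (rule cring_sect[OF U])

abbreviation "mnm (m :: nat \<Rightarrow>\<^sub>0 nat) \<equiv> \<Otimes>\<^bsub>sect X U\<^esub>l\<in>{..<n}. y l [^]\<^bsub>sect X U\<^esub> Poly_Mapping.lookup m l"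
abbreviation "pa \<equiv> poly_at X U n y"

lemma mon_closed: "mnm m : carrier (sect X U)" by (intro R.finprod_closed) (auto simp: y)

lemma poly_at_superset:
 assumes "finite K" "Poly_Mapping.keys P <= K" "P : polys n"
 shows "pa P = (\<Oplus>\<^bsub>sect X U\<^esub>m\<in>K. cst X U (Poly_Mapping.lookup P m) \<otimes>\<^bsub>sect X U\<^esub> mnm m)"
 unfolding poly_at_def
proof (rule R.add.finprod_mono_neutral_cong_left[OF assms(1,2)])
 show "cst X U (Poly_Mapping.lookup P i) \<otimes>\<^bsub>sect X U\<^esub> mnm i = \<zero>\<^bsub>sect X U\<^esub>"
  if "i : K - Poly_Mapping.keys P" for i
  using that mon_closed[of i] cst_0[OF U] by (simp add: in_keys_iff)
qed (auto intro!: cst_closed U lookup_polys[OF assms(3)] mon_closed)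

lemma poly_at_add: assumes "P : polys n" "Q : polys n" shows "pa (P + Q) = pa P \<oplus>\<^bsub>sect X U\<^esub> pa Q"
proof -
 let ?K = "Poly_Mapping.keys P \<union> Poly_Mapping.keys Q"
 have K: "finite ?K" "Poly_Mapping.keys (P + Q) <= ?K" "Poly_Mapping.keys P <= ?K" "Poly_Mapping.keys Q <= ?K"
  using Poly_Mapping.keys_add[of P Q] by auto
 note c = cst_closed[OF U lookup_polys[OF assms(1)]] cst_closed[OF U lookup_polys[OF assms(2)]] mon_closed
 have "pa (P + Q) = (\<Oplus>\<^bsub>sect X U\<^esub>m\<in>?K. cst X U (Poly_Mapping.lookup P m) \<otimes>\<^bsub>sect X U\<^esub> mnm m \<oplus>\<^bsub>sect X U\<^esub>
  cst X U (Poly_Mapping.lookup Q m) \<otimes>\<^bsub>sect X U\<^esub> mnm m)"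
  unfolding poly_at_superset[OF K(1,2) polys_add[OF assms]]
  using c by (intro R.finsum_cong') (auto simp: lookup_add cst_add[OF U lookup_polys[OF assms(1)] lookup_polys[OF assms(2)]] R.l_distr)
 also have "... = pa P \<oplus>\<^bsub>sect X U\<^esub> pa Q"
  unfolding poly_at_superset[OF K(1,3) assms(1)] poly_at_superset[OF K(1,4) assms(2)]
  using c by (intro R.finsum_addf) auto
 finally show ?thesis .
qed

lemma poly_at_single:
 "Poly_Mapping.keys m <= {..<n} ==> algebraic c ==> pa (Poly_Mapping.single m c) = cst X U c \<otimes>\<^bsub>sect X U\<^esub> mnm m"
 using poly_at_superset[of "{m}" "Poly_Mapping.single m c"] polys_single[of m n c] mon_closed[of m] cst_closed[OF U, of c]
 by simp

lemma poly_at_closed: "P : polys n ==> pa P : carrier (sect X U)"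
 unfolding poly_at_def
 by (intro R.finsum_closed) (auto intro!: R.m_closed cst_closed U lookup_polys mon_closed)

lemma poly_at_0: "pa 0 = \<zero>\<^bsub>sect X U\<^esub>" by (simp add: poly_at_def)

lemma mon_add: "mnm (m + m') = mnm m \<otimes>\<^bsub>sect X U\<^esub> mnm m'"
proof -
 have "mnm (m + m') = (\<Otimes>\<^bsub>sect X U\<^esub>l\<in>{..<n}. y l [^]\<^bsub>sect X U\<^esub> Poly_Mapping.lookup m l \<otimes>\<^bsub>sect X U\<^esub>
  y l [^]\<^bsub>sect X U\<^esub> Poly_Mapping.lookup m' l)"
  by (intro R.finprod_cong') (auto simp: lookup_add R.nat_pow_mult y)
 also have "... = mnm m \<otimes>\<^bsub>sect X U\<^esub> mnm m'"
  by (intro R.finprod_multf) (auto simp: y)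
 finally show ?thesis .
qed

lemma poly_at_mult: "P : polys n ==> Q : polys n ==> pa (P * Q) = pa P \<otimes>\<^bsub>sect X U\<^esub> pa Q"
proof (induction P rule: polys_induct)
 case zero
 then show ?case using poly_at_closed by (simp add: poly_at_0)
next
 case (add m c P)
 note s = polys_single[OF add.hyps(1,2)]
 have *: "pa (Poly_Mapping.single m c * Q) = pa (Poly_Mapping.single m c) \<otimes>\<^bsub>sect X U\<^esub> pa Q"
  using add.prems
 proof (induction Q rule: polys_induct)
  case zero
  then show ?case using poly_at_closed[OF s] by (simp add: poly_at_0)
 next
  case (add m' c' Q)
  note s' = polys_single[OF add.hyps(1,2)]
  have k: "Poly_Mapping.keys (m + m') <= {..<n}"
  using \<open>Poly_Mapping.keys m <= {..<n}\<close> add.hyps Poly_Mapping.keys_add[of m m'] by auto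
  have "pa (Poly_Mapping.single m c * Poly_Mapping.single m' c') =
  (cst X U c \<otimes>\<^bsub>sect X U\<^esub> cst X U c') \<otimes>\<^bsub>sect X U\<^esub> (mnm m \<otimes>\<^bsub>sect X U\<^esub> mnm m')"
  using \<open>algebraic c\<close> add.hyps k by (simp add: mult_single poly_at_single algebraic_mult mon_add cst_mult[OF U])
  also have "... = (cst X U c \<otimes>\<^bsub>sect X U\<^esub> mnm m) \<otimes>\<^bsub>sect X U\<^esub> (cst X U c' \<otimes>\<^bsub>sect X U\<^esub> mnm m')"
  using cst_closed[OF U \<open>algebraic c\<close>] cst_closed[OF U add.hyps(2)] mon_closed[of m] mon_closed[of m']
  by (simp add: R.m_ac)
  also have "... = pa (Poly_Mapping.single m c) \<otimes>\<^bsub>sect X U\<^esub> pa (Poly_Mapping.single m' c')"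
  using \<open>Poly_Mapping.keys m <= {..<n}\<close> \<open>algebraic c\<close> add.hyps by (simp add: poly_at_single)
  finally show ?case
  using add.IH add.hyps poly_at_closed[OF s] poly_at_closed[OF s'] poly_at_closed[OF add.hyps(3)]
  by (simp add: distrib_left poly_at_add polys_mult s s' R.r_distr)
 qed
 then show ?case
  using add.IH[OF add.prems] add.hyps poly_at_closed[OF s] poly_at_closed[OF add.hyps(3)] poly_at_closed[OF add.prems]
  by (simp add: distrib_right poly_at_add polys_mult s add.prems R.l_distr)
qed

lemma poly_at_const: "algebraic c ==> pa (Poly_Mapping.single 0 c) = cst X U c"
 using poly_at_single[of 0 c] cst_closed[OF U, of c] by simp

lemma poly_at_1: "pa 1 = \<one>\<^bsub>sect X U\<^esub>"
 using poly_at_const[OF algebraic_1] cst_1[OF U] by simp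

lemma combinations_poly_at:
 assumes "!!s. s : carrier (sect X U) ==> EX P:polys n. s = pa P"
 shows "set Gs <= polys n ==> s : combinations (sect X U) (map pa Gs) ==>
  EX Qs. length Qs = length Gs & set Qs <= polys n & s = pa (\<Sum>(Q, G)\<leftarrow>zip Qs Gs. Q * G)"
proof (induction Gs arbitrary: s)
 case Nil
 then show ?case using poly_at_0 by simp
next
 case (Cons G Gs)
 then obtain a b where ab: "a : carrier (sect X U)" "b : combinations (sect X U) (map pa Gs)"
  "s = a \<otimes>\<^bsub>sect X U\<^esub> pa G \<oplus>\<^bsub>sect X U\<^esub> b" by auto
 obtain Qs where Qs: "length Qs = length Gs" "set Qs <= polys n" "b = pa (\<Sum>(Q, G)\<leftarrow>zip Qs Gs. Q * G)"
  using Cons.IH[OF _ ab(2)] Cons.prems by auto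
 obtain Q where Q: "Q : polys n" "a = pa Q" using assms ab(1) by blast
 have "(\<Sum>(Q, G)\<leftarrow>zip Qs Gs. Q * G) : polys n"
  using Qs(2) Cons.prems(1) by (intro polys_sum_list) (auto intro!: polys_mult dest: set_zip_leftD set_zip_rightD)
 then have "s = pa (\<Sum>(Q, G)\<leftarrow>zip (Q # Qs) (G # Gs). Q * G)"
  using ab Q Qs Cons.prems(1) by (simp add: poly_at_add poly_at_mult polys_mult)
 then show ?case using Qs Q by (intro exI[of _ "Q # Qs"]) auto
qed

end

context lrs
begin

lemma affine_openD:
 assumes "affine_open X U"
 shows "op U" and "U <= topspace (topo X)"
  and "inj_on (%p. {s : carrier (sect X U). vanishes X U p s}) U"
  and "!!P. primeideal P (sect X U) ==> EX p:U. {s : carrier (sect X U). vanishes X U p s} = P"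
proof -
 let ?h = "%p. {s : carrier (sect X U). vanishes X U p s}"
 show U: "op U" using assms unfolding affine_open_def by simp
 then show sub: "U <= topspace (topo X)" by (rule openin_subset)
 then have ts: "topspace (subtopology (topo X) U) = U" by auto
 have h: "homeomorphic_map (subtopology (topo X) U) (zariski (sect X U)) ?h"
  using assms unfolding affine_open_def by simp
 show "inj_on ?h U" using homeomorphic_imp_injective_map[OF h] ts by simp
 fix P assume P: "primeideal P (sect X U)"
 interpret R: cring "sect X U" by (rule cring_sect[OF U])
 interpret P: primeideal P "sect X U" by (rule P)
 have "\<one>\<^bsub>sect X U\<^esub> ~: P" using P.I_notcarr P.one_imp_carrier by blast
 then have "P : topspace (zariski (sect X U))"
  unfolding zariski_def topology_generated_by_topspace Spec_def using P R.one_closed by blast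
 then show "EX p:U. ?h p = P" using homeomorphic_imp_surjective_map[OF h] ts
  by (metis (no_types, lifting) imageE)
qed

text \<open>The prime ideal of a rational point consists of the functions whose value is zero, and these
 values are determined by those of the generators.\<close>

lemma point_unique:
 assumes U: "affine_open X U" and y: "algebra_generators X U n y" and p: "p : U" "r : U"
  and v: "!!l. l < n ==> value_at X U p (y l) (a l)" "!!l. l < n ==> value_at X U r (y l) (a l)"
 shows "p = r"
proof -
 note o = affine_openD(1)[OF U]
 have "vanishes X U p s \<longleftrightarrow> vanishes X U r s" if "s : carrier (sect X U)" for s
 proof -
  obtain P where P: "P : polys n" "s = poly_at X U n y P" using y \<open>s : _\<close> unfolding algebra_generators_def by auto
  show ?thesis
  using value_at_vanishes[OF o p(1) value_at_poly_at[OF o p(1) P(1) v(1)]]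
  value_at_vanishes[OF o p(2) value_at_poly_at[OF o p(2) P(1) v(2)]] P(2) by simp
 qed
 then have "{s : carrier (sect X U). vanishes X U p s} = {s : carrier (sect X U). vanishes X U r s}" by blast
 then show ?thesis using affine_openD(3)[OF U] p unfolding inj_on_def by blast
qed

text \<open>Polynomials without a common zero on a chart generate, with the equations of the chart,
 the unit ideal: otherwise a maximal ideal of the ring of the chart would be a common zero.\<close>

text \<open>If these functions generated a proper ideal, a maximal ideal above it would be a prime ideal
 and hence, the chart being affine, a point at which all of them vanish.\<close>

lemma unit_ideal:
 assumes C: "presents_chart X U y (Chart n F)" and Gs: "set Gs <= polys n"
  and no_zero: "!!p. p : U ==> EX G:set Gs. ~ vanishes X U p (poly_at X U n y G)"
 shows "EX Qs. length Qs = length F + length Gs & set Qs <= polys n &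
  (\<Sum>(Q, G)\<leftarrow>zip Qs (map poly_value F @ Gs). Q * G) = 1"
proof -
 have U: "affine_open X U" and gen: "algebra_generators X U n y" using C by auto
 note o = affine_openD(1)[OF U]
 interpret S: sections X U n y
  by unfold_locales (use o gen in \<open>auto simp: algebra_generators_def\<close>)
 interpret R: cring "sect X U" by (rule cring_sect[OF o])
 let ?gs = "map (poly_at X U n y) Gs"
 have gs: "set ?gs <= carrier (sect X U)" using Gs S.poly_at_closed by auto
 have I: "ideal (combinations (sect X U) ?gs) (sect X U)" "set ?gs <= combinations (sect X U) ?gs"
  using combinations_ideal[OF R.is_cring gs] by auto
 have "\<one>\<^bsub>sect X U\<^esub> : combinations (sect X U) ?gs"
 proof (rule ccontr)
  assume "\<one>\<^bsub>sect X U\<^esub> ~: combinations (sect X U) ?gs"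
  then obtain M where M: "maximalideal M (sect X U)" "combinations (sect X U) ?gs <= M"
  using exists_maximalideal[OF R.is_cring I(1)] by auto
  then obtain p where p: "p : U" "{s : carrier (sect X U). vanishes X U p s} = M"
  using affine_openD(4)[OF U R.maximalideal_prime] by blast
  obtain G where "G : set Gs" "~ vanishes X U p (poly_at X U n y G)" using no_zero[OF p(1)] by blast
  then show False using p(2) M(2) I(2) by auto
 qed
 then obtain Qs where Qs: "length Qs = length Gs" "set Qs <= polys n"
  "\<one>\<^bsub>sect X U\<^esub> = poly_at X U n y (\<Sum>(Q, G)\<leftarrow>zip Qs Gs. Q * G)"
  using S.combinations_poly_at[OF _ Gs] gen unfolding algebra_generators_def by blast
 define T where "T = (\<Sum>(Q, G)\<leftarrow>zip Qs Gs. Q * G)"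
 define m1 where "m1 = (Poly_Mapping.single 0 (-1) :: mpoly)"
 have T: "T : polys n" unfolding T_def
  using Qs(2) Gs by (intro polys_sum_list) (auto intro!: polys_mult dest: set_zip_leftD set_zip_rightD)
 have m1: "m1 : polys n" unfolding m1_def using algebraic_1 by (intro polys_single) auto
 have "m1 * T = - T" unfolding m1_def
  by (metis mult_minus1 single_numeral single_one single_uminus)
 then have eq: "1 + m1 * T = 1 - T" by simp
 have "poly_at X U n y (1 + m1 * T) = \<one>\<^bsub>sect X U\<^esub> \<oplus>\<^bsub>sect X U\<^esub> cst X U (- 1) \<otimes>\<^bsub>sect X U\<^esub> \<one>\<^bsub>sect X U\<^esub>"
  using T m1 Qs(3) S.poly_at_const[of "-1"] algebraic_1
  by (simp add: S.poly_at_add S.poly_at_mult polys_mult polys_1 S.poly_at_1 T_def[symmetric] m1_def[symmetric])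
 also have "... = cst X U (1 + - 1)" using cst_closed[OF o, of "-1"] algebraic_1
  by (subst cst_add[OF o]) (auto simp: cst_1[OF o])
 finally have "poly_at X U n y (1 - T) = \<zero>\<^bsub>sect X U\<^esub>" using cst_0[OF o] eq by simp
 moreover have "1 - T : polys n" unfolding eq[symmetric] by (intro polys_add polys_mult polys_1 m1 T)
 ultimately have "1 - T : poly_ideal n (map poly_value F)" using C by auto
 then obtain q where q: "1 - T = (\<Sum>i<length F. q i * map poly_value F ! i)" "!!i. i < length F ==> q i : polys n"
  unfolding poly_ideal_def by auto
 have "(\<Sum>(Q, G)\<leftarrow>zip (map q [0..<length F]) (map poly_value F). Q * G) = (\<Sum>i<length F. q i * map poly_value F ! i)"
  by (simp add: sum_list_sum_nth atLeast0LessThan)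
 then have "(\<Sum>(Q, G)\<leftarrow>zip (map q [0..<length F] @ Qs) (map poly_value F @ Gs). Q * G) = 1"
  using q(1) T_def by (simp add: zip_append diff_eq_eq)
 then show ?thesis using Qs q(2) by (intro exI[of _ "map q [0..<length F] @ Qs"]) auto
qed

end

subsection \<open>Lists of terms\<close>

type_synonym cterms = "(complex \<times> nat list) list"

definition wf_terms :: "nat => cterms => bool" where
 "wf_terms n P \<longleftrightarrow> (\<forall>(c, e)\<in>set P. algebraic c & length e = n)"

definition vals :: "alg_poly => cterms" where
 "vals = map (%(c, e). (num_value c, e))"

definition mp :: "cterms => mpoly" where
 "mp P = (\<Sum>(c, e)\<leftarrow>P. Poly_Mapping.single (Poly_Mapping.nth e) c)"

definition monomial_value :: "complex list => nat list => complex" where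
 "monomial_value a e = prod_list (map (%(x, k). x ^ k) (zip a e))"

definition teval :: "cterms => complex list => complex" where
 "teval P a = (\<Sum>(c, e)\<leftarrow>P. c * monomial_value a e)"

definition tcoeff :: "cterms => nat list => complex" where
 "tcoeff P e = sum_list (map fst (filter (%t. snd t = e) P))"

definition tmul :: "cterms => cterms => cterms" where
 "tmul P Q = concat (map (%(c, e). map (%(d, k). (c * d, map2 (+) e k)) Q) P)"

text \<open>The certificate is a statement about coefficients of lists of terms, because it has to be
 found by a search and checked in a number field.\<close>

definition unit_terms :: "nat => cterms list => bool" where
 "unit_terms n gs \<longleftrightarrow> (EX qs. length qs = length gs & (ALL q:set qs. wf_terms n q) &
  (ALL e. length e = n -->
  tcoeff (concat (map2 tmul qs gs)) e = (if e = replicate n 0 then 1 else 0)))"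

lemma num_value_isolates: "isolates c z ==> num_value c = z & algebraic z"
proof -
 assume iso: "isolates c z"
 obtain p a b r where c: "c = (p, a, b, r)" by (metis prod_cases4)
 let ?S = "{w. poly (map_poly of_int p) w = 0 & cmod (w - Complex (of_rat a) (of_rat b)) < of_rat r}"
 have S: "p ~= 0" "?S = {z}" using iso unfolding c by auto
 have nv: "num_value c = z" unfolding num_value_def
 proof (rule the_equality)
  show "isolates c z" by (rule iso)
  fix w assume "isolates c w"
  then have "?S = {w}" unfolding c by auto
  then show "w = z" using S by auto
 qed
 have "z : ?S" using S(2) by simp
 moreover have "map_poly of_int p ~= (0 :: complex poly)"
  using S(1) by (auto simp: poly_eq_iff coeff_map_poly)
 ultimately have "algebraic z"
  by (intro algebraicI[of "map_poly of_int p"]) (auto simp: coeff_map_poly)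
 with nv show ?thesis by simp
qed

lemma num_value_algebraic: "EX z. isolates c z ==> algebraic (num_value c)"
 using num_value_isolates by blast

lemma wf_vals: "well_formed_poly n P ==> wf_terms n (vals P)"
 unfolding well_formed_poly_def wf_terms_def vals_def using num_value_algebraic by fastforce

lemma poly_value_vals: "poly_value P = mp (vals P)"
 unfolding poly_value_def mp_def vals_def by (simp add: comp_def split_def)

lemma poly_value_eq: "poly_value = mp \<circ> vals"
 by (rule ext) (simp add: poly_value_vals)

lemma mp_simps[simp]: "mp [] = 0" "mp (t # P) = Poly_Mapping.single (Poly_Mapping.nth (snd t)) (fst t) + mp P"
 "mp (P @ Q) = mp P + mp Q"
 by (simp_all add: mp_def split_def)

lemma keys_nth_subset: "Poly_Mapping.keys (Poly_Mapping.nth e :: nat \<Rightarrow>\<^sub>0 nat) <= {..<length e}"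
 by (auto simp del: keys_nth simp: in_keys_iff nth_default_def split: if_splits)

lemma mp_polys: "wf_terms n P ==> mp P : polys n"
proof (induction P)
 case (Cons t P)
 then show ?case using keys_nth_subset[of "snd t"]
  by (auto simp: wf_terms_def split_def simp del: keys_nth intro!: polys_add polys_single)
qed (simp add: polys_0)

lemma monomial_value_prod:
 assumes "length e = length a"
 shows "monomial_value a e = (\<Prod>l<length a. (a ! l) ^ (e ! l))"
 using assms by (simp add: monomial_value_def prod.list_conv_set_nth atLeast0LessThan)

lemma mpoly_value_mp:
 "wf_terms n P ==> length a = n ==> mpoly_value n (%l. a ! l) (mp P) = teval P a"
proof (induction P)
 case Nil
 then show ?case by (simp add: teval_def mpoly_value_def)
next
 case (Cons t P)
 have "(\<Prod>l<n. a ! l ^ Poly_Mapping.lookup (Poly_Mapping.nth (snd t)) l) = monomial_value a (snd t)"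
  using Cons.prems unfolding wf_terms_def
  by (subst monomial_value_prod) (auto simp: split_def nth_default_def intro!: prod.cong)
 moreover have "mpoly_value n (%l. a ! l) (mp P) = teval P a"
  using Cons unfolding wf_terms_def by auto
 ultimately show ?case by (simp add: mpoly_value_add mpoly_value_single teval_def split_def)
qed

lemma nth_inject:
 assumes "length e = length e'"
 shows "Poly_Mapping.nth e = (Poly_Mapping.nth e' :: nat \<Rightarrow>\<^sub>0 nat) \<longleftrightarrow> e = e'"
proof
 assume "Poly_Mapping.nth e = (Poly_Mapping.nth e' :: nat \<Rightarrow>\<^sub>0 nat)"
 then have "nth_default 0 e = nth_default 0 e'" by (metis lookup_nth)
 then show "e = e'" using assms by (metis nth_default_nth nth_equalityI)
qed simp

lemma lookup_mp:
 assumes "!!t. t : set P ==> length (snd t) = length e"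
 shows "Poly_Mapping.lookup (mp P) (Poly_Mapping.nth e) = tcoeff P e"
 using assms
proof (induction P)
 case (Cons t P)
 have "Poly_Mapping.lookup (Poly_Mapping.single (Poly_Mapping.nth (snd t)) (fst t)) (Poly_Mapping.nth e) =
  (if snd t = e then fst t else 0)"
  using nth_inject[of "snd t" e] Cons.prems by (simp add: lookup_single)
 then show ?case using Cons by (simp add: lookup_add tcoeff_def)
qed (simp add: tcoeff_def)

lemma nth_add:
 assumes "length e = length k"
 shows "Poly_Mapping.nth (map2 (+) e k) = Poly_Mapping.nth e + (Poly_Mapping.nth k :: nat \<Rightarrow>\<^sub>0 nat)"
 using assms by (intro poly_mapping_eqI) (simp add: lookup_add nth_default_def)

lemma mp_tmul:
 assumes "!!t. t : set P ==> length (snd t) = n" "!!t. t : set Q ==> length (snd t) = n"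
 shows "mp (tmul P Q) = mp P * mp Q"
proof -
 have 1: "mp (map (%(d, k). (c * d, map2 (+) e k)) Q) = Poly_Mapping.single (Poly_Mapping.nth e) c * mp Q"
  if "length e = n" for c e
  using assms(2)
 proof (induction Q)
  case (Cons t Q)
  then show ?case using nth_add[of e "snd t"] that by (simp add: split_def distrib_left mult_single)
 qed simp
 show ?thesis using assms(1)
 proof (induction P)
  case (Cons t P)
  then show ?case using 1[of "snd t" "fst t"] by (simp add: tmul_def split_def distrib_right)
 qed (simp add: tmul_def)
qed

lemma mp_surj: "P : polys n ==> EX ts. wf_terms n ts & mp ts = P"
proof (induction P rule: polys_induct)
 case zero
 then show ?case by (intro exI[of _ "[]"]) (simp add: wf_terms_def)
next
 case (add m c P)
 then obtain ts where ts: "wf_terms n ts" "mp ts = P" by auto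
 have "Poly_Mapping.nth (map (Poly_Mapping.lookup m) [0..<n]) = m"
  using add.hyps(1) by (intro poly_mapping_eqI) (auto simp: nth_default_def in_keys_iff)
 then show ?case using ts add.hyps
  by (intro exI[of _ "(c, map (Poly_Mapping.lookup m) [0..<n]) # ts"]) (auto simp: wf_terms_def)
qed

lemma tmul_lengths:
 assumes "!!t. t : set P ==> length (snd t) = n" "!!t. t : set Q ==> length (snd t) = n"
 shows "t : set (tmul P Q) ==> length (snd t) = n"
 using assms unfolding tmul_def by fastforce

lemma wf_terms_length: "wf_terms n P ==> t : set P ==> length (snd t) = n"
 unfolding wf_terms_def by auto

lemma unit_terms_of_polys:
 assumes Qs: "length Qs = length gs" "set Qs <= polys n" "(\<Sum>(Q, G)\<leftarrow>zip Qs (map mp gs). Q * G) = 1"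
  and gs: "!!g. g : set gs ==> wf_terms n g"
 shows "unit_terms n gs"
proof -
 define T where "T P = (SOME ts. wf_terms n ts & mp ts = P)" for P
 have T: "wf_terms n (T P) & mp (T P) = P" if "P : polys n" for P
  unfolding T_def by (rule someI_ex[OF mp_surj[OF that]])
 define qs where "qs = map T Qs"
 have qs: "length qs = length gs" "!!q. q : set qs ==> wf_terms n q" "map mp qs = Qs"
  using Qs T unfolding qs_def by (auto intro!: map_idI)
 have "mp (concat (map2 tmul qs gs)) = (\<Sum>(Q, G)\<leftarrow>zip (map mp qs) (map mp gs). Q * G)"
  using qs(1,2) gs
 proof (induction qs gs rule: list_induct2)
  case (Cons q qs g gs)
  then have "mp (tmul q g) = mp q * mp g" by (intro mp_tmul[of _ n]) (auto intro: wf_terms_length)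
  then show ?case using Cons by simp
 qed simp
 then have 1: "mp (concat (map2 tmul qs gs)) = 1" using Qs(3) qs(3) by simp
 have len: "length (snd t) = n" if "t : set (concat (map2 tmul qs gs))" for t
 proof -
  have "EX x:set (zip qs gs). t : set (case x of (q, g) => tmul q g)" using that by simp
  then obtain q g where "(q, g) : set (zip qs gs)" and t: "t : set (tmul q g)" by auto
  then have "wf_terms n q" "wf_terms n g" using qs(2) gs by (auto dest: set_zip_leftD set_zip_rightD)
  then show ?thesis by (intro tmul_lengths[OF _ _ t]) (auto intro: wf_terms_length)
 qed
 have "tcoeff (concat (map2 tmul qs gs)) e = (if e = replicate n 0 then 1 else 0)" if e: "length e = n" for e
 proof -
  have z: "Poly_Mapping.nth (replicate n 0) = (0 :: nat \<Rightarrow>\<^sub>0 nat)"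
  by (intro poly_mapping_eqI) (simp add: nth_default_def)
  have "tcoeff (concat (map2 tmul qs gs)) e = Poly_Mapping.lookup 1 (Poly_Mapping.nth e)"
  using lookup_mp[of "concat (map2 tmul qs gs)" e] len e 1 by metis
  also have "... = (if Poly_Mapping.nth (replicate n 0) = (Poly_Mapping.nth e :: nat \<Rightarrow>\<^sub>0 nat) then 1 else 0)"
  unfolding z single_one[symmetric] lookup_single by (simp add: when_def)
  also have "... = (if e = replicate n 0 then 1 else 0)"
  using nth_inject[of "replicate n 0" e] e by auto
  finally show ?thesis .
 qed
 then show ?thesis unfolding unit_terms_def using qs by blast
qed

subsection \<open>Points in charts\<close>

context lrs
begin

lemma nonvanishing_open: "op U ==> op (nonvanishing X U s)"
proof (subst openin_subopen, rule ballI)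
 fix p assume "p : nonvanishing X U s"
 then obtain W where W: "op W" "p : W" "W <= U" "res X U W s : Units (sect X W)"
  unfolding nonvanishing_def vanishes_def by auto
 then have "W <= nonvanishing X U s" unfolding nonvanishing_def vanishes_def by blast
 then show "EX T. op T & p : T & T <= nonvanishing X U s" using W by blast
qed

lemma preim_open: "endomorphism X f ==> op U ==> op (preim X f U)"
 unfolding preim_def endomorphism_def using openin_continuous_map_preimage by fastforce

lemma endo_hom:
 assumes "endomorphism X f" "op U"
 shows "snd f U : ring_hom (sect X U) (sect X (preim X f U))"
  and "algebraic c ==> snd f U (cst X U c) = cst X (preim X f U) c"
 using assms unfolding endomorphism_def by auto

lemma endo_res:
 assumes "endomorphism X f" "op U" "op W" "W <= U" "s : carrier (sect X U)"
 shows "res X (preim X f U) (preim X f W) (snd f U s) = snd f W (res X U W s)"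
 using assms unfolding endomorphism_def by blast

lemma endo_vanishes:
 assumes "endomorphism X f" "op U" "p : preim X f U" "s : carrier (sect X U)"
 shows "vanishes X U (fst f p) s \<longleftrightarrow> vanishes X (preim X f U) p (snd f U s)"
proof
 assume "vanishes X U (fst f p) s"
 then show "vanishes X (preim X f U) p (snd f U s)" using assms unfolding endomorphism_def by blast
next
 assume v: "vanishes X (preim X f U) p (snd f U s)"
 show "vanishes X U (fst f p) s"
  unfolding vanishes_def
 proof
  assume "EX W. op W & fst f p : W & W <= U & res X U W s : Units (sect X W)"
  then obtain W where W: "op W" "fst f p : W" "W <= U" "res X U W s : Units (sect X W)" by auto
  have "snd f W (res X U W s) : Units (sect X (preim X f W))"
  by (rule hom_Units[OF cring_sect cring_sect endo_hom(1)])
  (use W assms preim_open in auto)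
  then have "res X (preim X f U) (preim X f W) (snd f U s) : Units (sect X (preim X f W))"
  using endo_res[OF assms(1,2) W(1,3) assms(4)] by simp
  moreover have "p : preim X f W" "preim X f W <= preim X f U"
  using W assms(3) by (auto simp: preim_def)
  ultimately show False using v preim_open[OF assms(1) W(1)] unfolding vanishes_def by blast
 qed
qed

lemma endo_minus_cst:
 assumes f: "endomorphism X f" and U: "op U" and s: "s : carrier (sect X U)" and c: "algebraic c"
 shows "snd f U (s \<ominus>\<^bsub>sect X U\<^esub> cst X U c) = snd f U s \<ominus>\<^bsub>sect X (preim X f U)\<^esub> cst X (preim X f U) c"
proof -
 interpret R: cring "sect X U" by (rule cring_sect[OF U])
 interpret S: cring "sect X (preim X f U)" by (rule cring_sect[OF preim_open[OF f U]])
 interpret h: ring_hom_cring "sect X U" "sect X (preim X f U)" "snd f U"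
  by unfold_locales (rule endo_hom(1)[OF f U])
 show ?thesis using s cst_closed[OF U c] endo_hom(2)[OF f U c] by (simp add: a_minus_def)
qed

text \<open>A morphism of locally ringed spaces over the algebraic numbers preserves constants, and the
 germ of a function vanishes if and only if its pullback does.\<close>

lemma value_at_endo:
 assumes f: "endomorphism X f" and U: "op U" and p: "p : preim X f U" and s: "s : carrier (sect X U)"
 shows "value_at X U (fst f p) s c \<longleftrightarrow> value_at X (preim X f U) p (snd f U s) c"
proof (cases "algebraic c")
 case True
 interpret R: cring "sect X U" by (rule cring_sect[OF U])
 show ?thesis unfolding value_at_def
  using endo_minus_cst[OF f U s True] endo_vanishes[OF f U p, of "s \<ominus>\<^bsub>sect X U\<^esub> cst X U c"]
  s cst_closed[OF U True] ring_hom_closed[OF endo_hom(1)[OF f U] s] by simp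
qed (simp add: value_at_def)

lemma rational_pointsD:
 assumes "p : rational_points X" "op U" "p : U" "s : carrier (sect X U)"
 shows "EX c. value_at X U p s c"
proof -
 have "EX c:carrier Qbar. vanishes X U p (s \<ominus>\<^bsub>sect X U\<^esub> cst X U c)"
  using assms unfolding rational_points_def by blast
 then show ?thesis using assms(4) unfolding value_at_def by auto
qed

lemma rational_points_endo:
 assumes f: "endomorphism X f" and p: "p : rational_points X"
 shows "fst f p : rational_points X"
proof -
 have pt: "p : topspace (topo X)" using p unfolding rational_points_def by simp
 have "fst f p : topspace (topo X)"
  using f pt unfolding endomorphism_def continuous_map_def by auto
 moreover have "EX c:carrier Qbar. vanishes X U (fst f p) (s \<ominus>\<^bsub>sect X U\<^esub> cst X U c)"
  if U: "op U" "fst f p : U" "s : carrier (sect X U)" for U s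
 proof -
  have p': "p : preim X f U" using U pt unfolding preim_def by simp
  obtain c where "value_at X (preim X f U) p (snd f U s) c"
  using rational_pointsD[OF p preim_open[OF f U(1)] p' ring_hom_closed[OF endo_hom(1)[OF f U(1)] U(3)]] by auto
  then have "value_at X U (fst f p) s c" using value_at_endo[OF f U(1) p' U(3)] by simp
  then show ?thesis unfolding value_at_def by auto
 qed
 ultimately show ?thesis unfolding rational_points_def by auto
qed

end

fun chart_eqs :: "chart => alg_poly list" where
 "chart_eqs (Chart n F) = F"

definition pt :: "('p, 's) space => (nat => 'p set) => (nat => nat => 's) => chart list =>
  nat => complex list => 'p => bool" where
 "pt X U y Cs i a p \<longleftrightarrow> i < length Cs & length a = dim (Cs ! i) & p : U i & p : rational_points X &
  (\<forall>l<length a. value_at X (U i) p (y i l) (a ! l))"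

locale presented = lrs X for X :: "('p, 's) space" +
 fixes U :: "nat => 'p set" and y :: "nat => nat => 's" and Cs :: "chart list" and Os :: "overlap list list"
 assumes PV: "presents_variety X U y Cs Os"
begin

abbreviation "P \<equiv> pt X U y Cs"

lemma chart:
 assumes "i < length Cs"
 shows "presents_chart X (U i) (y i) (Chart (dim (Cs ! i)) (chart_eqs (Cs ! i)))"
proof -
 have "Chart (dim (Cs ! i)) (chart_eqs (Cs ! i)) = Cs ! i" by (cases "Cs ! i") simp
 then show ?thesis using PV assms unfolding presents_variety_def by metis
qed

lemma chart_facts:
 assumes "i < length Cs"
 shows "affine_open X (U i)" "algebra_generators X (U i) (dim (Cs ! i)) (y i)" "op (U i)"
  "g : set (chart_eqs (Cs ! i)) ==> well_formed_poly (dim (Cs ! i)) g"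
 using chart[OF assms] affine_openD(1) by auto

lemma pt_unique: "P i a p ==> P i a p' ==> p = p'"
 unfolding pt_def
 by (intro point_unique[OF chart_facts(1,2), of i p p' "%l. a ! l"]) auto

lemma pt_coords_unique: "P i a p ==> P i b p ==> a = b"
 unfolding pt_def using value_at_unique[OF chart_facts(3), of i p]
 by (intro nth_equalityI) auto

lemma pt_algebraic: "P i a p ==> c : set a ==> algebraic c"
 unfolding pt_def value_at_def by (auto simp: in_set_conv_nth)

lemma pt_value:
 assumes p: "P i a p" and g: "wf_terms (dim (Cs ! i)) g"
 shows "value_at X (U i) p (poly_at X (U i) (dim (Cs ! i)) (y i) (mp g)) (teval g a)"
proof -
 have i: "i < length Cs" and a: "length a = dim (Cs ! i)" using p unfolding pt_def by auto
 have "value_at X (U i) p (poly_at X (U i) (dim (Cs ! i)) (y i) (mp g)) (mpoly_value (dim (Cs ! i)) (%l. a ! l) (mp g))"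
  by (rule value_at_poly_at[OF chart_facts(3)[OF i] _ mp_polys[OF g]]) (use p in \<open>auto simp: pt_def\<close>)
 then show ?thesis using mpoly_value_mp[OF g a] by simp
qed

lemma poly_value_in_ideal: "g : set F ==> poly_value g : poly_ideal n (map poly_value F)"
proof -
 assume "g : set F"
 then obtain k where k: "k < length F" "F ! k = g" by (auto simp: in_set_conv_nth)
 have "(\<Sum>i<length F. (if i = k then 1 else 0) * map poly_value F ! i) = (\<Sum>i\<in>{k}. poly_value (F ! i))"
  using k(1) by (intro sum.mono_neutral_cong_right) auto
 then show ?thesis unfolding poly_ideal_def using k polys_1 polys_0
  by (auto intro!: exI[of _ "%i. if i = k then 1 else 0"])
qed

lemma pt_equations:
 assumes p: "P i a p" and g: "g : set (chart_eqs (Cs ! i))"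
 shows "teval (vals g) a = 0"
proof -
 have i: "i < length Cs" and pU: "p : U i" using p unfolding pt_def by auto
 note wf = wf_vals[OF chart_facts(4)[OF i g]]
 have "poly_at X (U i) (dim (Cs ! i)) (y i) (mp (vals g)) = \<zero>\<^bsub>sect X (U i)\<^esub>"
  using chart[OF i] poly_value_in_ideal[OF g] mp_polys[OF wf] unfolding poly_value_vals[symmetric] by auto
 then show ?thesis
  using pt_value[OF p wf] value_at_vanishes[OF chart_facts(3)[OF i] pU] vanishes_zero[OF chart_facts(3)[OF i] pU]
  by metis
qed

lemma endo_pieces:
 assumes "presents_endomorphism X U y Cs Ps f" "i < length Cs"
 shows "(\<Union>Q\<in>set (Ps ! i). case Q of Piece h j g =>
  nonvanishing X (U i) (poly_at X (U i) (dim (Cs ! i)) (y i) (mp (vals h)))) = U i"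
  "Piece h j g : set (Ps ! i) ==> j < length Cs & length g = dim (Cs ! j) &
  well_formed_poly (dim (Cs ! i)) h & (ALL q:set g. well_formed_poly (dim (Cs ! i)) q) &
  nonvanishing X (U i) (poly_at X (U i) (dim (Cs ! i)) (y i) (mp (vals h))) <= preim X f (U j) &
  (\<forall>l<length g. let D = nonvanishing X (U i) (poly_at X (U i) (dim (Cs ! i)) (y i) (mp (vals h))) in
  res X (U i) D (poly_at X (U i) (dim (Cs ! i)) (y i) (mp (vals h))) \<otimes>\<^bsub>sect X D\<^esub>
  res X (preim X f (U j)) D (snd f (U j) (y j l))
  = res X (U i) D (poly_at X (U i) (dim (Cs ! i)) (y i) (mp (vals (g ! l)))))"
proof -
 note E = assms(1)[unfolded presents_endomorphism_def poly_value_vals Let_def, THEN conjunct2, rule_format, OF assms(2)]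
 show "(\<Union>Q\<in>set (Ps ! i). case Q of Piece h j g =>
  nonvanishing X (U i) (poly_at X (U i) (dim (Cs ! i)) (y i) (mp (vals h)))) = U i"
  using E by (rule conjunct1)
 show "Piece h j g : set (Ps ! i) ==> j < length Cs & length g = dim (Cs ! j) &
  well_formed_poly (dim (Cs ! i)) h & (ALL q:set g. well_formed_poly (dim (Cs ! i)) q) &
  nonvanishing X (U i) (poly_at X (U i) (dim (Cs ! i)) (y i) (mp (vals h))) <= preim X f (U j) &
  (\<forall>l<length g. let D = nonvanishing X (U i) (poly_at X (U i) (dim (Cs ! i)) (y i) (mp (vals h))) in
  res X (U i) D (poly_at X (U i) (dim (Cs ! i)) (y i) (mp (vals h))) \<otimes>\<^bsub>sect X D\<^esub>
  res X (preim X f (U j)) D (snd f (U j) (y j l))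
  = res X (U i) D (poly_at X (U i) (dim (Cs ! i)) (y i) (mp (vals (g ! l)))))"
  using conjunct2[OF E] unfolding Let_def by simp
qed

lemma pt_nonvanishing:
 assumes p: "P i a p" and h: "well_formed_poly (dim (Cs ! i)) h"
 shows "p : nonvanishing X (U i) (poly_at X (U i) (dim (Cs ! i)) (y i) (mp (vals h))) \<longleftrightarrow> teval (vals h) a ~= 0"
proof -
 have i: "i < length Cs" and pU: "p : U i" using p unfolding pt_def by auto
 show ?thesis unfolding nonvanishing_def
  using value_at_vanishes[OF chart_facts(3)[OF i] pU pt_value[OF p wf_vals[OF h]]] pU by simp
qed

lemma pt_step:
 assumes f: "endomorphism X f" and E: "presents_endomorphism X U y Cs Ps f"
  and Q: "Piece h j g : set (Ps ! i)" and p: "P i a p" and h0: "teval (vals h) a ~= 0"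
 shows "P j (map (%q. teval (vals q) a / teval (vals h) a) g) (fst f p)"
proof -
 have i: "i < length Cs" and pU: "p : U i" and pr: "p : rational_points X" using p unfolding pt_def by auto
 note oi = chart_facts(3)[OF i]
 let ?n = "dim (Cs ! i)"
 define H where "H = poly_at X (U i) ?n (y i) (mp (vals h))"
 define D where "D = nonvanishing X (U i) H"
 note pieces = endo_pieces(2)[OF E i Q, unfolded Let_def, folded H_def, folded D_def]
 have j: "j < length Cs" and lg: "length g = dim (Cs ! j)" and wh: "well_formed_poly ?n h"
  and wg: "!!q. q : set g ==> well_formed_poly ?n q" and DV: "D <= preim X f (U j)"
  and eq: "!!l. l < length g ==> res X (U i) D H \<otimes>\<^bsub>sect X D\<^esub> res X (preim X f (U j)) D (snd f (U j) (y j l))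
  = res X (U i) D (poly_at X (U i) ?n (y i) (mp (vals (g ! l))))"
  using pieces by auto
 note oj = chart_facts(3)[OF j]
 note oV = preim_open[OF f oj]
 have oD: "op D" unfolding D_def by (rule nonvanishing_open[OF oi])
 have DU: "D <= U i" unfolding D_def nonvanishing_def by auto
 have pD: "p : D" unfolding D_def H_def using pt_nonvanishing[OF p wh] h0 by simp
 have pV: "p : preim X f (U j)" using pD DV by auto
 then have fU: "fst f p : U j" unfolding preim_def by simp
 have fr: "fst f p : rational_points X" by (rule rational_points_endo[OF f pr])
 have vH: "value_at X D p (res X (U i) D H) (teval (vals h) a)"
  using pt_value[OF p wf_vals[OF wh]] value_at_res[OF oi oD DU pD] unfolding H_def value_at_def by blast
 have "value_at X (U j) (fst f p) (y j l) (teval (vals (g ! l)) a / teval (vals h) a)" if l: "l < length g" for l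
 proof -
  have yc: "y j l : carrier (sect X (U j))"
  using chart_facts(2)[OF j] l lg unfolding algebra_generators_def by auto
  obtain b where b: "value_at X (U j) (fst f p) (y j l) b" using rational_pointsD[OF fr oj fU yc] by auto
  have cV: "snd f (U j) (y j l) : carrier (sect X (preim X f (U j)))"
  by (rule ring_hom_closed[OF endo_hom(1)[OF f oj] yc])
  have "value_at X D p (res X (preim X f (U j)) D (snd f (U j) (y j l))) b"
  using b value_at_endo[OF f oj pV yc] value_at_res[OF oV oD DV pD cV] by simp
  then have 1: "value_at X D p (res X (U i) D (poly_at X (U i) ?n (y i) (mp (vals (g ! l))))) (teval (vals h) a * b)"
  using value_at_mult[OF oD pD vH] eq[OF l] by metis
  have 2: "value_at X D p (res X (U i) D (poly_at X (U i) ?n (y i) (mp (vals (g ! l))))) (teval (vals (g ! l)) a)"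
  proof -
  have v: "value_at X (U i) p (poly_at X (U i) ?n (y i) (mp (vals (g ! l)))) (teval (vals (g ! l)) a)"
  using pt_value[OF p wf_vals[OF wg]] l by simp
  then have "poly_at X (U i) ?n (y i) (mp (vals (g ! l))) : carrier (sect X (U i))"
  by (simp add: value_at_def)
  then show ?thesis using v value_at_res[OF oi oD DU pD] by simp
  qed
  have "teval (vals h) a * b = teval (vals (g ! l)) a" by (rule value_at_unique[OF oD pD 1 2])
  then have "b = teval (vals (g ! l)) a / teval (vals h) a" using h0 by (simp add: field_simps)
  then show ?thesis using b by simp
 qed
 then show ?thesis unfolding pt_def using j lg fU fr by simp
qed

lemma pt_piece_exists:
 assumes E: "presents_endomorphism X U y Cs Ps f" and p: "P i a p"
 shows "EX h j g. Piece h j g : set (Ps ! i) & teval (vals h) a ~= 0"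
proof -
 have i: "i < length Cs" and pU: "p : U i" using p unfolding pt_def by auto
 obtain Q where Q: "Q : set (Ps ! i)" "p : (case Q of Piece h j g =>
  nonvanishing X (U i) (poly_at X (U i) (dim (Cs ! i)) (y i) (mp (vals h))))"
  using endo_pieces(1)[OF E i] pU by blast
 obtain h j g where "Q = Piece h j g" by (cases Q)
 then show ?thesis using Q endo_pieces(2)[OF E i] pt_nonvanishing[OF p] by auto
qed

text \<open>The domains of the pieces cover the chart, so that the functions \<open>h\<close> have no common zero.  The
 certificate is what excludes, later, that all of them vanish modulo a prime.\<close>

lemma pieces_unit_terms:
 assumes E: "presents_endomorphism X U y Cs Ps f" and i: "i < length Cs"
 shows "unit_terms (dim (Cs ! i)) (map vals (chart_eqs (Cs ! i)) @ map (%Q. case Q of Piece h j g => vals h) (Ps ! i))"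
proof -
 let ?n = "dim (Cs ! i)" and ?F = "chart_eqs (Cs ! i)"
 let ?gs = "map (%Q. case Q of Piece h j g => vals h) (Ps ! i)"
 have wf: "wf_terms ?n q" if "q : set ?gs" for q
  using that wf_vals endo_pieces(2)[OF E i] by (fastforce split: piece.splits)
 have "EX Qs. length Qs = length ?F + length (map mp ?gs) & set Qs <= polys ?n &
  (\<Sum>(Q, G)\<leftarrow>zip Qs (map poly_value ?F @ map mp ?gs). Q * G) = 1"
 proof (rule unit_ideal[OF chart[OF i]])
  show "set (map mp ?gs) <= polys ?n" using wf mp_polys by auto
  fix p assume pU: "p : U i"
  obtain Q where Q: "Q : set (Ps ! i)" "p : (case Q of Piece h j g =>
  nonvanishing X (U i) (poly_at X (U i) (dim (Cs ! i)) (y i) (mp (vals h))))"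
  using endo_pieces(1)[OF E i] pU by blast
  obtain h j g where Qh: "Q = Piece h j g" by (cases Q)
  have "mp (vals h) : set (map mp ?gs)" using Q(1) Qh by force
  moreover have "~ vanishes X (U i) p (poly_at X (U i) ?n (y i) (mp (vals h)))"
  using Q(2) Qh unfolding nonvanishing_def by simp
  ultimately show "EX G:set (map mp ?gs). ~ vanishes X (U i) p (poly_at X (U i) ?n (y i) G)" by blast
 qed
 then obtain Qs where Qs: "length Qs = length (map vals ?F @ ?gs)" "set Qs <= polys ?n"
  "(\<Sum>(Q, G)\<leftarrow>zip Qs (map mp (map vals ?F @ ?gs)). Q * G) = 1"
  unfolding poly_value_eq by (auto simp: comp_def)
 show ?thesis
  by (rule unit_terms_of_polys[OF Qs]) (use wf wf_vals chart_facts(4)[OF i] in auto)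
qed

definition overlap_coords :: "nat => nat => chart => alg_poly list => alg_poly list => (nat => 's) => bool" where
 "overlap_coords i j C G H z \<longleftrightarrow>
  presents_chart X (U i \<inter> U j) z (Chart (dim C) (chart_eqs C)) &
  length G = dim (Cs ! i) & length H = dim (Cs ! j) &
  (ALL g:set G \<union> set H. well_formed_poly (dim C) g) &
  (\<forall>l<dim (Cs ! i). res X (U i) (U i \<inter> U j) (y i l) = poly_at X (U i \<inter> U j) (dim C) z (mp (vals (G ! l)))) &
  (\<forall>l<dim (Cs ! j). res X (U j) (U i \<inter> U j) (y j l) = poly_at X (U i \<inter> U j) (dim C) z (mp (vals (H ! l))))"

lemma overlap:
 assumes "i < length Cs" "j < length Cs" "Os ! i ! j = Overlap C G H"
 shows "EX z. overlap_coords i j C G H z"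
proof -
 have "presents_overlap X (U i, y i, dim (Cs ! i)) (U j, y j, dim (Cs ! j)) (Overlap C G H)"
  using PV assms unfolding presents_variety_def by metis
 moreover have "Chart (dim C) (chart_eqs C) = C" by (cases C) simp
 ultimately show ?thesis unfolding presents_overlap.simps poly_value_vals overlap_coords_def by simp
qed

text \<open>Coordinates of equal points come from a point of the overlap.\<close>

lemma pt_equal_witness:
 assumes O: "Os ! i ! j = Overlap C G H" and p: "P i a p" "P j b p"
 shows "EX z. length z = dim C & (ALL c:set z. algebraic c) & (ALL g:set (chart_eqs C). teval (vals g) z = 0) &
  map (%g. teval (vals g) z) G = a & map (%g. teval (vals g) z) H = b"
proof -
 have ij: "i < length Cs" "j < length Cs" and la: "length a = dim (Cs ! i)" "length b = dim (Cs ! j)"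
  and pU: "p : U i \<inter> U j" and pr: "p : rational_points X"
  using p unfolding pt_def by auto
 let ?W = "U i \<inter> U j"
 obtain z where zO: "overlap_coords i j C G H z" using overlap[OF ij O] by auto
 note z1 = zO[unfolded overlap_coords_def]
 have z: "presents_chart X ?W z (Chart (dim C) (chart_eqs C))"
  "length G = dim (Cs ! i)" "length H = dim (Cs ! j)"
  "!!g. g : set G \<union> set H ==> wf_terms (dim C) (vals g)"
  "!!l. l < dim (Cs ! i) ==> res X (U i) ?W (y i l) = poly_at X ?W (dim C) z (mp (vals (G ! l)))"
  "!!l. l < dim (Cs ! j) ==> res X (U j) ?W (y j l) = poly_at X ?W (dim C) z (mp (vals (H ! l)))"
  using z1 wf_vals by (simp_all only:)
 have W: "op ?W" using chart_facts(3) ij by blast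
 have zc: "z l : carrier (sect X ?W)" if "l < dim C" for l
  using z(1) that unfolding presents_chart.simps algebra_generators_def by auto
 have "\<forall>l<dim C. EX c. value_at X ?W p (z l) c" using rational_pointsD[OF pr W pU] zc by blast
 then obtain v where v: "!!l. l < dim C ==> value_at X ?W p (z l) (v l)" by metis
 define vs where "vs = map v [0..<dim C]"
 have lv: "length vs = dim C" by (simp add: vs_def)
 have val: "value_at X ?W p (poly_at X ?W (dim C) z (mp g)) (teval g vs)" if "wf_terms (dim C) g" for g
  using value_at_poly_at[OF W pU mp_polys[OF that], of z "%l. vs ! l"] mpoly_value_mp[OF that lv] v
  by (simp add: vs_def)
 have F: "teval (vals g) vs = 0" if g: "g : set (chart_eqs C)" for g
 proof -
  have wf: "wf_terms (dim C) (vals g)" using z(1) g wf_vals by auto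
  have "poly_at X ?W (dim C) z (mp (vals g)) = \<zero>\<^bsub>sect X ?W\<^esub>"
  using z(1) poly_value_in_ideal[OF g] mp_polys[OF wf] unfolding poly_value_vals[symmetric] by auto
  then show ?thesis using val[OF wf] value_at_vanishes[OF W pU] vanishes_zero[OF W pU] by metis
 qed
 have coord: "teval (vals (K ! l)) vs = c ! l"
  if K: "k < length Cs" "P k c p" "?W <= U k" "l < dim (Cs ! k)" "wf_terms (dim C) (vals (K ! l))"
  "res X (U k) ?W (y k l) = poly_at X ?W (dim C) z (mp (vals (K ! l)))" for k c K l
 proof -
  have vk: "value_at X (U k) p (y k l) (c ! l)" using K(2,4) unfolding pt_def by auto
  then have "y k l : carrier (sect X (U k))" unfolding value_at_def by simp
  then have "value_at X ?W p (res X (U k) ?W (y k l)) (c ! l)"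
  using vk value_at_res[OF chart_facts(3)[OF K(1)] W K(3) pU] by simp
  then show ?thesis using val[OF K(5)] K(6) value_at_unique[OF W pU] by metis
 qed
 have "map (%g. teval (vals g) vs) G = a"
  using coord[OF ij(1) p(1)] z(2,4,5) la by (intro nth_equalityI) auto
 moreover have "map (%g. teval (vals g) vs) H = b"
  using coord[OF ij(2) p(2)] z(3,4,6) la by (intro nth_equalityI) auto
 moreover have "ALL c:set vs. algebraic c" using v unfolding vs_def value_at_def by auto
 ultimately show ?thesis using lv F by blast
qed

definition apart_terms :: "nat => cterms list => complex list => cterms list" where
 "apart_terms m G a = map (%(g, c). (- c, replicate m 0) # g) (zip G a)"

lemma wf_apart_terms:
 assumes "!!g. g : set gs ==> wf_terms m g" "!!c. c : set a ==> algebraic c" "q : set (apart_terms m gs a)"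
 shows "wf_terms m q"
proof -
 obtain g c where "(g, c) : set (zip gs a)" and q: "q = (- c, replicate m 0) # g"
  using assms(3) unfolding apart_terms_def by auto
 then have "wf_terms m g" "algebraic c" using assms(1,2) by (auto dest: set_zip_leftD set_zip_rightD)
 then show ?thesis unfolding q wf_terms_def by auto
qed

text \<open>If the points are different, then no point of the overlap has the two lists as its
 coordinates.\<close>

lemma pt_apart_unit_terms:
 assumes O: "Os ! i ! j = Overlap C G H" and p: "P i a p" "P j b p'" and ne: "p ~= p'"
 shows "unit_terms (dim C) (map vals (chart_eqs C) @
  apart_terms (dim C) (map vals G) a @ apart_terms (dim C) (map vals H) b)"
proof -
 have ij: "i < length Cs" "j < length Cs" and la: "length a = dim (Cs ! i)" "length b = dim (Cs ! j)"
  and pU: "p : U i" "p' : U j"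
  using p unfolding pt_def by auto
 let ?W = "U i \<inter> U j" and ?m = "dim C"
 obtain z where zO: "overlap_coords i j C G H z" using overlap[OF ij O] by auto
 note z1 = zO[unfolded overlap_coords_def]
 have z: "presents_chart X ?W z (Chart (dim C) (chart_eqs C))"
  "length G = dim (Cs ! i)" "length H = dim (Cs ! j)"
  "!!g. g : set G \<union> set H ==> wf_terms (dim C) (vals g)"
  "!!l. l < dim (Cs ! i) ==> res X (U i) ?W (y i l) = poly_at X ?W (dim C) z (mp (vals (G ! l)))"
  "!!l. l < dim (Cs ! j) ==> res X (U j) ?W (y j l) = poly_at X ?W (dim C) z (mp (vals (H ! l)))"
  using z1 wf_vals by (simp_all only:)
 have W: "op ?W" using chart_facts(3) ij by blast
 let ?gs = "apart_terms ?m (map vals G) a @ apart_terms ?m (map vals H) b"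
 interpret S: sections X ?W ?m z
  by unfold_locales (use W z(1) in \<open>auto simp: algebra_generators_def\<close>)
 have alg: "algebraic c" if "c : set a \<union> set b" for c using that pt_algebraic p by blast
 have wf: "wf_terms ?m q" if "q : set ?gs" for q
  using that wf_apart_terms[of "map vals G" ?m a q] wf_apart_terms[of "map vals H" ?m b q] z(4) alg by auto
 have coord: "value_at X (U k) r (y k l) (c ! l)"
  if K: "k < length Cs" "?W <= U k" "l < dim (Cs ! k)" "length c = dim (Cs ! k)" "length K = dim (Cs ! k)" "set c <= set a \<union> set b"
  "wf_terms ?m (vals (K ! l))" "res X (U k) ?W (y k l) = poly_at X ?W ?m z (mp (vals (K ! l)))"
  and r: "r : ?W" "!!q. q : set (apart_terms ?m (map vals K) c) ==> vanishes X ?W r (poly_at X ?W ?m z (mp q))"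
  for k c K l r
 proof -
  have cl: "algebraic (c ! l)" using K alg by (metis nth_mem subsetD)
  have yk: "y k l : carrier (sect X (U k))"
  using chart_facts(2)[OF K(1)] K(3) unfolding algebra_generators_def by auto
  let ?g = "(- (c ! l), replicate ?m 0) # vals (K ! l)"
  have "?g : set (apart_terms ?m (map vals K) c)"
  using K unfolding apart_terms_def by (force simp: set_zip)
  then have v: "vanishes X ?W r (poly_at X ?W ?m z (mp ?g))" by (rule r(2))
  have z0: "Poly_Mapping.nth (replicate ?m 0) = (0 :: nat \<Rightarrow>\<^sub>0 nat)"
  by (intro poly_mapping_eqI) (simp add: nth_default_def)
  interpret R: cring "sect X ?W" by (rule cring_sect[OF W])
  have "cst X ?W (c ! l) \<oplus>\<^bsub>sect X ?W\<^esub> cst X ?W (- (c ! l)) = \<zero>\<^bsub>sect X ?W\<^esub>"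
  using cst_add[OF W cl, of "- (c ! l)"] cst_0[OF W] cl by simp
  then have neg: "cst X ?W (- (c ! l)) = \<ominus>\<^bsub>sect X ?W\<^esub> cst X ?W (c ! l)"
  using R.minus_equality[of "cst X ?W (- (c ! l))" "cst X ?W (c ! l)"] cst_closed[OF W] cl R.a_comm by auto
  have "poly_at X ?W ?m z (mp ?g) = cst X ?W (- (c ! l)) \<oplus>\<^bsub>sect X ?W\<^esub> res X (U k) ?W (y k l)"
  using cl mp_polys[OF K(7)] K(8) by (simp add: z0 S.poly_at_add S.poly_at_const polys_single)
  also have "... = res X (U k) ?W (y k l) \<ominus>\<^bsub>sect X ?W\<^esub> cst X ?W (c ! l)"
  using neg cst_closed[OF W cl] res_closed[OF chart_facts(3)[OF K(1)] W K(2) yk]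
  by (simp add: a_minus_def R.a_comm)
  finally have "value_at X ?W r (res X (U k) ?W (y k l)) (c ! l)"
  unfolding value_at_def using v cl res_closed[OF chart_facts(3)[OF K(1)] W K(2) yk] by simp
  then show ?thesis using value_at_res[OF chart_facts(3)[OF K(1)] W K(2) r(1) yk] by simp
 qed
 have "EX Qs. length Qs = length (chart_eqs C) + length (map mp ?gs) & set Qs <= polys ?m &
  (\<Sum>(Q, G)\<leftarrow>zip Qs (map poly_value (chart_eqs C) @ map mp ?gs). Q * G) = 1"
 proof (rule unit_ideal[OF z(1)])
  show "set (map mp ?gs) <= polys ?m" using wf mp_polys by auto
  fix r assume r: "r : ?W"
  show "EX Q:set (map mp ?gs). ~ vanishes X ?W r (poly_at X ?W ?m z Q)"
  proof (rule ccontr)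
  assume "~ ?thesis"
  then have van: "vanishes X ?W r (poly_at X ?W ?m z (mp q))" if "q : set ?gs" for q using that by auto
  have 1: "value_at X (U i) r (y i l) (a ! l)" if "l < dim (Cs ! i)" for l
  by (rule coord[of i l a G r]) (use ij that la z(2,4,5) r van in auto)
  have 2: "value_at X (U j) r (y j l) (b ! l)" if "l < dim (Cs ! j)" for l
  by (rule coord[of j l b H r]) (use ij that la z(3,4,6) r van in auto)
  have "r = p"
  by (rule point_unique[OF chart_facts(1,2)[OF ij(1)] _ pU(1), of r "%l. a ! l"])
  (use 1 r p(1) in \<open>auto simp: pt_def\<close>)
  moreover have "r = p'"
  by (rule point_unique[OF chart_facts(1,2)[OF ij(2)] _ pU(2), of r "%l. b ! l"])
  (use 2 r p(2) in \<open>auto simp: pt_def\<close>)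
  ultimately show False using ne by simp
  qed
 qed
 then obtain Qs where Qs: "length Qs = length (map vals (chart_eqs C) @ ?gs)" "set Qs <= polys ?m"
  "(\<Sum>(Q, G)\<leftarrow>zip Qs (map mp (map vals (chart_eqs C) @ ?gs)). Q * G) = 1"
  unfolding poly_value_eq by (auto simp: comp_def)
 have "wf_terms ?m q" if "q : set (map vals (chart_eqs C) @ ?gs)" for q
  using that wf z(1) wf_vals by auto
 then show ?thesis using unit_terms_of_polys[OF Qs] by simp
qed

end

section \<open>Valuation rings\<close>

definition is_subring :: "complex set => bool" where
 "is_subring A \<longleftrightarrow> 1 : A & (ALL x:A. ALL y:A. x - y : A & x * y : A)"

lemma is_subringD:
 assumes "is_subring A"
 shows "0 : A" "1 : A" "x : A ==> y : A ==> x + y : A" "x : A ==> y : A ==> x - y : A"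
  "x : A ==> y : A ==> x * y : A" "x : A ==> - x : A" "x : A ==> x ^ n : A"
  "of_int k : A" "of_nat m : A"
  "(!!i. i : I ==> f i : A) ==> (\<Sum>i\<in>I. f i) : A"
proof -
 note A = assms[unfolded is_subring_def]
 show 1: "1 : A" using A by blast
 have d: "x - y : A" if "x : A" "y : A" for x y using A that by blast
 have m: "x * y : A" if "x : A" "y : A" for x y using A that by blast
 show z: "0 : A" using d[OF 1 1] by simp
 have um: "- x : A" if "x : A" for x using d[OF z that] by simp
 have a: "x + y : A" if "x : A" "y : A" for x y using d[OF that(1) um[OF that(2)]] by simp
 show "x : A ==> y : A ==> x + y : A" "x : A ==> y : A ==> x - y : A"
  "x : A ==> y : A ==> x * y : A" "x : A ==> - x : A" using a d m um by auto
 show "x ^ n : A" if "x : A" using that by (induction n) (auto intro: m 1)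
 have n: "of_nat m : A" for m by (induction m) (auto intro: a z 1)
 show "of_nat m : A" by (rule n)
 show "of_int k : A" using n um by (cases k rule: int_cases2) auto
 show "(\<Sum>i\<in>I. f i) : A" if "!!i. i : I ==> f i : A"
  using that by (induction I rule: infinite_finite_induct) (auto intro: a z)
qed

lemma adjoin_subring:
 assumes A: "is_subring A"
 shows "is_subring {poly q z | q. ALL i. coeff q i : A}"
 unfolding is_subring_def
proof (intro conjI ballI)
 note A' = is_subringD[OF A]
 show "1 : {poly q z | q. ALL i. coeff q i : A}"
  using A' by (auto intro!: exI[of _ "1 :: complex poly"] simp: coeff_1)
 fix x y assume "x : {poly q z | q. ALL i. coeff q i : A}" "y : {poly q z | q. ALL i. coeff q i : A}"
 then obtain q r where q: "x = poly q z" "!!i. coeff q i : A" and r: "y = poly r z" "!!i. coeff r i : A" by auto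
 show "x - y : {poly q z | q. ALL i. coeff q i : A}"
  using q r A' by (auto intro!: exI[of _ "q - r"])
 show "x * y : {poly q z | q. ALL i. coeff q i : A}"
  using q r A' by (auto intro!: exI[of _ "q * r"] A'(10) simp: coeff_mult)
qed

lemma exists_maximal_subring:
 assumes "prime (p::nat)"
 obtains A where "is_subring A" "inverse (of_nat p) ~: A"
  "!!B. is_subring B ==> A <= B ==> inverse (of_nat p) ~: B ==> B = A"
proof -
 let ?F = "{A. is_subring A & inverse (of_nat p) ~: A}"
 have "EX M:?F. ALL X:?F. M <= X --> X = M"
 proof (rule subset_Zorn_nonempty)
  have "inverse (of_nat p) ~: (\<int> :: complex set)"
  proof
  assume "inverse (of_nat p) : (\<int> :: complex set)"
  then obtain k :: int where "inverse (of_nat p) = (of_int k :: complex)" by (auto elim: Ints_cases)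
  then have "(of_int (int p * k) :: complex) = of_int 1" using prime_gt_0_nat[OF assms] by (auto simp: field_simps)
  then have "int p * k = 1" by (simp only: of_int_eq_iff)
  then show False using prime_gt_1_nat[OF assms] by (auto simp: zmult_eq_1_iff)
  qed
  moreover have "is_subring \<int>" unfolding is_subring_def by auto
  ultimately show "?F ~= {}" by blast
  fix C assume C: "C ~= {}" "subset.chain ?F C"
  have "EX Z:C. x : Z & y : Z" if "x : \<Union>C" "y : \<Union>C" for x y
  using C(2) that unfolding subset_chain_def by blast
  moreover have "is_subring Z" "inverse (of_nat p) ~: Z" if "Z : C" for Z
  using C(2) that unfolding subset_chain_def by auto
  ultimately show "\<Union>C : ?F" using C(1) unfolding is_subring_def by (auto, (meson+)?)
 qed
 then show ?thesis using that by blast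
qed

locale valuation_ring =
 fixes A :: "complex set" and p :: nat
 assumes prime: "prime p" and subring: "is_subring A" and not_inv_p: "inverse (of_nat p) ~: A"
  and total: "z ~= 0 ==> z : A \<or> inverse z : A"

text \<open>A maximal subring in which \<open>p\<close> is not invertible.  If neither \<open>z\<close> nor \<open>1/z\<close> belongs to it,
 then \<open>1/p\<close> is a polynomial in each of them; take both polynomials of least degree and use the
 one of smaller degree to lower the degree of the other.\<close>

lemma exists_valuation_ring:
 assumes p: "prime p"
 shows "EX A. valuation_ring A p"
proof -
 obtain A where A: "is_subring A" "inverse (of_nat p) ~: A"
  and max: "!!B. is_subring B ==> A <= B ==> inverse (of_nat p) ~: B ==> B = A"
  using exists_maximal_subring[OF p] by blast
 note A' = is_subringD[OF A(1)]
 let ?p = "of_nat p :: complex"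
 have p0: "?p ~= 0" using prime_gt_0_nat[OF p] by simp
 define rel where "rel z n \<longleftrightarrow> (EX a. (ALL i. a i : A) & 1 = ?p * (\<Sum>i\<le>n. a i * z ^ i))" for z :: complex and n :: nat
 have rel_ex: "EX n. rel z n" if z: "z ~: A" for z
 proof -
  let ?B = "{poly q z | q. ALL i. coeff q i : A}"
  have "z : ?B" using A' by (auto intro!: exI[of _ "[:0, 1:]"] simp: coeff_pCons split: nat.splits)
  moreover have "A <= ?B"
  proof
  fix a assume "a : A"
  then show "a : ?B" using A' by (auto intro!: exI[of _ "[:a:]"] simp: coeff_pCons split: nat.splits)
  qed
  ultimately have "inverse ?p : ?B" using max[OF adjoin_subring[OF A(1)], of z] z by blast
  then obtain q where q: "inverse ?p = poly q z" "!!i. coeff q i : A" by auto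
  have "1 = ?p * (\<Sum>i\<le>degree q. coeff q i * z ^ i)" using q(1) p0 by (simp add: poly_altdef[symmetric] field_simps)
  then show ?thesis using q(2) unfolding rel_def by blast
 qed
 have not_rel_0: "~ rel z 0" for z
 proof
  assume "rel z 0"
  then obtain a where "a : A" "1 = ?p * a" unfolding rel_def by auto
  then have "inverse ?p = a" using p0 by (simp add: field_simps)
  then show False using A(2) \<open>a : A\<close> by simp
 qed
 have unit: "inverse (1 - ?p * b) : A & 1 - ?p * b ~= 0" if b: "b : A" for b
 proof -
  let ?u = "1 - ?p * b"
  have nz: "?u ~= 0"
  proof
  assume "?u = 0"
  then have "inverse ?p = b" using p0 by (simp add: field_simps)
  then show False using A(2) b by simp
  qed
  have "inverse ?u : A"
  proof (rule ccontr)
  assume "inverse ?u ~: A"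
  then obtain n where "rel (inverse ?u) n" using rel_ex by blast
  then obtain a where a: "!!i. a i : A" "1 = ?p * (\<Sum>i\<le>n. a i * inverse ?u ^ i)" unfolding rel_def by auto
  have "?u ^ n = ?p * (\<Sum>i\<le>n. a i * inverse ?u ^ i) * ?u ^ n" using a(2) by simp
  also have "... = ?p * (\<Sum>i\<le>n. a i * (inverse ?u ^ i * ?u ^ n))" by (simp add: sum_distrib_right mult.assoc)
  also have "(\<Sum>i\<le>n. a i * (inverse ?u ^ i * ?u ^ n)) = (\<Sum>i\<le>n. a i * ?u ^ (n - i))"
  proof (intro sum.cong refl)
  fix i assume "i : {..n}"
  then have "?u ^ n = ?u ^ i * ?u ^ (n - i)" by (simp add: power_add[symmetric])
  moreover have "inverse ?u ^ i * ?u ^ i = 1" using nz by (simp add: power_mult_distrib[symmetric])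
  ultimately show "a i * (inverse ?u ^ i * ?u ^ n) = a i * ?u ^ (n - i)" by (simp add: mult.assoc[symmetric])
  qed
  finally have 1: "?u ^ n = ?p * (\<Sum>i\<le>n. a i * ?u ^ (n - i))" .
  have uA: "?u : A" by (intro A'(4) A'(5) A'(2) A'(9) b)
  have "EX b':A. ?u ^ k = 1 - ?p * b'" for k
  proof (induction k)
  case 0
  show ?case using A'(1) by (intro bexI[of _ 0]) auto
  next
  case (Suc k)
  then obtain b' where b': "b' : A" "?u ^ k = 1 - ?p * b'" by auto
  have "?u ^ Suc k = 1 - ?p * (b + b' * ?u)" unfolding power_Suc b'(2) by (simp add: algebra_simps)
  moreover have "b + b' * ?u : A" by (intro A'(3) A'(5) b b'(1) uA)
  ultimately show ?case by blast
  qed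
  then obtain b' where b': "b' : A" "?u ^ n = 1 - ?p * b'" by blast
  have "inverse ?p = (\<Sum>i\<le>n. a i * ?u ^ (n - i)) + b'" using 1 b'(2) p0 by (simp add: field_simps)
  also have "... : A" by (intro A'(3) A'(10) A'(5) A'(7) a(1) uA b'(1))
  finally show False using A(2) by simp
  qed
  then show ?thesis using nz by simp
 qed
 have reduce: "rel z (n - 1)" if nm: "rel z n" "rel (inverse z) m" "1 <= m" "m <= n" and z: "z ~= 0" for z n m
 proof -
  obtain a where a: "!!i. a i : A" "1 = ?p * (\<Sum>i\<le>n. a i * z ^ i)" using nm(1) unfolding rel_def by auto
  obtain b where b: "!!i. b i : A" "1 = ?p * (\<Sum>i\<le>m. b i * inverse z ^ i)" using nm(2) unfolding rel_def by auto
  define v where "v = inverse (1 - ?p * b 0)"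
  have v: "v : A" "v * (1 - ?p * b 0) = 1" unfolding v_def using unit[OF b(1)[of 0]] by auto
  define c where "c j = (if j <= m then v * b j else 0)" for j
  have c: "c j : A" for j unfolding c_def using A'(1) A'(5)[OF v(1) b(1)] by simp
  have "(\<Sum>i\<le>m. b i * inverse z ^ i) = b 0 + (\<Sum>i\<in>{1..m}. b i * inverse z ^ i)"
  by (simp add: atMost_atLeast0 sum.atLeast_Suc_atMost)
  then have "1 - ?p * b 0 = ?p * (\<Sum>i\<in>{1..m}. b i * inverse z ^ i)" using b(2) by (simp add: algebra_simps)
  then have "1 = v * (?p * (\<Sum>i\<in>{1..m}. b i * inverse z ^ i))" using v(2) by simp
  also have "... = ?p * (\<Sum>i\<in>{1..m}. c i * inverse z ^ i)"
  by (simp add: c_def sum_distrib_left algebra_simps)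
  also have "(\<Sum>i\<in>{1..m}. c i * inverse z ^ i) = (\<Sum>i\<in>{1..n}. c i * inverse z ^ i)"
  using nm(4) by (intro sum.mono_neutral_left) (auto simp: c_def)
  finally have "z ^ n = ?p * (\<Sum>i\<in>{1..n}. c i * inverse z ^ i) * z ^ n" by simp
  also have "... = ?p * (\<Sum>i\<in>{1..n}. c i * (inverse z ^ i * z ^ n))" by (simp add: sum_distrib_right mult.assoc)
  also have "(\<Sum>i\<in>{1..n}. c i * (inverse z ^ i * z ^ n)) = (\<Sum>i\<in>{1..n}. c i * z ^ (n - i))"
  proof (intro sum.cong refl)
  fix i assume "i : {1..n}"
  then have "z ^ n = z ^ i * z ^ (n - i)" by (simp add: power_add[symmetric])
  moreover have "inverse z ^ i * z ^ i = 1" using z by (simp add: power_mult_distrib[symmetric])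
  ultimately show "c i * (inverse z ^ i * z ^ n) = c i * z ^ (n - i)" by (simp add: mult.assoc[symmetric])
  qed
  also have "... = (\<Sum>i<n. c (n - i) * z ^ i)"
  by (rule sum.reindex_bij_witness[of _ "%i. n - i" "%i. n - i"]) auto
  finally have zn: "z ^ n = ?p * (\<Sum>i<n. c (n - i) * z ^ i)" .
  have "1 = ?p * ((\<Sum>i<n. a i * z ^ i) + a n * z ^ n)" using a(2) by (simp add: lessThan_Suc_atMost[symmetric])
  also have "... = ?p * (\<Sum>i<n. (a i + a n * ?p * c (n - i)) * z ^ i)"
  unfolding zn by (simp add: sum.distrib sum_distrib_left algebra_simps)
  also have "{..<n} = {..n - 1}" using nm(3,4) by auto
  finally have "1 = ?p * (\<Sum>i\<le>n - 1. (a i + a n * ?p * c (n - i)) * z ^ i)" .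
  moreover have "a i + a n * ?p * c (n - i) : A" for i by (intro A'(3) A'(5) A'(9) a(1) c)
  ultimately show ?thesis unfolding rel_def by (intro exI[of _ "%i. a i + a n * ?p * c (n - i)"]) simp
 qed
 have "z : A \<or> inverse z : A" if z: "z ~= 0" for z
 proof (rule ccontr)
  assume "~ ?thesis"
  then have ex: "EX n. rel z n" "EX n. rel (inverse z) n" using rel_ex by auto
  define n where "n = (LEAST n. rel z n)"
  define m where "m = (LEAST n. rel (inverse z) n)"
  have nm: "rel z n" "rel (inverse z) m" unfolding n_def m_def using ex by (auto intro: LeastI_ex)
  have least: "~ rel z k" if "k < n" for k using not_less_Least that unfolding n_def by blast
  have least': "~ rel (inverse z) k" if "k < m" for k using not_less_Least that unfolding m_def by blast
  have "n ~= 0" "m ~= 0" using nm not_rel_0 by (metis)+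
  then show False
  using reduce[OF nm] reduce[of "inverse z" m n] nm least[of "n - 1"] least'[of "m - 1"] z
  by (cases "m <= n") auto
 qed
 then show ?thesis using p A by (intro exI[of _ A]) (unfold_locales, auto)
qed

context valuation_ring
begin

lemmas A = is_subringD[OF subring]

definition M :: "complex set" where "M = {z : A. z = 0 \<or> inverse z ~: A}"

lemma M_A: "z : M ==> z : A" by (simp add: M_def)
lemma zero_M: "0 : M" using A(1) by (simp add: M_def)
lemma one_M: "1 ~: M" using A(2) by (simp add: M_def)
lemma unit_inverse: "z : A ==> z ~: M ==> z ~= 0 & inverse z : A" by (simp add: M_def)

lemma M_mult: assumes "a : A" "x : M" shows "a * x : M"
proof -
 have "a * x = 0 \<or> inverse (a * x) ~: A"
 proof (rule ccontr)
  assume *: "~ ?thesis"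
  then have "a * inverse (a * x) : A" using A(5)[OF assms(1), of "inverse (a * x)"] by blast
  moreover have "a * inverse (a * x) = inverse x" using * by (simp add: field_simps)
  ultimately have "inverse x : A" by (simp only:)
  then show False using assms(2) * by (simp add: M_def)
 qed
 then show ?thesis using A(5)[OF assms(1) M_A[OF assms(2)]] unfolding M_def by simp
qed

lemma M_mult': "x : M ==> a : A ==> x * a : M" using M_mult[of a x] by (simp add: mult.commute)

lemma M_minus: "x : M ==> - x : M" using M_mult[OF A(6)[OF A(2)], of x] by simp

lemma M_add: assumes "x : M" "y : M" shows "x + y : M"
proof -
 have *: "x + y : M" if "x : M" "y : M" "y ~= 0" "x / y : A" for x y
 proof -
  have "(x / y + 1) * y : M" by (intro M_mult A(3) A(2) that)
  moreover have "(x / y + 1) * y = x + y" using that(3) by (simp add: distrib_right)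
  ultimately show ?thesis by (simp only:)
 qed
 show ?thesis
 proof (cases "x = 0 \<or> y = 0")
  case False
  then show ?thesis using total[of "x / y"] *[OF assms] *[OF assms(2,1)]
  by (auto simp: add.commute)
 qed (use assms in auto)
qed

lemma M_diff: "x : M ==> y : M ==> x - y : M" using M_add[of x "- y"] M_minus by simp

lemma M_sum: "(!!i. i : I ==> f i : M) ==> (\<Sum>i\<in>I. f i) : M"
 by (induction I rule: infinite_finite_induct) (auto intro: M_add zero_M)

lemma M_prime: assumes "x : A" "y : A" "x * y : M" shows "x : M \<or> y : M"
proof (rule ccontr)
 assume "~ ?thesis"
 then have "inverse x : A" "inverse y : A" "x ~= 0" "y ~= 0" using unit_inverse assms by auto
 then have "inverse (x * y) : A" "x * y ~= 0" using A(5)[of "inverse x" "inverse y"] by simp_all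
 then show False using assms(3) by (simp add: M_def)
qed

lemma p_M: "of_nat p : M" using A(9) not_inv_p by (simp add: M_def)

lemma int_M_iff: "of_int k : M \<longleftrightarrow> int p dvd k"
proof
 assume k: "of_int k : M"
 show "int p dvd k"
 proof (rule ccontr)
  assume "~ int p dvd k"
  then have "coprime k (int p)" using prime prime_imp_coprime[of "int p" k] by (simp add: coprime_commute)
  then obtain a b where "a * k + b * int p = 1" using bezout_int[of k "int p"] by auto
  then have "(of_int (a * k + b * int p) :: complex) = 1" by (simp only: of_int_1)
  then have "1 = of_int a * of_int k + of_int b * (of_nat p :: complex)" by simp
  also have "... : M" by (intro M_add M_mult A(8) k p_M)
  finally show False using one_M by simp
 qed
next
 assume "int p dvd k"
 then obtain j where "k = int p * j" by auto
 then show "of_int k : M" using M_mult'[OF p_M A(8)[of j]] by simp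
qed

lemma nat_M_iff: "of_nat k : M \<longleftrightarrow> p dvd k"
 using int_M_iff[of "int k"] by simp

lemma inverse_nat: "~ p dvd k ==> inverse (of_nat k) : A"
 using unit_inverse[OF A(9)] nat_M_iff by simp

text \<open>An element with an equation whose leading coefficient is invertible is integral.\<close>

lemma integral_mem:
 assumes "of_int l * z ^ n + (\<Sum>i<n. of_int (b i) * z ^ i) = 0" "~ int p dvd l"
 shows "z : A"
proof (rule ccontr)
 assume z: "z ~: A"
 then have z0: "z ~= 0" using A(1) by auto
 have iz: "inverse z : A" using total[OF z0] z by simp
 then have izM: "inverse z : M" using z z0 by (simp add: M_def)
 have "of_int l + (\<Sum>i<n. of_int (b i) * inverse z ^ (n - i)) =
  (of_int l * z ^ n + (\<Sum>i<n. of_int (b i) * z ^ i)) * inverse z ^ n"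
 proof -
  have "z ^ i * inverse z ^ n = inverse z ^ (n - i)" if "i < n" for i
  proof -
  have "inverse z ^ n = inverse z ^ i * inverse z ^ (n - i)" using that by (simp add: power_add[symmetric])
  moreover have "z ^ i * inverse z ^ i = 1" using z0 by (simp add: power_mult_distrib[symmetric])
  ultimately show ?thesis by (simp add: mult.assoc[symmetric])
  qed
  then have "(\<Sum>i<n. of_int (b i) * z ^ i) * inverse z ^ n = (\<Sum>i<n. of_int (b i) * inverse z ^ (n - i))"
  by (simp add: sum_distrib_right mult.assoc)
  moreover have "z ^ n * inverse z ^ n = 1" using z0 by (simp add: power_mult_distrib[symmetric])
  ultimately show ?thesis by (simp add: distrib_right mult.assoc)
 qed
 then have "of_int l = - (\<Sum>i<n. of_int (b i) * inverse z ^ (n - i))" using assms(1)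
  by (simp add: eq_neg_iff_add_eq_0)
 also have "... : M"
 proof (intro M_minus M_sum)
  fix i assume "i : {..<n}"
  then have "inverse z ^ (n - i) = inverse z ^ (n - i - 1) * inverse z"
  by (metis Suc_diff_Suc diff_Suc_1 diff_diff_left lessThan_iff plus_1_eq_Suc power_Suc2 add.commute)
  moreover have "of_int (b i) * (inverse z ^ (n - i - 1) * inverse z) : M"
  by (intro M_mult A(8) A(7) iz izM)
  ultimately show "of_int (b i) * inverse z ^ (n - i) : M" by (simp only:)
 qed
 finally show False using assms(2) int_M_iff by simp
qed

lemma exists_common_divisor:
 assumes "finite D" "D <= A" "EX x:D. x ~= 0"
 shows "EX dl:D. dl ~= 0 & (ALL x:D. x / dl : A)"
 using assms
proof (induction D rule: finite_induct)
 case (insert d D)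
 show ?case
 proof (cases "EX x:D. x ~= 0")
  case True
  then obtain dl where dl: "dl : D" "dl ~= 0" "ALL x:D. x / dl : A" using insert by auto
  show ?thesis
  proof (cases "d / dl : A")
  case True
  then show ?thesis using dl by auto
  next
  case False
  then have d: "d ~= 0" using A(1) by auto
  then have i: "dl / d : A" using total[of "d / dl"] False dl(2) by auto
  have "x / d : A" if "x : D" for x
  proof -
  have "x / d = (x / dl) * (dl / d)" using dl(2) by simp
  then show ?thesis using A(5)[OF dl(3)[rule_format, OF that] i] by (simp only:)
  qed
  then show ?thesis using d A(2) by auto
  qed
 next
  case False
  then have "d ~= 0" using insert.prems by auto
  then show ?thesis using False A(1,2) by auto
 qed
qed auto

text \<open>The residue field of a number field of degree \<open>n\<close> has at most \<open>p^n\<close> elements: residues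
 independent over the prime field lift to numbers that are linearly independent over the
 rationals.\<close>

lemma finite_residues:
 assumes B: "finite B"
 obtains code :: "complex => (complex => nat)" and R where "finite R" "card R <= p ^ card B"
  "!!x. x : A ==> x : rat.span B ==> code x : R"
  "!!x y. x : A ==> y : A ==> x : rat.span B ==> y : rat.span B ==> code x = code y \<longleftrightarrow> x - y : M"
proof -
 let ?K = "A \<inter> rat.span B"
 define indep where "indep E \<longleftrightarrow> finite E & E <= ?K &
  (\<forall>c :: complex => int. (\<Sum>e\<in>E. of_int (c e) * e) : M --> (ALL e:E. int p dvd c e))" for E
 have bound: "card E <= card B" if E: "indep E" for E
 proof (rule ccontr)
  assume "~ card E <= card B"
  then have "rat.dependent E" using rat.independent_span_bound[OF B, of E] E unfolding indep_def by auto
  then obtain u where "(\<Sum>x\<in>E. of_rat (u x) * x) = 0" "EX x:E. u x ~= 0"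
  using rat.dependent_finite[of E] E unfolding indep_def by auto
  then obtain b where b: "EX e:E. b e ~= 0" "(\<Sum>e\<in>E. of_int (b e) * e) = 0"
  using rat_relation_imp_int_relation[of E u "%e. e"] E unfolding indep_def by auto
  have "ALL e:E. int p ^ k dvd b e" for k
  proof (induction k)
  case (Suc k)
  define c where "c e = b e div int p ^ k" for e
  have bc: "b e = int p ^ k * c e" if "e : E" for e using Suc that by (simp add: c_def)
  have "(\<Sum>e\<in>E. of_int (b e) * e) = of_int (int p ^ k) * (\<Sum>e\<in>E. of_int (c e) * e)"
  by (simp add: bc sum_distrib_left mult.assoc)
  then have "(\<Sum>e\<in>E. of_int (c e) * e) = 0" using b(2) prime_gt_0_nat[OF prime] by simp
  then have "ALL e:E. int p dvd c e" using E zero_M unfolding indep_def by metis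
  then show ?case using bc by (auto simp: mult.commute mult_dvd_mono)
  qed simp
  moreover obtain e where e: "e : E" "b e ~= 0" using b(1) by blast
  ultimately have le: "int p ^ k <= \<bar>b e\<bar>" for k using dvd_imp_le_int[of "b e" "int p ^ k"] by simp
  have less: "int k < int p ^ k" for k using power_gt_expt[of p k] prime_gt_1_nat[OF prime]
  by (simp flip: of_nat_power)
  show False using le[of "nat \<bar>b e\<bar>"] less[of "nat \<bar>b e\<bar>"] by simp
 qed
 have "indep {}" unfolding indep_def by simp
 then obtain E where E: "indep E" and maxE: "!!F. indep F ==> card F <= card E"
  using ex_has_greatest_nat[of indep "{}" card "Suc (card B)"] bound by (auto simp: less_Suc_eq_le)
 have finE: "finite E" and EK: "E <= ?K" using E unfolding indep_def by auto
 define rep where "rep x c \<longleftrightarrow> c : E \<rightarrow>\<^sub>E {..<p} & x - (\<Sum>e\<in>E. of_nat (c e) * e) : M" for x c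
 have reduce: "EX c. rep x c" if x: "x : ?K" and d: "x - (\<Sum>e\<in>E. of_int (d e) * e) : M" for x d
 proof -
  let ?c = "\<lambda>e\<in>E. nat (d e mod int p)"
  have p0: "int p > 0" using prime_gt_0_nat[OF prime] by simp
  have "(\<Sum>e\<in>E. of_int (d e) * e) - (\<Sum>e\<in>E. of_nat (?c e) * e) = (\<Sum>e\<in>E. of_int (d e - d e mod int p) * e)"
  using p0 by (simp add: sum_subtractf[symmetric] algebra_simps)
  also have "... : M"
  proof (rule M_sum)
  fix e assume "e : E"
  moreover have "of_int (d e - d e mod int p) : M" unfolding int_M_iff by (rule dvd_minus_mod)
  ultimately show "of_int (d e - d e mod int p) * e : M" using EK by (intro M_mult') auto
  qed
  finally have "x - (\<Sum>e\<in>E. of_nat (?c e) * e) : M" using M_add[OF d] by fastforce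
  moreover have "?c : E \<rightarrow>\<^sub>E {..<p}" using p0 by (auto simp: nat_less_iff)
  ultimately show ?thesis unfolding rep_def by blast
 qed
 have rep_ex: "EX c. rep x c" if x: "x : ?K" for x
 proof (cases "x : E")
  case True
  have "(\<Sum>e\<in>E. of_int (if e = x then 1 else 0) * e) = (\<Sum>e\<in>{x}. e)"
  using finE True by (intro sum.mono_neutral_cong_right) auto
  then show ?thesis using reduce[OF x, of "%e. if e = x then 1 else 0"] zero_M by simp
 next
  case False
  then have "~ indep (insert x E)" using maxE[of "insert x E"] finE by auto
  then obtain c :: "complex => int" where c: "(\<Sum>e\<in>insert x E. of_int (c e) * e) : M"
  "~ (ALL e:insert x E. int p dvd c e)"
  using x EK finE unfolding indep_def by auto
  have c1: "of_int (c x) * x + (\<Sum>e\<in>E. of_int (c e) * e) : M" using c(1) finE False by simp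
  have ndvd: "~ int p dvd c x"
  proof
  assume d: "int p dvd c x"
  then have "of_int (c x) * x : M" using M_mult' int_M_iff x by auto
  then have "(\<Sum>e\<in>E. of_int (c e) * e) : M" using M_diff[OF c1] by fastforce
  then show False using E d c(2) unfolding indep_def by auto
  qed
  then have "coprime (c x) (int p)" using prime prime_imp_coprime[of "int p" "c x"] by (simp add: coprime_commute)
  then obtain a b where ab: "a * c x + b * int p = 1" using bezout_int[of "c x" "int p"] by auto
  then have "(of_int (a * c x + b * int p) :: complex) = 1" by (simp only: of_int_1)
  then have ab': "of_int a * of_int (c x) = 1 - of_int b * (of_nat p :: complex)" by (simp add: algebra_simps)
  have "x - (\<Sum>e\<in>E. of_int (- a * c e) * e) =
  of_int a * (of_int (c x) * x + (\<Sum>e\<in>E. of_int (c e) * e)) + of_int b * x * of_nat p"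
  proof -
  have "of_int a * (of_int (c x) * x) = x - of_int b * x * of_nat p"
  unfolding mult.assoc[symmetric] ab' by (simp add: algebra_simps)
  then show ?thesis by (simp add: distrib_left sum_distrib_left sum_negf mult.assoc)
  qed
  also have "... : M" using x by (intro M_add M_mult c1 p_M A(8) A(5)) auto
  finally show ?thesis by (rule reduce[OF x])
 qed
 define code where "code x = (SOME c. rep x c)" for x
 have code: "rep x (code x)" if "x : ?K" for x unfolding code_def using rep_ex[OF that] by (rule someI_ex)
 show ?thesis
 proof (rule that[of "E \<rightarrow>\<^sub>E {..<p}" code])
  show "finite (E \<rightarrow>\<^sub>E {..<p})" using finE by (intro finite_PiE) auto
  have "card (E \<rightarrow>\<^sub>E {..<p}) = p ^ card E" using finE by (simp add: card_PiE)
  also have "... <= p ^ card B" using bound[OF E] prime_gt_0_nat[OF prime] by (intro power_increasing) auto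
  finally show "card (E \<rightarrow>\<^sub>E {..<p}) <= p ^ card B" .
  show "code x : E \<rightarrow>\<^sub>E {..<p}" if "x : A" "x : rat.span B" for x
  using code[of x] that unfolding rep_def by simp
  fix x y assume xy: "x : A" "y : A" "x : rat.span B" "y : rat.span B"
  show "code x = code y \<longleftrightarrow> x - y : M"
  proof
  assume eq: "code x = code y"
  have "(x - (\<Sum>e\<in>E. of_nat (code x e) * e)) - (y - (\<Sum>e\<in>E. of_nat (code x e) * e)) : M"
  by (rule M_diff) (use code[of x] code[of y] xy eq in \<open>auto simp: rep_def\<close>)
  then show "x - y : M" by simp
  next
  assume "x - y : M"
  then have "rep x c \<longleftrightarrow> rep y c" for c
  unfolding rep_def using M_add[of "x - y" "y - (\<Sum>e\<in>E. of_nat (c e) * e)"]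
  M_diff[of "x - (\<Sum>e\<in>E. of_nat (c e) * e)" "x - y"] by auto
  then have "rep x = rep y" by (rule ext)
  then show "code x = code y" unfolding code_def by simp
  qed
 qed
qed

end

section \<open>Residues of periodic orbits\<close>

lemma iterates_agree:
 assumes "finite X" "f ` X <= X"
 obtains i d where "0 < d" "!!x. x : X ==> (f ^^ (i + d)) x = (f ^^ i) x"
proof -
 have mem: "(f ^^ n) x : X" if "x : X" for n x using that assms(2) by (induction n) auto
 let ?g = "%n. restrict (f ^^ n) X"
 have "range ?g <= X \<rightarrow>\<^sub>E X" using mem by auto
 then have "finite (range ?g)" using finite_subset finite_PiE[OF assms(1), of "%_. X"] assms(1) by blast
 then have "~ inj ?g" using finite_imageD infinite_UNIV_nat by blast
 then obtain i j where ij: "i ~= j" "?g i = ?g j" unfolding inj_def by blast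
 have eq: "(f ^^ j) x = (f ^^ i) x" if "x : X" for x using fun_cong[OF ij(2), of x] that by simp
 show ?thesis
 proof (cases "i < j")
  case True
  show ?thesis by (rule that[of "j - i" i]) (use True eq in auto)
 next
  case False
  show ?thesis by (rule that[of "i - j" j]) (use False ij(1) eq in auto)
 qed
qed

lemma idempotent_power:
 assumes "finite X" "f ` X <= X"
 shows "\<exists>c>0. ALL x:X. (f ^^ c) ((f ^^ c) x) = (f ^^ c) x"
proof -
 obtain i d where d: "0 < d" "!!x. x : X ==> (f ^^ (i + d)) x = (f ^^ i) x"
  using iterates_agree[OF assms] by blast
 have step: "(f ^^ (n + d)) x = (f ^^ n) x" if "x : X" "i <= n" for n x
 proof -
  have "(f ^^ (n + d)) x = (f ^^ (n - i)) ((f ^^ (i + d)) x)"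
  using that(2) by (simp add: funpow_add[symmetric, unfolded o_def, THEN fun_cong])
  also have "... = (f ^^ (n - i)) ((f ^^ i) x)" using d(2) that(1) by simp
  also have "... = (f ^^ n) x" using that(2) by (simp add: funpow_add[symmetric, unfolded o_def, THEN fun_cong])
  finally show ?thesis .
 qed
 have mult: "(f ^^ (n + k * d)) x = (f ^^ n) x" if "x : X" "i <= n" for n k x
 proof (induction k)
  case (Suc k)
  then show ?case using step[OF that(1), of "n + k * d"] that(2) by (simp add: algebra_simps)
 qed simp
 let ?c = "(i + 1) * d"
 have "i + 1 <= ?c" using d(1) by (cases d) auto
 then have "i <= ?c" by linarith
 then have "(f ^^ ?c) ((f ^^ ?c) x) = (f ^^ ?c) x" if "x : X" for x
  using mult[OF that, of ?c "i + 1"] by (simp add: funpow_add)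
 then show ?thesis using d(1) by (intro exI[of _ ?c]) simp
qed

lemma finite_order:
 assumes "finite X" "f ` X <= X" "inj_on f X"
 shows "\<exists>N>0. ALL x:X. (f ^^ N) x = x"
proof -
 obtain i d where d: "0 < d" "!!x. x : X ==> (f ^^ (i + d)) x = (f ^^ i) x"
  using iterates_agree[OF assms(1,2)] by blast
 have mem: "(f ^^ n) x : X" if "x : X" for n x using that assms(2) by (induction n) auto
 have inj: "(f ^^ n) x = (f ^^ n) y ==> x = y" if "x : X" "y : X" for n x y
 proof (induction n)
  case (Suc n)
  then show ?case using assms(3) mem that unfolding inj_on_def by auto
 qed simp
 have *: "(f ^^ d) x = x" if "x : X" for x
  using inj[of "(f ^^ d) x" x i] mem[OF that] that d(2)[OF that] by (simp add: funpow_add)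
 then show ?thesis using d(1) by blast
qed

lemma coprime_orders:
 assumes "(\<kappa> ^^ a) x = x" "(\<kappa> ^^ b) x = x" "coprime a b" "a ~= 0"
 shows "\<kappa> x = x"
proof -
 have pow: "(\<kappa> ^^ (k * n)) x = x" if "(\<kappa> ^^ n) x = x" for k n
  using that by (induction k) (simp_all add: funpow_add)
 have "gcd a b = 1" using assms(3) by simp
 then obtain u v where "a * u = b * v + 1" using bezout_nat[OF assms(4), of b] by auto
 then have "u * a = Suc (v * b)" by (simp add: mult.commute)
 then have "\<kappa> ((\<kappa> ^^ (v * b)) x) = (\<kappa> ^^ (u * a)) x" by simp
 then show ?thesis using pow[OF assms(1), of u] pow[OF assms(2), of v] by simp
qed

type_synonym state = "nat \<times> complex list"

context valuation_ring
begin

text \<open>A pair of congruent states, with a number \<open>dl\<close> of positive valuation that divides their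
 difference, stands for the tangent vector (difference divided by \<open>dl\<close>) at their common residue;
 \<open>tangent_eq\<close> says that two pairs have the same residue and the same tangent vector.\<close>

definition divided_pair :: "complex set => complex => state => state => bool" where
 "divided_pair K dl x x' \<longleftrightarrow> dl : M & dl : K & dl ~= 0 & fst x = fst x' &
  length (snd x) = length (snd x') & (\<forall>l<length (snd x). (snd x' ! l - snd x ! l) / dl : A)"

definition tangent_eq :: "complex => state => state => complex => state => state => bool" where
 "tangent_eq dl x x' ep y y' \<longleftrightarrow> fst x = fst y & length (snd x) = length (snd y) &
  (\<forall>l<length (snd x). snd x ! l - snd y ! l : M &
  (snd x' ! l - snd x ! l) / dl - (snd y' ! l - snd y ! l) / ep : M)"

lemma tangent_eq_refl: "tangent_eq dl x x' dl x x'"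
 by (simp add: tangent_eq_def zero_M)

lemma tangent_eq_sym: "tangent_eq dl x x' ep y y' ==> tangent_eq ep y y' dl x x'"
 unfolding tangent_eq_def using M_minus by (metis minus_diff_eq)

lemma tangent_eq_trans:
 assumes "tangent_eq dl x x' ep y y'" "tangent_eq ep y y' \<zeta> z z'"
 shows "tangent_eq dl x x' \<zeta> z z'"
proof -
 have "a - c : M" if "a - b : M" "b - c : M" for a b c using M_add[OF that] by simp
 then show ?thesis using assms unfolding tangent_eq_def by metis
qed

end

locale residue_dynamics = valuation_ring +
 fixes K :: "complex set" and code :: "complex => 'r" and Good :: "state set"
  and ph :: "nat => state => state" and S :: "nat set"
 assumes K_diff: "a : K ==> b : K ==> a - b : K" and K_divide: "a : K ==> b : K ==> a / b : K"
  and p_K: "of_nat p : K"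
  and code_eq: "a : A ==> b : A ==> a : K ==> b : K ==> code a = code b \<longleftrightarrow> a - b : M"
  and finite_Good: "finite Good" and Good_AK: "x : Good ==> set (snd x) <= A \<inter> K"
  and Good_length: "x : Good ==> y : Good ==> fst x = fst y ==> length (snd x) = length (snd y)"
  and step: "s : S ==> x : Good ==> ph s x : Good"
  and tangent: "s : S ==> x : Good ==> x' : Good ==> y : Good ==> y' : Good ==>
  divided_pair K dl x x' ==> divided_pair K ep y y' ==> tangent_eq dl x x' ep y y' ==>
  divided_pair K dl (ph s x) (ph s x') & tangent_eq dl (ph s x) (ph s x') ep (ph s y) (ph s y')"
begin

abbreviation "act \<equiv> fold ph"

lemma act_Good: "set w <= S ==> x : Good ==> act w x : Good"
proof (induction w arbitrary: x)
 case (Cons s w)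
 then show ?case using Cons.IH[of "ph s x"] step[of s x] by simp
qed simp

lemma act_tangent:
 assumes "set w <= S" "x : Good" "x' : Good" "y : Good" "y' : Good"
  "divided_pair K dl x x'" "divided_pair K ep y y'" "tangent_eq dl x x' ep y y'"
 shows "divided_pair K dl (act w x) (act w x') & tangent_eq dl (act w x) (act w x') ep (act w y) (act w y')"
 using assms
proof (induction w arbitrary: x x' y y')
 case (Cons s w)
 have 1: "divided_pair K dl (ph s x) (ph s x')" "tangent_eq dl (ph s x) (ph s x') ep (ph s y) (ph s y')"
  using tangent[of s x x' y y' dl ep] Cons.prems by auto
 have 2: "divided_pair K ep (ph s y) (ph s y')"
  using tangent[of s y y' y y' ep ep] Cons.prems tangent_eq_refl by auto
 show ?case using Cons.IH[of "ph s x" "ph s x'" "ph s y" "ph s y'"] 1 2 Cons.prems step by auto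
qed simp

lemma coords: "x : Good ==> l < length (snd x) ==> snd x ! l : A & snd x ! l : K"
 using Good_AK[of x] by (meson IntD1 IntD2 nth_mem subsetD)

definition cls :: "complex => state => state => nat \<times> 'r list \<times> 'r list" where
 "cls dl x x' = (fst x, map code (snd x),
  map (%l. code ((snd x' ! l - snd x ! l) / dl)) [0..<length (snd x)])"

lemma cls_eq_iff:
 assumes "x : Good" "x' : Good" "y : Good" "y' : Good" and d: "divided_pair K dl x x'" "divided_pair K ep y y'"
 shows "cls dl x x' = cls ep y y' \<longleftrightarrow> tangent_eq dl x x' ep y y'"
proof -
 have q: "(snd x' ! l - snd x ! l) / dl : A & (snd x' ! l - snd x ! l) / dl : K" if "l < length (snd x)" for l
  using d(1) that coords[OF assms(1), of l] coords[OF assms(2), of l] K_diff K_divide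
  unfolding divided_pair_def by auto
 have q': "(snd y' ! l - snd y ! l) / ep : A & (snd y' ! l - snd y ! l) / ep : K" if "l < length (snd y)" for l
  using d(2) that coords[OF assms(3), of l] coords[OF assms(4), of l] K_diff K_divide
  unfolding divided_pair_def by auto
 show ?thesis
 proof (cases "fst x = fst y")
  case True
  then have len: "length (snd x) = length (snd y)" using Good_length assms(1,3) by blast
  have c1: "code (snd x ! l) = code (snd y ! l) \<longleftrightarrow> snd x ! l - snd y ! l : M" if l: "l < length (snd y)" for l
  using code_eq coords[OF assms(1), of l] coords[OF assms(3), of l] l len by simp
  have c2: "code ((snd x' ! l - snd x ! l) / dl) = code ((snd y' ! l - snd y ! l) / ep) \<longleftrightarrow>
  (snd x' ! l - snd x ! l) / dl - (snd y' ! l - snd y ! l) / ep : M" if l: "l < length (snd y)" for l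
  using code_eq q[of l] q'[of l] l len by simp
  have "map code (snd x) = map code (snd y) \<longleftrightarrow> (\<forall>l<length (snd y). code (snd x ! l) = code (snd y ! l))"
  using len by (simp add: list_eq_iff_nth_eq)
  then have "cls dl x x' = cls ep y y' \<longleftrightarrow> (\<forall>l<length (snd y). code (snd x ! l) = code (snd y ! l)) &
  (\<forall>l<length (snd y). code ((snd x' ! l - snd x ! l) / dl) = code ((snd y' ! l - snd y ! l) / ep))"
  unfolding cls_def using True len by (simp add: Ball_def)
  then show ?thesis unfolding tangent_eq_def using True len c1 c2 by (simp add: all_conj_distrib imp_conjR)
 qed (simp add: cls_def tangent_eq_def)
qed

definition graph :: "nat list => ((nat \<times> 'r list \<times> 'r list) \<times> nat \<times> 'r list \<times> 'r list) set" where
 "graph w = {(cls dl x x', cls dl (act w x) (act w x')) | dl x x'.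
  x : Good & x' : Good & divided_pair K dl x x'}"

lemma act_divided: "set w <= S ==> x : Good ==> x' : Good ==> divided_pair K dl x x' ==>
  divided_pair K dl (act w x) (act w x')"
 using act_tangent[of w x x' x x' dl dl] tangent_eq_refl by blast

lemma same_graph:
 assumes w: "set w <= S" "set w' <= S" "graph w = graph w'"
  and x: "x : Good" "x' : Good" "divided_pair K dl x x'"
 shows "tangent_eq dl (act w x) (act w x') dl (act w' x) (act w' x')"
proof -
 have "(cls dl x x', cls dl (act w x) (act w x')) : graph w"
  unfolding graph_def using x by blast
 then have "(cls dl x x', cls dl (act w x) (act w x')) : graph w'" using w(3) by simp
 then obtain ep y y' where y: "y : Good" "y' : Good" "divided_pair K ep y y'" "cls dl x x' = cls ep y y'"
  "cls dl (act w x) (act w x') = cls ep (act w' y) (act w' y')" unfolding graph_def by auto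
 have "tangent_eq dl x x' ep y y'" using cls_eq_iff[of x x' y y' dl ep] x y by blast
 then have "tangent_eq dl (act w' x) (act w' x') ep (act w' y) (act w' y')"
  using act_tangent[of w' x x' y y' dl ep] w x y by blast
 moreover have "tangent_eq dl (act w x) (act w x') ep (act w' y) (act w' y')"
  using cls_eq_iff[of "act w x" "act w x'" "act w' y" "act w' y'" dl ep] act_Good act_divided w x y by blast
 ultimately show ?thesis using tangent_eq_trans tangent_eq_sym by blast
qed

text \<open>A permutation of states that preserves all tangent vectors of pairs has \<open>p\<close>-power order:
 if a power of it, say \<open>k\<close>, has order \<open>m\<close> prime to \<open>p\<close>, then the differences of consecutive
 points of a \<open>k\<close>-orbit, divided by a common divisor of all differences in this orbit, are
 congruent to each other and sum up to zero over a period, hence they are all congruent to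
 zero.\<close>

lemma tangent_preserving_trivial:
 assumes X: "X <= Good" "k ` X <= X"
  and pres: "!!dl x x'. x : X ==> x' : X ==> divided_pair K dl x x' ==> tangent_eq dl (k x) (k x') dl x x'"
  and m: "~ p dvd m" "!!x. x : X ==> (k ^^ m) x = x" and x: "x : X"
 shows "k x = x"
proof (rule ccontr)
 assume ne: "k x ~= x"
 define y where "y i = (k ^^ i) x" for i
 have yX: "y i : X" for i unfolding y_def using X(2) x by (induction i) auto
 have yG: "y i : Good" for i using yX X(1) by blast
 have p0: "of_nat p ~= (0::complex)" using prime_gt_0_nat[OF prime] by simp
 have congr: "fst (k z) = fst z & length (snd (k z)) = length (snd z) & (\<forall>l<length (snd z). snd (k z) ! l - snd z ! l : M)"
  if z: "z : X" for z
 proof -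
  have "divided_pair K (of_nat p) z z" unfolding divided_pair_def using p_M p_K p0 A(1) by simp
  from pres[OF z z this] show ?thesis unfolding tangent_eq_def by auto
 qed
 define n where "n = length (snd x)"
 have y0: "y 0 = x" by (simp add: y_def)
 have ySuc: "y (Suc i) = k (y i)" for i by (simp add: y_def)
 have yfst: "fst (y i) = fst x" "length (snd (y i)) = n" for i
  by (induction i) (use congr[OF yX] in \<open>auto simp: ySuc y0 n_def\<close>)
 have ycong: "snd (y i) ! l - snd x ! l : M" if l: "l < n" for i l
 proof (induction i)
  case (Suc i)
  have "snd (y (Suc i)) ! l - snd (y i) ! l : M" using congr[OF yX[of i]] l yfst unfolding ySuc by simp
  then show ?case using M_add[OF _ Suc] by fastforce
 qed (simp add: y0 zero_M)
 have diff: "snd (y j) ! l - snd (y i) ! l : M & snd (y j) ! l - snd (y i) ! l : K" if l: "l < n" for i j l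
  using M_diff[OF ycong[OF l, of j] ycong[OF l, of i]] coords[OF yG, of l i] coords[OF yG, of l j] K_diff yfst l by simp
 define D where "D = (%(i, j, l). snd (y j) ! l - snd (y i) ! l) ` ({..m} \<times> {..m} \<times> {..<n})"
 have m0: "m ~= 0" using m(1) by (metis dvd_0_right)
 have "finite D" unfolding D_def by simp
 moreover have "D <= A" unfolding D_def using diff M_A by auto
 moreover have "EX z:D. z ~= 0"
 proof -
  have "y 1 ~= y 0" using ne by (simp add: y_def)
  then have "snd (y 1) ~= snd (y 0)" using yfst(1)[of 1] yfst(1)[of 0] by (auto simp: prod_eq_iff)
  then obtain l where l: "l < n" "snd (y 1) ! l ~= snd (y 0) ! l"
  using nth_equalityI[of "snd (y 1)" "snd (y 0)"] yfst by auto
  have "(0, 1, l) : {..m} \<times> {..m} \<times> {..<n}" using l m0 by auto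
  then have "snd (y 1) ! l - snd (y 0) ! l : D" unfolding D_def by force
  then show ?thesis using l(2) by (intro bexI[of _ "snd (y 1) ! l - snd (y 0) ! l"]) auto
 qed
 ultimately obtain dl where dl: "dl : D" "dl ~= 0" "ALL z:D. z / dl : A" using exists_common_divisor by blast
 define u where "u i j l = (snd (y j) ! l - snd (y i) ! l) / dl" for i j l
 have uA: "u i j l : A" if "i <= m" "j <= m" "l < n" for i j l
 proof -
  have "snd (y j) ! l - snd (y i) ! l : D" unfolding D_def using that by force
  then show ?thesis unfolding u_def using dl(3) by blast
 qed
 have \<delta>MK: "dl : M & dl : K" using dl(1) diff unfolding D_def by auto
 have dp: "divided_pair K dl (y i) (y j)" if "i <= m" "j <= m" for i j
  unfolding divided_pair_def using that \<delta>MK dl(2) yfst uA unfolding u_def by simp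
 have shift: "u (Suc i) (Suc (Suc i)) l - u i (Suc i) l : M" if "Suc i <= m" "l < n" for i l
  using pres[OF yX yX dp[of i "Suc i"]] that yfst unfolding tangent_eq_def u_def ySuc[symmetric] by auto
 have const: "u i (Suc i) l - u 0 1 l : M" if "i < m" "l < n" for i l
  using that
 proof (induction i)
  case (Suc i)
  then show ?case using M_add[OF shift[of i l] Suc.IH] by simp
 qed (simp add: zero_M)
 have tele: "u 0 j l = (\<Sum>i<j. u i (Suc i) l)" for j l
 proof (induction j)
  case (Suc j)
  have "u 0 (Suc j) l = u 0 j l + u j (Suc j) l" by (simp add: u_def add_divide_distrib[symmetric])
  then show ?case using Suc by simp
 qed (simp add: u_def)
 have u01: "u 0 1 l : M" if l: "l < n" for l
 proof -
  have "y m = y 0" unfolding y_def using m(2)[OF x] by simp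
  then have "0 = (\<Sum>i<m. u i (Suc i) l)" using tele[of m l] by (simp add: u_def)
  then have "- (of_nat m * u 0 1 l) = (\<Sum>i<m. u i (Suc i) l - u 0 1 l)" by (simp add: sum_subtractf)
  also have "... : M" using const l by (intro M_sum) auto
  finally have "of_nat m * u 0 1 l : M" using M_minus by fastforce
  moreover have "of_nat m ~: M" using m(1) nat_M_iff by simp
  ultimately show ?thesis using M_prime[OF A(9) uA[of 0 1 l]] m0 l by auto
 qed
 have u0: "u 0 j l : M" if "j <= m" "l < n" for j l
  unfolding tele
 proof (rule M_sum)
  fix i assume "i : {..<j}"
  then show "u i (Suc i) l : M" using M_add[OF const[of i l] u01[of l]] that by simp
 qed
 obtain i j l where ijl: "i <= m" "j <= m" "l < n" "dl = snd (y j) ! l - snd (y i) ! l"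
  using dl(1) unfolding D_def by auto
 have "1 = u i j l" using ijl(4) dl(2) by (simp add: u_def)
 also have "... = u 0 j l - u 0 i l" by (simp add: u_def diff_divide_distrib[symmetric])
 also have "... : M" using M_diff[OF u0[OF ijl(2,3)] u0[OF ijl(1,3)]] .
 finally show False using one_M by simp
qed

lemma congruent_refl: "x : Good ==> divided_pair K (of_nat p) x x"
 using p_M p_K prime_gt_0_nat[OF prime] A(1) unfolding divided_pair_def by simp

lemma tangent_preserving_inj:
 assumes x: "x : Good" "x' : Good"
  and pres: "!!dl z z'. z : {x, x'} ==> z' : {x, x'} ==> divided_pair K dl z z' ==> tangent_eq dl (k z) (k z') dl z z'"
  and eq: "k x = k x'"
 shows "x = x'"
proof (rule ccontr)
 assume ne: "x ~= x'"
 have "tangent_eq (of_nat p) (k x) (k x) (of_nat p) x x" "tangent_eq (of_nat p) (k x') (k x') (of_nat p) x' x'"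
  using pres congruent_refl x by auto
 then have f: "fst x = fst x'" "length (snd x) = length (snd x')"
  and c: "!!l. l < length (snd x) ==> snd (k x) ! l - snd x ! l : M" "!!l. l < length (snd x) ==> snd (k x) ! l - snd x' ! l : M"
  unfolding tangent_eq_def eq by auto
 have diff: "snd x' ! l - snd x ! l : M & snd x' ! l - snd x ! l : K" if l: "l < length (snd x)" for l
  using M_diff[OF c(1)[OF l] c(2)[OF l]] coords[OF x(1) l] coords[OF x(2), of l] l f K_diff by simp
 let ?D = "(%l. snd x' ! l - snd x ! l) ` {..<length (snd x)}"
 have "snd x ~= snd x'" using ne f by (auto simp: prod_eq_iff)
 then obtain l where l: "l < length (snd x)" "snd x ! l ~= snd x' ! l"
  using nth_equalityI[of "snd x" "snd x'"] f by auto
 then have "EX z:?D. z ~= 0" by (intro bexI[of _ "snd x' ! l - snd x ! l"]) auto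
 moreover have "?D <= A" using diff M_A by auto
 ultimately obtain dl where dl: "dl : ?D" "dl ~= 0" "ALL z:?D. z / dl : A"
  using exists_common_divisor[of ?D] finite_imageI[OF finite_lessThan] by blast
 then have dp: "divided_pair K dl x x'" unfolding divided_pair_def using diff f by auto
 obtain j where j: "j < length (snd x)" "dl = snd x' ! j - snd x ! j" using dl(1) by auto
 have "tangent_eq dl (k x) (k x') dl x x'" using pres dp by blast
 then have "(snd (k x') ! j - snd (k x) ! j) / dl - (snd x' ! j - snd x ! j) / dl : M"
  using j(1) unfolding tangent_eq_def by auto
 then have "- 1 : M" using eq j(2) dl(2) by simp
 then show False using M_minus[of "-1"] one_M by simp
qed

text \<open>Words with the same action on tangent vectors differ, as permutations of the orbit, by an
 element of \<open>p\<close>-power order.  The action on states need not be by permutations, but an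
 idempotent power \<open>E\<close> of the action of \<open>w'\<close> acts trivially on the orbit, and \<open>E\<close> composed with
 the quotient of \<open>w\<close> and \<open>w'\<close> permutes the image of \<open>E\<close>.\<close>

lemma quotient_p_power_order:
 assumes w: "set w <= S" "set w' <= S" "graph w = graph w'"
  and pi: "!!s x. s : S ==> x : Good ==> \<pi> (ph s x) = F s (\<pi> x)"
  and inj: "!!s. s : S ==> inj_on (F s) (\<pi> ` Good)"
 shows "EX e. ALL y:\<pi> ` Good. ((%y. fold F w (inv_into (\<pi> ` Good) (fold F w') y)) ^^ (p ^ e)) y = y"
proof -
 let ?O = "\<pi> ` Good"
 have pi_act: "\<pi> (act v x) = fold F v (\<pi> x)" if "set v <= S" "x : Good" for v x
  using that
 proof (induction v arbitrary: x)
  case (Cons s v)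
  then show ?case using Cons.IH[of "ph s x"] pi step by simp
 qed simp
 have F_O: "fold F v y : ?O" if "set v <= S" "y : ?O" for v y
  using that pi_act[of v] act_Good[of v] by (metis (no_types, lifting) image_iff)
 have F_inj: "inj_on (fold F v) ?O" if "set v <= S" for v
  using that
 proof (induction v)
  case (Cons s v)
  have "F s y : ?O" if "y : ?O" for y using F_O[of "[s]" y] Cons.prems that by simp
  then have "F s ` ?O <= ?O" by blast
  then have "inj_on (fold F v \<circ> F s) ?O" using Cons inj by (intro comp_inj_on) (auto intro: inj_on_subset)
  then show ?case by (simp add: comp_def)
 qed simp
 define W where "W = act w'"
 have W_Good: "W x : Good" if "x : Good" for x unfolding W_def using act_Good w(2) that by blast
 have "W ` Good <= Good" using W_Good by blast
 from idempotent_power[OF finite_Good this]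
 obtain c where c: "0 < c" "!!x. x : Good ==> (W ^^ c) ((W ^^ c) x) = (W ^^ c) x" by blast
 have Wn_Good: "(W ^^ n) x : Good" if "x : Good" for n x using that by (induction n) (auto intro: W_Good)
 have Wn_pi: "\<pi> ((W ^^ n) x) = (fold F w' ^^ n) (\<pi> x)" if "x : Good" for n x
 proof (induction n)
  case (Suc n)
  then show ?case using pi_act[OF w(2) Wn_Good[OF that, of n]] by (simp add: W_def)
 qed simp
 have Wn_tangent: "divided_pair K dl ((W ^^ n) x) ((W ^^ n) x') & tangent_eq dl ((W ^^ n) x) ((W ^^ n) x') ep ((W ^^ n) y) ((W ^^ n) y')"
  if "x : Good" "x' : Good" "y : Good" "y' : Good" "divided_pair K dl x x'" "divided_pair K ep y y'" "tangent_eq dl x x' ep y y'"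
  for n x x' y y' dl ep
 proof -
  have "W ^^ n = act (concat (replicate n w'))"
  proof (induction n)
  case 0
  show ?case by (simp add: fun_eq_iff)
  next
  case (Suc n)
  show ?case unfolding funpow_Suc_right Suc by (rule ext) (simp add: W_def)
  qed
  moreover have "set (concat (replicate n w')) <= S" using w(2) by auto
  ultimately show ?thesis using act_tangent[of "concat (replicate n w')" x x' y y' dl ep] that by simp
 qed
 define E where "E = W ^^ c"
 define k where "k x = E (act w ((W ^^ (c - 1)) x))" for x
 have E_Good: "E x : Good" if "x : Good" for x unfolding E_def using Wn_Good that by blast
 have EE: "E (E x) = E x" if "x : Good" for x unfolding E_def using c(2) that by blast
 have k_Good: "k x : E ` Good" if "x : Good" for x
  unfolding k_def using act_Good[OF w(1) Wn_Good[OF that]] by blast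
 let ?X = "E ` Good"
 have XG: "?X <= Good" using E_Good by blast
 have kX: "k ` ?X <= ?X" using k_Good XG by blast
 have k_pres: "tangent_eq dl (k x) (k x') dl x x'" if x: "x : ?X" "x' : ?X" "divided_pair K dl x x'" for dl x x'
 proof -
  have G: "x : Good" "x' : Good" using x XG by auto
  have Ex: "E x = x" "E x' = x'" using x EE by auto
  let ?z = "(W ^^ (c - 1)) x" and ?z' = "(W ^^ (c - 1)) x'"
  have z: "?z : Good" "?z' : Good" "divided_pair K dl ?z ?z'"
  using Wn_Good G Wn_tangent[OF G G x(3) x(3) tangent_eq_refl] by auto
  have Wz: "W ?z = E x" "W ?z' = E x'" unfolding E_def using c(1) by (cases c; simp)+
  have t: "tangent_eq dl (act w ?z) (act w ?z') dl (W ?z) (W ?z')"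
  unfolding W_def by (rule same_graph[OF w z, unfolded W_def])
  then have t': "tangent_eq dl (act w ?z) (act w ?z') dl x x'" unfolding Wz Ex .
  have "tangent_eq dl ((W ^^ c) (act w ?z)) ((W ^^ c) (act w ?z')) dl ((W ^^ c) x) ((W ^^ c) x')"
  using Wn_tangent[OF act_Good[OF w(1) z(1)] act_Good[OF w(1) z(2)] G act_divided[OF w(1) z] x(3) t'] by blast
  then show ?thesis unfolding k_def using Ex unfolding E_def by simp
 qed
 have k_inj: "inj_on k ?X"
 proof (rule inj_onI)
  fix x x' assume x: "x : ?X" "x' : ?X" "k x = k x'"
  show "x = x'"
  proof (rule tangent_preserving_inj[of x x' k])
  show "x : Good" "x' : Good" using x XG by blast+
  show "tangent_eq dl (k z) (k z') dl z z'" if "z : {x, x'}" "z' : {x, x'}" "divided_pair K dl z z'" for dl z z'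
  proof (rule k_pres[OF _ _ that(3)])
  show "z : ?X" "z' : ?X" using that(1,2) x(1,2) by blast+
  qed
  qed (rule x(3))
 qed
 obtain N where N: "0 < N" "!!x. x : ?X ==> (k ^^ N) x = x"
  using finite_order[OF finite_imageI[OF finite_Good] kX k_inj] by blast
 obtain e m where em: "N = p ^ e * m" "~ p dvd m"
  using multiplicity_decompose'[of N p] N(1) prime not_prime_unit[of p] by (metis neq0_conv)
 define k1 where "k1 = k ^^ (p ^ e)"
 have kn: "(k ^^ n) x : ?X" if "x : ?X" for n x using that kX by (induction n) auto
 have kn_pres: "tangent_eq dl ((k ^^ n) x) ((k ^^ n) x') dl x x' & divided_pair K dl ((k ^^ n) x) ((k ^^ n) x')"
  if x: "x : ?X" "x' : ?X" "divided_pair K dl x x'" for n dl x x'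
 proof (induction n)
  case 0
  then show ?case using x(3) tangent_eq_refl by simp
 next
  case (Suc n)
  let ?z = "(k ^^ n) x" and ?z' = "(k ^^ n) x'"
  have z: "?z : ?X" "?z' : ?X" "?z : Good" "?z' : Good" using kn x XG by blast+
  have "divided_pair K dl (k ?z) (k ?z')"
  proof -
  note W1 = Wn_tangent[OF z(3,4) z(3,4) _ _ tangent_eq_refl, of dl "c - 1"]
  have d1: "divided_pair K dl ((W ^^ (c - 1)) ?z) ((W ^^ (c - 1)) ?z')" using W1 Suc by blast
  have d2: "divided_pair K dl (act w ((W ^^ (c - 1)) ?z)) (act w ((W ^^ (c - 1)) ?z'))"
  by (rule act_divided[OF w(1) Wn_Good[OF z(3)] Wn_Good[OF z(4)] d1])
  have keq: "k u = (W ^^ c) (act w ((W ^^ (c - 1)) u))" for u unfolding k_def E_def by (rule refl)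
  show ?thesis unfolding keq[of ?z] keq[of ?z']
  using Wn_tangent[OF act_Good[OF w(1) Wn_Good[OF z(3)]] act_Good[OF w(1) Wn_Good[OF z(4)]]
  act_Good[OF w(1) Wn_Good[OF z(3)]] act_Good[OF w(1) Wn_Good[OF z(4)]] d2 d2 tangent_eq_refl] by blast
  qed
  moreover have "tangent_eq dl (k ?z) (k ?z') dl ?z ?z'" using k_pres z Suc by blast
  ultimately show ?case using Suc tangent_eq_trans[of dl "k ?z" "k ?z'" dl ?z ?z' dl x x'] by simp
 qed
 have k1_id: "k1 x = x" if x: "x : ?X" for x
 proof (rule tangent_preserving_trivial[OF XG _ _ em(2) _ x])
  show "k1 ` ?X <= ?X" unfolding k1_def using kn by blast
  show "tangent_eq dl (k1 x) (k1 x') dl x x'" if "x : ?X" "x' : ?X" "divided_pair K dl x x'" for dl x x'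
  unfolding k1_def using kn_pres that by blast
  show "(k1 ^^ m) x = x" if "x : ?X" for x
  unfolding k1_def funpow_mult using N(2)[OF that] em(1) by simp
 qed
 have Fc: "(fold F w' ^^ c) y = y" if y: "y : ?O" for y
 proof -
  obtain x where x: "x : Good" "y = \<pi> x" using y by blast
  have eq: "(fold F w' ^^ c) ((fold F w' ^^ c) y) = (fold F w' ^^ c) y"
  using Wn_pi[OF x(1), of c] Wn_pi[OF Wn_Good[OF x(1)], of c c] c(2)[OF x(1)] x(2) by simp
  have Fn: "(fold F w' ^^ n) z : ?O" if "z : ?O" for z n
  using that by (induction n) (simp_all add: F_O[OF w(2)])
  have injc: "a = b" if "(fold F w' ^^ n) a = (fold F w' ^^ n) b" "a : ?O" "b : ?O" for n a b
  using that
  proof (induction n)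
  case (Suc n)
  have "(fold F w' ^^ n) a = (fold F w' ^^ n) b"
  using Suc.prems by (intro inj_onD[OF F_inj[OF w(2)] _ Fn Fn]) simp_all
  then show ?case using Suc.IH Suc.prems by blast
  qed simp
  have "(fold F w' ^^ c) y : ?O" using Wn_pi[OF x(1), of c] Wn_Good[OF x(1), of c] x(2) by (metis imageI)
  then show ?thesis using injc[OF eq] y by blast
 qed
 let ?\<kappa> = "%y. fold F w (inv_into ?O (fold F w') y)"
 have inv: "inv_into ?O (fold F w') y = (fold F w' ^^ (c - 1)) y" if y: "y : ?O" for y
 proof (rule inv_into_f_eq[OF F_inj[OF w(2)]])
  obtain x where x: "x : Good" "y = \<pi> x" using y by blast
  show "(fold F w' ^^ (c - 1)) y : ?O"
  using Wn_pi[OF x(1), of "c - 1"] Wn_Good[OF x(1), of "c - 1"] x(2) by (metis imageI)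
  have "fold F w' ((fold F w' ^^ (c - 1)) y) = (fold F w' ^^ c) y" using c(1) by (cases c) simp_all
  then show "fold F w' ((fold F w' ^^ (c - 1)) y) = y" using Fc[OF y] by simp
 qed
 have pi_E: "\<pi> (E x) = \<pi> x" if "x : Good" for x
  using Wn_pi[OF that, of c] Fc[of "\<pi> x"] that unfolding E_def by simp
 have pi_k: "\<pi> (k x) = ?\<kappa> (\<pi> x)" if x: "x : Good" for x
 proof -
  have "\<pi> (k x) = fold F w (\<pi> ((W ^^ (c - 1)) x))"
  unfolding k_def using pi_E[OF act_Good[OF w(1) Wn_Good[OF x]]] pi_act[OF w(1) Wn_Good[OF x]] by simp
  then show ?thesis using inv[of "\<pi> x"] Wn_pi[OF x, of "c - 1"] x by simp
 qed
 have pi_kn: "\<pi> ((k ^^ n) x) = (?\<kappa> ^^ n) (\<pi> x)" if x: "x : ?X" for n x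
 proof (induction n)
  case (Suc n)
  then show ?case using pi_k[of "(k ^^ n) x"] kn[OF x, of n] XG by auto
 qed simp
 have "(?\<kappa> ^^ (p ^ e)) y = y" if y: "y : ?O" for y
 proof -
  obtain x where x: "x : Good" "y = \<pi> x" using y by blast
  have "(?\<kappa> ^^ (p ^ e)) (\<pi> (E x)) = \<pi> (E x)"
  using pi_kn[of "E x" "p ^ e"] k1_id[of "E x"] x(1) unfolding k1_def by simp
  then show ?thesis using pi_E x by simp
 qed
 then show ?thesis by blast
qed

text \<open>The number of tangent classes, hence of their self-relations, is bounded in terms of the
 number of residues.\<close>

lemma card_graphs:
 assumes c: "!!x. x : Good ==> fst x < c & length (snd x) <= d"
  and R: "finite R" "!!a. a : A ==> a : K ==> code a : R"
 shows "finite (graph ` {w. set w <= S}) &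
  card (graph ` {w. set w <= S}) <= 2 ^ ((c * ((card R + 1) ^ d) ^ 2) ^ 2)"
proof -
 define L where "L = {xs. set xs <= R & length xs <= d}"
 define T where "T = {..<c} \<times> L \<times> L"
 have finL: "finite L" unfolding L_def by (rule finite_lists_length_le[OF R(1)])
 have "(\<Sum>i\<le>n. r ^ i) <= (r + 1) ^ n" for r n :: nat
 proof (induction n)
  case (Suc n)
  have "r ^ n <= (r + 1) ^ n" by (rule power_mono) auto
  then have "r * r ^ n <= r * (r + 1) ^ n" by (rule mult_le_mono2)
  from add_mono[OF Suc this] show ?case by simp
 qed simp
 then have cardL: "card L <= (card R + 1) ^ d" unfolding L_def card_lists_length_le[OF R(1)] .
 have cls_T: "cls dl x x' : T" if x: "x : Good" "x' : Good" "divided_pair K dl x x'" for dl x x'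
 proof -
  have 1: "code (snd x ! l) : R" if "l < length (snd x)" for l using R(2) coords[OF x(1) that] by blast
  have 2: "code ((snd x' ! l - snd x ! l) / dl) : R" if l: "l < length (snd x)" for l
  using x(3) coords[OF x(1) l] coords[OF x(2), of l] l K_diff K_divide unfolding divided_pair_def
  by (intro R(2)) auto
  have "map code (snd x) : L" unfolding L_def using 1 c[OF x(1)] by (auto simp: in_set_conv_nth)
  moreover have "map (%l. code ((snd x' ! l - snd x ! l) / dl)) [0..<length (snd x)] : L"
  unfolding L_def using 2 c[OF x(1)] by auto
  ultimately show ?thesis unfolding T_def cls_def using c[OF x(1)] by simp
 qed
 have sub: "graph ` {w. set w <= S} <= Pow (T \<times> T)"
 proof (intro subsetI PowI, elim imageE)
  fix G w t assume "G = graph w" "w : {w. set w <= S}" "t : G"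
  then obtain dl x x' where "t = (cls dl x x', cls dl (act w x) (act w x'))" "x : Good" "x' : Good"
  "divided_pair K dl x x'" "set w <= S" unfolding graph_def by auto
  then show "t : T \<times> T" using cls_T[of x x' dl] cls_T[of "act w x" "act w x'" dl] act_Good act_divided by simp
 qed
 have finT: "finite T" unfolding T_def using finL by simp
 then have finP: "finite (Pow (T \<times> T))" by simp
 have "card (graph ` {w. set w <= S}) <= card (Pow (T \<times> T))" by (rule card_mono[OF finP sub])
 also have "... = 2 ^ (card T ^ 2)" using finT by (simp add: card_Pow card_cartesian_product power2_eq_square)
 also have "card T = c * card L ^ 2" unfolding T_def by (simp add: card_cartesian_product power2_eq_square)
 also have "(2::nat) ^ ((c * card L ^ 2) ^ 2) <= 2 ^ ((c * ((card R + 1) ^ d) ^ 2) ^ 2)"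
  using cardL by (intro power_increasing power_mono mult_le_mono) auto
 finally show ?thesis using finite_subset[OF sub finP] by blast
qed

end

text \<open>Two primes together: a permutation whose order is a power of both is trivial, so that a
 point of the orbit is determined by the graphs, for both primes, of a word that leads to it.\<close>

lemma orbit_bound_two_primes:
 assumes D1: "residue_dynamics A p K code G ph S" and D2: "residue_dynamics A' q K code' G' ph' S" and pq: "p ~= q"
  and pi1: "!!s x. s : S ==> x : G ==> \<pi> (ph s x) = F s (\<pi> x)" and O1: "\<pi> ` G = Orb"
  and pi2: "!!s x. s : S ==> x : G' ==> \<pi>' (ph' s x) = F s (\<pi>' x)" and O2: "\<pi>' ` G' = Orb"
  and inj: "!!s. s : S ==> inj_on (F s) Orb"
  and x0: "x0 : Orb" and reach: "!!y. y : Orb ==> EX w. set w <= S & fold F w x0 = y"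
  and g1: "finite (residue_dynamics.graph A K code G ph ` {w. set w <= S})"
  "card (residue_dynamics.graph A K code G ph ` {w. set w <= S}) <= N1"
  and g2: "finite (residue_dynamics.graph A' K code' G' ph' ` {w. set w <= S})"
  "card (residue_dynamics.graph A' K code' G' ph' ` {w. set w <= S}) <= N2"
 shows "card Orb <= N1 * N2"
proof -
 interpret D1: residue_dynamics A p K code G ph S by (rule D1)
 interpret D2: residue_dynamics A' q K code' G' ph' S by (rule D2)
 let ?W = "{w. set w <= S}"
 obtain w where w: "!!y. y : Orb ==> set (w y) <= S & fold F (w y) x0 = y" using reach by metis
 have F_O: "F s y : Orb" if s: "s : S" and y: "y : Orb" for s y
 proof -
  obtain x where x: "x : G" "y = \<pi> x" using y O1 by blast
  then have "F s y = \<pi> (ph s x)" using pi1 s by simp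
  then show ?thesis using D1.step[OF s x(1)] O1 by blast
 qed
 have Fw_O: "fold F v y : Orb" if "set v <= S" "y : Orb" for v y
  using that by (induction v arbitrary: y) (auto intro: F_O)
 have F_inj: "inj_on (fold F v) Orb" if "set v <= S" for v
  using that
 proof (induction v)
  case (Cons s v)
  have "F s ` Orb <= Orb" using F_O Cons.prems by auto
  then have "inj_on (fold F v \<circ> F s) Orb" using Cons inj by (intro comp_inj_on) (auto intro: inj_on_subset)
  then show ?case by (simp add: comp_def)
 qed simp
 have "inj_on (%y. (D1.graph (w y), D2.graph (w y))) Orb"
 proof (rule inj_onI)
  fix y y' assume y: "y : Orb" "y' : Orb" "(D1.graph (w y), D2.graph (w y)) = (D1.graph (w y'), D2.graph (w y'))"
  define \<kappa> where "\<kappa> = (%z. fold F (w y) (inv_into Orb (fold F (w y')) z))"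
  obtain e1 where e1: "ALL z:Orb. (\<kappa> ^^ (p ^ e1)) z = z"
  using D1.quotient_p_power_order[of "w y" "w y'" \<pi> F] w y pi1 inj unfolding \<kappa>_def O1 by auto
  obtain e2 where e2: "ALL z:Orb. (\<kappa> ^^ (q ^ e2)) z = z"
  using D2.quotient_p_power_order[of "w y" "w y'" \<pi>' F] w y pi2 inj unfolding \<kappa>_def O2 by auto
  have "coprime (p ^ e1) (q ^ e2)" using primes_coprime[OF D1.prime D2.prime pq] by simp
  moreover have "p ^ e1 ~= 0" using prime_gt_0_nat[OF D1.prime] by simp
  moreover have "(\<kappa> ^^ (p ^ e1)) y' = y'" "(\<kappa> ^^ (q ^ e2)) y' = y'" using e1 e2 y(2) by auto
  ultimately have "\<kappa> y' = y'" by (intro coprime_orders[of "p ^ e1" \<kappa> y' "q ^ e2"])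
  moreover have "inv_into Orb (fold F (w y')) y' = x0"
  using inv_into_f_f[OF F_inj x0, of "w y'"] w[OF y(2)] by simp
  ultimately show "y = y'" unfolding \<kappa>_def using w[OF y(1)] by simp
 qed
 moreover have "(%y. (D1.graph (w y), D2.graph (w y))) ` Orb <= (D1.graph ` ?W) \<times> (D2.graph ` ?W)"
  using w by auto
 ultimately have "card Orb <= card ((D1.graph ` ?W) \<times> (D2.graph ` ?W))"
  using g1(1) g2(1) by (intro card_inj_on_le[of "%y. (D1.graph (w y), D2.graph (w y))"]) auto
 also have "... <= N1 * N2" using g1(2) g2(2) by (simp add: card_cartesian_product mult_le_mono)
 finally show ?thesis .
qed

section \<open>Codes for numbers in a number field\<close>

text \<open>A pair \<open>(a, n)\<close> of type \<open>kc\<close> stands for the expression \<open>a\<close> in \<open>th\<close>, divided by \<open>n + 1\<close>; the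
 shift makes every pair a code.  A polynomial \<open>f\<close> of type \<open>fcert\<close> consists of its degree, its leading
 coefficient and the terms of lower degree.  The operations are defined with \<open>fold\<close>, \<open>map\<close>, \<open>concat\<close>
 and \<open>filter\<close> because these are the constructions known to be computable.\<close>

type_synonym iterms = "(int \<times> nat) list"
type_synonym kc = "iterms \<times> nat"
type_synonym fcert = "nat \<times> int \<times> iterms"

definition iscale :: "int => iterms => iterms" where
 "iscale c a = map (%t. (c * fst t, snd t)) a"
definition pmul :: "iterms => iterms => iterms" where
 "pmul a b = concat (map (%t. map (%u. (fst t * fst u, snd t + snd u)) b) a)"
definition icoeff :: "iterms => nat => int" where
 "icoeff a e = fold (%t s. fst t + s) (filter (%t. snd t = e) a) 0"
definition izero :: "iterms => bool" where
 "izero a \<longleftrightarrow> (ALL t:set a. icoeff a (snd t) = 0)"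
definition kadd :: "kc => kc => kc" where
 "kadd x y = (iscale (int (snd y) + 1) (fst x) @ iscale (int (snd x) + 1) (fst y),
  snd x * snd y + snd x + snd y)"
definition kmul :: "kc => kc => kc" where
 "kmul x y = (pmul (fst x) (fst y), snd x * snd y + snd x + snd y)"
definition kneg :: "kc => kc" where "kneg x = (iscale (-1) (fst x), snd x)"
definition kint :: "int => kc" where "kint i = ([(i, 0)], 0)"
definition kpow :: "kc => nat => kc" where "kpow x n = ((%y. kmul x y) ^^ n) (kint 1)"
definition fterms :: "fcert => iterms" where "fterms f = (fst (snd f), fst f) # snd (snd f)"
text \<open>The number is zero because an integral multiple of its numerator is a multiple of \<open>f\<close>.\<close>

definition kzero :: "fcert => kc => bool" where
 "kzero f x \<longleftrightarrow> (EX E Q. E ~= 0 & izero (iscale E (fst x) @ pmul Q (fterms f)))"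

type_synonym kpoly = "(kc \<times> nat list) list"

definition kmon :: "kc list => nat list => kc" where
 "kmon a e = fold (%z s. kmul (kpow (fst z) (snd z)) s) (zip a e) (kint 1)"
definition keval :: "kpoly => kc list => kc" where
 "keval P a = fold (%t s. kadd (kmul (fst t) (kmon a (snd t))) s) P (kint 0)"
definition kcoeff :: "kpoly => nat list => kc" where
 "kcoeff P e = fold (%t s. kadd (fst t) s) (filter (%t. snd t = e) P) (kint 0)"
definition eadd :: "nat list => nat list => nat list" where
 "eadd e k = map (%z. fst z + snd z) (zip e k)"
definition ktmul :: "kpoly => kpoly => kpoly" where
 "ktmul P Q = concat (map (%t. map (%u. (kmul (fst t) (fst u), eadd (snd t) (snd u))) Q) P)"
text \<open>The coefficients of the sum of products, minus one, vanish.  The test for zero is a parameter: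
 it is \<open>kzero f\<close> in a search and vanishing of the value in the arguments for completeness.\<close>

definition kunit_cert :: "(kc => bool) => nat => (kpoly \<times> kpoly) list => bool" where
 "kunit_cert Z n zs \<longleftrightarrow> (ALL z:set zs. (ALL t:set (fst z). length (snd t) = n) & (ALL t:set (snd z). length (snd t) = n)) &
  (ALL t:set ((kint (-1), replicate n 0) # concat (map (%z. ktmul (fst z) (snd z)) zs)).
  Z (kcoeff ((kint (-1), replicate n 0) # concat (map (%z. ktmul (fst z) (snd z)) zs)) (snd t)))"
definition kunit :: "(kc => bool) => nat => kpoly list => bool" where
 "kunit Z n gs \<longleftrightarrow> (EX zs. map snd zs = gs & kunit_cert Z n zs)"
definition kapart :: "nat => kpoly list => kc list => kpoly list" where
 "kapart m G a = map (%z. (kneg (snd z), replicate m 0) # fst z) (zip G a)"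

type_synonym kchart = "nat \<times> kpoly list"
type_synonym koverlap = "kchart \<times> kpoly list \<times> kpoly list"
type_synonym kpiece = "kpoly \<times> nat \<times> kpoly list"
type_synonym kproblem = "kchart list \<times> koverlap list list \<times> kpiece list list list \<times> nat \<times> kc list"
type_synonym kstate = "nat \<times> kc list"

abbreviation kCs :: "kproblem => kchart list" where "kCs d \<equiv> fst d"
abbreviation kOs :: "kproblem => koverlap list list" where "kOs d \<equiv> fst (snd d)"
abbreviation kFs :: "kproblem => kpiece list list list" where "kFs d \<equiv> fst (snd (snd d))"
abbreviation kstart :: "kproblem => kstate" where "kstart d \<equiv> snd (snd (snd d))"

definition nth_rel :: "'a list => nat => 'a => bool" where
 "nth_rel xs i y \<longleftrightarrow> i < length xs & xs ! i = y"
text \<open>That a number is not zero has to be certified positively, by its inverse, since \<open>Z\<close> is only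
 enumerable.\<close>

definition knz :: "(kc => bool) => kc => bool" where
 "knz Z x \<longleftrightarrow> (EX v. Z (kadd (kmul x v) (kint (-1))))"
definition kstep :: "(kc => bool) => kproblem => nat => kstate => kstate => bool" where
 "kstep Z d s x y \<longleftrightarrow> (EX Ps Qs. nth_rel (kFs d) s Ps & nth_rel Ps (fst x) Qs &
  (EX q:set Qs. knz Z (keval (fst q) (snd x)) & fst y = fst (snd q) &
  list_all2 (%g b. Z (kadd (kmul (keval (fst q) (snd x)) b) (kneg (keval g (snd x)))))
  (snd (snd q)) (snd y)))"
text \<open>The witness \<open>z\<close> is a point of the overlap with both coordinates.\<close>

definition kEq :: "(kc => bool) => kproblem => kstate => kstate => bool" where
 "kEq Z d x y \<longleftrightarrow> (EX Rs R z. nth_rel (kOs d) (fst x) Rs & nth_rel Rs (fst y) R &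
  length z = fst (fst R) & (ALL g:set (snd (fst R)). Z (keval g z)) &
  list_all2 (%g a. Z (kadd (keval g z) (kneg a))) (fst (snd R)) (snd x) &
  list_all2 (%g a. Z (kadd (keval g z) (kneg a))) (snd (snd R)) (snd y))"
text \<open>No point of the overlap has both coordinates.\<close>

definition kNeq :: "(kc => bool) => kproblem => kstate => kstate => bool" where
 "kNeq Z d x y \<longleftrightarrow> (EX Rs R. nth_rel (kOs d) (fst x) Rs & nth_rel Rs (fst y) R &
  kunit Z (fst (fst R)) (snd (fst R) @ kapart (fst (fst R)) (fst (snd R)) (snd x) @
  kapart (fst (fst R)) (snd (snd R)) (snd y)))"
definition kreach :: "(kc => bool) => kproblem => kstate => bool" where
 "kreach Z d y \<longleftrightarrow> y = kstart d \<or>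
  (EX q. list_all2 (%u v. EX s. kstep Z d s u v) (kstart d # q) (q @ [y]))"
definition kper :: "(kc => bool) => kproblem => bool" where
 "kper Z d \<longleftrightarrow> (EX L. kstart d : set L &
  (ALL s:set [0..<length (kFs d)]. ALL x:set L. (EX y:set L. kstep Z d s x y) &
  (ALL x':set L. kEq Z d x x' \<or> (EX y y'. kstep Z d s x y & kstep Z d s x' y' & kNeq Z d y y'))))"
definition kfold :: "(kc => bool) => kproblem => bool" where
 "kfold Z d \<longleftrightarrow> (EX s x x' y y'. kreach Z d x & kreach Z d x' & kstep Z d s x y & kstep Z d s x' y' &
  kNeq Z d x x' & kEq Z d y y')"
definition kmany :: "(kc => bool) => kproblem => nat => bool" where
 "kmany Z d m \<longleftrightarrow> (EX L. m < length L & (ALL x:set L. kreach Z d x) &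
  (ALL z:set (zip [0..<length L] L). ALL z':set (zip [0..<length L] L). fst z = fst z' \<or> kNeq Z d (snd z) (snd z')))"

definition divides_denominators :: "nat => kpoly => bool" where
 "divides_denominators N P \<longleftrightarrow> (ALL t:set P. EX k. N = k * (snd (fst t) + 1))"
text \<open>Here \<open>N + 1\<close> and \<open>N * N + N + 1\<close> are prime to \<open>N\<close> and to each other, so that different prime
 factors of them are two primes of good reduction, both at most \<open>N * N + N + 1\<close>.  A number field of
 degree \<open>n\<close> has at most \<open>p ^ n\<close> residues at \<open>p\<close>, and an orbit in \<open>c\<close> charts of dimension at most \<open>m\<close>
 has at most \<open>c * ((p ^ n + 1) ^ m) ^ 2\<close> tangent vectors modulo \<open>p\<close>.  The exponential
 counts relations between them.\<close>

definition orbit_bound :: "nat => nat => nat => nat => nat" where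
 "orbit_bound N n c m = (2 ^ ((c * (((N * N + N + 1) ^ n + 1) ^ m) ^ 2) ^ 2)) ^ 2"
text \<open>The number \<open>N\<close> is a multiple of all denominators, including those of certificates that the
 pieces cover the charts, and of the leading coefficient of \<open>f\<close>, so that \<open>th\<close> is integral at the primes
 that do not divide \<open>N\<close>.\<close>

definition kbound :: "fcert => kproblem => nat => bool" where
 "kbound f d B \<longleftrightarrow> (EX N m. 0 < N & (EX k. int N = k * fst (snd f)) &
  (ALL C:set (kCs d). fst C <= m) & orbit_bound N (fst f) (length (kCs d)) m <= B &
  (ALL a:set (snd (kstart d)). EX k. N = k * (snd a + 1)) &
  (ALL Ps:set (kFs d). ALL Qs:set Ps. ALL q:set Qs. divides_denominators N (fst q) &
  (ALL g:set (snd (snd q)). divides_denominators N g)) &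
  (ALL Ps:set (kFs d). ALL z:set (zip (kCs d) Ps). EX zs. map snd zs = snd (fst z) @ map fst (snd z) &
  kunit_cert (kzero f) (fst (fst z)) zs & (ALL y:set zs. divides_denominators N (fst y))))"

section \<open>The conditions are recursively enumerable\<close>

lemma cf_upt: "cf n ==> cf (%x. [0..<n x])"
proof -
 assume n: "cf n"
 have "cf (%x. rev (((%xs. length xs # xs) ^^ n x) []))"
  by (intro cf_rev cf_funpow cf_cons cf_length n cf_snd cf_id cf_const)
 moreover have "((%xs. length xs # xs) ^^ k) [] = rev [0..<k]" for k by (induction k) auto
 ultimately show ?thesis by simp
qed

lemma cf_int_plus: "cf f ==> cf g ==> cf (%x. f x + g x :: int)" by (rule cf_int_ops(1))
lemma cf_int_times: "cf f ==> cf g ==> cf (%x. f x * g x :: int)" by (rule cf_int_ops(2))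
lemma cf_int_neg: "cf f ==> cf (%x. - f x :: int)" by (rule cf_int_ops(3)[OF _ cf_const[of 0]])

lemmas cfs = cf_id cf_const cf_fst cf_snd cf_pair cf_cons cf_append cf_concat cf_map cf_filter
 cf_fold cf_zip cf_replicate cf_length cf_rev cf_add cf_mult cf_Suc cf_int cf_nat cf_power cf_upt
 cf_int_plus cf_int_times cf_int_neg cf_funpow dc_eq

lemma cf2: "cf (%z. F (fst z) (snd z)) ==> cf f ==> cf g ==> cf (%x. F (f x) (g x))"
 by (rule cf_comp2)

lemma cf_iscale: "cf f ==> cf g ==> cf (%x. iscale (f x) (g x))"
 by (rule cf2) (unfold iscale_def, intro cfs)
lemma cf_pmul: "cf f ==> cf g ==> cf (%x. pmul (f x) (g x))"
 by (rule cf2) (unfold pmul_def, intro cfs)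
lemma cf_icoeff: "cf f ==> cf g ==> cf (%x. icoeff (f x) (g x))"
 by (rule cf2) (unfold icoeff_def, intro cfs)
lemma dc_izero: "cf f ==> dc (%x. izero (f x))"
 by (rule dc_comp[of izero]) (unfold izero_def, intro dc_ball cf_icoeff cfs)
lemma cf_kadd: "cf f ==> cf g ==> cf (%x. kadd (f x) (g x))"
 by (rule cf2) (unfold kadd_def, intro cf_iscale cfs)
lemma cf_kmul: "cf f ==> cf g ==> cf (%x. kmul (f x) (g x))"
 by (rule cf2) (unfold kmul_def, intro cf_pmul cfs)
lemma cf_kneg: "cf f ==> cf (%x. kneg (f x))"
 by (rule cf_comp[of kneg]) (unfold kneg_def, intro cf_iscale cfs)
lemma cf_kint: "cf f ==> cf (%x. kint (f x))"
 by (rule cf_comp[of kint]) (unfold kint_def, intro cfs)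
lemma cf_kpow: "cf f ==> cf g ==> cf (%x. kpow (f x) (g x))"
 by (rule cf2) (unfold kpow_def, intro cf_kmul cfs)
lemma cf_kmon: "cf f ==> cf g ==> cf (%x. kmon (f x) (g x))"
 by (rule cf2) (unfold kmon_def, intro cf_kmul cf_kpow cfs)
lemma cf_keval: "cf f ==> cf g ==> cf (%x. keval (f x) (g x))"
 by (rule cf2) (unfold keval_def, intro cf_kadd cf_kmul cf_kmon cfs)
lemma cf_kcoeff: "cf f ==> cf g ==> cf (%x. kcoeff (f x) (g x))"
 by (rule cf2) (unfold kcoeff_def, intro cf_kadd cfs)
lemma cf_eadd: "cf f ==> cf g ==> cf (%x. eadd (f x) (g x))"
 by (rule cf2) (unfold eadd_def, intro cfs)
lemma cf_ktmul: "cf f ==> cf g ==> cf (%x. ktmul (f x) (g x))"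
 by (rule cf2) (unfold ktmul_def, intro cf_kmul cf_eadd cfs)
lemma cf_fterms: "cf f ==> cf (%x. fterms (f x))"
 by (rule cf_comp[of fterms]) (unfold fterms_def, intro cfs)
lemma cf3:
 assumes "cf (%z. F (fst z) (fst (snd z)) (snd (snd z)))" "cf f" "cf g" "cf h"
 shows "cf (%x. F (f x) (g x) (h x))"
 using cf_comp[OF assms(1) cf_pair[OF assms(2) cf_pair[OF assms(3,4)]]] by simp
lemma cf_kapart: "cf m ==> cf f ==> cf g ==> cf (%x. kapart (m x) (f x) (g x))"
 by (rule cf3) (unfold kapart_def, intro cf_kneg cfs)

lemmas kcfs = cf_kadd cf_kmul cf_kneg cf_kint cf_kpow cf_keval cf_kcoeff cf_ktmul cf_fterms cf_kapart
 cf_iscale cf_pmul cfs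

lemma RE2: "RE (%z. P (fst z) (snd z)) ==> cf f ==> cf g ==> RE (%x. P (f x) (g x))"
 using RE_comp[of "%z. P (fst z) (snd z)" "%x. (f x, g x)"] cf_pair by auto
lemma RE3:
 assumes "RE (%z. P (fst z) (fst (snd z)) (snd (snd z)))" "cf f" "cf g" "cf h"
 shows "RE (%x. P (f x) (g x) (h x))"
 using RE_comp[OF assms(1) cf_pair[OF assms(2) cf_pair[OF assms(3,4)]]] by simp
lemma RE4:
 assumes "RE (%z. P (fst z) (fst (snd z)) (fst (snd (snd z))) (snd (snd (snd z))))" "cf f" "cf g" "cf h" "cf k"
 shows "RE (%x. P (f x) (g x) (h x) (k x))"
 using RE_comp[OF assms(1) cf_pair[OF assms(2) cf_pair[OF assms(3) cf_pair[OF assms(4,5)]]]] by simp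
lemma RE5:
 assumes "RE (%z. P (fst z) (fst (snd z)) (fst (snd (snd z))) (fst (snd (snd (snd z)))) (snd (snd (snd (snd z)))))"
  "cf f" "cf g" "cf h" "cf k" "cf l"
 shows "RE (%x. P (f x) (g x) (h x) (k x) (l x))"
 using RE_comp[OF assms(1) cf_pair[OF assms(2) cf_pair[OF assms(3) cf_pair[OF assms(4) cf_pair[OF assms(5,6)]]]]] by simp

lemmas REs = RE_ex RE_conj RE_disj RE_ball RE_bex RE_list_all2 RE_dc[OF dc_eq] RE_dc[OF dc_not[OF dc_eq]]
 RE_dc[OF dc_mem] RE_dc[OF dc_less] RE_dc[OF dc_le] RE_dc[OF dc_int_less] RE_dc[OF dc_int_le]

lemma RE_kzero: "cf f ==> cf g ==> RE (%x. kzero (f x) (g x))"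
 by (rule RE2) (unfold kzero_def, intro REs RE_dc[OF dc_izero] kcfs)

lemma RE_nth_rel: "cf f ==> cf g ==> cf h ==> RE (%x. nth_rel (f x) (g x) (h x))"
proof (rule RE3)
 have "RE (%z :: 'b list \<times> nat \<times> 'b. EX us vs. length us = fst (snd z) & fst z = us @ snd (snd z) # vs)"
  by (intro REs kcfs)
 moreover have "nth_rel xs i y \<longleftrightarrow> (EX us vs. length us = i & xs = us @ y # vs)" for xs :: "'b list" and i y
 proof
  assume "nth_rel xs i y"
  then have "length (take i xs) = i & xs = take i xs @ y # drop (Suc i) xs"
  unfolding nth_rel_def using id_take_nth_drop[of i xs] by auto
  then show "EX us vs. length us = i & xs = us @ y # vs" by blast
 qed (auto simp: nth_rel_def)
 ultimately show "RE (%z :: 'b list \<times> nat \<times> 'b. nth_rel (fst z) (fst (snd z)) (snd (snd z)))" by simp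
qed

lemma RE_kunit_cert: "cf f ==> cf g ==> cf h ==> RE (%x. kunit_cert (kzero (f x)) (g x) (h x))"
 by (rule RE3[of "%f. kunit_cert (kzero f)"]) (unfold kunit_cert_def, intro REs RE_kzero kcfs)

lemma RE_kunit: "cf f ==> cf g ==> cf h ==> RE (%x. kunit (kzero (f x)) (g x) (h x))"
 by (rule RE3[of "%f. kunit (kzero f)"]) (unfold kunit_def, intro REs RE_kunit_cert kcfs)

lemma RE_knz: "cf f ==> cf g ==> RE (%x. knz (kzero (f x)) (g x))"
 by (rule RE2[of "%f. knz (kzero f)"]) (unfold knz_def, intro REs RE_kzero kcfs)

lemma RE_kstep: "cf f ==> cf g ==> cf h ==> cf k ==> cf l ==> RE (%x. kstep (kzero (f x)) (g x) (h x) (k x) (l x))"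
 by (rule RE5[of "%f. kstep (kzero f)"]) (unfold kstep_def, intro REs RE_nth_rel RE_knz RE_kzero kcfs)

lemma RE_kEq: "cf f ==> cf g ==> cf h ==> cf k ==> RE (%x. kEq (kzero (f x)) (g x) (h x) (k x))"
 by (rule RE4[of "%f. kEq (kzero f)"]) (unfold kEq_def, intro REs RE_nth_rel RE_kzero kcfs)

lemma RE_kNeq: "cf f ==> cf g ==> cf h ==> cf k ==> RE (%x. kNeq (kzero (f x)) (g x) (h x) (k x))"
 by (rule RE4[of "%f. kNeq (kzero f)"]) (unfold kNeq_def, intro REs RE_nth_rel RE_kunit kcfs)

lemma RE_kreach: "cf f ==> cf g ==> cf h ==> RE (%x. kreach (kzero (f x)) (g x) (h x))"
 by (rule RE3[of "%f. kreach (kzero f)"]) (unfold kreach_def, intro REs RE_kstep kcfs)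

lemma RE_kper: "cf f ==> cf g ==> RE (%x. kper (kzero (f x)) (g x))"
 by (rule RE2[of "%f. kper (kzero f)"]) (unfold kper_def, intro REs RE_kstep RE_kEq RE_kNeq kcfs)

lemma RE_kfold: "cf f ==> cf g ==> RE (%x. kfold (kzero (f x)) (g x))"
 by (rule RE2[of "%f. kfold (kzero f)"]) (unfold kfold_def, intro REs RE_kreach RE_kstep RE_kEq RE_kNeq kcfs)

lemma RE_kmany: "cf f ==> cf g ==> cf h ==> RE (%x. kmany (kzero (f x)) (g x) (h x))"
 by (rule RE3[of "%f. kmany (kzero f)"]) (unfold kmany_def, intro REs RE_kreach RE_kNeq kcfs)

lemma RE_divides_denominators: "cf f ==> cf g ==> RE (%x. divides_denominators (f x) (g x))"
 by (rule RE2) (unfold divides_denominators_def, intro REs kcfs)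

lemma RE_kbound: "cf f ==> cf g ==> cf h ==> RE (%x. kbound (f x) (g x) (h x))"
 by (rule RE3) (unfold kbound_def orbit_bound_def, intro REs RE_kunit_cert RE_divides_denominators kcfs)

section \<open>Reading a presentation in a number field\<close>

text \<open>Gaussian rationals \<open>(u + iv)/(w + 1)\<close>.\<close>

type_synonym gauss = "int \<times> int \<times> nat"

definition gadd :: "gauss => gauss => gauss" where
 "gadd x y = (fst x * (int (snd (snd y)) + 1) + fst y * (int (snd (snd x)) + 1),
  fst (snd x) * (int (snd (snd y)) + 1) + fst (snd y) * (int (snd (snd x)) + 1),
  snd (snd x) * snd (snd y) + snd (snd x) + snd (snd y))"
definition gmul :: "gauss => gauss => gauss" where
 "gmul x y = (fst x * fst y + - (fst (snd x) * fst (snd y)), fst x * fst (snd y) + fst (snd x) * fst y,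
  snd (snd x) * snd (snd y) + snd (snd x) + snd (snd y))"
definition gint :: "int => gauss" where "gint c = (c, 0, 0)"
definition gpow :: "gauss => nat => gauss" where "gpow x n = ((%y. gmul x y) ^^ n) (gint 1)"
definition geval :: "iterms => gauss => gauss" where
 "geval a x = fold (%t s. gadd (gmul (gint (fst t)) (gpow x (snd t))) s) a (gint 0)"
definition gless :: "gauss => nat => nat => bool" where
 "gless x k m \<longleftrightarrow> (fst x * fst x + fst (snd x) * fst (snd x)) * (int (m + 1) * int (m + 1)) <
  int k * int k * (int (snd (snd x) + 1) * int (snd (snd x) + 1))"
text \<open>A Lipschitz constant on the disc of radius \<open>B\<close>.\<close>

definition lip :: "iterms => nat => nat" where
 "lip a B = fold (%t s. (nat (fst t) + nat (- fst t)) * (snd t * B ^ snd t) + s) a 0"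

text \<open>A location \<open>(f, x, N)\<close> determines a disc of radius \<open>1/(N + 1)\<close> about \<open>x\<close> that contains a root
 of \<open>f\<close>.\<close>

type_synonym loc = "fcert \<times> gauss \<times> nat"

definition fwf :: "fcert => bool" where
 "fwf f \<longleftrightarrow> 0 < fst f & fst (snd f) ~= 0 & (ALL t:set (snd (snd f)). snd t < fst f)"
definition root_check :: "loc => bool" where
 "root_check tu \<longleftrightarrow> fwf (fst tu) & (EX m. m + 1 = (snd (snd tu) + 1) ^ fst (fst tu) &
  gless (geval (fterms (fst tu)) (fst (snd tu))) (nat (fst (snd (fst tu))) + nat (- fst (snd (fst tu)))) m)"
definition khorner :: "int list => kc => kc" where
 "khorner p g = fold (%c s. kadd (kint c) (kmul g s)) (rev p) (kint 0)"
text \<open>With the approximation \<open>x\<close> in place of \<open>th\<close>, the distance of the value of \<open>g\<close> from the centre is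
 less than \<open>k / (m + 1)\<close>, up to the factor \<open>snd g + 1\<close>; the error that is due to the distance of \<open>th\<close> from \<open>x\<close> is
 at most the Lipschitz constant divided by \<open>N + 1\<close>.  The last inequality says that both together do not
 exceed the radius.\<close>

definition disc_check :: "loc => (int \<times> nat) => (int \<times> nat) => (int \<times> nat) => kc => bool" where
 "disc_check tu a b r g \<longleftrightarrow> (EX B k m w. gless (fst (snd tu)) B 0 & w + 1 = snd a * snd b &
  gless (gadd (geval (fst g) (fst (snd tu)))
  (gmul (gint (- int (snd g + 1))) (fst a * int (snd b), fst b * int (snd a), w))) k m &
  int (snd r * (k * (snd (snd tu) + 1) + lip (fst g) (B + 1) * (m + 1))) \<le>
  int (snd g + 1) * fst r * int ((m + 1) * (snd (snd tu) + 1)))"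
definition num_rel :: "loc => nat => kc => bool" where
 "num_rel tu n g \<longleftrightarrow> (\<exists>(p :: int list) a b r. n = enc [enc p, enc a, enc b, enc r] &
  kzero (fst tu) (khorner p g) & disc_check tu a b r g)"
definition poly_rel :: "loc => nat => kpoly => bool" where
 "poly_rel tu n P \<longleftrightarrow> (\<exists>ms :: nat list. n = enc ms &
  list_all2 (%m t. \<exists>u :: nat. m = enc (u, snd t) & num_rel tu u (fst t)) ms P)"
definition polys_rel :: "loc => nat => kpoly list => bool" where
 "polys_rel tu n Ps \<longleftrightarrow> (\<exists>ms :: nat list. n = enc ms & list_all2 (poly_rel tu) ms Ps)"
definition chart_rel :: "loc => nat => kchart => bool" where
 "chart_rel tu n C \<longleftrightarrow> (\<exists>u :: nat. n = enc (fst C, u) & polys_rel tu u (snd C))"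
definition overlap_rel :: "loc => nat => koverlap => bool" where
 "overlap_rel tu n R \<longleftrightarrow> (\<exists>u v w :: nat. n = enc [u, v, w] & chart_rel tu u (fst R) &
  polys_rel tu v (fst (snd R)) & polys_rel tu w (snd (snd R)))"
definition piece_rel :: "loc => nat => kpiece => bool" where
 "piece_rel tu n q \<longleftrightarrow> (\<exists>u w :: nat. n = enc [u, fst (snd q), w] & poly_rel tu u (fst q) &
  polys_rel tu w (snd (snd q)))"
definition problem_rel :: "loc => nat => kproblem => bool" where
 "problem_rel tu n d \<longleftrightarrow> (\<exists>(us :: nat list) (vs :: nat list list) (ws :: nat list list list) (as :: nat list).
  n = enc [enc us, enc vs, enc ws, fst (kstart d), enc as] &
  list_all2 (chart_rel tu) us (kCs d) &
  list_all2 (%v Rs. list_all2 (overlap_rel tu) v Rs) vs (kOs d) &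
  list_all2 (%w Ps. list_all2 (%x Qs. list_all2 (piece_rel tu) x Qs) w Ps) ws (kFs d) &
  list_all2 (num_rel tu) as (snd (kstart d)))"

lemma cf_enc: "cf f ==> cf (%x. enc (f x) :: nat)"
 by (rule cf_comp[of enc]) (rule cfI[OF C1_id], simp)

lemma cf_gadd: "cf f ==> cf g ==> cf (%x. gadd (f x) (g x))"
 by (rule cf2) (unfold gadd_def, intro cfs)
lemma cf_gmul: "cf f ==> cf g ==> cf (%x. gmul (f x) (g x))"
 by (rule cf2) (unfold gmul_def, intro cfs)
lemma cf_gint: "cf f ==> cf (%x. gint (f x))"
 by (rule cf_comp[of gint]) (unfold gint_def, intro cfs)
lemma cf_gpow: "cf f ==> cf g ==> cf (%x. gpow (f x) (g x))"
 by (rule cf2) (unfold gpow_def, intro cf_gmul cf_gint cfs)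
lemma cf_geval: "cf f ==> cf g ==> cf (%x. geval (f x) (g x))"
 by (rule cf2) (unfold geval_def, intro cf_gadd cf_gmul cf_gint cf_gpow cfs)
lemma cf_lip: "cf f ==> cf g ==> cf (%x. lip (f x) (g x))"
 by (rule cf2) (unfold lip_def, intro cfs)
lemma cf_khorner: "cf f ==> cf g ==> cf (%x. khorner (f x) (g x))"
 by (rule cf2) (unfold khorner_def, intro cf_kadd cf_kint cf_kmul cfs)

lemmas gcfs = cf_gadd cf_gmul cf_gint cf_geval cf_lip cf_khorner cf_enc kcfs

lemma RE_gless: "cf f ==> cf g ==> cf h ==> RE (%x. gless (f x) (g x) (h x))"
 by (rule RE3) (unfold gless_def, intro RE_dc[OF dc_int_less] gcfs)

lemma RE_root_check: "cf f ==> RE (%x. root_check (f x))"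
 by (rule RE_comp[of root_check]) (unfold root_check_def fwf_def, intro REs RE_gless gcfs)

lemma RE_num_rel: "cf f ==> cf g ==> cf h ==> RE (%x. num_rel (f x) (g x) (h x))"
 by (rule RE3) (unfold num_rel_def disc_check_def, intro REs RE_gless RE_kzero gcfs)

lemma RE_poly_rel: "cf f ==> cf g ==> cf h ==> RE (%x. poly_rel (f x) (g x) (h x))"
 by (rule RE3) (unfold poly_rel_def, intro REs RE_num_rel gcfs)

lemma RE_polys_rel: "cf f ==> cf g ==> cf h ==> RE (%x. polys_rel (f x) (g x) (h x))"
 by (rule RE3) (unfold polys_rel_def, intro REs RE_poly_rel gcfs)

lemma RE_chart_rel: "cf f ==> cf g ==> cf h ==> RE (%x. chart_rel (f x) (g x) (h x))"
 by (rule RE3) (unfold chart_rel_def, intro REs RE_polys_rel gcfs)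

lemma RE_overlap_rel: "cf f ==> cf g ==> cf h ==> RE (%x. overlap_rel (f x) (g x) (h x))"
 by (rule RE3) (unfold overlap_rel_def, intro REs RE_chart_rel RE_polys_rel gcfs)

lemma RE_piece_rel: "cf f ==> cf g ==> cf h ==> RE (%x. piece_rel (f x) (g x) (h x))"
 by (rule RE3) (unfold piece_rel_def, intro REs RE_poly_rel RE_polys_rel gcfs)

lemma RE_problem_rel: "cf f ==> cf g ==> cf h ==> RE (%x. problem_rel (f x) (g x) (h x))"
 by (rule RE3) (unfold problem_rel_def, intro REs RE_chart_rel RE_overlap_rel RE_piece_rel RE_num_rel gcfs)

definition reads :: "nat => loc => kproblem => bool" where
 "reads n tu d \<longleftrightarrow> root_check tu & problem_rel tu n d"

definition periodic_cert :: "nat => bool" where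
 "periodic_cert n \<longleftrightarrow> (EX tu d. reads n tu d & kper (kzero (fst tu)) d)"

text \<open>The bound and the large set of points may be found in different number fields.\<close>

definition nonperiodic_cert :: "nat => bool" where
 "nonperiodic_cert n \<longleftrightarrow> (EX tu d. reads n tu d & kfold (kzero (fst tu)) d) \<or>
  (EX B. (EX tu d. reads n tu d & kbound (fst tu) d B) &
  (EX tu d. reads n tu d & kmany (kzero (fst tu)) d B))"

lemma RE_periodic_cert: "RE periodic_cert"
 unfolding periodic_cert_def[abs_def] reads_def
 by (intro REs RE_root_check RE_problem_rel RE_kper gcfs)

lemma RE_nonperiodic_cert: "RE nonperiodic_cert"
 unfolding nonperiodic_cert_def[abs_def] reads_def
 by (intro REs RE_root_check RE_problem_rel RE_kfold RE_kbound RE_kmany gcfs)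

section \<open>Values of codes\<close>

definition tval :: "complex => iterms => complex" where
 "tval th a = (\<Sum>t\<leftarrow>a. of_int (fst t) * th ^ snd t)"
definition kval :: "complex => kc => complex" where
 "kval th x = tval th (fst x) / of_nat (snd x + 1)"
definition kvp :: "complex => kpoly => cterms" where
 "kvp th = map (%t. (kval th (fst t), snd t))"

lemma tval_simps[simp]: "tval th [] = 0" "tval th (t # a) = of_int (fst t) * th ^ snd t + tval th a"
 "tval th (a @ b) = tval th a + tval th b"
 by (simp_all add: tval_def)

lemma tval_iscale: "tval th (iscale c a) = of_int c * tval th a"
 by (induction a) (simp_all add: iscale_def algebra_simps)

lemma tval_pmul: "tval th (pmul a b) = tval th a * tval th b"
proof (induction a)
 case (Cons t a)
 have "tval th (map (%u. (fst t * fst u, snd t + snd u)) b) = of_int (fst t) * th ^ snd t * tval th b"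
  by (induction b) (simp_all add: algebra_simps power_add)
 then show ?case using Cons by (simp add: pmul_def algebra_simps)
qed (simp add: pmul_def)

lemma kval_kadd: "kval th (kadd x y) = kval th x + kval th y"
proof -
 have "of_nat (snd x + 1) ~= (0::complex)" "of_nat (snd y + 1) ~= (0::complex)" by (simp_all only: of_nat_eq_0_iff)
 moreover have "snd (kadd x y) + 1 = (snd x + 1) * (snd y + 1)" by (simp add: kadd_def algebra_simps)
 ultimately show ?thesis unfolding kval_def
  by (simp only: of_nat_mult) (simp add: kadd_def tval_iscale divide_simps, simp add: algebra_simps)
qed

lemma kval_kmul: "kval th (kmul x y) = kval th x * kval th y"
proof -
 have "snd (kmul x y) + 1 = (snd x + 1) * (snd y + 1)" by (simp add: kmul_def algebra_simps)
 then show ?thesis unfolding kval_def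
  by (simp only: of_nat_mult) (simp add: kmul_def tval_pmul)
qed

lemma kval_kneg: "kval th (kneg x) = - kval th x"
 by (simp add: kval_def kneg_def tval_iscale)
lemma kval_kint: "kval th (kint i) = of_int i"
 by (simp add: kval_def kint_def)
lemma kval_kpow: "kval th (kpow x n) = kval th x ^ n"
 unfolding kpow_def by (induction n) (simp_all add: kval_kint kval_kmul)

lemmas kval_ops = kval_kadd kval_kmul kval_kneg kval_kint kval_kpow

lemma fold_kadd: "kval th (fold (%t s. kadd (h t) s) xs s0) = (\<Sum>t\<leftarrow>xs. kval th (h t)) + kval th s0"
 by (induction xs arbitrary: s0) (simp_all add: kval_ops algebra_simps)

lemma kval_kmon: "kval th (kmon a e) = monomial_value (map (kval th) a) e"
proof -
 have "kval th (fold (%z s. kmul (kpow (fst z) (snd z)) s) zs s0) =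
  prod_list (map (%z. kval th (fst z) ^ snd z) zs) * kval th s0" for zs s0
  by (induction zs arbitrary: s0) (simp_all add: kval_ops algebra_simps)
 then show ?thesis unfolding kmon_def monomial_value_def
  by (simp add: kval_ops zip_map1 comp_def split_def)
qed

lemma kval_keval: "kval th (keval P a) = teval (kvp th P) (map (kval th) a)"
 unfolding keval_def fold_kadd teval_def kvp_def by (simp add: kval_ops kval_kmon comp_def split_def)

lemma kval_kcoeff: "kval th (kcoeff P e) = tcoeff (kvp th P) e"
 unfolding kcoeff_def fold_kadd tcoeff_def kvp_def by (simp add: kval_ops filter_map comp_def)

lemma kvp_Cons: "kvp th (t # Q) = (kval th (fst t), snd t) # kvp th Q" by (simp add: kvp_def)

lemma eadd_map2: "eadd e k = map2 (+) e k" by (simp add: eadd_def split_def)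

lemma kvp_ktmul: "kvp th (ktmul P Q) = tmul (kvp th P) (kvp th Q)"
 unfolding kvp_def ktmul_def tmul_def
 by (simp add: map_concat comp_def split_def kval_ops eadd_def)

lemma teval_simps[simp]: "teval [] a = 0" "teval (t # P) a = fst t * monomial_value a (snd t) + teval P a"
 "teval (P @ Q) a = teval P a + teval Q a"
 by (simp_all add: teval_def split_def)

lemma monomial_value_add:
 "length e = length a ==> length k = length a ==> monomial_value a (map2 (+) e k) = monomial_value a e * monomial_value a k"
 by (simp add: monomial_value_prod power_add prod.distrib)

lemma teval_tmul:
 assumes "!!t. t : set P ==> length (snd t) = length a" "!!t. t : set Q ==> length (snd t) = length a"
 shows "teval (tmul P Q) a = teval P a * teval Q a"
proof -
 have 1: "teval (map (%(d, k). (c * d, map2 (+) e k)) Q) a = c * monomial_value a e * teval Q a"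
  if "length e = length a" for c e
  using assms(2)
 proof (induction Q)
  case (Cons t Q)
  then show ?case using monomial_value_add[OF that, of "snd t"] by (simp add: split_def algebra_simps)
 qed simp
 show ?thesis using assms(1)
 proof (induction P)
  case (Cons t P)
  then show ?case using 1[of "snd t" "fst t"] by (simp add: tmul_def split_def algebra_simps)
 qed (simp add: tmul_def)
qed

text \<open>Terms with equal exponents may occur repeatedly in a list; they are collected here.\<close>

lemma teval_by_coefficients:
 assumes "finite E" "snd ` set P <= E"
 shows "teval P a = (\<Sum>e\<in>E. tcoeff P e * monomial_value a e)"
 using assms(2)
proof (induction P)
 case (Cons t P)
 have "(\<Sum>e\<in>E. tcoeff (t # P) e * monomial_value a e) =
  (\<Sum>e\<in>E. (if e = snd t then fst t * monomial_value a e else 0)) + (\<Sum>e\<in>E. tcoeff P e * monomial_value a e)"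
  unfolding sum.distrib[symmetric] by (intro sum.cong) (auto simp: tcoeff_def algebra_simps)
 also have "(\<Sum>e\<in>E. (if e = snd t then fst t * monomial_value a e else 0)) = fst t * monomial_value a (snd t)"
  using assms(1) Cons.prems by (simp add: sum.delta)
 finally show ?case using Cons by simp
qed (simp add: tcoeff_def)

lemma icoeff_simps[simp]: "icoeff [] e = 0" "icoeff (t # a) e = (if snd t = e then fst t else 0) + icoeff a e"
proof -
 have *: "fold (%t s. fst t + s) xs s0 = sum_list (map fst xs) + s0" for xs :: iterms and s0
  by (induction xs arbitrary: s0) simp_all
 show "icoeff [] e = 0" "icoeff (t # a) e = (if snd t = e then fst t else 0) + icoeff a e"
  by (simp_all add: icoeff_def *)
qed

definition ip :: "iterms => int poly" where "ip a = (\<Sum>t\<leftarrow>a. monom (fst t) (snd t))"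

lemma ip_simps[simp]: "ip [] = 0" "ip (t # a) = monom (fst t) (snd t) + ip a" "ip (a @ b) = ip a + ip b"
 by (simp_all add: ip_def)

lemma coeff_ip: "coeff (ip a) e = icoeff a e"
 by (induction a) simp_all

lemma ip_iscale: "ip (iscale c a) = smult c (ip a)"
 by (induction a) (simp_all add: iscale_def smult_monom smult_add_right)

lemma ip_pmul: "ip (pmul a b) = ip a * ip b"
proof (induction a)
 case (Cons t a)
 have "ip (map (%u. (fst t * fst u, snd t + snd u)) b) = monom (fst t) (snd t) * ip b"
  by (induction b) (simp_all add: mult_monom distrib_left)
 then show ?case using Cons by (simp add: pmul_def distrib_right)
qed (simp add: pmul_def)

lemma poly_ip: "poly (map_poly of_int (ip a)) th = tval th a"
proof (induction a)
 case (Cons t a)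
 have "map_poly of_int (monom (fst t) (snd t) + ip a) = monom (of_int (fst t)) (snd t) + (map_poly of_int (ip a) :: complex poly)"
  by (intro poly_eqI) (simp add: coeff_map_poly)
 then show ?case using Cons by (simp add: poly_monom)
qed simp

lemma izero_iff: "izero a \<longleftrightarrow> ip a = 0"
proof
 assume z: "izero a"
 have "icoeff a e = 0" for e
 proof (cases "EX t:set a. snd t = e")
  case False
  then show ?thesis by (induction a) auto
 qed (use z in \<open>auto simp: izero_def\<close>)
 then show "ip a = 0" by (intro poly_eqI) (simp add: coeff_ip)
qed (simp add: izero_def coeff_ip[symmetric])

lemma kzero_sound:
 assumes "tval th (fterms f) = 0" "kzero f x"
 shows "kval th x = 0"
proof -
 obtain E Q where EQ: "E ~= 0" "ip (iscale E (fst x) @ pmul Q (fterms f)) = 0"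
  using assms(2) unfolding kzero_def izero_iff by auto
 then have "tval th (iscale E (fst x) @ pmul Q (fterms f)) = 0"
  using poly_ip[of "iscale E (fst x) @ pmul Q (fterms f)" th] by simp
 then show ?thesis using EQ(1) assms(1) by (simp add: tval_iscale tval_pmul kval_def)
qed

text \<open>For a polynomial of least degree the certificates for zero are complete; that it is minimal is
 never certified.\<close>

definition minimal_cert :: "fcert => complex => bool" where
 "minimal_cert f th \<longleftrightarrow> fwf f & tval th (fterms f) = 0 & (ALL x. kval th x = 0 --> kzero f x)"

lemma minimal_cert_kzero: "minimal_cert f th ==> kzero f x \<longleftrightarrow> kval th x = 0"
 using kzero_sound unfolding minimal_cert_def by blast

lemma map_poly_of_int_ops:
 "map_poly of_int (p * q) = (map_poly of_int p * map_poly of_int q :: complex poly)"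
 "map_poly of_int (p + q) = (map_poly of_int p + map_poly of_int q :: complex poly)"
 "map_poly of_int (smult c p) = (smult (of_int c) (map_poly of_int p) :: complex poly)"
 by (intro poly_eqI; simp add: coeff_map_poly coeff_mult)+

text \<open>Pseudo-division by a nonzero integer polynomial of least degree that vanishes at \<open>th\<close> leaves the
 remainder zero.\<close>

lemma exists_minimal_cert:
 assumes "algebraic th"
 shows "EX f. minimal_cert f th"
proof -
 let ?ev = "%p :: int poly. poly (map_poly of_int p) th = 0"
 obtain p0 where "p0 ~= 0 & ?ev p0" using algebraicE'[OF assms] by metis
 then obtain p where p: "p ~= 0" "?ev p" and min: "!!q. q ~= 0 ==> ?ev q ==> degree p <= degree q"
  using ex_has_least_nat[of "%p. p ~= 0 & ?ev p" p0 degree] by blast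
 define n where "n = degree p"
 have n0: "n ~= 0"
 proof
  assume "n = 0"
  then obtain c where "p = [:c:]" unfolding n_def by (metis degree_eq_zeroE)
  then show False using p by (simp add: map_poly_pCons)
 qed
 define f :: fcert where "f = (n, lead_coeff p, map (%i. (coeff p i, i)) [0..<n])"
 have "fwf f" unfolding fwf_def f_def using n0 p(1) by auto
 have ic: "icoeff (map (%i. (g i, i)) xs) e = (if e : set xs then g e else 0)" if "distinct xs" for g :: "nat => int" and xs e
  using that by (induction xs) auto
 have ipf: "ip (fterms f) = p"
 proof (intro poly_eqI)
  fix e
  have "coeff (ip (fterms f)) e = icoeff (fterms f) e" by (rule coeff_ip)
  also have "... = (if n = e then lead_coeff p else 0) + icoeff (map (%i. (coeff p i, i)) [0..<n]) e"
  unfolding fterms_def f_def by simp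
  also have "... = coeff p e" unfolding ic[OF distinct_upt] using coeff_eq_0[of p e] by (auto simp: n_def)
  finally show "coeff (ip (fterms f)) e = coeff p e" .
 qed
 have "tval th (fterms f) = 0" using poly_ip[of "fterms f" th] ipf p(2) by simp
 moreover have "kzero f x" if x: "kval th x = 0" for x
 proof -
  have "tval th (fst x) = 0" using x of_nat_eq_0_iff[of "snd x + 1", where 'a = complex] unfolding kval_def
  by (simp del: of_nat_eq_0_iff of_nat_add of_nat_Suc)
  then have G: "?ev (ip (fst x))" by (simp add: poly_ip)
  obtain q r where qr: "pseudo_divmod (ip (fst x)) p = (q, r)" by fastforce
  define E where "E = lead_coeff p ^ (Suc (degree (ip (fst x))) - degree p)"
  have eq: "smult E (ip (fst x)) = p * q + r" "r = 0 \<or> degree r < degree p"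
  using pseudo_divmod[OF p(1) qr] unfolding E_def by auto
  have "?ev r"
  proof -
  have "poly (map_poly of_int (smult E (ip (fst x)))) th = (0::complex)" using G by (simp add: map_poly_of_int_ops)
  then show ?thesis unfolding eq(1) map_poly_of_int_ops using p(2) by simp
  qed
  then have "r = 0" using eq(2) min[of r] by (metis not_le)
  define Q where "Q = map (%i. (- coeff q i, i)) [0..<Suc (degree q)]"
  have "ip Q = - q"
  by (intro poly_eqI) (auto simp: coeff_ip Q_def ic coeff_eq_0 simp del: upt_Suc)
  then have "ip (iscale E (fst x) @ pmul Q (fterms f)) = 0"
  using eq(1) \<open>r = 0\<close> by (simp add: ip_iscale ip_pmul ipf)
  moreover have "E ~= 0" unfolding E_def using p(1) by simp
  ultimately show ?thesis unfolding kzero_def izero_iff by blast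
 qed
 ultimately show ?thesis using \<open>fwf f\<close> unfolding minimal_cert_def by blast
qed

lemma kval_surj: "z : adjoin th ==> EX x. kval th x = z"
 unfolding adjoin_def
proof (induction rule: rat.span_induct_alt)
 case base
 show ?case by (intro exI[of _ "kint 0"]) (simp add: kval_kint)
next
 case (step q b z)
 then obtain i x where i: "b = th ^ i" and x: "kval th x = z" by auto
 define y :: kc where "y = ([(fst (quotient_of q), i)], nat (snd (quotient_of q)) - 1)"
 have pos: "snd (quotient_of q) > 0" by (rule quotient_of_denom_pos')
 then have "snd y + 1 = nat (snd (quotient_of q))" unfolding y_def by simp
 then have "of_nat (snd y + 1) = (of_int (snd (quotient_of q)) :: complex)" using pos by (simp only: of_nat_nat less_imp_le)
 moreover have "of_rat q = (of_int (fst (quotient_of q)) / of_int (snd (quotient_of q)) :: complex)"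
  using quotient_of_div[of q "fst (quotient_of q)" "snd (quotient_of q)"] by (metis of_rat_divide of_rat_of_int_eq prod.collapse)
 ultimately have "kval th y = of_rat q * b" unfolding kval_def i by (simp add: y_def)
 then show ?case using x kval_kadd[of th y x] by metis
qed

lemma kval_mem_adjoin: "algebraic th ==> kval th x : adjoin th"
proof -
 assume th: "algebraic th"
 have "tval th a : adjoin th" for a
 proof (induction a)
  case Nil
  show ?case using adjoin_rat[OF th, of 0] by simp
 next
  case (Cons t a)
  have "th ^ k : adjoin th" for k unfolding adjoin_def by (rule rat.span_base) auto
  then show ?case using Cons adjoin_rat[OF th, of "of_int (fst t)"] by (auto intro!: adjoin_add adjoin_mult th)
 qed
 moreover have "of_nat (snd x + 1) : adjoin th"
  using adjoin_rat[OF th, of "of_nat (snd x + 1)"] by (simp only: of_rat_of_nat_eq)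
 ultimately show ?thesis unfolding kval_def by (intro adjoin_divide th)
qed

section \<open>Numerical localization\<close>

definition gval :: "gauss => complex" where
 "gval x = Complex (of_int (fst x)) (of_int (fst (snd x))) / of_nat (snd (snd x) + 1)"

lemma gval_gadd: "gval (gadd x y) = gval x + gval y"
proof -
 have n: "of_nat (snd (snd x) + 1) ~= (0::complex)" "of_nat (snd (snd y) + 1) ~= (0::complex)" by (simp_all only: of_nat_eq_0_iff)
 have s: "snd (snd (gadd x y)) + 1 = (snd (snd x) + 1) * (snd (snd y) + 1)" by (simp add: gadd_def algebra_simps)
 have "gval x + gval y = (Complex (of_int (fst x)) (of_int (fst (snd x))) * of_nat (snd (snd y) + 1) +
  Complex (of_int (fst y)) (of_int (fst (snd y))) * of_nat (snd (snd x) + 1)) / (of_nat (snd (snd x) + 1) * of_nat (snd (snd y) + 1))"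
  unfolding gval_def by (rule add_frac_eq[OF n])
 also have "... = gval (gadd x y)" unfolding gval_def s of_nat_mult
  by (intro arg_cong2[where f = "(/)"] refl) (simp add: complex_eq_iff gadd_def algebra_simps)
 finally show ?thesis by simp
qed

lemma gval_gmul: "gval (gmul x y) = gval x * gval y"
proof -
 have "snd (snd (gmul x y)) + 1 = (snd (snd x) + 1) * (snd (snd y) + 1)" by (simp add: gmul_def algebra_simps)
 then have "gval x * gval y = (Complex (of_int (fst x)) (of_int (fst (snd x))) *
  Complex (of_int (fst y)) (of_int (fst (snd y)))) / of_nat (snd (snd (gmul x y)) + 1)"
  unfolding gval_def by (simp only: of_nat_mult) simp
 also have "... = gval (gmul x y)" unfolding gval_def
  by (intro arg_cong2[where f = "(/)"] refl) (simp add: complex_eq_iff gmul_def)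
 finally show ?thesis by simp
qed

lemma gval_gint: "gval (gint c) = of_int c"
 by (simp add: gval_def gint_def complex_eq_iff)

lemma gval_gpow: "gval (gpow x n) = gval x ^ n"
 unfolding gpow_def by (induction n) (simp_all add: gval_gint gval_gmul)

lemma gval_geval: "gval (geval a x) = tval (gval x) a"
proof -
 have "gval (fold (%t s. gadd (gmul (gint (fst t)) (gpow x (snd t))) s) a s0) = tval (gval x) a + gval s0" for s0
  by (induction a arbitrary: s0) (simp_all add: gval_gadd gval_gmul gval_gint gval_gpow)
 then show ?thesis unfolding geval_def by (simp add: gval_gint)
qed

lemma gless_iff: "gless x k m \<longleftrightarrow> cmod (gval x) < real k / real (m + 1)"
proof -
 define u v w where "u = fst x" "v = fst (snd x)" "w = snd (snd x)"
 have w0: "real (w + 1) > 0" "real (m + 1) > 0" by simp_all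
 have sq: "cmod (gval x) ^ 2 = (of_int u ^ 2 + of_int v ^ 2) / real (w + 1) ^ 2"
  unfolding gval_def u_v_w_def[symmetric] norm_divide power_divide by (simp add: cmod_power2 norm_of_nat del: of_nat_add of_nat_Suc)
 have "cmod (gval x) < real k / real (m + 1) \<longleftrightarrow> cmod (gval x) ^ 2 < (real k / real (m + 1)) ^ 2"
  unfolding not_le[symmetric] by (subst power_mono_iff) auto
 also have "... \<longleftrightarrow> (of_int u ^ 2 + of_int v ^ 2) * real (m + 1) ^ 2 < real k ^ 2 * real (w + 1) ^ 2"
  unfolding sq power_divide using w0 by (simp only: divide_less_eq less_divide_eq zero_less_power times_divide_eq_left) (simp add: mult.commute)
 also have "... \<longleftrightarrow> real_of_int ((u * u + v * v) * (int (m + 1) * int (m + 1))) < real_of_int (int k * int k * (int (w + 1) * int (w + 1)))"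
  by (simp add: power2_eq_square)
 also have "... \<longleftrightarrow> gless x k m" unfolding gless_def u_v_w_def[symmetric] by (simp only: of_int_less_iff)
 finally show ?thesis by simp
qed

lemma norm_power_diff_le:
 assumes "cmod z <= B" "cmod w <= B" "1 <= B"
 shows "cmod (z ^ e - w ^ e) <= cmod (z - w) * (real e * B ^ e)"
proof (induction e)
 case (Suc e)
 have "z ^ Suc e - w ^ Suc e = z * (z ^ e - w ^ e) + (z - w) * w ^ e" by (simp add: algebra_simps)
 then have "cmod (z ^ Suc e - w ^ Suc e) <= cmod z * cmod (z ^ e - w ^ e) + cmod (z - w) * cmod w ^ e"
  by (metis norm_mult norm_power norm_triangle_ineq)
 also have "... <= B * (cmod (z - w) * (real e * B ^ e)) + cmod (z - w) * B ^ Suc e"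
 proof (intro add_mono mult_mono Suc assms(1))
  have "cmod w ^ e <= B ^ e" by (rule power_mono[OF assms(2)]) simp
  also have "... <= B ^ Suc e" using assms(3) by (intro power_increasing) auto
  finally show "cmod w ^ e <= B ^ Suc e" .
 qed (use assms in auto)
 also have "... = cmod (z - w) * (real (Suc e) * B ^ Suc e)" by (simp add: algebra_simps)
 finally show ?case .
qed simp

lemma lip_simps: "lip [] B = 0" "lip (t # a) B = (nat (fst t) + nat (- fst t)) * (snd t * B ^ snd t) + lip a B"
proof -
 have *: "fold (%t s. (nat (fst t) + nat (- fst t)) * (snd t * B ^ snd t) + s) xs s0 =
  fold (%t s. (nat (fst t) + nat (- fst t)) * (snd t * B ^ snd t) + s) xs 0 + s0" for xs :: iterms and s0
 proof (induction xs arbitrary: s0)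
  case (Cons t xs)
  show ?case using Cons[of "(nat (fst t) + nat (- fst t)) * (snd t * B ^ snd t) + s0"]
  Cons[of "(nat (fst t) + nat (- fst t)) * (snd t * B ^ snd t)"] by simp
 qed simp
 show "lip [] B = 0" "lip (t # a) B = (nat (fst t) + nat (- fst t)) * (snd t * B ^ snd t) + lip a B"
  unfolding lip_def using *[of a "(nat (fst t) + nat (- fst t)) * (snd t * B ^ snd t)"] by simp_all
qed

lemma real_nat_abs: "real (nat i) + real (nat (- i)) = \<bar>of_int i\<bar>"
 by (cases "0 <= i") auto

lemma tval_lipschitz:
 assumes "cmod z <= real B" "cmod w <= real B" "1 <= B"
 shows "cmod (tval z a - tval w a) <= cmod (z - w) * real (lip a B)"
proof (induction a)
 case (Cons t a)
 have "cmod (of_int (fst t) * z ^ snd t - of_int (fst t) * w ^ snd t) =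
  real (nat (fst t) + nat (- fst t)) * cmod (z ^ snd t - w ^ snd t)"
  by (simp add: right_diff_distrib[symmetric] norm_mult real_nat_abs)
 also have "... <= real (nat (fst t) + nat (- fst t)) * (cmod (z - w) * (real (snd t) * real B ^ snd t))"
  using norm_power_diff_le[OF assms(1,2), of "snd t"] assms(3) by (intro mult_left_mono) auto
 finally have 1: "cmod (of_int (fst t) * z ^ snd t - of_int (fst t) * w ^ snd t) \<le>
  cmod (z - w) * real ((nat (fst t) + nat (- fst t)) * (snd t * B ^ snd t))" by (simp add: algebra_simps)
 have "tval z (t # a) - tval w (t # a) = (of_int (fst t) * z ^ snd t - of_int (fst t) * w ^ snd t) + (tval z a - tval w a)"
  by simp
 then have "cmod (tval z (t # a) - tval w (t # a)) \<le>
  cmod (of_int (fst t) * z ^ snd t - of_int (fst t) * w ^ snd t) + cmod (tval z a - tval w a)"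
  by (simp only: norm_triangle_ineq)
 then show ?case using 1 Cons unfolding lip_simps of_nat_add distrib_left by linarith
qed simp

text \<open>The product of the distances from a point to the roots is the absolute value of the
 polynomial divided by that of its leading coefficient.\<close>

lemma exists_near_root:
 assumes f: "fwf f" and small: "cmod (tval z (fterms f)) < \<bar>of_int (fst (snd f))\<bar> * dl ^ fst f" and dl: "0 < dl"
 shows "EX th. tval th (fterms f) = 0 & cmod (th - z) < dl"
proof (rule ccontr)
 assume no: "~ ?thesis"
 define p where "p = (map_poly of_int (ip (fterms f)) :: complex poly)"
 have pv: "poly p x = tval x (fterms f)" for x unfolding p_def by (rule poly_ip)
 have rest: "icoeff (snd (snd f)) e = 0" if "fst f <= e" for e
 proof -
  have "icoeff a e = 0" if "ALL t:set a. snd t < fst f" for a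
  using that \<open>fst f <= e\<close> by (induction a) auto
  then show ?thesis using f unfolding fwf_def by blast
 qed
 have c: "coeff p e = (if e = fst f then of_int (fst (snd f)) else 0)" if "fst f <= e" for e
  using rest[OF that] by (simp add: p_def coeff_map_poly coeff_ip fterms_def)
 have l0: "of_int (fst (snd f)) ~= (0::complex)" using f unfolding fwf_def by simp
 have deg: "degree p = fst f"
 proof (rule antisym)
  show "degree p <= fst f" using c by (intro degree_le) auto
  show "fst f <= degree p" using c[of "fst f"] l0 by (intro le_degree) simp
 qed
 have lc: "lead_coeff p = of_int (fst (snd f))" using c[of "fst f"] deg by simp
 then have "p ~= 0" using l0 by auto
 then obtain R where R: "size R = degree p" "p = smult (lead_coeff p) (\<Prod>x\<in>#R. [:- x, 1:])"
  using alg_closed_imp_factorization[of p] by auto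
 have "poly p z = lead_coeff p * (\<Prod>x\<in>#R. z - x)"
  by (subst R(2)) (simp add: poly_prod_mset)
 then have "cmod (poly p z) = \<bar>of_int (fst (snd f))\<bar> * cmod (\<Prod>x\<in>#R. z - x)" using lc by (simp add: norm_mult)
 moreover have "dl ^ size R' <= cmod (\<Prod>x\<in>#R'. z - x)" if "R' \<subseteq># R" for R'
  using that
 proof (induction R')
  case (add x R')
  have "x \<in># R" using add.prems by (metis mset_subset_eqD union_single_eq_member)
  then have "poly p x = 0" by (subst R(2)) (auto simp: poly_prod_mset)
  then have "dl <= cmod (z - x)" using no pv by (metis norm_minus_commute not_less)
  moreover have "dl ^ size R' <= cmod (\<Prod>x\<in>#R'. z - x)" using add by (meson mset_subset_eq_insertD subset_mset.less_imp_le)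
  ultimately show ?case using dl by (simp add: norm_mult mult_mono)
 qed simp
 then have "dl ^ fst f <= cmod (\<Prod>x\<in>#R. z - x)" using R(1) deg by (metis subset_mset.order_refl)
 then have "\<bar>of_int (fst (snd f))\<bar> * dl ^ fst f <= \<bar>of_int (fst (snd f))\<bar> * cmod (\<Prod>x\<in>#R. z - x)"
  by (rule mult_left_mono) simp
 ultimately show False using small unfolding pv[symmetric] by linarith
qed

lemma root_check_iff:
 "root_check (f, x, N) \<longleftrightarrow> fwf f & cmod (tval (gval x) (fterms f)) < \<bar>of_int (fst (snd f))\<bar> * (1 / real (N + 1)) ^ fst f"
proof -
 have "0 < (N + 1) ^ fst f" by simp
 then have ex: "(EX m. m + 1 = (N + 1) ^ fst f & Q m) \<longleftrightarrow> Q ((N + 1) ^ fst f - 1)" for Q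
  by (metis Suc_eq_plus1 Suc_pred diff_Suc_1)
 have "(N + 1) ^ fst f - 1 + 1 = (N + 1) ^ fst f" using \<open>0 < (N + 1) ^ fst f\<close> by linarith
 then have "real ((N + 1) ^ fst f - 1 + 1) = real (N + 1) ^ fst f" by (simp only: of_nat_power)
 moreover have "real (nat (fst (snd f)) + nat (- fst (snd f))) = \<bar>of_int (fst (snd f))\<bar>" by (simp add: real_nat_abs)
 ultimately show ?thesis unfolding root_check_def
  by (simp only: fst_conv snd_conv ex gless_iff gval_geval power_one_over) (simp add: divide_inverse)
qed

lemma gval_fraction:
 assumes "0 < s" "0 < t" "w + 1 = s * t"
 shows "gval (u * int t, v * int s, w) = Complex (of_int u / real s) (of_int v / real t)"
 unfolding gval_def fst_conv snd_conv assms(3) complex_eq_iff Re_divide_of_nat Im_divide_of_nat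
 using assms(1,2) by simp

lemma gval_offset:
 "gval (gadd (geval a x) (gmul (gint (- int (d + 1))) y)) = tval (gval x) a - of_real (real (d + 1)) * gval y"
 by (simp add: gval_gadd gval_gmul gval_gint gval_geval algebra_simps)

lemma disc_check_sound:
 assumes chk: "disc_check (f, x, N) a b r g" and near: "cmod (th - gval x) < 1 / real (N + 1)"
  and pos: "0 < snd a" "0 < snd b" "0 < snd r"
 shows "cmod (kval th g - Complex (of_int (fst a) / real (snd a)) (of_int (fst b) / real (snd b))) < of_int (fst r) / real (snd r)"
proof -
 obtain B k m w where B: "gless x B 0" and w: "w + 1 = snd a * snd b"
  and G: "gless (gadd (geval (fst g) x) (gmul (gint (- int (snd g + 1))) (fst a * int (snd b), fst b * int (snd a), w))) k m"
  and I: "int (snd r * (k * (N + 1) + lip (fst g) (B + 1) * (m + 1))) <= int (snd g + 1) * fst r * int ((m + 1) * (N + 1))"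
  using chk unfolding disc_check_def by auto
 define c where "c = Complex (of_int (fst a) / real (snd a)) (of_int (fst b) / real (snd b))"
 define D where "D = real (snd g + 1)"
 have D0: "D > 0" unfolding D_def by simp
 have kvD: "kval th g = tval th (fst g) / of_real D" unfolding kval_def D_def by (simp only: of_real_of_nat_eq)
 have gc: "gval (fst a * int (snd b), fst b * int (snd a), w) = c"
  unfolding c_def by (rule gval_fraction[OF pos(1,2) w])
 have G': "cmod (tval (gval x) (fst g) - of_real D * c) < real k / real (m + 1)"
  using G unfolding gless_iff gval_offset gc D_def .
 have bx: "cmod (gval x) < real B" using B unfolding gless_iff by simp
 have b\<theta>: "cmod th <= real (B + 1)"
 proof -
  have "cmod th <= cmod (gval x) + cmod (th - gval x)" using norm_triangle_sub[of th "gval x"] by simp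
  moreover have "1 / real (N + 1) <= 1" by simp
  ultimately show ?thesis using bx near by linarith
 qed
 define L where "L = real (lip (fst g) (B + 1))"
 have "cmod (tval th (fst g) - tval (gval x) (fst g)) <= cmod (th - gval x) * L"
  unfolding L_def using bx b\<theta> by (intro tval_lipschitz) auto
 also have "... <= 1 / real (N + 1) * L" using near unfolding L_def by (intro mult_right_mono) auto
 finally have lipb: "cmod (tval th (fst g) - tval (gval x) (fst g)) <= L / real (N + 1)" by simp
 have "cmod (tval th (fst g) - of_real D * c) <= cmod (tval (gval x) (fst g) - of_real D * c) + cmod (tval th (fst g) - tval (gval x) (fst g))"
  using norm_triangle_ineq[of "tval (gval x) (fst g) - of_real D * c" "tval th (fst g) - tval (gval x) (fst g)"] by simp
 then have 1: "cmod (tval th (fst g) - of_real D * c) < real k / real (m + 1) + L / real (N + 1)" using G' lipb by linarith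
 have "real_of_int (int (snd r * (k * (N + 1) + lip (fst g) (B + 1) * (m + 1)))) <= real_of_int (int (snd g + 1) * fst r * int ((m + 1) * (N + 1)))"
  using I by (simp only: of_int_le_iff)
 then have "real (snd r) * (real k * real (N + 1) + L * real (m + 1)) <= D * of_int (fst r) * (real (m + 1) * real (N + 1))"
  unfolding L_def D_def by (simp only: of_int_of_nat_eq of_int_mult of_int_add of_nat_mult of_nat_add of_nat_1 of_int_1)
 then have 2: "real k / real (m + 1) + L / real (N + 1) <= D * (of_int (fst r) / real (snd r))"
  using pos(3) by (simp add: divide_simps del: of_nat_add of_nat_Suc) (simp add: algebra_simps)
 have "kval th g - c = (tval th (fst g) - of_real D * c) / of_real D"
  using kvD D0 by (simp add: diff_divide_distrib)
 then have "cmod (kval th g - c) = cmod (tval th (fst g) - of_real D * c) / D" using D0 by (simp add: norm_divide)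
 also have "... < (D * (of_int (fst r) / real (snd r))) / D" using 1 2 D0 by (intro divide_strict_right_mono) auto
 finally show ?thesis using D0 unfolding c_def by simp
qed

lemma exists_fraction_between:
 assumes "0 <= s" "s < (t::real)"
 shows "EX k m. s < real k / real (m + 1) & real k / real (m + 1) < t"
proof -
 obtain q where q: "s < of_rat q" "of_rat q < t" using of_rat_dense[OF assms(2)] by auto
 obtain k d where kd: "quotient_of q = (k, d)" by fastforce
 have d: "d > 0" using quotient_of_denom_pos[OF kd] .
 have qq: "real_of_rat q = of_int k / of_int d" using quotient_of_div[OF kd] by (simp add: of_rat_divide)
 have "0 < k"
 proof -
  have "0 < real_of_rat q" using q(1) assms(1) by linarith
  then show ?thesis unfolding qq using d by (simp add: zero_less_divide_iff)
 qed
 then have "real (nat k) / real (nat d - 1 + 1) = real_of_rat q" using d unfolding qq by simp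
 then show ?thesis using q by metis
qed

lemma halves_add: "a <= (d - c) / 2 + c ==> l < (d - c) / 2 ==> a < d - l" for a c d l :: real
 unfolding diff_divide_distrib by (simp add: field_simps)

text \<open>The error bound decreases with \<open>1 / (N + 1)\<close>, and the approximation \<open>x\<close> has to be
 chosen after \<open>N\<close>.\<close>

lemma disc_check_complete:
 assumes near: "cmod (kval th g - Complex (of_int (fst a) / real (snd a)) (of_int (fst b) / real (snd b))) < of_int (fst r) / real (snd r)"
  and pos: "0 < snd a" "0 < snd b" "0 < snd r"
 shows "EX N0. \<forall>N\<ge>N0. \<exists>et>0. ALL x. cmod (gval x - th) < et --> disc_check (f, x, N) a b r g"
proof -
 define c where "c = Complex (of_int (fst a) / real (snd a)) (of_int (fst b) / real (snd b))"
 define \<rho> where "\<rho> = of_int (fst r) / real (snd r)"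
 define D where "D = real (snd g + 1)"
 have D0: "D > 0" unfolding D_def by simp
 have kvD: "kval th g = tval th (fst g) / of_real D" unfolding kval_def D_def by (simp only: of_real_of_nat_eq)
 define B where "B = nat \<lceil>cmod th\<rceil> + 2"
 have B: "cmod th + 1 < real B" unfolding B_def by linarith
 define L where "L = real (lip (fst g) (B + 1))"
 have L0: "L \<ge> 0" unfolding L_def by simp
 have "kval th g - c = (tval th (fst g) - of_real D * c) / of_real D"
  using kvD D0 by (simp add: diff_divide_distrib)
 then have "cmod (tval th (fst g) - of_real D * c) = D * cmod (kval th g - c)" using D0 by (simp add: norm_divide)
 then have "cmod (tval th (fst g) - of_real D * c) < D * \<rho>" using mult_strict_left_mono[OF near D0] unfolding c_def \<rho>_def by simp
 define \<sigma> where "\<sigma> = D * \<rho> - cmod (tval th (fst g) - of_real D * c)"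
 have \<sigma>: "\<sigma> > 0" unfolding \<sigma>_def using \<open>_ < D * \<rho>\<close> by simp
 obtain N0 :: nat where N0: "2 * L / \<sigma> < real N0" using reals_Archimedean2 by blast
 show ?thesis
 proof (intro exI[of _ N0] allI impI)
  fix N assume "N0 <= N"
  then have "2 * L / \<sigma> < real (N + 1)" using N0 by linarith
  then have LN: "L / real (N + 1) < \<sigma> / 2" using \<sigma> by (simp add: field_simps)
  define et where "et = min 1 (\<sigma> / (2 * (L + 1)))"
  have \<eta>0: "et > 0" unfolding et_def using \<sigma> L0 by simp
  show "\<exists>et>0. ALL x. cmod (gval x - th) < et --> disc_check (f, x, N) a b r g"
  proof (intro exI[of _ et] conjI \<eta>0 allI impI)
  fix x assume x: "cmod (gval x - th) < et"
  have bx: "cmod (gval x) < real B"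
  using x norm_triangle_sub[of "gval x" th] B unfolding et_def by linarith
  have "cmod (tval (gval x) (fst g) - tval th (fst g)) <= cmod (gval x - th) * L"
  unfolding L_def using bx B by (intro tval_lipschitz) auto
  also have "... <= \<sigma> / (2 * (L + 1)) * L" using x L0 unfolding et_def by (intro mult_right_mono) auto
  also have "... <= \<sigma> / 2" using \<sigma> L0 by (simp add: field_simps)
  finally have "cmod (tval (gval x) (fst g) - of_real D * c) <= \<sigma> / 2 + cmod (tval th (fst g) - of_real D * c)"
  using norm_triangle_ineq[of "tval (gval x) (fst g) - tval th (fst g)" "tval th (fst g) - of_real D * c"] by simp
  then have lt: "cmod (tval (gval x) (fst g) - of_real D * c) < D * \<rho> - L / real (N + 1)"
  using LN unfolding \<sigma>_def by (rule halves_add)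
  obtain k m where km: "cmod (tval (gval x) (fst g) - of_real D * c) < real k / real (m + 1)"
  "real k / real (m + 1) < D * \<rho> - L / real (N + 1)"
  using exists_fraction_between[OF norm_ge_zero lt] by blast
  define w where "w = snd a * snd b - 1"
  have w: "w + 1 = snd a * snd b" unfolding w_def using pos by simp
  have gc: "gval (fst a * int (snd b), fst b * int (snd a), w) = c"
  unfolding c_def by (rule gval_fraction[OF pos(1,2) w])
  have G: "gless (gadd (geval (fst g) x) (gmul (gint (- int (snd g + 1))) (fst a * int (snd b), fst b * int (snd a), w))) k m"
  using km(1) unfolding gless_iff gval_offset gc D_def .
  have "real k / real (m + 1) + L / real (N + 1) <= D * (of_int (fst r) / real (snd r))"
  using km(2) unfolding \<rho>_def by linarith
  then have "real (snd r) * (real k * real (N + 1) + L * real (m + 1)) <= D * of_int (fst r) * (real (m + 1) * real (N + 1))"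
  using pos(3) by (simp add: divide_simps del: of_nat_add of_nat_Suc) (simp add: algebra_simps)
  then have "real_of_int (int (snd r * (k * (N + 1) + lip (fst g) (B + 1) * (m + 1)))) <= real_of_int (int (snd g + 1) * fst r * int ((m + 1) * (N + 1)))"
  unfolding L_def D_def by (simp only: of_int_of_nat_eq of_int_mult of_int_add of_nat_mult of_nat_add of_nat_1 of_int_1)
  then have I: "int (snd r * (k * (N + 1) + lip (fst g) (B + 1) * (m + 1))) <= int (snd g + 1) * fst r * int ((m + 1) * (N + 1))"
  by (simp only: of_int_le_iff)
  have "gless x B 0" unfolding gless_iff using bx by simp
  then show "disc_check (f, x, N) a b r g" unfolding disc_check_def fst_conv snd_conv using w G I by blast
  qed
 qed
qed

lemma gauss_dense: "0 < et ==> EX x. cmod (gval x - th) < et"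
proof -
 assume et: "0 < et"
 obtain n :: nat where n: "2 / et < real n" using reals_Archimedean2 by blast
 let ?x = "(\<lfloor>Re th * real (n + 1)\<rfloor>, \<lfloor>Im th * real (n + 1)\<rfloor>, n)"
 have *: "\<bar>of_int \<lfloor>t * real (n + 1)\<rfloor> / real (n + 1) - t\<bar> < et / 2" for t
 proof -
  have "\<bar>of_int \<lfloor>t * real (n + 1)\<rfloor> - t * real (n + 1)\<bar> <= 1" by linarith
  then have "\<bar>(of_int \<lfloor>t * real (n + 1)\<rfloor> - t * real (n + 1)) / real (n + 1)\<bar> <= 1 / real (n + 1)"
  by (simp add: abs_divide divide_right_mono del: of_nat_add of_nat_Suc)
  moreover have "(of_int \<lfloor>t * real (n + 1)\<rfloor> - t * real (n + 1)) / real (n + 1) = of_int \<lfloor>t * real (n + 1)\<rfloor> / real (n + 1) - t"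
  by (simp add: diff_divide_distrib del: of_nat_add of_nat_Suc)
  moreover have "1 / real (n + 1) < et / 2"
  proof -
  have "2 / et < real (n + 1)" using n by linarith
  then show ?thesis using et by (simp add: field_simps)
  qed
  ultimately show ?thesis by linarith
 qed
 have "Re (gval ?x - th) = of_int \<lfloor>Re th * real (n + 1)\<rfloor> / real (n + 1) - Re th"
  "Im (gval ?x - th) = of_int \<lfloor>Im th * real (n + 1)\<rfloor> / real (n + 1) - Im th"
  unfolding gval_def by (simp_all add: Re_divide_of_nat Im_divide_of_nat del: of_nat_add of_nat_Suc)
 then have "cmod (gval ?x - th) < et"
  using cmod_le[of "gval ?x - th"] *[of "Re th"] *[of "Im th"] by linarith
 then show ?thesis by blast
qed

section \<open>Reading the algebraic numbers of a presentation\<close>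

lemma kval_khorner: "kval th (khorner (coeffs q) g) = poly (map_poly of_int q) (kval th g)"
proof -
 have h: "kval th (khorner p g) = foldr (%c s. of_int c + kval th g * s) p 0" for p
 proof -
  have "kval th (foldr (%c s. kadd (kint c) (kmul g s)) p (kint 0)) = foldr (%c s. of_int c + kval th g * s) p 0"
  by (induction p) (simp_all add: kval_ops)
  then show ?thesis unfolding khorner_def by (simp add: foldr_conv_fold)
 qed
 show ?thesis unfolding h
 proof (induction q)
  case (pCons a q)
  have "coeffs (pCons a q) = a # coeffs q" using pCons.hyps by (auto simp: coeffs_pCons_eq_cCons cCons_def)
  then show ?case using pCons.IH by (simp add: map_poly_pCons)
 qed simp
qed

definition rat_pair :: "rat => int \<times> nat" where
 "rat_pair q = (fst (quotient_of q), nat (snd (quotient_of q)))"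

lemma rat_pair: "0 < snd (rat_pair q)" "of_int (fst (rat_pair q)) / real (snd (rat_pair q)) = of_rat q"
proof -
 have pos: "snd (quotient_of q) > 0" by (rule quotient_of_denom_pos')
 then show "0 < snd (rat_pair q)" by (simp add: rat_pair_def)
 have "q = of_int (fst (quotient_of q)) / of_int (snd (quotient_of q))"
  using quotient_of_div[of q] by (metis prod.collapse)
 then have "real_of_rat q = of_int (fst (quotient_of q)) / of_int (snd (quotient_of q))"
  by (metis of_rat_divide of_rat_of_int_eq)
 then show "of_int (fst (rat_pair q)) / real (snd (rat_pair q)) = of_rat q" using pos by (simp add: rat_pair_def)
qed

lemma encode_num_enc:
 "encode_num (q, a, b, r) = enc [enc (coeffs q), enc (rat_pair a), enc (rat_pair b), enc (rat_pair r)]"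
 by (simp add: encode_list_def encode_rat_def rat_pair_def enc_list_def enc_int_def enc_nat_def del: enc_list_simps)

lemma num_rel_encode_num:
 "num_rel tu (encode_num (q, a, b, r)) g \<longleftrightarrow>
  kzero (fst tu) (khorner (coeffs q) g) & disc_check tu (rat_pair a) (rat_pair b) (rat_pair r) g"
 unfolding num_rel_def encode_num_enc enc_eq by (simp only: list.inject enc_eq) blast

lemma num_rel_sound:
 assumes root: "tval th (fterms f) = 0" and near: "cmod (th - gval x) < 1 / real (N + 1)"
  and c: "isolates c z" and rel: "num_rel (f, x, N) (encode_num c) g"
 shows "kval th g = num_value c"
proof -
 obtain q a b r where cq: "c = (q, a, b, r)" by (metis prod_cases4)
 have iso: "{w. poly (map_poly of_int q) w = 0 & cmod (w - Complex (of_rat a) (of_rat b)) < of_rat r} = {z}"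
  using c unfolding cq by simp
 have kz: "kzero f (khorner (coeffs q) g)" and dc: "disc_check (f, x, N) (rat_pair a) (rat_pair b) (rat_pair r) g"
  using rel unfolding cq num_rel_encode_num by simp_all
 have "poly (map_poly of_int q) (kval th g) = 0" using kzero_sound[OF root kz] by (simp add: kval_khorner)
 moreover have "cmod (kval th g - Complex (of_rat a) (of_rat b)) < of_rat r"
  using disc_check_sound[OF dc near rat_pair(1) rat_pair(1) rat_pair(1)] by (simp only: rat_pair(2))
 ultimately have "kval th g = z" using iso by blast
 then show ?thesis using num_value_isolates[OF c] by simp
qed

lemma num_rel_complete:
 assumes f: "minimal_cert f th" and c: "isolates c (kval th g)"
 shows "EX N0. \<forall>N\<ge>N0. \<exists>et>0. ALL x. cmod (gval x - th) < et --> num_rel (f, x, N) (encode_num c) g"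
proof -
 obtain q a b r where cq: "c = (q, a, b, r)" by (metis prod_cases4)
 have iso: "kval th g : {w. poly (map_poly of_int q) w = 0 & cmod (w - Complex (of_rat a) (of_rat b)) < of_rat r}"
  using c unfolding cq by simp
 have "kzero f (khorner (coeffs q) g)" using iso minimal_cert_kzero[OF f] by (simp add: kval_khorner)
 then show ?thesis
  using disc_check_complete[of th g "rat_pair a" "rat_pair b" "rat_pair r" f] iso rat_pair
  unfolding cq num_rel_encode_num by simp
qed

lemma root_check_near:
 assumes f: "fwf f" "tval th (fterms f) = 0"
 shows "\<exists>et>0. ALL x. cmod (gval x - th) < et --> root_check (f, x, N)"
proof -
 have "isCont (%z. tval z a) th" for a
  by (induction a) (auto intro!: continuous_intros)
 moreover have pos: "0 < \<bar>real_of_int (fst (snd f))\<bar> * (1 / real (N + 1)) ^ fst f" using f(1) unfolding fwf_def by simp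
 ultimately obtain et where "et > 0" and
  et: "!!z. z ~= th & cmod (z - th) < et ==> cmod (tval z (fterms f) - tval th (fterms f)) < \<bar>real_of_int (fst (snd f))\<bar> * (1 / real (N + 1)) ^ fst f"
  using LIM_D[OF isContD] by blast
 have "root_check (f, x, N)" if "cmod (gval x - th) < et" for x
  unfolding root_check_iff using f et[of "gval x"] pos that by (cases "gval x = th") auto
 then show ?thesis using \<open>et > 0\<close> by blast
qed

text \<open>The tests for finitely many numbers hold simultaneously for large \<open>N\<close> and \<open>x\<close> close to \<open>th\<close>.\<close>

lemma exists_location:
 assumes f: "minimal_cert f th" and T: "finite T" "!!c g. (c, g) : T ==> isolates c (kval th g)"
 shows "EX tu. fst tu = f & root_check tu & (\<forall>(c, g)\<in>T. num_rel tu (encode_num c) g)"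
proof -
 have "EX N0. \<forall>N\<ge>N0. \<exists>et>0. ALL x. cmod (gval x - th) < et --> (ALL t:T. num_rel (f, x, N) (encode_num (fst t)) (snd t))"
  using T
 proof (induction T rule: finite_induct)
  case empty
  show ?case by (auto intro: exI[of _ 1])
 next
  case (insert t T)
  then obtain N1 where N1: "!!N. N \<ge> N1 ==> \<exists>et>0. ALL x. cmod (gval x - th) < et --> (ALL t:T. num_rel (f, x, N) (encode_num (fst t)) (snd t))"
  by (metis insertI2)
  obtain N2 where N2: "!!N. N \<ge> N2 ==> \<exists>et>0. ALL x. cmod (gval x - th) < et --> num_rel (f, x, N) (encode_num (fst t)) (snd t)"
  using num_rel_complete[OF f insert.prems[of "fst t" "snd t"]] by auto
  show ?case
  proof (intro exI[of _ "max N1 N2"] allI impI)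
  fix N assume "max N1 N2 <= N"
  then obtain \<eta>1 \<eta>2 where "\<eta>1 > 0" "ALL x. cmod (gval x - th) < \<eta>1 --> (ALL t:T. num_rel (f, x, N) (encode_num (fst t)) (snd t))"
  "\<eta>2 > 0" "ALL x. cmod (gval x - th) < \<eta>2 --> num_rel (f, x, N) (encode_num (fst t)) (snd t)"
  using N1[of N] N2[of N] by auto
  then show "\<exists>et>0. ALL x. cmod (gval x - th) < et --> (ALL t:insert t T. num_rel (f, x, N) (encode_num (fst t)) (snd t))"
  by (intro exI[of _ "min \<eta>1 \<eta>2"]) simp
  qed
 qed
 then obtain N \<eta>1 where \<eta>1: "\<eta>1 > 0" "!!x. cmod (gval x - th) < \<eta>1 ==> (ALL t:T. num_rel (f, x, N) (encode_num (fst t)) (snd t))"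
  by blast
 obtain \<eta>2 where \<eta>2: "\<eta>2 > 0" "!!x. cmod (gval x - th) < \<eta>2 ==> root_check (f, x, N)"
  using root_check_near[of f th N] f unfolding minimal_cert_def by blast
 have "0 < min \<eta>1 \<eta>2" using \<eta>1(1) \<eta>2(1) by simp
 then obtain x where "cmod (gval x - th) < min \<eta>1 \<eta>2" using gauss_dense by blast
 then show ?thesis using \<eta>1(2)[of x] \<eta>2(2)[of x] by (intro exI[of _ "(f, x, N)"]) auto
qed

section \<open>Presentations and their codes\<close>

text \<open>A relation between algebraic numbers and their codes is extended to presentations.  It is used
 with \<open>num_rel\<close>, which a search can test, and with equality of values.\<close>

definition prel :: "(alg_num => kc => bool) => alg_poly => kpoly => bool" where
 "prel R = list_all2 (%t u. snd u = snd t & R (fst t) (fst u))"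
fun crel :: "(alg_num => kc => bool) => chart => kchart => bool" where
 "crel R (Chart n F) C' \<longleftrightarrow> fst C' = n & list_all2 (prel R) F (snd C')"
fun orel :: "(alg_num => kc => bool) => overlap => koverlap => bool" where
 "orel R (Overlap C G H) K \<longleftrightarrow> crel R C (fst K) & list_all2 (prel R) G (fst (snd K)) & list_all2 (prel R) H (snd (snd K))"
fun qrel :: "(alg_num => kc => bool) => piece => kpiece => bool" where
 "qrel R (Piece h j g) q \<longleftrightarrow> prel R h (fst q) & fst (snd q) = j & list_all2 (prel R) g (snd (snd q))"
fun drel :: "(alg_num => kc => bool) => problem => kproblem => bool" where
 "drel R (Problem Cs Os Fs i a) d \<longleftrightarrow> list_all2 (crel R) Cs (kCs d) & list_all2 (list_all2 (orel R)) Os (kOs d) &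
  list_all2 (list_all2 (list_all2 (qrel R))) Fs (kFs d) & fst (kstart d) = i & list_all2 R a (snd (kstart d))"

definition pnums :: "alg_poly => alg_num set" where "pnums P = fst ` set P"
fun cnums :: "chart => alg_num set" where "cnums (Chart n F) = \<Union>(pnums ` set F)"
fun onums :: "overlap => alg_num set" where
 "onums (Overlap C G H) = cnums C \<union> \<Union>(pnums ` set G) \<union> \<Union>(pnums ` set H)"
fun qnums :: "piece => alg_num set" where "qnums (Piece h j g) = pnums h \<union> \<Union>(pnums ` set g)"
fun dnums :: "problem => alg_num set" where
 "dnums (Problem Cs Os Fs i a) = \<Union>(cnums ` set Cs) \<union> (\<Union>v\<in>set Os. \<Union>(onums ` set v)) \<union>
  (\<Union>Ps\<in>set Fs. \<Union>Qs\<in>set Ps. \<Union>(qnums ` set Qs)) \<union> set a"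

lemma finite_cnums: "finite (cnums C)" by (cases C) (simp add: pnums_def)
lemma finite_onums: "finite (onums K)" by (cases K) (simp add: pnums_def finite_cnums)
lemma finite_qnums: "finite (qnums Q)" by (cases Q) (simp add: pnums_def)
lemma finite_dnums: "finite (dnums d)" by (cases d) (simp add: finite_cnums finite_onums finite_qnums)

lemma prel_mono: "prel R P P' ==> (!!c g. c : pnums P ==> R c g ==> R' c g) ==> prel R' P P'"
 unfolding prel_def pnums_def by (erule list.rel_mono_strong) auto
lemma prels_mono:
 assumes "list_all2 (prel R) F F'" and mono: "!!c g. c : \<Union>(pnums ` set F) ==> R c g ==> R' c g"
 shows "list_all2 (prel R') F F'"
 using assms(1) by (rule list.rel_mono_strong) (erule prel_mono, use mono in blast)
lemma crel_mono:
 assumes "crel R C C'" and mono: "!!c g. c : cnums C ==> R c g ==> R' c g"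
 shows "crel R' C C'"
proof (cases C)
 case (Chart n F)
 have "fst C' = n" and F: "list_all2 (prel R) F (snd C')" using assms(1) unfolding Chart by simp_all
 moreover have "list_all2 (prel R') F (snd C')" by (rule prels_mono[OF F], rule mono) (simp_all add: Chart)
 ultimately show ?thesis unfolding Chart by simp
qed
lemma orel_mono:
 assumes "orel R K K'" and mono: "!!c g. c : onums K ==> R c g ==> R' c g"
 shows "orel R' K K'"
proof (cases K)
 case (Overlap C G H)
 have 1: "crel R C (fst K')" and 2: "list_all2 (prel R) G (fst (snd K'))" and 3: "list_all2 (prel R) H (snd (snd K'))"
  using assms(1) unfolding Overlap by simp_all
 have "crel R' C (fst K')" by (rule crel_mono[OF 1], rule mono) (simp_all add: Overlap)
 moreover have "list_all2 (prel R') G (fst (snd K'))" by (rule prels_mono[OF 2], rule mono) (simp_all add: Overlap)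
 moreover have "list_all2 (prel R') H (snd (snd K'))" by (rule prels_mono[OF 3], rule mono) (simp_all add: Overlap)
 ultimately show ?thesis unfolding Overlap by simp
qed
lemma qrel_mono:
 assumes "qrel R Q Q'" and mono: "!!c g. c : qnums Q ==> R c g ==> R' c g"
 shows "qrel R' Q Q'"
proof (cases Q)
 case (Piece h j g)
 have 1: "prel R h (fst Q')" "fst (snd Q') = j" and 2: "list_all2 (prel R) g (snd (snd Q'))"
  using assms(1) unfolding Piece by simp_all
 have "prel R' h (fst Q')" by (rule prel_mono[OF 1(1)], rule mono) (simp_all add: Piece)
 moreover have "list_all2 (prel R') g (snd (snd Q'))" by (rule prels_mono[OF 2], rule mono) (simp_all add: Piece)
 ultimately show ?thesis unfolding Piece using 1 by simp
qed

lemma drel_mono: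
 assumes "drel R d d'" and mono: "!!c g. c : dnums d ==> R c g ==> R' c g"
 shows "drel R' d d'"
proof (cases d)
 case (Problem Cs Os Fs i a)
 have R: "list_all2 (crel R) Cs (kCs d')" "list_all2 (list_all2 (orel R)) Os (kOs d')"
  "list_all2 (list_all2 (list_all2 (qrel R))) Fs (kFs d')" "fst (kstart d') = i" "list_all2 R a (snd (kstart d'))"
  using assms(1) unfolding Problem by simp_all
 have m: "c : \<Union>(cnums ` set Cs) ==> R c g ==> R' c g" "c : (\<Union>v\<in>set Os. \<Union>(onums ` set v)) ==> R c g ==> R' c g"
  "c : (\<Union>Ps\<in>set Fs. \<Union>Qs\<in>set Ps. \<Union>(qnums ` set Qs)) ==> R c g ==> R' c g" "c : set a ==> R c g ==> R' c g" for c g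
  using mono unfolding Problem dnums.simps by blast+
 have "list_all2 (crel R') Cs (kCs d')"
  using R(1) by (rule list.rel_mono_strong) (erule crel_mono, use m(1) in blast)
 moreover have "list_all2 (list_all2 (orel R')) Os (kOs d')"
  using R(2) by (rule list.rel_mono_strong) (erule list.rel_mono_strong, erule orel_mono, use m(2) in blast)
 moreover have "list_all2 (list_all2 (list_all2 (qrel R'))) Fs (kFs d')"
  using R(3) by (rule list.rel_mono_strong)
  (erule list.rel_mono_strong, erule list.rel_mono_strong, erule qrel_mono, use m(3) in blast)
 moreover have "list_all2 R' a (snd (kstart d'))"
  using R(5) by (rule list.rel_mono_strong) (use m(4) in blast)
 ultimately show ?thesis unfolding Problem using R(4) by simp
qed

lemma list_all2_exists: "(!!x. x : set xs ==> EX y. R x y) ==> EX ys. list_all2 R xs ys"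
proof (induction xs)
 case (Cons x xs)
 then obtain y ys where "R x y" "list_all2 R xs ys" by (metis list.set_intros)
 then show ?case by (intro exI[of _ "y # ys"]) simp
qed (simp add: exI[of _ "[]"])

lemma drel_exists: "EX d'. drel (%c g. g = code c) d d'"
proof -
 let ?R = "%c g. g = code c"
 have p: "EX P'. prel ?R P P'" for P unfolding prel_def by (rule list_all2_exists) (auto intro: exI[of _ "(_, _)"])
 have ps: "EX F'. list_all2 (prel ?R) F F'" for F by (rule list_all2_exists) (rule p)
 have c: "EX C'. crel ?R C C'" for C
 proof (cases C)
  case (Chart n F)
  obtain F' where "list_all2 (prel ?R) F F'" using ps by blast
  then show ?thesis unfolding Chart by (intro exI[of _ "(n, F')"]) simp
 qed
 have o: "EX K'. orel ?R K K'" for K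
 proof (cases K)
  case (Overlap C G H)
  obtain C' G' H' where "crel ?R C C'" "list_all2 (prel ?R) G G'" "list_all2 (prel ?R) H H'" using ps c by metis
  then show ?thesis unfolding Overlap by (intro exI[of _ "(C', G', H')"]) simp
 qed
 have q: "EX Q'. qrel ?R Q Q'" for Q
 proof (cases Q)
  case (Piece h j g)
  obtain h' g' where "prel ?R h h'" "list_all2 (prel ?R) g g'" using ps p by metis
  then show ?thesis unfolding Piece by (intro exI[of _ "(h', j, g')"]) simp
 qed
 show ?thesis
 proof (cases d)
  case (Problem Cs Os Fs i a)
  obtain Cs' where "list_all2 (crel ?R) Cs Cs'" using list_all2_exists[of Cs "crel ?R"] c by blast
  moreover have os: "EX ys. list_all2 (orel ?R) xs ys" for xs by (rule list_all2_exists) (rule o)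
  have "EX ys. list_all2 (list_all2 (orel ?R)) Os ys" by (rule list_all2_exists) (rule os)
  moreover have qs: "EX ys. list_all2 (qrel ?R) xs ys" for xs by (rule list_all2_exists) (rule q)
  have qss: "EX ys. list_all2 (list_all2 (qrel ?R)) xs ys" for xs by (rule list_all2_exists) (rule qs)
  have "EX ys. list_all2 (list_all2 (list_all2 (qrel ?R))) Fs ys" by (rule list_all2_exists) (rule qss)
  moreover have "list_all2 ?R a (map code a)" by (simp add: list_all2_conv_all_nth)
  ultimately obtain Os' Fs' where "list_all2 (list_all2 (orel ?R)) Os Os'"
  "list_all2 (list_all2 (list_all2 (qrel ?R))) Fs Fs'" "list_all2 (crel ?R) Cs Cs'" "list_all2 ?R a (map code a)"
  by (elim exE) blast
  then show ?thesis unfolding Problem by (intro exI[of _ "(Cs', Os', Fs', i, map code a)"]) simp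
 qed
qed

lemma encode_list_enc: "encode_list (%x. enc (f x)) xs = enc (map f xs)"
 by (simp add: encode_list_def enc_list_def comp_def del: enc_list_simps)

lemma encode_list_nat: "encode_list f xs = enc (map f xs :: nat list)"
 using encode_list_enc[of f xs] by (simp add: enc_nat_def)

lemma enc_map_enc: "enc (map (%x. enc (f x)) xs) = enc (map f xs)"
 using encode_list_enc[of f xs] unfolding encode_list_nat .

lemma list_encode_enc: "list_encode ns = enc (ns :: nat list)"
 by (simp add: enc_list_def enc_nat_def)

lemma encode_poly_enc: "encode_poly P = enc (map (%t. enc (encode_num (fst t), snd t)) P)"
 unfolding encode_poly_def encode_list_nat[symmetric]
 by (intro arg_cong2[where f = encode_list] ext refl) (simp add: split_def list_encode_enc)

abbreviation "nrel tu \<equiv> %c. num_rel tu (encode_num c)"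

lemma poly_rel_iff: "poly_rel tu (encode_poly P) P' \<longleftrightarrow> prel (nrel tu) P P'"
proof -
 have "(EX u. enc (n, e) = (enc (u, e') :: nat) & num_rel tu u g) \<longleftrightarrow> e' = e & num_rel tu n g" for n :: nat and e e' :: "nat list" and g
  unfolding enc_eq by auto
 then show ?thesis unfolding poly_rel_def encode_poly_enc enc_eq prel_def
  by (simp add: list_all2_map1 del: enc_prod_simps)
qed

lemma polys_rel_iff: "polys_rel tu (encode_list encode_poly F) F' \<longleftrightarrow> list_all2 (prel (nrel tu)) F F'"
 unfolding polys_rel_def encode_list_nat enc_eq by (simp add: list_all2_map1 poly_rel_iff)

lemma chart_rel_iff: "chart_rel tu (encode_chart C) C' \<longleftrightarrow> crel (nrel tu) C C'"
 by (cases C) (auto simp: chart_rel_def polys_rel_iff)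

lemma overlap_rel_iff: "overlap_rel tu (encode_overlap K) K' \<longleftrightarrow> orel (nrel tu) K K'"
 by (cases K) (simp add: overlap_rel_def chart_rel_iff polys_rel_iff list_encode_enc del: enc_list_simps list_encode.simps)

lemma piece_rel_iff: "piece_rel tu (encode_piece Q) Q' \<longleftrightarrow> qrel (nrel tu) Q Q'"
 by (cases Q) (auto simp: piece_rel_def poly_rel_iff polys_rel_iff list_encode_enc simp del: enc_list_simps list_encode.simps)

lemma problem_rel_iff: "problem_rel tu (encode_problem d) d' \<longleftrightarrow> drel (nrel tu) d d'"
proof (cases d)
 case (Problem Cs Os Fs i a)
 have 0: "encode_list f = (%x. enc (map f x))" for f :: "'a => nat" by (rule ext) (rule encode_list_nat)
 have 1: "encode_list (encode_list f) = (%x. enc (map (map f) x))" for f :: "'a => nat"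
  unfolding 0[of f] by (rule ext) (rule encode_list_enc)
 have 2: "encode_list (encode_list (encode_list f)) = (%x. enc (map (map (map f)) x))" for f :: "'a => nat"
  unfolding 1[of f] by (rule ext) (rule encode_list_enc)
 have e: "encode_problem d = enc [enc (map encode_chart Cs), enc (map (map encode_overlap) Os),
  enc (map (map (map encode_piece)) Fs), i, enc (map encode_num a)]"
  unfolding Problem encode_problem.simps list_encode_enc by (simp only: 2 1 encode_list_nat enc_map_enc)
 show ?thesis unfolding problem_rel_def e enc_eq unfolding Problem
  by (auto simp: list_all2_map1 chart_rel_iff overlap_rel_iff piece_rel_iff simp del: enc_list_simps)
qed

abbreviation "same_value th \<equiv> %c g. kval th g = num_value c"

lemma icoeff_high: "(!!t. t : set a ==> snd t < n) ==> n <= e ==> icoeff a e = 0"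
 by (induction a) fastforce+

lemma root_algebraic:
 assumes "fwf f" "tval th (fterms f) = 0"
 shows "algebraic th"
proof (rule algebraicI)
 have "coeff (map_poly of_int (ip (fterms f)) :: complex poly) (fst f) = of_int (fst (snd f))"
  using assms(1) icoeff_high[of "snd (snd f)" "fst f" "fst f"] by (simp add: coeff_map_poly coeff_ip fterms_def fwf_def)
 then show "map_poly of_int (ip (fterms f)) ~= (0 :: complex poly)" using assms(1) unfolding fwf_def by auto
qed (use assms in \<open>auto simp: coeff_map_poly poly_ip\<close>)

lemma reads_sound:
 assumes r: "reads (encode_problem d) tu d'" and iso: "!!c. c : dnums d ==> EX z. isolates c z"
 shows "EX th. algebraic th & fwf (fst tu) & tval th (fterms (fst tu)) = 0 & drel (same_value th) d d'"
proof -
 obtain f x N where tu: "tu = (f, x, N)" by (metis prod_cases3)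
 have rc: "fwf f" "cmod (tval (gval x) (fterms f)) < \<bar>of_int (fst (snd f))\<bar> * (1 / real (N + 1)) ^ fst f"
  using r root_check_iff unfolding reads_def tu by auto
 obtain th where th: "tval th (fterms f) = 0" "cmod (th - gval x) < 1 / real (N + 1)"
  using exists_near_root[OF rc] by auto
 have "drel (nrel tu) d d'" using r unfolding reads_def problem_rel_iff by simp
 then have "drel (same_value th) d d'"
  by (rule drel_mono) (use iso num_rel_sound[OF th] tu in blast)
 then show ?thesis using th(1) rc(1) root_algebraic[OF rc(1) th(1)] tu by (intro exI[of _ th]) simp
qed

lemma reads_complete:
 assumes th: "algebraic th" and iso: "!!c. c : dnums d ==> EX z. isolates c z" and mem: "num_value ` dnums d <= adjoin th"
 shows "EX tu d'. reads (encode_problem d) tu d' & minimal_cert (fst tu) th & drel (same_value th) d d'"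
proof -
 obtain f where f: "minimal_cert f th" using exists_minimal_cert[OF th] by blast
 define code where "code c = (SOME g. kval th g = num_value c)" for c
 have code: "kval th (code c) = num_value c" if "c : dnums d" for c
  unfolding code_def by (rule someI_ex, rule kval_surj) (use that mem in auto)
 obtain d' where d': "drel (%c g. g = code c) d d'" using drel_exists by blast
 have "EX tu. fst tu = f & root_check tu & (\<forall>(c, g)\<in>(%c. (c, code c)) ` dnums d. num_rel tu (encode_num c) g)"
 proof (rule exists_location[OF f])
  fix c g assume "(c, g) : (%c. (c, code c)) ` dnums d"
  then show "isolates c (kval th g)" using code iso num_value_isolates by fastforce
 qed (simp add: finite_dnums)
 then obtain tu where tu: "fst tu = f" "root_check tu" and all: "\<forall>(c, g)\<in>(%c. (c, code c)) ` dnums d. num_rel tu (encode_num c) g"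
  by blast
 have \<tau>3: "num_rel tu (encode_num c) (code c)" if "c : dnums d" for c using bspec[OF all imageI[OF that]] by simp
 have "drel (nrel tu) d d'" using d' by (rule drel_mono) (use \<tau>3 in blast)
 moreover have "drel (same_value th) d d'" using d' by (rule drel_mono) (use code in blast)
 ultimately show ?thesis unfolding reads_def problem_rel_iff using tu f by blast
qed

section \<open>Unit certificates\<close>

text \<open>Each step of an argument for completeness needs finitely many algebraic numbers in the field.
 The properties that hold for all sufficiently large fields form a filter, in which finitely many
 steps are combined.\<close>

definition evt :: "(complex => bool) => bool" where
 "evt Q \<longleftrightarrow> (EX Z. finite Z & (ALL z:Z. algebraic z) & (ALL th. algebraic th & Z <= adjoin th --> Q th))"

lemma evt_adjoin: "finite Z ==> (!!z. z : Z ==> algebraic z) ==> evt (%th. algebraic th & Z <= adjoin th)"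
 unfolding evt_def by blast
lemma evt_mono: "evt Q ==> (!!th. Q th ==> R th) ==> evt R"
 unfolding evt_def by meson
lemma evt_conj: "evt Q ==> evt R ==> evt (%th. Q th & R th)"
proof -
 assume "evt Q" "evt R"
 then obtain Z Z' where Z: "finite Z" "ALL z:Z. algebraic z" "!!th. algebraic th ==> Z <= adjoin th ==> Q th"
  "finite Z'" "ALL z:Z'. algebraic z" "!!th. algebraic th ==> Z' <= adjoin th ==> R th"
  unfolding evt_def by metis
 then show ?thesis unfolding evt_def by (intro exI[of _ "Z \<union> Z'"]) auto
qed
lemma evt_True: "(!!th. Q th) ==> evt Q" unfolding evt_def by (intro exI[of _ "{}"]) simp
lemma evt_ball: "finite I ==> (!!i. i : I ==> evt (Q i)) ==> evt (%th. ALL i:I. Q i th)"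
 by (induction I rule: finite_induct) (auto intro: evt_True evt_conj)
lemma evt_ex: "evt Q ==> EX th. Q th"
 unfolding evt_def using primitive_element by meson

abbreviation "kz th \<equiv> %x. kval th x = 0"

lemma monomial_value_0: "length a = n ==> monomial_value a (replicate n 0) = 1"
 by (subst monomial_value_prod) auto

lemma teval_concat: "teval (concat Ps) a = (\<Sum>P\<leftarrow>Ps. teval P a)"
 by (induction Ps) simp_all

lemma kvp_concat: "kvp th (concat Ps) = concat (map (kvp th) Ps)"
 by (simp add: kvp_def map_concat)

lemma kvp_snd: "t : set (kvp th q) ==> snd t : snd ` set q"
 by (force simp: kvp_def)

lemma kunit_cert_value:
 assumes k: "kunit_cert Z n zs" and Z: "!!x. Z x ==> kval th x = 0" and a: "length a = n"
 shows "(\<Sum>z\<leftarrow>zs. teval (kvp th (fst z)) a * teval (kvp th (snd z)) a) = 1"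
proof -
 define T where "T = (kint (-1), replicate n 0) # concat (map (%z. ktmul (fst z) (snd z)) zs)"
 have l: "ALL z:set zs. (ALL t:set (fst z). length (snd t) = n) & (ALL t:set (snd z). length (snd t) = n)"
  using k unfolding kunit_cert_def by (rule conjunct1)
 have len: "length (snd t) = n" if z: "z : set zs" "t : set (kvp th (fst z)) \<or> t : set (kvp th (snd z))" for z t
 proof -
  have "snd t : snd ` set (fst z) \<or> snd t : snd ` set (snd z)" using z(2) kvp_snd by blast
  then show ?thesis using bspec[OF l z(1)] by (metis imageE)
 qed
 have T0: "Z (kcoeff T (snd t))" if "t : set T" for t using k that unfolding kunit_cert_def T_def by blast
 have "teval (kvp th T) a = (\<Sum>e\<in>snd ` set (kvp th T). tcoeff (kvp th T) e * monomial_value a e)"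
  by (rule teval_by_coefficients) auto
 also have "... = 0"
 proof (intro sum.neutral ballI)
  fix e assume "e : snd ` set (kvp th T)"
  then obtain t where "t : set T" "e = snd t" unfolding kvp_def by auto
  then show "tcoeff (kvp th T) e * monomial_value a e = 0" using Z[OF T0] kval_kcoeff[of th T e] by simp
 qed
 finally have "teval (kvp th T) a = 0" .
 moreover have "teval (kvp th T) a = - 1 + (\<Sum>z\<leftarrow>zs. teval (tmul (kvp th (fst z)) (kvp th (snd z))) a)"
  unfolding T_def kvp_Cons kvp_concat by (simp add: kval_ops monomial_value_0[OF a] teval_concat comp_def kvp_ktmul)
 moreover have "(\<Sum>z\<leftarrow>zs. teval (tmul (kvp th (fst z)) (kvp th (snd z))) a) = (\<Sum>z\<leftarrow>zs. teval (kvp th (fst z)) a * teval (kvp th (snd z)) a)"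
  by (intro arg_cong[where f = sum_list] map_cong refl teval_tmul) (use len a in auto)
 ultimately show ?thesis by simp
qed

lemma sum_list_zero: "(!!x. x : set xs ==> f x = 0) ==> (\<Sum>x\<leftarrow>xs. f x) = (0 :: complex)"
 by (induction xs) auto

lemma kunit_no_zero:
 assumes k: "kunit Z n gs" and Z: "!!x. Z x ==> kval th x = 0" and a: "length a = n"
 shows "EX g:set (map (kvp th) gs). teval g a ~= 0"
proof (rule ccontr)
 assume no: "~ ?thesis"
 obtain zs where zs: "map snd zs = gs" "kunit_cert Z n zs" using k unfolding kunit_def by auto
 have s: "teval (kvp th (snd z)) a = 0" if "z : set zs" for z using no zs(1) that by auto
 have "(\<Sum>z\<leftarrow>zs. teval (kvp th (fst z)) a * teval (kvp th (snd z)) a) = 0"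
  by (rule sum_list_zero) (simp add: s)
 then show False using kunit_cert_value[OF zs(2) Z a] by simp
qed

lemma unit_terms_no_zero:
 assumes u: "unit_terms n gs" and a: "length a = n" and wf: "!!g. g : set gs ==> wf_terms n g"
 shows "EX g:set gs. teval g a ~= 0"
proof (rule ccontr)
 assume no: "~ ?thesis"
 obtain qs where qs: "length qs = length gs" "!!q. q : set qs ==> wf_terms n q"
  "!!e. length e = n ==> tcoeff (concat (map2 tmul qs gs)) e = (if e = replicate n 0 then 1 else 0)"
  using u unfolding unit_terms_def by metis
 define T where "T = concat (map2 tmul qs gs)"
 have mem: "q : set qs & g : set gs" if "(q, g) : set (zip qs gs)" for q g
  using that by (auto dest: set_zip_leftD set_zip_rightD)
 have len: "length (snd t) = n" if t: "t : set T" for t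
 proof -
  obtain q g where "(q, g) : set (zip qs gs)" and t': "t : set (tmul q g)" using t unfolding T_def by auto
  then show ?thesis using mem qs(2) wf by (intro tmul_lengths[OF _ _ t']) (blast intro: wf_terms_length)+
 qed
 let ?E = "insert (replicate n 0) (snd ` set T)"
 have "teval T a = (\<Sum>e\<in>?E. tcoeff T e * monomial_value a e)" by (rule teval_by_coefficients) auto
 also have "... = (\<Sum>e\<in>?E. if e = replicate n 0 then 1 else 0)"
  by (intro sum.cong refl) (use len qs(3) monomial_value_0[OF a] in \<open>auto simp: T_def[symmetric]\<close>)
 also have "... = 1" by (simp add: sum.delta)
 finally have 1: "teval T a = 1" .
 have "teval (tmul q g) a = 0" if "(q, g) : set (zip qs gs)" for q g
 proof -
  have "teval (tmul q g) a = teval q a * teval g a"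
  using mem[OF that] qs(2) wf a by (intro teval_tmul) (blast intro: wf_terms_length)+
  then show ?thesis using no mem[OF that] by simp
 qed
 then have "(\<Sum>P\<leftarrow>map2 tmul qs gs. teval P a) = 0"
  by (intro sum_list_zero) auto
 then show False using 1 unfolding T_def teval_concat by simp
qed

lemma kvp_surj:
 assumes "!!t. t : set q ==> fst t : adjoin th"
 shows "EX q'. kvp th q' = q"
 using assms
proof (induction q)
 case (Cons t q)
 then obtain q' g where "kvp th q' = q" "kval th g = fst t" using kval_surj by (metis list.set_intros)
 then show ?case by (intro exI[of _ "(g, snd t) # q'"]) (simp add: kvp_Cons)
qed (simp add: kvp_def)

text \<open>The coefficients of a representation of the unit are the numbers that the field has to
 contain.\<close>

lemma kunit_complete:
 assumes u: "unit_terms n gs" and wf: "!!g. g : set gs ==> wf_terms n g"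
 shows "evt (%th. ALL gs'. map (kvp th) gs' = gs --> kunit (kz th) n gs')"
proof -
 obtain qs where qs: "length qs = length gs" "!!q. q : set qs ==> wf_terms n q"
  "!!e. length e = n ==> tcoeff (concat (map2 tmul qs gs)) e = (if e = replicate n 0 then 1 else 0)"
  using u unfolding unit_terms_def by metis
 have "evt (%th. algebraic th & (\<Union>q\<in>set qs. fst ` set q) <= adjoin th)"
  by (rule evt_adjoin) (use qs(2) in \<open>fastforce simp: wf_terms_def\<close>)+
 then show ?thesis
 proof (rule evt_mono, intro allI impI)
  fix th gs' assume th: "algebraic th & (\<Union>q\<in>set qs. fst ` set q) <= adjoin th" and gs': "map (kvp th) gs' = gs"
  have "EX q'. kvp th q' = q" if "q : set qs" for q by (rule kvp_surj) (use that th in blast)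
  then obtain r where r: "!!q. q : set qs ==> kvp th (r q) = q" by metis
  define zs where "zs = zip (map r qs) gs'"
  have l: "length qs = length gs'" using qs(1) gs' by auto
  have snd: "map snd zs = gs'" unfolding zs_def using l by simp
  have len: "length (snd t) = n" if "kvp th h = g" "wf_terms n g" "t : set h" for h g t
  proof -
  have "(kval th (fst t), snd t) : set g" using that(1,3) unfolding kvp_def by force
  then show ?thesis using wf_terms_length[OF that(2)] by fastforce
  qed
  have z: "(ALL t:set (fst z). length (snd t) = n) & (ALL t:set (snd z). length (snd t) = n)" if "z : set zs" for z
  proof -
  have zz: "(fst z, snd z) : set (zip (map r qs) gs')" using that unfolding zs_def by simp
  have "fst z : set (map r qs)" by (rule set_zip_leftD[OF zz])
  then obtain q where q: "q : set qs" "fst z = r q" by auto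
  have "snd z : set gs'" by (rule set_zip_rightD[OF zz])
  then have "kvp th (snd z) : set gs" unfolding gs'[symmetric] by simp
  then have "wf_terms n (kvp th (snd z))" by (rule wf)
  moreover have "wf_terms n (kvp th (fst z))" using qs(2)[OF q(1)] r[OF q(1)] q(2) by simp
  ultimately have "wf_terms n (kvp th (fst z))" "wf_terms n (kvp th (snd z))" by simp_all
  then show ?thesis using len[OF refl, of "fst z"] len[OF refl, of "snd z"] by blast
  qed
  define T where "T = (kint (-1), replicate n 0) # concat (map (%z. ktmul (fst z) (snd z)) zs)"
  have kT: "kvp th T = (-1, replicate n 0) # concat (map2 tmul qs gs)"
  proof -
  have "map (%z. tmul (kvp th (fst z)) (kvp th (snd z))) zs = map2 tmul qs gs"
  unfolding zs_def gs'[symmetric] using l r by (intro nth_equalityI) auto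
  then show ?thesis unfolding T_def kvp_Cons kvp_concat by (simp add: kval_ops comp_def kvp_ktmul)
  qed
  have lT: "length (snd t) = n" if t: "t : set T" for t
  proof (cases "t = (kint (-1), replicate n 0)")
  case False
  then obtain z where "z : set zs" "t : set (ktmul (fst z) (snd z))" using t unfolding T_def by auto
  then show ?thesis using z[of z] unfolding ktmul_def eadd_map2 by fastforce
  qed simp
  have "kval th (kcoeff T (snd t)) = 0" if t: "t : set T" for t
  unfolding kval_kcoeff kT using qs(3)[OF lT[OF t]] by (simp add: tcoeff_def)
  then show "kunit (kz th) n gs'" unfolding kunit_def kunit_cert_def
  using snd z unfolding T_def by (intro exI[of _ zs]) blast
 qed
qed

section \<open>What the searches find\<close>

lemma list_all2_ex2: "list_all2 R xs ys ==> y : set ys ==> EX x:set xs. R x y"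
 by (induction rule: list_all2_induct) auto
lemma list_all2_ex1: "list_all2 R xs ys ==> x : set xs ==> EX y:set ys. R x y"
 by (induction rule: list_all2_induct) auto

lemma same_value_kvp: "prel (same_value th) P P' ==> kvp th P' = vals P"
proof -
 assume "prel (same_value th) P P'"
 then have "list_all2 (%t u. snd u = snd t & kval th (fst u) = num_value (fst t)) P P'" by (simp add: prel_def)
 then show ?thesis by (induction rule: list_all2_induct) (simp_all add: kvp_def vals_def split_def)
qed

lemma same_value_kvps: "list_all2 (prel (same_value th)) F F' ==> map (kvp th) F' = map vals F"
 by (induction rule: list_all2_induct) (simp_all add: same_value_kvp)

definition cval :: "complex => kstate => state" where
 "cval th k = (fst k, map (kval th) (snd k))"

lemma cval_simps[simp]: "fst (cval th k) = fst k" "snd (cval th k) = map (kval th) (snd k)"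
 by (simp_all add: cval_def)

lemma cval_surj: "set (snd w) <= adjoin th ==> EX k. cval th k = w"
proof -
 assume "set (snd w) <= adjoin th"
 then have "ALL z:set (snd w). EX x. kval th x = z" using kval_surj by blast
 then obtain c where "!!z. z : set (snd w) ==> kval th (c z) = z" by metis
 then show ?thesis by (intro exI[of _ "(fst w, map c (snd w))"]) (simp add: cval_def map_idI prod_eq_iff)
qed

text \<open>A state is a chart with a list of coordinates.  The soundness of a search is stated for any
 test \<open>Z\<close> that accepts only codes of zero.\<close>

locale presented_problem = presented X U y Cs Os for X :: "('p, 's) space" and U y Cs Os +
 fixes Fs :: "piece list list list" and fs :: "('p, 's) mor list" and i0 :: nat and a0 :: "alg_num list" and x0 :: 'p
 assumes endo: "!!s. s < length fs ==> endomorphism X (fs ! s)"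
  and endo_pres: "list_all2 (presents_endomorphism X U y Cs) Fs fs"
  and point: "presents_point X U y Cs i0 a0 x0" and rational: "x0 : rational_points X"
begin

definition d :: problem where "d = Problem Cs Os Fs i0 a0"
definition F :: "nat => 'p => 'p" where "F s p = fst (fs ! s) p"
definition Pt :: "state => 'p => bool" where "Pt w p \<longleftrightarrow> P (fst w) (snd w) p"
definition start :: state where "start = (i0, map num_value a0)"
definition cstep :: "nat => state => state => bool" where
 "cstep s w w' \<longleftrightarrow> s < length fs & (EX h j g. Piece h j g : set (Fs ! s ! fst w) & teval (vals h) (snd w) ~= 0 &
  w' = (j, map (%q. teval (vals q) (snd w) / teval (vals h) (snd w)) g))"
definition orb :: "'p set" where "orb = {fold F w x0 | w. set w <= {..<length fs}}"

abbreviation "match th d' \<equiv> drel (same_value th) d d'"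

lemma Fs_pres: "s < length fs ==> presents_endomorphism X U y Cs (Fs ! s) (fs ! s)"
 using endo_pres by (simp add: list_all2_conv_all_nth)

lemma Pt_unique: "Pt w p ==> Pt w p' ==> p = p'" unfolding Pt_def by (rule pt_unique)

lemma Pt_facts: "Pt w p ==> fst w < length Cs & length (snd w) = dim (Cs ! fst w)"
 unfolding Pt_def pt_def by simp

lemma Pt_algebraic: "Pt w p ==> c : set (snd w) ==> algebraic c"
 unfolding Pt_def by (rule pt_algebraic)

lemma Pt_start: "Pt start x0"
proof -
 have f: "i0 < length Cs" "x0 : U i0" "length a0 = dim (Cs ! i0)"
  "!!l. l < length a0 ==> (EX z. isolates (a0 ! l) z) &
  vanishes X (U i0) x0 (y i0 l \<ominus>\<^bsub>sect X (U i0)\<^esub> cst X (U i0) (num_value (a0 ! l)))"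
  using point unfolding presents_point_def by auto
 have "y i0 l : carrier (sect X (U i0))" if "l < length a0" for l
  using chart_facts(2)[OF f(1)] f(3) that unfolding algebra_generators_def by auto
 then have "value_at X (U i0) x0 (y i0 l) (num_value (a0 ! l))" if "l < length a0" for l
  using f(4)[OF that] num_value_algebraic that unfolding value_at_def by blast
 then show ?thesis unfolding Pt_def pt_def start_def using f rational by simp
qed

lemma cstep_Pt: "Pt w p ==> cstep s w w' ==> Pt w' (F s p)"
 unfolding cstep_def Pt_def F_def using pt_step[OF endo Fs_pres] by fastforce

lemma cstep_exists: "Pt w p ==> s < length fs ==> EX w'. cstep s w w'"
 unfolding cstep_def Pt_def using pt_piece_exists[OF Fs_pres, of s "fst w" "snd w" p] by blast

lemma start_match: "match th d' ==> cval th (kstart d') = start"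
proof -
 assume "match th d'"
 then have "fst (kstart d') = i0" "list_all2 (same_value th) a0 (snd (kstart d'))" unfolding d_def by simp_all
 then show ?thesis unfolding start_def cval_def by (simp add: list_all2_conv_all_nth list_eq_iff_nth_eq)
qed

lemma pieces_match:
 assumes "match th d'" "s < length fs" "i < length Cs"
 shows "s < length (kFs d') & i < length (kFs d' ! s) & list_all2 (qrel (same_value th)) (Fs ! s ! i) (kFs d' ! s ! i)"
proof -
 have m: "list_all2 (list_all2 (list_all2 (qrel (same_value th)))) Fs (kFs d')" using assms(1) unfolding d_def by simp
 have l: "length Fs = length fs" by (rule list_all2_lengthD[OF endo_pres])
 have 1: "list_all2 (list_all2 (qrel (same_value th))) (Fs ! s) (kFs d' ! s)" using list_all2_nthD[OF m] l assms(2) by simp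
 have l': "length (Fs ! s) = length Cs" using Fs_pres[OF assms(2)] unfolding presents_endomorphism_def by simp
 have "list_all2 (qrel (same_value th)) (Fs ! s ! i) (kFs d' ! s ! i)" using list_all2_nthD[OF 1] l' assms(3) by simp
 then show ?thesis using list_all2_lengthD[OF m] list_all2_lengthD[OF 1] l l' assms by simp
qed

lemma length_kFs: "match th d' ==> length (kFs d') = length fs"
 using list_all2_lengthD[OF endo_pres] list_all2_lengthD unfolding d_def drel.simps by metis

lemma kstep_sound:
 assumes m: "match th d'" and Z: "!!x. Z x ==> kval th x = 0" and k: "kstep Z d' s k k'" and i: "fst k < length Cs"
 shows "cstep s (cval th k) (cval th k')"
proof -
 obtain Ps Qs q where "nth_rel (kFs d') s Ps" "nth_rel Ps (fst k) Qs" and q: "q : set Qs" "knz Z (keval (fst q) (snd k))"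
  "fst k' = fst (snd q)" "list_all2 (%g b. Z (kadd (kmul (keval (fst q) (snd k)) b) (kneg (keval g (snd k))))) (snd (snd q)) (snd k')"
  using k unfolding kstep_def by blast
 then have s: "s < length fs" and Qs: "Qs = kFs d' ! s ! fst k" using length_kFs[OF m] unfolding nth_rel_def by auto
 obtain Q where Q: "Q : set (Fs ! s ! fst k)" "qrel (same_value th) Q q"
  using list_all2_ex2[of "qrel (same_value th)" "Fs ! s ! fst k" Qs q] pieces_match[OF m s i] Qs q(1) by blast
 obtain h j g where Qh: "Q = Piece h j g" by (cases Q)
 have h: "kvp th (fst q) = vals h" and j: "fst (snd q) = j" and g: "list_all2 (prel (same_value th)) g (snd (snd q))"
  using Q(2) same_value_kvp unfolding Qh by auto
 let ?a = "map (kval th) (snd k)"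
 have H: "kval th (keval (fst q) (snd k)) = teval (vals h) ?a" by (simp add: kval_keval h)
 obtain v where "Z (kadd (kmul (keval (fst q) (snd k)) v) (kint (-1)))" using q(2) unfolding knz_def by auto
 then have "teval (vals h) ?a * kval th v + - 1 = 0" using Z H by (fastforce simp: kval_ops)
 then have h0: "teval (vals h) ?a ~= 0" by auto
 have "map (kval th) (snd k') = map (%q. teval (vals q) ?a / teval (vals h) ?a) g"
 proof (rule nth_equalityI)
  show l: "length (map (kval th) (snd k')) = length (map (%q. teval (vals q) ?a / teval (vals h) ?a) g)"
  using list_all2_lengthD[OF q(4)] list_all2_lengthD[OF g] by simp
  fix l assume "l < length (map (kval th) (snd k'))"
  then have l1: "l < length (snd k')" and l2: "l < length g" "l < length (snd (snd q))"
  using l list_all2_lengthD[OF g] by simp_all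
  have "Z (kadd (kmul (keval (fst q) (snd k)) (snd k' ! l)) (kneg (keval (snd (snd q) ! l) (snd k))))"
  using list_all2_nthD[OF q(4) l2(2)] .
  then have "teval (vals h) ?a * kval th (snd k' ! l) + - teval (kvp th (snd (snd q) ! l)) ?a = 0"
  using Z H kval_keval by (fastforce simp: kval_ops)
  moreover have "kvp th (snd (snd q) ! l) = vals (g ! l)" by (rule same_value_kvp[OF list_all2_nthD[OF g l2(1)]])
  ultimately have "kval th (snd k' ! l) = teval (vals (g ! l)) ?a / teval (vals h) ?a" using h0 by (simp add: field_simps)
  then show "map (kval th) (snd k') ! l = map (%q. teval (vals q) ?a / teval (vals h) ?a) g ! l" using l1 l2 by simp
 qed
 then show ?thesis unfolding cstep_def using s Q(1) Qh h0 q(3) j by (auto simp: cval_def)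
qed

lemma cstep_lift:
 assumes m: "match th d'" and th: "algebraic th" and c: "cstep s (cval th k) w'" and p: "Pt (cval th k) p"
 shows "EX k'. cval th k' = w'" and "cval th k' = w' ==> kstep (kz th) d' s k k'"
proof -
 let ?a = "map (kval th) (snd k)"
 obtain h j g where s: "s < length fs" and Q: "Piece h j g : set (Fs ! s ! fst k)" and h0: "teval (vals h) ?a ~= 0"
  and w': "w' = (j, map (%q. teval (vals q) ?a / teval (vals h) ?a) g)" using c unfolding cstep_def by auto
 have i: "fst k < length Cs" using Pt_facts[OF p] by simp
 note pm = pieces_match[OF m s i]
 obtain q where q: "q : set (kFs d' ! s ! fst k)" "qrel (same_value th) (Piece h j g) q"
  using list_all2_ex1[OF _ Q] pm by blast
 have h: "kvp th (fst q) = vals h" and j: "fst (snd q) = j" and g: "list_all2 (prel (same_value th)) g (snd (snd q))"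
  using q(2) same_value_kvp by auto
 have H: "kval th (keval (fst q) (snd k)) = teval (vals h) ?a" by (simp add: kval_keval h)
 have G: "kval th (keval (snd (snd q) ! l) (snd k)) = teval (vals (g ! l)) ?a" if "l < length g" for l
  using same_value_kvp[OF list_all2_nthD[OF g that]] by (simp add: kval_keval)
 have mem: "teval (vals r) ?a / teval (vals h) ?a : adjoin th" if "r : set g" for r
  using that G H kval_mem_adjoin[OF th] adjoin_divide[OF th] by (metis in_set_conv_nth)
 show "EX k'. cval th k' = w'" by (rule cval_surj) (use mem w' in auto)
 assume k': "cval th k' = w'"
 have fk: "fst k' = j" and sk: "map (kval th) (snd k') = map (%q. teval (vals q) ?a / teval (vals h) ?a) g"
  using k' unfolding w' cval_def by simp_all
 have "inverse (teval (vals h) ?a) : adjoin th" using H kval_mem_adjoin[OF th] adjoin_inverse[OF th] by metis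
 then obtain v where v: "kval th v = inverse (teval (vals h) ?a)" using kval_surj by blast
 have k1: "knz (kz th) (keval (fst q) (snd k))" unfolding knz_def
  by (rule exI[of _ v]) (simp add: kval_ops H v h0)
 have k2: "list_all2 (%g b. kval th (kadd (kmul (keval (fst q) (snd k)) b) (kneg (keval g (snd k)))) = 0) (snd (snd q)) (snd k')"
 proof (rule list_all2_all_nthI)
  show l: "length (snd (snd q)) = length (snd k')" using arg_cong[OF sk, of length] list_all2_lengthD[OF g] by simp
  fix l assume "l < length (snd (snd q))"
  then have l2: "l < length g" and l1: "l < length (snd k')" using l list_all2_lengthD[OF g] by simp_all
  have "kval th (snd k' ! l) = teval (vals (g ! l)) ?a / teval (vals h) ?a" using arg_cong[OF sk, of "%xs. xs ! l"] l1 l2 by simp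
  then show "kval th (kadd (kmul (keval (fst q) (snd k)) (snd k' ! l)) (kneg (keval (snd (snd q) ! l) (snd k)))) = 0"
  using h0 by (simp add: kval_ops H G[OF l2])
 qed
 show "kstep (kz th) d' s k k'" unfolding kstep_def nth_rel_def
  by (rule exI[of _ "kFs d' ! s"], rule exI[of _ "kFs d' ! s ! fst k"], intro conjI bexI[of _ q])
  (use pm in blast, rule refl, use pm in blast, rule refl, rule k1, use fk j in simp, rule k2, rule q(1))
qed

lemma overlap_match:
 assumes m: "match th d'" and ij: "i < length Cs" "j < length Cs" and O: "Os ! i ! j = Overlap C G H"
 shows "i < length (kOs d') & j < length (kOs d' ! i) & fst (fst (kOs d' ! i ! j)) = dim C &
  map (kvp th) (snd (fst (kOs d' ! i ! j))) = map vals (chart_eqs C) &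
  map (kvp th) (fst (snd (kOs d' ! i ! j))) = map vals G & map (kvp th) (snd (snd (kOs d' ! i ! j))) = map vals H"
proof -
 have l: "length Os = length Cs" "length (Os ! i) = length Cs" using PV ij unfolding presents_variety_def by auto
 have m1: "list_all2 (list_all2 (orel (same_value th))) Os (kOs d')" using m unfolding d_def by simp
 have m2: "list_all2 (orel (same_value th)) (Os ! i) (kOs d' ! i)" using list_all2_nthD[OF m1] l ij by simp
 have "orel (same_value th) (Os ! i ! j) (kOs d' ! i ! j)" using list_all2_nthD[OF m2, of j] l ij by simp
 then have m3: "orel (same_value th) (Overlap C G H) (kOs d' ! i ! j)" unfolding O .
 obtain n E where C: "C = Chart n E" by (cases C)
 show ?thesis using m3 list_all2_lengthD[OF m1] list_all2_lengthD[OF m2] l ij same_value_kvps unfolding C by auto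
qed

lemma kapart_kvp: "map (kvp th) (kapart m G a) = apart_terms m (map (kvp th) G) (map (kval th) a)"
 unfolding kapart_def apart_terms_def by (simp add: zip_map_map comp_def split_def kvp_Cons kval_ops)

lemma apart_terms_zero:
 assumes "map (%g. teval g z) gs = a" "length z = m" "q : set (apart_terms m gs a)"
 shows "teval q z = 0"
proof -
 obtain g c where gc: "(g, c) : set (zip gs a)" "q = (- c, replicate m 0) # g" using assms(3) unfolding apart_terms_def by auto
 then have "c = teval g z" using assms(1) by (auto simp: set_zip)
 then show ?thesis using gc(2) monomial_value_0[OF assms(2)] by simp
qed

lemma overlap_wf:
 assumes ij: "i < length Cs" "j < length Cs" and O: "Os ! i ! j = Overlap C G H"
 shows "!!g. g : set (chart_eqs C) ==> wf_terms (dim C) (vals g)" "!!g. g : set G \<union> set H ==> wf_terms (dim C) (vals g)"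
proof -
 obtain z where "overlap_coords i j C G H z" using overlap[OF ij O] by blast
 then show "!!g. g : set (chart_eqs C) ==> wf_terms (dim C) (vals g)" "!!g. g : set G \<union> set H ==> wf_terms (dim C) (vals g)"
  unfolding overlap_coords_def using wf_vals by auto
qed

text \<open>If the points were different, the certificate for this, evaluated at the point of the overlap,
 would read \<open>1 = 0\<close>.\<close>

lemma kEq_sound:
 assumes m: "match th d'" and Z: "!!x. Z x ==> kval th x = 0" and k: "kEq Z d' k k'"
  and p: "Pt (cval th k) p" and p': "Pt (cval th k') p'"
 shows "p = p'"
proof (rule ccontr)
 assume ne: "p ~= p'"
 have ij: "fst k < length Cs" "fst k' < length Cs" using Pt_facts[OF p] Pt_facts[OF p'] by simp_all
 obtain C G H where O: "Os ! fst k ! fst k' = Overlap C G H" by (cases "Os ! fst k ! fst k'")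
 define R where "R = kOs d' ! fst k ! fst k'"
 note om = overlap_match[OF m ij O, folded R_def]
 obtain z where z: "length z = fst (fst R)" "!!g. g : set (snd (fst R)) ==> Z (keval g z)"
  "list_all2 (%g a. Z (kadd (keval g z) (kneg a))) (fst (snd R)) (snd k)"
  "list_all2 (%g a. Z (kadd (keval g z) (kneg a))) (snd (snd R)) (snd k')"
  using k unfolding kEq_def nth_rel_def R_def by blast
 define v where "v = map (kval th) z"
 have lv: "length v = dim C" using z(1) om unfolding v_def by simp
 have eqs: "teval g v = 0" if "g : set (map vals (chart_eqs C))" for g
 proof -
  have "g : set (map (kvp th) (snd (fst R)))" using om that by metis
  then obtain g' where "g' : set (snd (fst R))" "g = kvp th g'" by auto
  then show ?thesis using Z[OF z(2)] kval_keval[of th g' z] unfolding v_def by simp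
 qed
 have co: "map (%g. teval g v) (map (kvp th) gs) = map (kval th) b" if "list_all2 (%g a. Z (kadd (keval g z) (kneg a))) gs b" for gs b
  using that
 proof (induction rule: list_all2_induct)
  case (Cons g gs a b)
  have "kval th (kadd (keval g z) (kneg a)) = 0" by (rule Z) (rule Cons)
  then show ?case using Cons unfolding v_def by (simp add: kval_ops kval_keval)
 qed simp
 have GH: "map (%g. teval g v) (map vals G) = map (kval th) (snd k)" "map (%g. teval g v) (map vals H) = map (kval th) (snd k')"
  using co[OF z(3)] co[OF z(4)] om by metis+
 let ?gs = "map vals (chart_eqs C) @ apart_terms (dim C) (map vals G) (map (kval th) (snd k)) @
  apart_terms (dim C) (map vals H) (map (kval th) (snd k'))"
 have P1: "P (fst k) (map (kval th) (snd k)) p" "P (fst k') (map (kval th) (snd k')) p'" using p p' unfolding Pt_def by simp_all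
 have "unit_terms (dim C) ?gs" by (rule pt_apart_unit_terms[OF O P1 ne])
 moreover have "wf_terms (dim C) g" if "g : set ?gs" for g
 proof -
  have "wf_terms (dim C) q" if "q : set (map vals G)" for q using overlap_wf(2)[OF ij O] that by auto
  moreover have "wf_terms (dim C) q" if "q : set (map vals H)" for q using overlap_wf(2)[OF ij O] that by auto
  ultimately show ?thesis
  using that overlap_wf(1)[OF ij O] wf_apart_terms[of "map vals G" "dim C" "map (kval th) (snd k)" g]
  wf_apart_terms[of "map vals H" "dim C" "map (kval th) (snd k')" g] pt_algebraic[OF P1(1)] pt_algebraic[OF P1(2)] by auto
 qed
 ultimately obtain g where g: "g : set ?gs" "teval g v ~= 0" using unit_terms_no_zero[OF _ lv] by blast
 then show False using eqs apart_terms_zero[OF GH(1) lv, of g] apart_terms_zero[OF GH(2) lv, of g]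
  unfolding set_append by blast
qed

lemma kNeq_sound:
 assumes m: "match th d'" and Z: "!!x. Z x ==> kval th x = 0" and k: "kNeq Z d' k k'"
  and p: "Pt (cval th k) p" and p': "Pt (cval th k') p'"
 shows "p ~= p'"
proof
 assume "p = p'"
 have ij: "fst k < length Cs" "fst k' < length Cs" using Pt_facts[OF p] Pt_facts[OF p'] by simp_all
 obtain C G H where O: "Os ! fst k ! fst k' = Overlap C G H" by (cases "Os ! fst k ! fst k'")
 define R where "R = kOs d' ! fst k ! fst k'"
 note om = overlap_match[OF m ij O, folded R_def]
 have u: "kunit Z (dim C) (snd (fst R) @ kapart (dim C) (fst (snd R)) (snd k) @ kapart (dim C) (snd (snd R)) (snd k'))"
  using k om unfolding kNeq_def nth_rel_def R_def by auto
 have P1: "P (fst k) (map (kval th) (snd k)) p" "P (fst k') (map (kval th) (snd k')) p" using p p' \<open>p = p'\<close> unfolding Pt_def by simp_all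
 obtain z where z: "length z = dim C" "!!g. g : set (chart_eqs C) ==> teval (vals g) z = 0"
  "map (%g. teval (vals g) z) G = map (kval th) (snd k)" "map (%g. teval (vals g) z) H = map (kval th) (snd k')"
  using pt_equal_witness[OF O P1] by blast
 have "map (kvp th) (snd (fst R) @ kapart (dim C) (fst (snd R)) (snd k) @ kapart (dim C) (snd (snd R)) (snd k')) =
  map vals (chart_eqs C) @ apart_terms (dim C) (map vals G) (map (kval th) (snd k)) @
  apart_terms (dim C) (map vals H) (map (kval th) (snd k'))"
  using om unfolding map_append kapart_kvp by simp
 then obtain g where g: "g : set (map vals (chart_eqs C) @ apart_terms (dim C) (map vals G) (map (kval th) (snd k)) @
  apart_terms (dim C) (map vals H) (map (kval th) (snd k')))" "teval g z ~= 0"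
  using kunit_no_zero[OF u Z z(1)] by metis
 have GH: "map (%g. teval g z) (map vals G) = map (kval th) (snd k)" "map (%g. teval g z) (map vals H) = map (kval th) (snd k')"
  using z(3,4) by (simp_all add: comp_def)
 have "teval q z = 0" if "q : set (map vals (chart_eqs C))" for q using that z(2) by auto
 then show False using g apart_terms_zero[OF GH(1) z(1), of g] apart_terms_zero[OF GH(2) z(1), of g]
  unfolding set_append by blast
qed

lemma kEq_complete:
 assumes p: "Pt w p" "Pt w' p"
 shows "evt (%th. ALL d' k k'. match th d' --> cval th k = w --> cval th k' = w' --> kEq (kz th) d' k k')"
proof -
 have ij: "fst w < length Cs" "fst w' < length Cs" using Pt_facts[OF p(1)] Pt_facts[OF p(2)] by simp_all
 obtain C G H where O: "Os ! fst w ! fst w' = Overlap C G H" by (cases "Os ! fst w ! fst w'")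
 obtain z where z: "length z = dim C" "!!c. c : set z ==> algebraic c" "!!g. g : set (chart_eqs C) ==> teval (vals g) z = 0"
  "map (%g. teval (vals g) z) G = snd w" "map (%g. teval (vals g) z) H = snd w'"
  using pt_equal_witness[OF O p[unfolded Pt_def]] by blast
 have "evt (%th. algebraic th & set z <= adjoin th)" by (rule evt_adjoin) (use z(2) in auto)
 then show ?thesis
 proof (rule evt_mono, intro allI impI)
  fix th d' k k' assume th: "algebraic th & set z <= adjoin th" and m: "match th d'" and k: "cval th k = w" "cval th k' = w'"
  define R where "R = kOs d' ! fst w ! fst w'"
  note om = overlap_match[OF m ij O, folded R_def]
  obtain v where v: "cval th v = (0, z)" using cval_surj[of "(0, z)" th] th by auto
  then have vz: "map (kval th) (snd v) = z" by (simp add: cval_def)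
  have f: "fst w = fst k" "fst w' = fst k'" "snd w = map (kval th) (snd k)" "snd w' = map (kval th) (snd k')" using k by auto
  have e1: "kval th (keval g (snd v)) = 0" if "g : set (snd (fst R))" for g
  proof -
  have "kvp th g : set (map vals (chart_eqs C))" using om that by (metis imageI list.set_map)
  then show ?thesis using z(3) by (auto simp: kval_keval vz)
  qed
  have co: "list_all2 (%g a. kval th (kadd (keval g (snd v)) (kneg a)) = 0) gs b"
  if "map (%g. teval g z) (map (kvp th) gs) = map (kval th) b" for gs b
  proof (rule list_all2_all_nthI)
  show l: "length gs = length b" using arg_cong[OF that, of length] by simp
  fix l assume "l < length gs"
  then show "kval th (kadd (keval (gs ! l) (snd v)) (kneg (b ! l))) = 0"
  using arg_cong[OF that, of "%xs. xs ! l"] l by (simp add: kval_ops kval_keval vz)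
  qed
  have e2: "list_all2 (%g a. kval th (kadd (keval g (snd v)) (kneg a)) = 0) (fst (snd R)) (snd k)"
  "list_all2 (%g a. kval th (kadd (keval g (snd v)) (kneg a)) = 0) (snd (snd R)) (snd k')"
  by (rule co, use om z(4,5) f in \<open>simp add: comp_def\<close>)+
  have e3: "length (snd v) = fst (fst R)" using om z(1) arg_cong[OF vz, of length] by simp
  have e4: "fst k < length (kOs d') & fst k' < length (kOs d' ! fst k) & kOs d' ! fst k ! fst k' = R" using om f R_def by simp
  show "kEq (kz th) d' k k'" unfolding kEq_def nth_rel_def
  by (rule exI[of _ "kOs d' ! fst k"], rule exI[of _ R], rule exI[of _ "snd v"]) (use e1 e2 e3 e4 in blast)
 qed
qed

lemma kNeq_complete:
 assumes p: "Pt w p" "Pt w' p'" "p ~= p'"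
 shows "evt (%th. ALL d' k k'. match th d' --> cval th k = w --> cval th k' = w' --> kNeq (kz th) d' k k')"
proof -
 have ij: "fst w < length Cs" "fst w' < length Cs" using Pt_facts[OF p(1)] Pt_facts[OF p(2)] by simp_all
 obtain C G H where O: "Os ! fst w ! fst w' = Overlap C G H" by (cases "Os ! fst w ! fst w'")
 note P1 = p(1,2)[unfolded Pt_def]
 let ?gs = "map vals (chart_eqs C) @ apart_terms (dim C) (map vals G) (snd w) @ apart_terms (dim C) (map vals H) (snd w')"
 have "evt (%th. ALL gs'. map (kvp th) gs' = ?gs --> kunit (kz th) (dim C) gs')"
 proof (rule kunit_complete[OF pt_apart_unit_terms[OF O P1 p(3)]])
  fix g assume "g : set ?gs"
  moreover have "wf_terms (dim C) q" if "q : set (map vals G)" for q using overlap_wf(2)[OF ij O] that by auto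
  moreover have "wf_terms (dim C) q" if "q : set (map vals H)" for q using overlap_wf(2)[OF ij O] that by auto
  ultimately show "wf_terms (dim C) g"
  using overlap_wf(1)[OF ij O] wf_apart_terms[of "map vals G" "dim C" "snd w" g]
  wf_apart_terms[of "map vals H" "dim C" "snd w'" g] pt_algebraic[OF P1(1)] pt_algebraic[OF P1(2)] by auto
 qed
 then show ?thesis
 proof (rule evt_mono, intro allI impI)
  fix th d' k k' assume u: "ALL gs'. map (kvp th) gs' = ?gs --> kunit (kz th) (dim C) gs'"
  and m: "match th d'" and k: "cval th k = w" "cval th k' = w'"
  define R where "R = kOs d' ! fst w ! fst w'"
  note om = overlap_match[OF m ij O, folded R_def]
  have f: "fst w = fst k" "fst w' = fst k'" "snd w = map (kval th) (snd k)" "snd w' = map (kval th) (snd k')" using k by auto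
  have "map (kvp th) (snd (fst R) @ kapart (dim C) (fst (snd R)) (snd k) @ kapart (dim C) (snd (snd R)) (snd k')) = ?gs"
  using om unfolding map_append kapart_kvp f by simp
  then have "kunit (kz th) (dim C) (snd (fst R) @ kapart (dim C) (fst (snd R)) (snd k) @ kapart (dim C) (snd (snd R)) (snd k'))"
  using u by blast
  then show "kNeq (kz th) d' k k'" unfolding kNeq_def nth_rel_def using om f R_def by auto
 qed
qed

section \<open>Orbits\<close>

lemma x0_orb: "x0 : orb" unfolding orb_def by (rule CollectI, rule exI[of _ "[]"]) simp

lemma orb_step: "p : orb ==> s < length fs ==> F s p : orb"
proof -
 assume "p : orb" and s: "s < length fs"
 then obtain w where "set w <= {..<length fs}" "p = fold F w x0" unfolding orb_def by blast
 then show ?thesis unfolding orb_def using s by (intro CollectI exI[of _ "w @ [s]"]) simp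
qed

lemma orb_induct:
 assumes "p : orb" and base: "Q x0" and step: "!!p s. p : orb ==> Q p ==> s < length fs ==> Q (F s p)"
 shows "Q p"
proof -
 have "set w <= {..<length fs} ==> Q (fold F w x0)" for w
 proof (induction w rule: rev_induct)
  case (snoc s w)
  then have "Q (fold F w x0)" "fold F w x0 : orb" unfolding orb_def by auto
  then show ?case using step snoc.prems by simp
 qed (simp add: base)
 then show ?thesis using assms(1) unfolding orb_def by blast
qed

lemma monoid_words: "g : generated_monoid X (set fs) ==> EX w. set w <= {..<length fs} & fst g = fold F w"
proof (induction rule: generated_monoid.induct)
 case one
 show ?case by (rule exI[of _ "[]"]) (simp add: id_mor_def fun_eq_iff)
next
 case (gen f)
 then obtain s where "s < length fs" "fs ! s = f" by (auto simp: in_set_conv_nth)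
 then show ?case by (intro exI[of _ "[s]"]) (auto simp: F_def fun_eq_iff)
next
 case (comp f g)
 then obtain w w' where "set w <= {..<length fs}" "fst f = fold F w" "set w' <= {..<length fs}" "fst g = fold F w'" by blast
 then show ?case by (intro exI[of _ "w' @ w"]) (simp add: comp_mor_def fun_eq_iff)
qed

lemma words_monoid: "set w <= {..<length fs} ==> EX g:generated_monoid X (set fs). fst g = fold F w"
proof (induction w)
 case Nil
 show ?case by (rule bexI[OF _ generated_monoid.one]) (simp add: id_mor_def fun_eq_iff)
next
 case (Cons s w)
 then obtain g where g: "g : generated_monoid X (set fs)" "fst g = fold F w" by auto
 have "fs ! s : generated_monoid X (set fs)" using Cons.prems by (intro generated_monoid.gen) simp
 then have "comp_mor X g (fs ! s) : generated_monoid X (set fs)" using g(1) by (intro generated_monoid.comp)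
 then show ?case by (rule bexI[rotated]) (simp add: comp_mor_def g(2) F_def[symmetric] fun_eq_iff)
qed

lemma orbit_orb: "orbit X (set fs) x0 = orb"
proof
 show "orbit X (set fs) x0 <= orb" unfolding orbit_def orb_def using monoid_words by fastforce
 show "orb <= orbit X (set fs) x0" unfolding orbit_def orb_def using words_monoid by fastforce
qed

lemma periodic_iff: "periodic X (set fs) x0 \<longleftrightarrow> finite orb & (\<forall>s<length fs. inj_on (F s) orb)"
proof
 assume per: "periodic X (set fs) x0"
 have "inj_on (F s) orb" if "s < length fs" for s
 proof -
  have "fs ! s : generated_monoid X (set fs)" using that by (intro generated_monoid.gen) simp
  then have "bij_betw (fst (fs ! s)) orb orb" using per unfolding periodic_def orbit_orb by blast
  then show ?thesis unfolding bij_betw_def F_def[abs_def] by simp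
 qed
 then show "finite orb & (\<forall>s<length fs. inj_on (F s) orb)" using per unfolding periodic_def orbit_orb by blast
next
 assume inj: "finite orb & (\<forall>s<length fs. inj_on (F s) orb)"
 have b1: "bij_betw (F s) orb orb" if "s < length fs" for s
 proof -
  have "F s ` orb <= orb" using orb_step that by blast
  then show ?thesis unfolding bij_betw_def using endo_inj_surj[of orb "F s"] inj that by blast
 qed
 have "set w <= {..<length fs} ==> bij_betw (fold F w) orb orb" for w
 proof (induction w)
  case Nil
  show ?case by (simp add: bij_betw_def)
 next
  case (Cons s w)
  then have "bij_betw (fold F w \<circ> F s) orb orb" using b1 by (intro bij_betw_trans[of "F s" orb orb]) auto
  then show ?case by (simp add: comp_def)
 qed
 then show "periodic X (set fs) x0" unfolding periodic_def orbit_orb using inj monoid_words by metis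
qed

lemma chain_induct:
 "list_all2 R (a # q) (q @ [b]) ==> Q a ==> (!!u v. R u v ==> Q u ==> Q v) ==> Q b"
proof (induction q arbitrary: a)
 case (Cons c q)
 have "R a c" "list_all2 R (c # q) (q @ [b])" using Cons.prems(1) by simp_all
 then show ?case using Cons by blast
qed auto

lemma kreach_sound:
 assumes m: "match th d'" and Z: "!!x. Z x ==> kval th x = 0" and k: "kreach Z d' k"
 shows "EX p:orb. Pt (cval th k) p"
proof -
 have base: "EX p:orb. Pt (cval th (kstart d')) p" unfolding start_match[OF m] using Pt_start x0_orb by blast
 have step: "EX p:orb. Pt (cval th v) p" if uv: "EX s. kstep Z d' s u v" and u: "EX p:orb. Pt (cval th u) p" for u v
 proof -
  obtain s p where s: "kstep Z d' s u v" "p : orb" "Pt (cval th u) p" using uv u by blast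
  have c: "cstep s (cval th u) (cval th v)" by (rule kstep_sound[OF m Z s(1)]) (use Pt_facts[OF s(3)] in simp_all)
  then show ?thesis using cstep_Pt[OF s(3) c] orb_step[OF s(2)] unfolding cstep_def by blast
 qed
 show ?thesis using k unfolding kreach_def
 proof
  assume "k = kstart d'"
  then show ?thesis using base by simp
 next
  assume "EX q. list_all2 (%u v. EX s. kstep Z d' s u v) (kstart d' # q) (q @ [k])"
  then obtain q where q: "list_all2 (%u v. EX s. kstep Z d' s u v) (kstart d' # q) (q @ [k])" by blast
  show ?thesis by (rule chain_induct[where Q = "%k. EX p:orb. Pt (cval th k) p", OF q base step])
 qed
qed

lemma kreach_step:
 assumes "kreach Z d' k" "kstep Z d' s k k'"
 shows "kreach Z d' k'"
 using assms(1) unfolding kreach_def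
proof
 assume "k = kstart d'"
 then show "k' = kstart d' \<or> (EX q. list_all2 (%u v. EX s. kstep Z d' s u v) (kstart d' # q) (q @ [k']))"
  using assms(2) by (intro disjI2 exI[of _ "[]"]) auto
next
 assume "EX q. list_all2 (%u v. EX s. kstep Z d' s u v) (kstart d' # q) (q @ [k])"
 then obtain q where "list_all2 (%u v. EX s. kstep Z d' s u v) (kstart d' # q) (q @ [k])" by blast
 then have "list_all2 (%u v. EX s. kstep Z d' s u v) ((kstart d' # q) @ [k]) ((q @ [k]) @ [k'])"
  using assms(2) by (intro list_all2_appendI) auto
 then show "k' = kstart d' \<or> (EX q. list_all2 (%u v. EX s. kstep Z d' s u v) (kstart d' # q) (q @ [k']))"
  by (intro disjI2 exI[of _ "q @ [k]"]) simp
qed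

text \<open>The coordinates are chosen before the field, since the choice of a piece among those that are
 defined at a point must not depend on it.\<close>

lemma orb_state:
 assumes "p : orb"
 shows "EX w. Pt w p & (ALL th d'. algebraic th --> match th d' --> (EX k. cval th k = w & kreach (kz th) d' k))"
 using assms
proof (rule orb_induct)
 show "EX w. Pt w x0 & (ALL th d'. algebraic th --> match th d' --> (EX k. cval th k = w & kreach (kz th) d' k))"
  using Pt_start start_match unfolding kreach_def by blast
next
 fix p s assume s: "s < length fs"
  and "EX w. Pt w p & (ALL th d'. algebraic th --> match th d' --> (EX k. cval th k = w & kreach (kz th) d' k))"
 then obtain w where w: "Pt w p" "!!th d'. algebraic th ==> match th d' ==> EX k. cval th k = w & kreach (kz th) d' k" by blast
 obtain w' where w': "cstep s w w'" using cstep_exists[OF w(1) s] by blast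
 have "EX k. cval th k = w' & kreach (kz th) d' k" if th: "algebraic th" and m: "match th d'" for th d'
 proof -
  obtain k where k: "cval th k = w" "kreach (kz th) d' k" using w(2)[OF th m] by blast
  have c: "cstep s (cval th k) w'" and p: "Pt (cval th k) p" using w' w(1) k(1) by simp_all
  obtain k' where "cval th k' = w'" using cstep_lift(1)[OF m th c p] by blast
  then show ?thesis using cstep_lift(2)[OF m th c p] kreach_step[OF k(2)] by blast
 qed
 then show "EX w. Pt w (F s p) & (ALL th d'. algebraic th --> match th d' --> (EX k. cval th k = w & kreach (kz th) d' k))"
  using cstep_Pt[OF w(1) w'] by blast
qed

definition orb_states :: "state set" where "orb_states = {w. EX p:orb. Pt w p}"

lemma finite_orb_states: "finite orb ==> finite orb_states"
proof -
 assume fin: "finite orb"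
 let ?g = "%w. (fst w, THE p. Pt w p)"
 have the: "(THE p. Pt w p) = p" if "Pt w p" for w p using that Pt_unique by blast
 have "inj_on ?g orb_states"
 proof (rule inj_onI)
  fix w w' assume "w : orb_states" "w' : orb_states" and e: "?g w = ?g w'"
  then obtain p p' where p: "Pt w p" "Pt w' p'" unfolding orb_states_def by blast
  then have "p = p'" "fst w = fst w'" using e the[OF p(1)] the[OF p(2)] by simp_all
  then show "w = w'" using p pt_coords_unique[of "fst w" "snd w" p "snd w'"] unfolding Pt_def by (simp add: prod_eq_iff)
 qed
 moreover have "?g ` orb_states <= {..<length Cs} \<times> orb"
 proof
  fix z assume "z : ?g ` orb_states"
  then obtain w p where "p : orb" "Pt w p" "z = ?g w" unfolding orb_states_def by blast
  then show "z : {..<length Cs} \<times> orb" using the[of w p] Pt_facts[of w p] by simp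
 qed
 ultimately show ?thesis using fin by (meson finite_SigmaI finite_imageD finite_lessThan finite_subset)
qed

text \<open>Every point of the orbit has a state in the list, so that the orbit is finite.\<close>

lemma kper_sound:
 assumes m: "match th d'" and Z: "!!x. Z x ==> kval th x = 0" and k: "kper Z d'"
 shows "finite orb & (\<forall>s<length fs. inj_on (F s) orb)"
proof -
 obtain L where L: "kstart d' : set L" "!!s x. s < length fs ==> x : set L ==> EX y:set L. kstep Z d' s x y"
  "!!s x x'. s < length fs ==> x : set L ==> x' : set L ==>
  kEq Z d' x x' \<or> (EX y y'. kstep Z d' s x y & kstep Z d' s x' y' & kNeq Z d' y y')"
  using k length_kFs[OF m] unfolding kper_def by auto
 have st: "Pt (cval th v) (F s p)" if "Pt (cval th u) p" "kstep Z d' s u v" for u v s p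
  by (rule cstep_Pt[OF that(1) kstep_sound[OF m Z that(2)]]) (use Pt_facts[OF that(1)] in simp_all)
 have ex: "EX x:set L. Pt (cval th x) p" if "p : orb" for p
  using that
 proof (rule orb_induct)
  show "EX x:set L. Pt (cval th x) x0" using L(1) start_match[OF m] Pt_start by metis
  fix p s assume "EX x:set L. Pt (cval th x) p" and s: "s < length fs"
  then obtain x where x: "x : set L" "Pt (cval th x) p" by blast
  then show "EX x:set L. Pt (cval th x) (F s p)" using L(2)[OF s x(1)] st[OF x(2)] by blast
 qed
 have "orb <= (%x. THE p. Pt (cval th x) p) ` set L"
 proof
  fix p assume "p : orb"
  then obtain x where x: "x : set L" "Pt (cval th x) p" using ex by blast
  then have "(THE p. Pt (cval th x) p) = p" using Pt_unique by blast
  then show "p : (%x. THE p. Pt (cval th x) p) ` set L" using x(1) by force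
 qed
 then have "finite orb" by (rule finite_subset) simp
 moreover have "inj_on (F s) orb" if s: "s < length fs" for s
 proof (rule inj_onI, rule ccontr)
  fix p p' assume p: "p : orb" "p' : orb" "F s p = F s p'" "p ~= p'"
  obtain x x' where x: "x : set L" "Pt (cval th x) p" "x' : set L" "Pt (cval th x') p'" using ex p by blast
  have "~ kEq Z d' x x'" using kEq_sound[OF m Z _ x(2,4)] p(4) by blast
  then obtain y y' where y: "kstep Z d' s x y" "kstep Z d' s x' y'" "kNeq Z d' y y'" using L(3)[OF s x(1,3)] by blast
  show False using kNeq_sound[OF m Z y(3) st[OF x(2) y(1)] st[OF x(4) y(2)]] p(3) by simp
 qed
 ultimately show ?thesis by blast
qed

text \<open>The list consists of all states of all points of the orbit; there are finitely many, one for
 each point and each chart that contains it.\<close>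

lemma kper_complete:
 assumes fin: "finite orb" and inj: "!!s. s < length fs ==> inj_on (F s) orb"
 shows "evt (%th. ALL d'. match th d' --> kper (kz th) d')"
proof -
 let ?W = orb_states
 have W: "finite ?W" by (rule finite_orb_states[OF fin])
 define E where "E z th \<longleftrightarrow> (ALL d' k k'. match th d' --> cval th k = fst z --> cval th k' = snd z -->
  (if EX p. Pt (fst z) p & Pt (snd z) p then kEq (kz th) d' k k' else kNeq (kz th) d' k k'))" for z th
 have "evt (E z)" if z: "z : ?W \<times> ?W" for z
 proof -
  obtain p p' where p: "Pt (fst z) p" "Pt (snd z) p'" using z unfolding orb_states_def by auto
  show ?thesis
  proof (cases "p = p'")
  case True
  then have "EX p. Pt (fst z) p & Pt (snd z) p" using p by blast
  moreover have "Pt (snd z) p" using p(2) True by simp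
  ultimately show ?thesis unfolding E_def[abs_def] using kEq_complete[OF p(1)] by (simp only: if_True simp_thms)
  next
  case False
  then have "~ (EX p. Pt (fst z) p & Pt (snd z) p)" using p Pt_unique by metis
  then show ?thesis unfolding E_def[abs_def] using kNeq_complete[OF p False] by (simp only: if_False simp_thms)
  qed
 qed
 then have "evt (%th. ALL z:?W \<times> ?W. E z th)" using W by (intro evt_ball) auto
 moreover have "evt (%th. algebraic th & (\<Union>w\<in>?W. set (snd w)) <= adjoin th)"
 proof (rule evt_adjoin)
  fix z assume "z : (\<Union>w\<in>?W. set (snd w))"
  then show "algebraic z" using Pt_algebraic unfolding orb_states_def by blast
 qed (simp add: W)
 ultimately have "evt (%th. (ALL z:?W \<times> ?W. E z th) & (algebraic th & (\<Union>w\<in>?W. set (snd w)) <= adjoin th))" by (rule evt_conj)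
 then show ?thesis
 proof (rule evt_mono, intro allI impI)
  fix th d' assume *: "(ALL z:?W \<times> ?W. E z th) & (algebraic th & (\<Union>w\<in>?W. set (snd w)) <= adjoin th)" and m: "match th d'"
  then have E: "!!w w'. w : ?W ==> w' : ?W ==> E (w, w') th" and th: "algebraic th" by auto
  have "EX k. cval th k = w" if "w : ?W" for w by (rule cval_surj) (use * that in blast)
  then obtain c where c: "!!w. w : ?W ==> cval th (c w) = w" by metis
  obtain ws where ws: "set ws = ?W" using finite_list[OF W] by blast
  define L where "L = kstart d' # map c ws"
  have L1: "cval th k : ?W" if "k : set L" for k
  proof (cases "k = kstart d'")
  case True
  then show ?thesis using start_match[OF m] Pt_start x0_orb unfolding orb_states_def by auto
  next
  case False
  then show ?thesis using that c ws unfolding L_def by auto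
  qed
  have L2: "EX k:set L. cval th k = w" if "w : ?W" for w using that c ws unfolding L_def by auto
  have st: "EX y:set L. kstep (kz th) d' s x y & Pt (cval th y) (F s p)"
  if s: "s < length fs" and x: "Pt (cval th x) p" "p : orb" for s x p
  proof -
  obtain w' where w': "cstep s (cval th x) w'" using cstep_exists[OF x(1) s] by blast
  have pw: "Pt w' (F s p)" by (rule cstep_Pt[OF x(1) w'])
  then have "w' : ?W" unfolding orb_states_def using orb_step[OF x(2) s] by blast
  then obtain y where y: "y : set L" "cval th y = w'" using L2 by blast
  then show ?thesis using cstep_lift(2)[OF m th w' x(1) y(2)] pw by auto
  qed
  have "kstart d' : set L" unfolding L_def by simp
  moreover have "(EX y:set L. kstep (kz th) d' s x y) &
  (ALL x':set L. kEq (kz th) d' x x' \<or> (EX y y'. kstep (kz th) d' s x y & kstep (kz th) d' s x' y' & kNeq (kz th) d' y y'))"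
  if s: "s : set [0..<length (kFs d')]" and x: "x : set L" for s x
  proof -
  have s': "s < length fs" using s length_kFs[OF m] by simp
  obtain p where p: "p : orb" "Pt (cval th x) p" using L1[OF x] unfolding orb_states_def by blast
  obtain y where y: "y : set L" "kstep (kz th) d' s x y" "Pt (cval th y) (F s p)" using st[OF s' p(2,1)] by blast
  have "kEq (kz th) d' x x' \<or> (EX y y'. kstep (kz th) d' s x y & kstep (kz th) d' s x' y' & kNeq (kz th) d' y y')"
  if x': "x' : set L" for x'
  proof -
  obtain p' where p': "p' : orb" "Pt (cval th x') p'" using L1[OF x'] unfolding orb_states_def by blast
  show ?thesis
  proof (cases "p = p'")
  case True
  then have yes: "EX p. Pt (cval th x) p & Pt (cval th x') p" using p p' by blast
  have "kEq (kz th) d' x x'"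
  by (rule E[OF L1[OF x] L1[OF x'], unfolded E_def fst_conv snd_conv if_P[OF yes], rule_format, OF m refl refl])
  then show ?thesis by blast
  next
  case False
  obtain y' where y': "y' : set L" "kstep (kz th) d' s x' y'" "Pt (cval th y') (F s p')" using st[OF s' p'(2,1)] by blast
  have "F s p ~= F s p'" using inj[OF s'] p(1) p'(1) False by (meson inj_onD)
  then have no: "~ (EX p. Pt (cval th y) p & Pt (cval th y') p)" using y(3) y'(3) Pt_unique by metis
  have "kNeq (kz th) d' y y'"
  by (rule E[OF L1[OF y(1)] L1[OF y'(1)], unfolded E_def fst_conv snd_conv if_not_P[OF no], rule_format, OF m refl refl])
  then show ?thesis using y(2) y'(2) by blast
  qed
  qed
  then show ?thesis using y by blast
  qed
  ultimately show "kper (kz th) d'" unfolding kper_def by blast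
 qed
qed

lemma kfold_sound:
 assumes m: "match th d'" and Z: "!!x. Z x ==> kval th x = 0" and k: "kfold Z d'"
 shows "\<exists>s<length fs. ~ inj_on (F s) orb"
proof -
 obtain s x x' y y' where k: "kreach Z d' x" "kreach Z d' x'" "kstep Z d' s x y" "kstep Z d' s x' y'" "kNeq Z d' x x'" "kEq Z d' y y'"
  using k unfolding kfold_def by blast
 obtain p where p: "p : orb" "Pt (cval th x) p" using kreach_sound[OF m Z k(1)] by blast
 obtain p' where p': "p' : orb" "Pt (cval th x') p'" using kreach_sound[OF m Z k(2)] by blast
 have c: "cstep s (cval th x) (cval th y)" by (rule kstep_sound[OF m Z k(3)]) (use Pt_facts[OF p(2)] in simp_all)
 have c': "cstep s (cval th x') (cval th y')" by (rule kstep_sound[OF m Z k(4)]) (use Pt_facts[OF p'(2)] in simp_all)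
 have "F s p = F s p'" by (rule kEq_sound[OF m Z k(6) cstep_Pt[OF p(2) c] cstep_Pt[OF p'(2) c']])
 moreover have "p ~= p'" by (rule kNeq_sound[OF m Z k(5) p(2) p'(2)])
 moreover have "s < length fs" using c unfolding cstep_def by blast
 ultimately show ?thesis using p(1) p'(1) unfolding inj_on_def by blast
qed

lemma evt_algebraic: "evt Q ==> evt (%th. Q th & algebraic th)"
 using evt_conj[OF _ evt_adjoin[of "{}"], of Q] by (auto elim: evt_mono)

lemma kfold_complete:
 assumes s: "s < length fs" and p: "p : orb" "p' : orb" "p ~= p'" "F s p = F s p'"
 shows "evt (%th. ALL d'. match th d' --> kfold (kz th) d')"
proof -
 obtain w where w: "Pt w p" "!!th d'. algebraic th ==> match th d' ==> EX k. cval th k = w & kreach (kz th) d' k" using orb_state[OF p(1)] by blast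
 obtain w' where w': "Pt w' p'" "!!th d'. algebraic th ==> match th d' ==> EX k. cval th k = w' & kreach (kz th) d' k" using orb_state[OF p(2)] by blast
 obtain v where v: "cstep s w v" using cstep_exists[OF w(1) s] by blast
 obtain v' where v': "cstep s w' v'" using cstep_exists[OF w'(1) s] by blast
 have pv: "Pt v (F s p)" "Pt v' (F s p)" using cstep_Pt[OF w(1) v] cstep_Pt[OF w'(1) v'] p(4) by simp_all
 from evt_algebraic[OF evt_conj[OF kNeq_complete[OF w(1) w'(1) p(3)] kEq_complete[OF pv]]]
 show ?thesis
 proof (rule evt_mono, elim conjE, intro allI impI)
  fix th d' assume N: "ALL d' k k'. match th d' --> cval th k = w --> cval th k' = w' --> kNeq (kz th) d' k k'"
  and E: "ALL d' k k'. match th d' --> cval th k = v --> cval th k' = v' --> kEq (kz th) d' k k'"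
  and th: "algebraic th" and m: "match th d'"
  obtain k where k: "cval th k = w" "kreach (kz th) d' k" using w(2)[OF th m] by blast
  obtain k' where k': "cval th k' = w'" "kreach (kz th) d' k'" using w'(2)[OF th m] by blast
  have c: "cstep s (cval th k) v" "Pt (cval th k) p" using v w(1) k(1) by simp_all
  have c': "cstep s (cval th k') v'" "Pt (cval th k') p'" using v' w'(1) k'(1) by simp_all
  obtain l where l: "cval th l = v" using cstep_lift(1)[OF m th c] by blast
  obtain l' where l': "cval th l' = v'" using cstep_lift(1)[OF m th c'] by blast
  show "kfold (kz th) d'" unfolding kfold_def
  using k(2) k'(2) cstep_lift(2)[OF m th c l] cstep_lift(2)[OF m th c' l'] N m k(1) k'(1) E l l' by blast
 qed
qed

lemma kmany_sound:
 assumes m: "match th d'" and Z: "!!x. Z x ==> kval th x = 0" and k: "kmany Z d' B" and fin: "finite orb"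
 shows "B < card orb"
proof -
 obtain L where L: "B < length L" "!!x. x : set L ==> kreach Z d' x"
  and N: "ALL z:set (zip [0..<length L] L). ALL z':set (zip [0..<length L] L). fst z = fst z' \<or> kNeq Z d' (snd z) (snd z')"
  using k unfolding kmany_def by blast
 have "ALL x:set L. EX p:orb. Pt (cval th x) p" using kreach_sound[OF m Z L(2)] by blast
 then obtain g where g: "!!x. x : set L ==> g x : orb & Pt (cval th x) (g x)" by metis
 have "distinct (map g L)"
 proof (subst distinct_conv_nth, intro allI impI)
  fix i j assume ij: "i < length (map g L)" "j < length (map g L)" "i ~= j"
  have "(i, L ! i) : set (zip [0..<length L] L)" if "i < length L" for i
  using that by (auto simp: set_zip intro!: exI[of _ i])
  then have mem: "(i, L ! i) : set (zip [0..<length L] L)" "(j, L ! j) : set (zip [0..<length L] L)" using ij by auto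
  have "kNeq Z d' (L ! i) (L ! j)" using bspec[OF bspec[OF N mem(1)] mem(2)] ij(3) by simp
  then have "g (L ! i) ~= g (L ! j)" using kNeq_sound[OF m Z] g ij by simp
  then show "map g L ! i ~= map g L ! j" using ij by simp
 qed
 then have "length L = card (set (map g L))" using distinct_card by fastforce
 also have "... <= card orb" using g by (intro card_mono fin) auto
 finally show ?thesis using L(1) by simp
qed

lemma kmany_complete:
 assumes T: "finite T" "T <= orb" "B < card T"
 shows "evt (%th. ALL d'. match th d' --> kmany (kz th) d' B)"
proof -
 have "ALL p:T. EX w. Pt w p & (ALL th d'. algebraic th --> match th d' --> (EX k. cval th k = w & kreach (kz th) d' k))"
  using orb_state T(2) by blast
 then obtain w where w: "!!p. p : T ==> Pt (w p) p" "!!p th d'. p : T ==> algebraic th ==> match th d' ==> EX k. cval th k = w p & kreach (kz th) d' k"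
  by metis
 define E where "E z th \<longleftrightarrow> (ALL d' k k'. match th d' --> cval th k = w (fst z) --> cval th k' = w (snd z) --> fst z = snd z \<or> kNeq (kz th) d' k k')" for z th
 have "evt (E z)" if z: "z : T \<times> T" for z
 proof (cases "fst z = snd z")
  case True
  then show ?thesis unfolding E_def[abs_def] by (intro evt_True) simp
 next
  case False
  have "Pt (w (fst z)) (fst z)" "Pt (w (snd z)) (snd z)" using z w(1) by auto
  from kNeq_complete[OF this False] show ?thesis by (rule evt_mono) (simp add: E_def)
 qed
 then have "evt (%th. ALL z:T \<times> T. E z th)" using T(1) by (intro evt_ball) auto
 from evt_algebraic[OF this] show ?thesis
 proof (rule evt_mono, elim conjE, intro allI impI)
  fix th d' assume E: "ALL z:T \<times> T. E z th" and th: "algebraic th" and m: "match th d'"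
  obtain k where k: "!!p. p : T ==> cval th (k p) = w p & kreach (kz th) d' (k p)" using w(2)[OF _ th m] by metis
  obtain ps where ps: "set ps = T" "distinct ps" using finite_distinct_list[OF T(1)] by blast
  have "B < length (map k ps)" using T(3) ps distinct_card by fastforce
  moreover have "ALL x:set (map k ps). kreach (kz th) d' x" using k ps by auto
  moreover have "fst z = fst z' \<or> kNeq (kz th) d' (snd z) (snd z')"
  if zz: "z : set (zip [0..<length (map k ps)] (map k ps))" "z' : set (zip [0..<length (map k ps)] (map k ps))" for z z'
  proof -
  obtain i where i: "i < length ps" "z = (i, k (ps ! i))" using zz(1) by (auto simp: set_zip)
  obtain j where j: "j < length ps" "z' = (j, k (ps ! j))" using zz(2) by (auto simp: set_zip)
  have t: "ps ! i : T" "ps ! j : T" using i j ps by auto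
  have "E (ps ! i, ps ! j) th" using E t by blast
  then have "ps ! i = ps ! j \<or> kNeq (kz th) d' (k (ps ! i)) (k (ps ! j))"
  using E_def m k[OF t(1)] k[OF t(2)] by (metis fst_conv snd_conv)
  then show ?thesis using i j ps(2) nth_eq_iff_index_eq by auto
  qed
  ultimately show "kmany (kz th) d' B" unfolding kmany_def by blast
 qed
qed

end

section \<open>The bound on the orbit\<close>

lemma is_subring_adjoin:
 assumes th: "algebraic th"
 shows "is_subring (adjoin th)"
proof -
 have "1 : adjoin th" using adjoin_rat[OF th, of 1] by simp
 then show ?thesis unfolding is_subring_def using adjoin_diff[OF th] adjoin_mult[OF th] by blast
qed

lemma monomial_value_in_subring:
 assumes A: "is_subring A" and a: "set a <= A"
 shows "monomial_value a e : A"
 using a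
proof (induction a arbitrary: e)
 case Nil
 show ?case using is_subringD(2)[OF A] by (simp add: monomial_value_def)
next
 case (Cons z a)
 show ?case
 proof (cases e)
  case Nil
  then show ?thesis using is_subringD(2)[OF A] by (simp add: monomial_value_def)
 next
  case (Cons k e')
  have "z ^ k : A" using is_subringD(7)[OF A] Cons.prems by simp
  then have "z ^ k * monomial_value a e' : A" using is_subringD(5)[OF A] Cons.IH Cons.prems by simp
  then show ?thesis using Cons by (simp add: monomial_value_def)
 qed
qed

lemma teval_in_subring:
 assumes A: "is_subring A" and a: "set a <= A" and P: "!!t. t : set P ==> fst t : A"
 shows "teval P a : A"
 using P
proof (induction P)
 case Nil
 show ?case using is_subringD(1)[OF A] by simp
next
 case (Cons t P)
 have "fst t * monomial_value a (snd t) : A"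
  by (rule is_subringD(5)[OF A]) (use Cons.prems monomial_value_in_subring[OF A a] in auto)
 then show ?case using is_subringD(3)[OF A] Cons by simp
qed

lemma tval_by_degree: "(!!t. t : set a ==> snd t < n) ==> tval th a = (\<Sum>i<n. of_int (icoeff a i) * th ^ i)"
proof (induction a)
 case (Cons t a)
 have "(\<Sum>i<n. of_int (icoeff (t # a) i) * th ^ i) =
  (\<Sum>i<n. (if i = snd t then of_int (fst t) * th ^ i else 0)) + (\<Sum>i<n. of_int (icoeff a i) * th ^ i)"
  unfolding sum.distrib[symmetric] by (intro sum.cong) (auto simp: algebra_simps)
 also have "(\<Sum>i<n. (if i = snd t then of_int (fst t) * th ^ i else 0)) = of_int (fst t) * th ^ snd t"
  using Cons.prems[of t] by (simp add: sum.delta)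
 finally show ?case using Cons by simp
qed simp

lemma root_equation:
 assumes "fwf f" "tval th (fterms f) = 0"
 shows "of_int (fst (snd f)) * th ^ fst f + (\<Sum>i<fst f. of_int (icoeff (snd (snd f)) i) * th ^ i) = 0"
 using assms tval_by_degree[of "snd (snd f)" "fst f" th] unfolding fterms_def fwf_def by simp

lemma adjoin_subset_span:
 assumes f: "fwf f" "tval th (fterms f) = 0"
 shows "adjoin th <= rat.span ((%i. th ^ i) ` {..<fst f})"
proof -
 let ?n = "fst f" and ?B = "(%i. th ^ i) ` {..<fst f}"
 let ?l = "fst (snd f)" and ?b = "%i. icoeff (snd (snd f)) i"
 have l0: "of_int ?l ~= (0::complex)" using f(1) unfolding fwf_def by simp
 have "of_int ?l * th ^ ?n = - (\<Sum>i<?n. of_int (?b i) * th ^ i)"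
  using root_equation[OF f] by (simp add: eq_neg_iff_add_eq_0)
 then have "th ^ ?n = (\<Sum>i<?n. of_rat (- of_int (?b i) / of_int ?l) * th ^ i)"
  using l0 by (simp add: of_rat_divide of_rat_minus field_simps sum_divide_distrib[symmetric] sum_negf)
 then have top: "th ^ ?n : rat.span ?B"
  by (simp only:) (intro rat.span_sum rat.span_scale rat.span_base, simp)
 have times: "th * z : rat.span ?B" if "z : rat.span ?B" for z
  using that
 proof (induction rule: rat.span_induct_alt)
  case base
  show ?case using rat.span_zero by simp
 next
  case (step c x y)
  then obtain i where i: "i < ?n" "x = th ^ i" by auto
  have "th * x : rat.span ?B"
  proof (cases "Suc i = ?n")
  case True
  then show ?thesis using top i by (metis power_Suc)
  next
  case False
  then have "th ^ Suc i : ?B" using i by (intro imageI) simp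
  then show ?thesis using i rat.span_base by (metis power_Suc)
  qed
  then have "of_rat c * (th * x) + th * y : rat.span ?B" using step by (intro rat.span_add rat.span_scale) auto
  then show ?case by (simp add: algebra_simps)
 qed
 have "th ^ k : rat.span ?B" for k
 proof (induction k)
  case 0
  have "th ^ 0 : ?B" using f(1) unfolding fwf_def by (intro imageI) simp
  then show ?case by (rule rat.span_base)
 qed (simp add: times)
 then show ?thesis unfolding adjoin_def by (intro rat.span_minimal rat.subspace_span) auto
qed

subsection \<open>Congruence of tangent vectors\<close>

context valuation_ring
begin

text \<open>The elements \<open>u'\<close> and \<open>v'\<close> are displaced from \<open>u\<close> and \<open>v\<close> by multiples of \<open>dl\<close> and \<open>ep\<close>, with
 congruent factors.  As for dual numbers, this is compatible with the ring operations and with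
 inverses of units, so that rational functions act on tangent vectors.\<close>

definition cong2 :: "complex => complex => complex => complex => complex => complex => bool" where
 "cong2 dl ep u u' v v' \<longleftrightarrow> u : A & v : A & u - v : M &
  (EX a b. a : A & b : A & a - b : M & u' = u + dl * a & v' = v + ep * b)"

lemma cong2_const: "c : A ==> cong2 dl ep c c c c"
 unfolding cong2_def using A(1) zero_M by (intro conjI exI[of _ 0]) simp_all

lemma cong2_add:
 assumes "cong2 dl ep u u' v v'" "cong2 dl ep x x' y y'"
 shows "cong2 dl ep (u + x) (u' + x') (v + y) (v' + y')"
proof -
 obtain a b where 1: "u : A" "v : A" "u - v : M" "a : A" "b : A" "a - b : M" "u' = u + dl * a" "v' = v + ep * b"
  using assms(1) unfolding cong2_def by blast
 obtain c d where 2: "x : A" "y : A" "x - y : M" "c : A" "d : A" "c - d : M" "x' = x + dl * c" "y' = y + ep * d"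
  using assms(2) unfolding cong2_def by blast
 have "u + x - (v + y) : M" using M_add[OF 1(3) 2(3)] by (simp add: algebra_simps)
 moreover have "a + c - (b + d) : M" using M_add[OF 1(6) 2(6)] by (simp add: algebra_simps)
 ultimately show ?thesis unfolding cong2_def
  using A(3)[OF 1(1) 2(1)] A(3)[OF 1(2) 2(2)] A(3)[OF 1(4) 2(4)] A(3)[OF 1(5) 2(5)] 1(7,8) 2(7,8)
  by (intro conjI exI[of _ "a + c"] exI[of _ "b + d"]) (simp_all add: algebra_simps)
qed

context
 fixes dl ep assumes dl: "dl : M" and ep: "ep : M"
begin

lemma cong2_members:
 assumes "cong2 dl ep u u' v v'"
 shows "u : A" "v : A" "u' : A" "v' : A" "u - v : M" "u' - u : M" "v' - v : M" "u' - v' : M"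
proof -
 obtain a b where 1: "u : A" "v : A" "u - v : M" "a : A" "b : A" "a - b : M" "u' = u + dl * a" "v' = v + ep * b"
  using assms(1) unfolding cong2_def by blast
 show "u : A" "v : A" "u - v : M" using 1 by simp_all
 show m: "u' - u : M" "v' - v : M" using M_mult'[OF dl 1(4)] M_mult'[OF ep 1(5)] 1(7,8) by simp_all
 show "u' : A" "v' : A" using A(3)[OF 1(1) M_A[OF m(1)]] A(3)[OF 1(2) M_A[OF m(2)]] by simp_all
 show "u' - v' : M" using M_add[OF M_diff[OF m] 1(3)] by (simp add: algebra_simps)
qed

lemma cong2_mult:
 assumes c1: "cong2 dl ep u u' v v'" and c2: "cong2 dl ep x x' y y'"
 shows "cong2 dl ep (u * x) (u' * x') (v * y) (v' * y')"
proof -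
 obtain a b where 1: "u : A" "v : A" "u - v : M" "a : A" "b : A" "a - b : M" "u' = u + dl * a" "v' = v + ep * b"
  using c1 unfolding cong2_def by blast
 obtain c d where 2: "x : A" "y : A" "x - y : M" "c : A" "d : A" "c - d : M" "x' = x + dl * c" "y' = y + ep * d"
  using c2 unfolding cong2_def by blast
 note x' = cong2_members[OF c2]
 have prod: "r * s - r' * s' : M" if "r - r' : M" "s - s' : M" "s : A" "r' : A" for r s r' s'
  using M_add[OF M_mult'[OF that(1,3)] M_mult[OF that(4,2)]] by (simp add: algebra_simps)
 have "u * x - v * y : M" by (rule prod) (use 1 2 in simp_all)
 moreover have "a * x' + u * c - (b * y' + v * d) : M"
 proof -
  have "a * x' - b * y' : M" "u * c - v * d : M" by (rule prod; use 1 2 x' in simp)+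
  then show ?thesis using M_add by (metis add_diff_add)
 qed
 moreover have "a * x' + u * c : A" "b * y' + v * d : A"
  using A(3)[OF A(5)[OF 1(4) x'(3)] A(5)[OF 1(1) 2(4)]] A(3)[OF A(5)[OF 1(5) x'(4)] A(5)[OF 1(2) 2(5)]] by simp_all
 moreover have "u' * x' = u * x + dl * (a * x' + u * c)" "v' * y' = v * y + ep * (b * y' + v * d)"
  unfolding 1(7,8) 2(7,8) by (simp_all add: algebra_simps)
 ultimately show ?thesis unfolding cong2_def using A(5)[OF 1(1) 2(1)] A(5)[OF 1(2) 2(2)] by blast
qed

lemma cong2_inverse:
 assumes c1: "cong2 dl ep u u' v v'" and u: "u ~: M"
 shows "cong2 dl ep (inverse u) (inverse u') (inverse v) (inverse v')"
proof -
 obtain a b where 1: "u : A" "v : A" "u - v : M" "a : A" "b : A" "a - b : M" "u' = u + dl * a" "v' = v + ep * b"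
  using c1 unfolding cong2_def by blast
 note m = cong2_members[OF c1]
 have vM: "v ~: M" using M_add[OF m(5), of v] u by auto
 have u'M: "u' ~: M" using M_diff[of u' "u' - u"] m(6) u by auto
 have v'M: "v' ~: M" using M_diff[of v' "v' - v"] m(7) vM by auto
 have i: "u ~= 0 & inverse u : A" "v ~= 0 & inverse v : A" "u' ~= 0 & inverse u' : A" "v' ~= 0 & inverse v' : A"
  using unit_inverse m(1-4) u vM u'M v'M by blast+
 define s t where "s = inverse u * inverse u'" and "t = inverse v * inverse v'"
 have st: "s : A" "t : A" unfolding s_def t_def using A(5) i by simp_all
 have "inverse u - inverse v = - ((u - v) * (inverse u * inverse v))" using i by (simp add: field_simps)
 then have "inverse u - inverse v : M" using M_minus[OF M_mult'[OF m(5) A(5)[of "inverse u" "inverse v"]]] i by simp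
 moreover have "- a * s - - b * t : M"
 proof -
  have "u * u' - v * v' : M" using M_add[OF M_mult'[OF m(5) m(3)] M_mult[OF m(2) m(8)]] by (simp add: algebra_simps)
  then have "b * (s * t) * (u * u' - v * v') : M" using A(5)[OF 1(5) A(5)[OF st]] by (intro M_mult)
  moreover have "(a - b) * s : M" by (rule M_mult'[OF 1(6) st(1)])
  ultimately have "b * (s * t) * (u * u' - v * v') - (a - b) * s : M" by (rule M_diff)
  moreover have "b * (s * t) * (u * u' - v * v') - (a - b) * s = - a * s - - b * t"
  proof -
  have "s * (u * u') = 1" "t * (v * v') = 1" unfolding s_def t_def using i by (simp_all add: field_simps)
  then have "b * (s * t) * (u * u' - v * v') = b * t * (s * (u * u')) - b * s * (t * (v * v'))" by (simp add: algebra_simps)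
  also have "... = b * t - b * s" using \<open>s * (u * u') = 1\<close> \<open>t * (v * v') = 1\<close> by simp
  finally show ?thesis by (simp add: algebra_simps)
  qed
  ultimately show ?thesis by simp
 qed
 moreover have "- a * s : A" "- b * t : A" using A(5)[OF A(6)[OF 1(4)] st(1)] A(5)[OF A(6)[OF 1(5)] st(2)] by simp_all
 moreover have "inverse u' = inverse u + dl * (- a * s)"
 proof -
  have "dl * a = u' - u" using 1(7) by simp
  have "inverse u + dl * (- a * s) = inverse u - (dl * a) * s" by (simp add: algebra_simps)
  also have "... = inverse u - (u' - u) * (inverse u * inverse u')" by (simp only: \<open>dl * a = u' - u\<close> s_def)
  also have "... = inverse u'" using i by (simp add: field_simps)
  finally show ?thesis by simp
 qed
 moreover have "inverse v' = inverse v + ep * (- b * t)"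
 proof -
  have "ep * b = v' - v" using 1(8) by simp
  have "inverse v + ep * (- b * t) = inverse v - (ep * b) * t" by (simp add: algebra_simps)
  also have "... = inverse v - (v' - v) * (inverse v * inverse v')" by (simp only: \<open>ep * b = v' - v\<close> t_def)
  also have "... = inverse v'" using i by (simp add: field_simps)
  finally show ?thesis by simp
 qed
 ultimately show ?thesis unfolding cong2_def using i by blast
qed

lemma cong2_divide:
 assumes "cong2 dl ep x x' y y'" "cong2 dl ep u u' v v'" "u ~: M"
 shows "cong2 dl ep (x / u) (x' / u') (y / v) (y' / v')"
 using cong2_mult[OF assms(1) cong2_inverse[OF assms(2,3)]] by (simp add: divide_inverse)

lemma cong2_power: "cong2 dl ep u u' v v' ==> cong2 dl ep (u ^ n) (u' ^ n) (v ^ n) (v' ^ n)"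
 by (induction n) (simp_all add: cong2_const A(2) cong2_mult)

lemma cong2_monomial:
 assumes "length a = length e" "length a' = length e" "length b = length e" "length b' = length e"
  and "!!l. l < length e ==> cong2 dl ep (a ! l) (a' ! l) (b ! l) (b' ! l)"
 shows "cong2 dl ep (monomial_value a e) (monomial_value a' e) (monomial_value b e) (monomial_value b' e)"
 using assms
proof (induction e arbitrary: a a' b b')
 case Nil
 then show ?case using cong2_const[OF A(2)] by (simp add: monomial_value_def)
next
 case (Cons k e)
 obtain x as where a: "a = x # as" using Cons.prems(1) by (cases a) auto
 obtain x' as' where a': "a' = x' # as'" using Cons.prems(2) by (cases a') auto
 obtain y bs where b: "b = y # bs" using Cons.prems(3) by (cases b) auto
 obtain y' bs' where b': "b' = y' # bs'" using Cons.prems(4) by (cases b') auto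
 have 0: "cong2 dl ep x x' y y'" using Cons.prems(5)[of 0] a a' b b' by simp
 have "cong2 dl ep (monomial_value as e) (monomial_value as' e) (monomial_value bs e) (monomial_value bs' e)"
 proof (rule Cons.IH)
  show "cong2 dl ep (as ! l) (as' ! l) (bs ! l) (bs' ! l)" if "l < length e" for l
  using Cons.prems(5)[of "Suc l"] that a a' b b' by simp
 qed (use Cons.prems a a' b b' in auto)
 from cong2_mult[OF cong2_power[OF 0, of k] this] show ?case unfolding a a' b b' by (simp add: monomial_value_def)
qed

lemma cong2_teval:
 assumes "!!t. t : set P ==> length (snd t) = n & fst t : A"
  and "length a = n" "length a' = n" "length b = n" "length b' = n"
  and c: "!!l. l < n ==> cong2 dl ep (a ! l) (a' ! l) (b ! l) (b' ! l)"
 shows "cong2 dl ep (teval P a) (teval P a') (teval P b) (teval P b')"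
 using assms(1)
proof (induction P)
 case Nil
 show ?case using cong2_const[OF A(1)] by simp
next
 case (Cons t P)
 have t: "length (snd t) = n" "fst t : A" using Cons.prems by auto
 have "cong2 dl ep (monomial_value a (snd t)) (monomial_value a' (snd t)) (monomial_value b (snd t)) (monomial_value b' (snd t))"
  by (rule cong2_monomial) (use t assms(2-5) c in simp_all)
 then show ?case using cong2_add[OF cong2_mult[OF cong2_const[OF t(2)]]] Cons by simp
qed

end

lemma cong2_of_tangent:
 assumes d: "divided_pair K dl x x'" "divided_pair K ep y y'" and t: "tangent_eq dl x x' ep y y'" and l: "l < length (snd x)"
  and mem: "set (snd x) <= A" "set (snd y) <= A"
 shows "cong2 dl ep (snd x ! l) (snd x' ! l) (snd y ! l) (snd y' ! l)"
proof -
 have len: "length (snd x) = length (snd x')" "length (snd y) = length (snd y')" "length (snd x) = length (snd y)" and nz: "dl ~= 0" "ep ~= 0"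
  using d t unfolding divided_pair_def tangent_eq_def by auto
 let ?a = "(snd x' ! l - snd x ! l) / dl" and ?b = "(snd y' ! l - snd y ! l) / ep"
 have "?a : A" "?b : A" "?a - ?b : M" "snd x ! l - snd y ! l : M"
  using d t l len unfolding divided_pair_def tangent_eq_def by auto
 moreover have "snd x ! l : A" "snd y ! l : A" using mem l len nth_mem by (metis subsetD)+
 moreover have "snd x' ! l = snd x ! l + dl * ?a" "snd y' ! l = snd y ! l + ep * ?b" using nz by simp_all
 ultimately show ?thesis unfolding cong2_def by blast
qed

lemma tangent_of_cong2:
 assumes nz: "dl : M" "dl : K" "dl ~= 0" "ep ~= 0"
  and len: "fst x = fst x'" "fst x = fst y" "length (snd x) = n" "length (snd x') = n" "length (snd y) = n"
  and c: "!!l. l < n ==> cong2 dl ep (snd x ! l) (snd x' ! l) (snd y ! l) (snd y' ! l)"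
 shows "divided_pair K dl x x' & tangent_eq dl x x' ep y y'"
proof -
 have "(snd x' ! l - snd x ! l) / dl : A & snd x ! l - snd y ! l : M &
  (snd x' ! l - snd x ! l) / dl - (snd y' ! l - snd y ! l) / ep : M" if l: "l < n" for l
 proof -
  obtain a b where "a : A" "a - b : M" "snd x ! l - snd y ! l : M" "snd x' ! l = snd x ! l + dl * a" "snd y' ! l = snd y ! l + ep * b"
  using c[OF l] unfolding cong2_def by blast
  then show ?thesis using nz by simp
 qed
 then show ?thesis unfolding divided_pair_def tangent_eq_def using nz len by simp
qed

end

section \<open>The search for a bound\<close>

fun piece_h :: "piece => cterms" where "piece_h (Piece h j g) = vals h"

definition dens :: "kpoly => nat set" where "dens P = (%t. snd (fst t) + 1) ` set P"

lemma common_multiple: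
 assumes "finite D" "0 ~: D" "l ~= (0::int)"
 shows "\<exists>N>0. (EX k. int N = k * l) & (ALL n:D. EX k. N = k * n)"
proof -
 let ?N = "nat \<bar>l\<bar> * \<Prod>D"
 have "?N > 0" using assms by (simp add: prod_pos) (metis gr0I)
 moreover have "int ?N = (sgn l * int (\<Prod>D)) * l"
 proof -
  have "int ?N = \<bar>l\<bar> * int (\<Prod>D)" unfolding of_nat_mult by simp
  then show ?thesis by (simp only: abs_sgn mult_ac)
 qed
 moreover have "EX k. ?N = k * n" if "n : D" for n
 proof -
  have "n dvd \<Prod>D" using assms(1) that by (rule dvd_prodI)
  then have "n dvd ?N" by simp
  then show ?thesis by (metis dvd_def mult.commute)
 qed
 ultimately show ?thesis by blast
qed

context presented_problem
begin

definition point_of :: "state => 'p" where "point_of w = (THE p. Pt w p)"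

lemma point_of: "Pt w p ==> point_of w = p"
 unfolding point_of_def using Pt_unique by blast

lemma charts_match:
 assumes m: "match th d'"
 shows "length (kCs d') = length Cs"
  and "i < length Cs ==> fst (kCs d' ! i) = dim (Cs ! i) & map (kvp th) (snd (kCs d' ! i)) = map vals (chart_eqs (Cs ! i))"
proof -
 have m1: "list_all2 (crel (same_value th)) Cs (kCs d')" using m unfolding d_def by simp
 show "length (kCs d') = length Cs" using list_all2_lengthD[OF m1] by simp
 assume "i < length Cs"
 then have m2: "crel (same_value th) (Cs ! i) (kCs d' ! i)" using list_all2_nthD[OF m1] by simp
 obtain n E where C: "Cs ! i = Chart n E" by (cases "Cs ! i")
 show "fst (kCs d' ! i) = dim (Cs ! i) & map (kvp th) (snd (kCs d' ! i)) = map vals (chart_eqs (Cs ! i))"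
  using m2 same_value_kvps unfolding C by simp
qed

lemma kFs_lengths: "match th d' ==> s < length fs ==> length (kFs d' ! s) = length Cs"
proof -
 assume m: "match th d'" and s: "s < length fs"
 have m1: "list_all2 (list_all2 (list_all2 (qrel (same_value th)))) Fs (kFs d')" using m unfolding d_def by simp
 have "list_all2 (list_all2 (qrel (same_value th))) (Fs ! s) (kFs d' ! s)"
  using list_all2_nthD[OF m1] s list_all2_lengthD[OF endo_pres] by simp
 then show ?thesis using list_all2_lengthD Fs_pres[OF s] unfolding presents_endomorphism_def by metis
qed

definition cover :: "kproblem => nat => nat => kpoly list" where
 "cover d' s i = snd (kCs d' ! i) @ map fst (kFs d' ! s ! i)"

lemma cover_match:
 assumes m: "match th d'" and s: "s < length fs" and i: "i < length Cs"
 shows "map (kvp th) (cover d' s i) = map vals (chart_eqs (Cs ! i)) @ map piece_h (Fs ! s ! i)"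
proof -
 have "list_all2 (qrel (same_value th)) (Fs ! s ! i) (kFs d' ! s ! i)" using pieces_match[OF m s i] by blast
 then have "map (kvp th) (map fst (kFs d' ! s ! i)) = map piece_h (Fs ! s ! i)"
 proof (induction rule: list_all2_induct)
  case (Cons Q Qs q qs)
  then show ?case using same_value_kvp by (cases Q) simp
 qed simp
 then show ?thesis unfolding cover_def using charts_match(2)[OF m i] by simp
qed

lemma kunit_cover:
 assumes s: "s < length fs" and i: "i < length Cs"
 shows "evt (%th. ALL d'. match th d' --> kunit (kz th) (dim (Cs ! i)) (cover d' s i))"
proof -
 have h: "(%Q. case Q of Piece h j g => vals h) = piece_h" by (rule ext) (simp split: piece.split)
 have "evt (%th. ALL gs'. map (kvp th) gs' = map vals (chart_eqs (Cs ! i)) @ map piece_h (Fs ! s ! i) --> kunit (kz th) (dim (Cs ! i)) gs')"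
 proof (rule kunit_complete[OF pieces_unit_terms[OF Fs_pres[OF s] i, unfolded h]])
  fix g assume g: "g : set (map vals (chart_eqs (Cs ! i)) @ map piece_h (Fs ! s ! i))"
  have "wf_terms (dim (Cs ! i)) (piece_h Q)" if Q: "Q : set (Fs ! s ! i)" for Q
  proof (cases Q)
  case (Piece h j g)
  have "Piece h j g : set (Fs ! s ! i)" using Q Piece by simp
  from endo_pieces(2)[OF Fs_pres[OF s] i this] have "well_formed_poly (dim (Cs ! i)) h" by blast
  then show ?thesis using wf_vals Piece by simp
  qed
  then show "wf_terms (dim (Cs ! i)) g" using g chart_facts(4)[OF i] wf_vals by auto
 qed
 then show ?thesis
 proof (rule evt_mono, intro allI impI)
  fix th d' assume u: "ALL gs'. map (kvp th) gs' = map vals (chart_eqs (Cs ! i)) @ map piece_h (Fs ! s ! i) --> kunit (kz th) (dim (Cs ! i)) gs'"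
  and m: "match th d'"
  show "kunit (kz th) (dim (Cs ! i)) (cover d' s i)" using u cover_match[OF m s i] by blast
 qed
qed

text \<open>The pieces cover the charts, so that in a large field there are certificates of this; a common
 multiple of the denominators is then a suitable \<open>N\<close>.\<close>

lemma kbound_complete:
 "evt (%th. ALL d' f. match th d' --> minimal_cert f th --> (EX B. kbound f d' B))"
proof -
 have "evt (%th. ALL z:{..<length fs} \<times> {..<length Cs}. ALL d'. match th d' --> kunit (kz th) (dim (Cs ! snd z)) (cover d' (fst z) (snd z)))"
 proof (rule evt_ball)
  fix z assume z: "z : {..<length fs} \<times> {..<length Cs}"
  show "evt (%th. ALL d'. match th d' --> kunit (kz th) (dim (Cs ! snd z)) (cover d' (fst z) (snd z)))"
  by (rule kunit_cover) (use z in auto)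
 qed simp
 then show ?thesis
 proof (rule evt_mono, intro allI impI)
  fix th d' f
  assume u: "ALL z:{..<length fs} \<times> {..<length Cs}. ALL d'. match th d' --> kunit (kz th) (dim (Cs ! snd z)) (cover d' (fst z) (snd z))"
  and m: "match th d'" and f: "minimal_cert f th"
  have kz: "kzero f = kz th" using minimal_cert_kzero[OF f] by blast
  have "EX zs. map snd zs = cover d' s i & kunit_cert (kzero f) (dim (Cs ! i)) zs" if si: "s < length fs" "i < length Cs" for s i
  proof -
  have "(s, i) : {..<length fs} \<times> {..<length Cs}" using si by simp
  from bspec[OF u this, unfolded fst_conv snd_conv] have "kunit (kz th) (dim (Cs ! i)) (cover d' s i)" using m by blast
  then show ?thesis unfolding kunit_def kz .
  qed
  then obtain zs where zs: "!!s i. s < length fs ==> i < length Cs ==>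
  map snd (zs s i) = cover d' s i & kunit_cert (kzero f) (dim (Cs ! i)) (zs s i)" by metis
  define D1 where "D1 = (%a. snd a + 1) ` set (snd (kstart d'))"
  define D2 where "D2 = (\<Union>Ps\<in>set (kFs d'). \<Union>Qs\<in>set Ps. \<Union>q\<in>set Qs. dens (fst q) \<union> (\<Union>g\<in>set (snd (snd q)). dens g))"
  define D3 where "D3 = (\<Union>s<length fs. \<Union>i<length Cs. \<Union>y\<in>set (zs s i). dens (fst y))"
  define D where "D = D1 \<union> D2 \<union> D3"
  have "finite D1" "0 ~: D1" "finite D2" "0 ~: D2" "finite D3" "0 ~: D3" unfolding D1_def D2_def D3_def dens_def by auto
  then have fD: "finite D" "0 ~: D" unfolding D_def by simp_all
  have "fst (snd f) ~= 0" using f unfolding minimal_cert_def fwf_def by blast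
  from common_multiple[OF fD this] obtain N where N: "0 < N" "EX k. int N = k * fst (snd f)" and ND: "ALL n:D. EX k. N = k * n"
  by blast
  have N3: "EX k. N = k * n" if "n : D" for n by (rule bspec[OF ND that])
  have dd: "divides_denominators N pl" if "dens pl <= D" for pl
  using that N3 unfolding divides_denominators_def dens_def by (auto simp del: mult_Suc_right)
  define k where "k = sum_list (map fst (kCs d'))"
  have k: "ALL C:set (kCs d'). fst C <= k"
  proof
  fix C assume "C : set (kCs d')"
  then have "fst C : set (map fst (kCs d'))" unfolding set_map by (rule imageI)
  then show "fst C <= k" unfolding k_def by (rule member_le_sum_list) simp
  qed
  have c1: "ALL a:set (snd (kstart d')). EX k. N = k * (snd a + 1)"
  proof
  fix a assume "a : set (snd (kstart d'))"
  then have "snd a + 1 : D" unfolding D_def D1_def by (intro UnI1 imageI)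
  then show "EX k. N = k * (snd a + 1)" by (rule N3)
  qed
  have c2: "ALL Ps:set (kFs d'). ALL Qs:set Ps. ALL q:set Qs. divides_denominators N (fst q) &
  (ALL g:set (snd (snd q)). divides_denominators N g)"
  proof (intro ballI conjI)
  fix Ps Qs q assume q: "Ps : set (kFs d')" "Qs : set Ps" "q : set Qs"
  have "dens (fst q) <= D2" unfolding D2_def using q by blast
  then show "divides_denominators N (fst q)" by (intro dd) (simp add: D_def le_supI1 le_supI2)
  fix g assume g: "g : set (snd (snd q))"
  have "dens g <= D2" unfolding D2_def using q g by blast
  then show "divides_denominators N g" by (intro dd) (simp add: D_def le_supI1 le_supI2)
  qed
  have c3: "ALL Ps:set (kFs d'). ALL z:set (zip (kCs d') Ps). EX zs. map snd zs = snd (fst z) @ map fst (snd z) &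
  kunit_cert (kzero f) (fst (fst z)) zs & (ALL y:set zs. divides_denominators N (fst y))"
  proof (intro ballI)
  fix Ps z assume "Ps : set (kFs d')" and z: "z : set (zip (kCs d') Ps)"
  then obtain s where s: "s < length fs" "Ps = kFs d' ! s" using length_kFs[OF m] by (auto simp: in_set_conv_nth)
  obtain i where i: "i < length Cs" "z = (kCs d' ! i, kFs d' ! s ! i)"
  using z charts_match(1)[OF m] kFs_lengths[OF m s(1)] unfolding s(2) by (auto simp: set_zip)
  show "EX zs. map snd zs = snd (fst z) @ map fst (snd z) &
  kunit_cert (kzero f) (fst (fst z)) zs & (ALL y:set zs. divides_denominators N (fst y))"
  proof (intro exI[of _ "zs s i"] conjI ballI)
  show "map snd (zs s i) = snd (fst z) @ map fst (snd z)" using zs[OF s(1) i(1)] unfolding cover_def i(2) by simp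
  show "kunit_cert (kzero f) (fst (fst z)) (zs s i)" using zs[OF s(1) i(1)] charts_match(2)[OF m i(1)] unfolding i(2) by simp
  show "divides_denominators N (fst y)" if "y : set (zs s i)" for y
  proof -
  have "dens (fst y) <= D3" unfolding D3_def using that s(1) i(1) by blast
  then show ?thesis by (intro dd) (simp add: D_def le_supI2)
  qed
  qed
  qed
  show "EX B. kbound f d' B" unfolding kbound_def
  by (rule exI[of _ "orbit_bound N (fst f) (length (kCs d')) k"], rule exI[of _ N], rule exI[of _ k], intro conjI)
  (rule N(1), rule N(2), rule k, rule order_refl, rule c1, rule c2, rule c3)
 qed
qed

text \<open>Each generator acts by the first piece whose function \<open>h\<close> is a unit.  By the certificate of the
 cover not all \<open>h\<close> lie in the maximal ideal, so that such a piece exists, and the choice depends on the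
 residue only.  Hence the action is compatible with congruence, and it preserves integral coordinates.\<close>

lemma prime_dynamics:
 assumes m: "match th d'" and th: "algebraic th" and f: "fwf f" "tval th (fterms f) = 0"
  and fin: "finite orb" and p: "prime p" "~ p dvd N"
  and l: "int N = k * fst (snd f)" and dm: "ALL C:set (kCs d'). fst C <= dmax"
  and c1: "ALL a:set (snd (kstart d')). EX k. N = k * (snd a + 1)"
  and c2: "ALL Ps:set (kFs d'). ALL Qs:set Ps. ALL q:set Qs. divides_denominators N (fst q) &
  (ALL g:set (snd (snd q)). divides_denominators N g)"
  and c3: "ALL Ps:set (kFs d'). ALL z:set (zip (kCs d') Ps). EX zs. map snd zs = snd (fst z) @ map fst (snd z) &
  kunit_cert (kzero f) (fst (fst z)) zs & (ALL y:set zs. divides_denominators N (fst y))"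
 shows "\<exists>A (code :: complex => complex => nat) Good ph.
  residue_dynamics A p (adjoin th) code Good ph {..<length fs} &
  (ALL s:{..<length fs}. ALL w:Good. point_of (ph s w) = F s (point_of w)) & point_of ` Good = orb &
  finite (residue_dynamics.graph A (adjoin th) code Good ph ` {w. set w <= {..<length fs}}) &
  card (residue_dynamics.graph A (adjoin th) code Good ph ` {w. set w <= {..<length fs}})
  <= 2 ^ ((length Cs * ((p ^ fst f + 1) ^ dmax) ^ 2) ^ 2)"
proof -
 obtain A where V: "valuation_ring A p" using exists_valuation_ring[OF p(1)] by blast
 interpret V: valuation_ring A p by (rule V)
 let ?K = "adjoin th"
 have Kr: "is_subring ?K" by (rule is_subring_adjoin[OF th])
 have "~ int p dvd fst (snd f)"
 proof
  assume "int p dvd fst (snd f)"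
  then have "int p dvd int N" unfolding l by simp
  then show False using p(2) by simp
 qed
 then have \<theta>A: "th : A" by (rule V.integral_mem[OF root_equation[OF f]])
 have tA: "tval th a : A" for a
 proof (induction a)
  case Nil
  show ?case using V.A(1) by simp
 next
  case (Cons t a)
  then show ?case using V.A(3)[OF V.A(5)[OF V.A(8) V.A(7)[OF \<theta>A]] Cons] by simp
 qed
 have kA: "kval th c : A" if "EX k. N = k * (snd c + 1)" for c
 proof -
  have "~ p dvd snd c + 1" using that p(2) by (metis dvd_mult)
  then have "inverse (of_nat (snd c + 1)) : A" by (rule V.inverse_nat)
  then show ?thesis unfolding kval_def divide_inverse using V.A(5)[OF tA] by blast
 qed
 have pA: "fst t : A" if h: "divides_denominators N pl" "t : set (kvp th pl)" for pl t
 proof -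
  obtain u where "u : set pl" "fst t = kval th (fst u)" using h(2) unfolding kvp_def by auto
  then show ?thesis using kA h(1) unfolding divides_denominators_def by simp
 qed
 have pK: "fst t : ?K" if "t : set (kvp th pl)" for pl t
  using that kval_mem_adjoin[OF th] unfolding kvp_def by auto
 have piece: "(ALL t:set (vals q). fst t : A \<inter> ?K & length (snd t) = dim (Cs ! i))"
  if s: "s < length fs" and i: "i < length Cs" and Q: "Piece h j g : set (Fs ! s ! i)" and q: "q : insert h (set g)" for s i h j g q
 proof -
  have "list_all2 (qrel (same_value th)) (Fs ! s ! i) (kFs d' ! s ! i)" using pieces_match[OF m s i] by blast
  then obtain Q' where Q': "Q' : set (kFs d' ! s ! i)" "qrel (same_value th) (Piece h j g) Q'"
  using list_all2_ex1[OF _ Q] by blast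
  have mem: "kFs d' ! s : set (kFs d')" "kFs d' ! s ! i : set (kFs d' ! s)" using pieces_match[OF m s i] by simp_all
  have dd: "divides_denominators N (fst Q')" "!!g. g : set (snd (snd Q')) ==> divides_denominators N g"
  using bspec[OF bspec[OF bspec[OF c2 mem(1)] mem(2)] Q'(1)] by blast+
  have "EX pl. divides_denominators N pl & kvp th pl = vals q"
  proof (cases "q = h")
  case True
  then show ?thesis using dd(1) Q'(2) same_value_kvp by auto
  next
  case False
  then have "q : set g" using q by simp
  moreover have "list_all2 (prel (same_value th)) g (snd (snd Q'))" using Q'(2) by simp
  ultimately obtain pl where "pl : set (snd (snd Q'))" "prel (same_value th) q pl" using list_all2_ex1 by metis
  then show ?thesis using dd(2) same_value_kvp by blast
  qed
  then obtain pl where pl: "divides_denominators N pl" "kvp th pl = vals q" by blast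
  have "wf_terms (dim (Cs ! i)) (vals q)" using endo_pieces(2)[OF Fs_pres[OF s] i Q] q wf_vals by auto
  then show ?thesis using pA[OF pl(1)] pK[of _ pl] pl(2) wf_terms_length by auto
 qed
 define sel where "sel s w = (case find (%Q. teval (piece_h Q) (snd w) ~: V.M) (Fs ! s ! fst w) of Some Q => Q)" for s and w :: state
 define ph where "ph s w = (case sel s w of Piece h j g =>
  (j, map (%q. teval (vals q) (snd w) / teval (vals h) (snd w)) g))" for s and w :: state
 define Good where "Good = {w. (EX q:orb. Pt w q) & set (snd w) <= A \<inter> ?K}"
 have GoodD: "fst w < length Cs" "length (snd w) = dim (Cs ! fst w)" "set (snd w) <= A" "set (snd w) <= ?K" if h: "w : Good" for w
 proof -
  obtain q where q: "Pt w q" "set (snd w) <= A \<inter> ?K" using h unfolding Good_def by blast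
  show "fst w < length Cs" "length (snd w) = dim (Cs ! fst w)" "set (snd w) <= A" "set (snd w) <= ?K"
  using Pt_facts[OF q(1)] q(2) by simp_all
 qed
 have sel: "EX h j g. find (%Q. teval (piece_h Q) (snd w) ~: V.M) (Fs ! s ! fst w) = Some (Piece h j g) &
  Piece h j g : set (Fs ! s ! fst w) & teval (vals h) (snd w) ~: V.M"
  if w: "w : Good" and s: "s < length fs" for s w
 proof (cases "find (%Q. teval (piece_h Q) (snd w) ~: V.M) (Fs ! s ! fst w)")
  case (Some Q)
  then have Q1: "Q : set (Fs ! s ! fst w)" "teval (piece_h Q) (snd w) ~: V.M" by (auto simp: find_Some_iff)
  obtain h j g where Qh: "Q = Piece h j g" by (cases Q)
  show ?thesis using Some Q1 unfolding Qh piece_h.simps by blast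
 next
  case None
  then have all: "teval (piece_h Q) (snd w) : V.M" if "Q : set (Fs ! s ! fst w)" for Q using that by (auto simp: find_None_iff)
  note i = GoodD(1)[OF w]
  obtain q where q: "Pt w q" using w unfolding Good_def by blast
  have mem: "kFs d' ! s : set (kFs d')" using pieces_match[OF m s i] by simp
  have "(kCs d' ! fst w, kFs d' ! s ! fst w) : set (zip (kCs d') (kFs d' ! s))"
  using charts_match(1)[OF m] kFs_lengths[OF m s] i by (auto simp: set_zip)
  from bspec[OF bspec[OF c3 mem] this] obtain zs where zs: "map snd zs = cover d' s (fst w)"
  "kunit_cert (kzero f) (dim (Cs ! fst w)) zs" "!!y. y : set zs ==> divides_denominators N (fst y)"
  unfolding cover_def using charts_match(2)[OF m i] by auto
  have "teval (kvp th (snd z)) (snd w) : V.M" if "z : set zs" for z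
  proof -
  have "snd z : set (cover d' s (fst w))" using zs(1) that by (metis imageI list.set_map)
  then have "kvp th (snd z) : set (map (kvp th) (cover d' s (fst w)))" by simp
  then consider g where "g : set (chart_eqs (Cs ! fst w))" "kvp th (snd z) = vals g" | Q where "Q : set (Fs ! s ! fst w)" "kvp th (snd z) = piece_h Q"
  unfolding cover_match[OF m s i] by auto
  then show ?thesis
  proof cases
  case 1
  then show ?thesis using pt_equations[OF q[unfolded Pt_def]] V.zero_M by simp
  next
  case 2
  then show ?thesis using all by simp
  qed
  qed
  moreover have "teval (kvp th (fst z)) (snd w) : A" if "z : set zs" for z
  by (rule teval_in_subring[OF V.subring GoodD(3)[OF w]]) (rule pA[OF zs(3)[OF that]])
  ultimately have pr: "teval (kvp th (fst z)) (snd w) * teval (kvp th (snd z)) (snd w) : V.M" if "z : set zs" for z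
  using V.M_mult that by blast
  have "(\<Sum>z\<leftarrow>xs. teval (kvp th (fst z)) (snd w) * teval (kvp th (snd z)) (snd w)) : V.M" if "set xs <= set zs" for xs
  using that
  proof (induction xs)
  case (Cons x xs)
  then show ?case using V.M_add[OF pr[of x]] by simp
  qed (simp add: V.zero_M)
  then have "(\<Sum>z\<leftarrow>zs. teval (kvp th (fst z)) (snd w) * teval (kvp th (snd z)) (snd w)) : V.M" by blast
  moreover have "(\<Sum>z\<leftarrow>zs. teval (kvp th (fst z)) (snd w) * teval (kvp th (snd z)) (snd w)) = 1"
  by (rule kunit_cert_value[OF zs(2) kzero_sound[OF f(2)] GoodD(2)[OF w]])
  ultimately show ?thesis using V.one_M by simp
 qed
 have ph: "cstep s w (ph s w) & ph s w : Good & point_of (ph s w) = F s (point_of w)" if s: "s < length fs" and w: "w : Good" for s w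
 proof -
  obtain h j g where h: "find (%Q. teval (piece_h Q) (snd w) ~: V.M) (Fs ! s ! fst w) = Some (Piece h j g)"
  "Piece h j g : set (Fs ! s ! fst w)" "teval (vals h) (snd w) ~: V.M" using sel[OF w s] by blast
  have e: "ph s w = (j, map (%q. teval (vals q) (snd w) / teval (vals h) (snd w)) g)" unfolding ph_def sel_def h(1) by simp
  have h0: "teval (vals h) (snd w) ~= 0" using h(3) V.zero_M by auto
  have c: "cstep s w (ph s w)" unfolding cstep_def using s h(2) h0 e by blast
  obtain q where q: "q : orb" "Pt w q" using w unfolding Good_def by blast
  have pt: "Pt (ph s w) (F s q)" by (rule cstep_Pt[OF q(2) c])
  note i = GoodD(1)[OF w]
  have val: "teval (vals r) (snd w) : A \<inter> ?K" if "r : insert h (set g)" for r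
  proof
  show "teval (vals r) (snd w) : A" by (rule teval_in_subring[OF V.subring GoodD(3)[OF w]]) (use piece[OF s i h(2) that] in blast)
  show "teval (vals r) (snd w) : ?K" by (rule teval_in_subring[OF Kr GoodD(4)[OF w]]) (use piece[OF s i h(2) that] in blast)
  qed
  have hA: "teval (vals h) (snd w) : A" "teval (vals h) (snd w) : ?K" using val[of h] by simp_all
  have inv: "inverse (teval (vals h) (snd w)) : A" using V.unit_inverse[OF hA(1) h(3)] by blast
  have "teval (vals r) (snd w) / teval (vals h) (snd w) : A \<inter> ?K" if "r : set g" for r
  proof -
  have rA: "teval (vals r) (snd w) : A" "teval (vals r) (snd w) : ?K" using val[of r] that by simp_all
  show ?thesis using V.A(5)[OF rA(1) inv] adjoin_divide[OF th rA(2) hA(2)] by (simp add: divide_inverse)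
  qed
  then have "set (snd (ph s w)) <= A \<inter> ?K" unfolding e by auto
  then have "ph s w : Good" unfolding Good_def using pt orb_step[OF q(1) s] by blast
  then show ?thesis using c point_of[OF pt] point_of[OF q(2)] by simp
 qed
 have pi: "point_of ` Good = orb"
 proof
  show "point_of ` Good <= orb" unfolding Good_def using point_of by auto
  have "EX w:Good. point_of w = q" if "q : orb" for q
  using that
  proof (rule orb_induct)
  have "set (snd (cval th (kstart d'))) <= A \<inter> ?K"
  proof
  fix z assume "z : set (snd (cval th (kstart d')))"
  then have "z : kval th ` set (snd (kstart d'))" by (simp only: cval_simps set_map)
  then obtain a where a: "a : set (snd (kstart d'))" and z: "z = kval th a" by (rule imageE)
  show "z : A \<inter> ?K" unfolding z by (rule IntI[OF kA[OF bspec[OF c1 a]] kval_mem_adjoin[OF th]])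
  qed
  then have "set (snd start) <= A \<inter> ?K" unfolding start_match[OF m] .
  then have "start : Good" unfolding Good_def using Pt_start x0_orb by blast
  then show "EX w:Good. point_of w = x0" using point_of[OF Pt_start] by blast
  fix q s assume "EX w:Good. point_of w = q" and s: "s < length fs"
  then obtain w where "w : Good" "point_of w = q" by blast
  then show "EX w:Good. point_of w = F s q" using ph[OF s] by metis
  qed
  then show "orb <= point_of ` Good" by blast
 qed
 let ?B = "(%i. th ^ i) ` {..<fst f}"
 have KB: "?K <= rat.span ?B" by (rule adjoin_subset_span[OF f])
 have "\<exists>(code :: complex => complex => nat) R. finite R & card R <= p ^ card ?B &
  (ALL x:A. x : rat.span ?B --> code x : R) &
  (ALL x:A. ALL y:A. x : rat.span ?B --> y : rat.span ?B --> (code x = code y) = (x - y : V.M))"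
 proof (rule V.finite_residues)
  show "finite ?B" by simp
  fix code :: "complex => complex => nat" and R
  assume h: "finite R" "card R <= p ^ card ?B" and h3: "!!x. x : A ==> x : rat.span ?B ==> code x : R"
  and h4: "!!x y. x : A ==> y : A ==> x : rat.span ?B ==> y : rat.span ?B ==> (code x = code y) = (x - y : V.M)"
  show ?thesis
  by (rule exI[of _ code], rule exI[of _ R], intro conjI ballI impI)
  (rule h(1), rule h(2), rule h3, assumption, assumption, rule h4, assumption, assumption, assumption, assumption)
 qed
 then obtain code :: "complex => complex => nat" and R where R1: "finite R" "card R <= p ^ card ?B"
  and R3: "ALL x:A. x : rat.span ?B --> code x : R"
  and R4: "ALL x:A. ALL y:A. x : rat.span ?B --> y : rat.span ?B --> (code x = code y) = (x - y : V.M)"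
  by (elim exE conjE) (rule that)
 note R = R1 R3[rule_format] R4[rule_format]
 have D: "residue_dynamics A p ?K code Good ph {..<length fs}"
 proof unfold_locales
  show "a - b : ?K" "a / b : ?K" if "a : ?K" "b : ?K" for a b using that adjoin_diff[OF th] adjoin_divide[OF th] by blast+
  show "of_nat p : ?K" by (rule is_subringD(9)[OF Kr])
  show "code a = code b \<longleftrightarrow> a - b : V.M" if "a : A" "b : A" "a : ?K" "b : ?K" for a b using that KB by (intro R(4)) auto
  have "Good <= orb_states" unfolding Good_def orb_states_def by blast
  then show "finite Good" using finite_orb_states[OF fin] finite_subset by blast
  show "set (snd x) <= A \<inter> ?K" if "x : Good" for x using that unfolding Good_def by blast
  show "length (snd x) = length (snd y)" if "x : Good" "y : Good" "fst x = fst y" for x y using GoodD(2) that by metis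
  show "ph s x : Good" if "s : {..<length fs}" "x : Good" for s x using ph that by blast
  show "V.divided_pair ?K dl (ph s x) (ph s x') & V.tangent_eq dl (ph s x) (ph s x') ep (ph s y) (ph s y')"
  if s: "s : {..<length fs}" and G: "x : Good" "x' : Good" "y : Good" "y' : Good"
  and dp: "V.divided_pair ?K dl x x'" "V.divided_pair ?K ep y y'" and te: "V.tangent_eq dl x x' ep y y'" for s x x' y y' dl ep
  proof -
  have s': "s < length fs" using s by simp
  have dl: "dl : V.M" "dl : ?K" "dl ~= 0" "ep : V.M" "ep ~= 0" using dp unfolding V.divided_pair_def by blast+
  have ch: "fst x' = fst x" "fst y = fst x" "fst y' = fst x" using dp te unfolding V.divided_pair_def V.tangent_eq_def by simp_all
  let ?i = "fst x"
  let ?n = "dim (Cs ! ?i)"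
  note i = GoodD(1)[OF G(1)]
  have len: "length (snd x) = ?n" "length (snd x') = ?n" "length (snd y) = ?n" "length (snd y') = ?n"
  using GoodD(2)[OF G(1)] GoodD(2)[OF G(2)] GoodD(2)[OF G(3)] GoodD(2)[OF G(4)] ch by simp_all
  have co: "V.cong2 dl ep (snd x ! l) (snd x' ! l) (snd y ! l) (snd y' ! l)" if "l < ?n" for l
  by (rule V.cong2_of_tangent[OF dp te]) (use that len GoodD(3) G in auto)
  have tev: "V.cong2 dl ep (teval (vals q) (snd x)) (teval (vals q) (snd x')) (teval (vals q) (snd y)) (teval (vals q) (snd y'))"
  if "Piece h j g : set (Fs ! s ! ?i)" "q : insert h (set g)" for h j g q
  by (rule V.cong2_teval[OF dl(1,4) _ len co]) (use piece[OF s' i that] in blast)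
  have same: "(teval (piece_h Q) (snd v) ~: V.M) = (teval (piece_h Q) (snd x) ~: V.M)"
  if Q: "Q : set (Fs ! s ! ?i)" and v: "v : {x', y, y'}" for Q v
  proof -
  obtain h j g where Qh: "Q = Piece h j g" by (cases Q)
  note c = V.cong2_members[OF dl(1,4) tev[of h j g h]]
  have mM: "a : V.M \<longleftrightarrow> b : V.M" if "a - b : V.M" for a b
  using V.M_add[OF that, of b] V.M_diff[of a "a - b"] that by auto
  have d: "teval (vals h) (snd x) - teval (vals h) (snd y) : V.M" "teval (vals h) (snd x') - teval (vals h) (snd x) : V.M"
  "teval (vals h) (snd y') - teval (vals h) (snd y) : V.M" using c(5-7) Q Qh by simp_all
  show ?thesis using v mM[OF d(1)] mM[OF d(2)] mM[OF d(3)] unfolding Qh by auto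
  qed
  have fnd: "find (%Q. teval (piece_h Q) (snd v) ~: V.M) (Fs ! s ! ?i) = find (%Q. teval (piece_h Q) (snd x) ~: V.M) (Fs ! s ! ?i)"
  if "v : {x', y, y'}" for v
  by (rule find_cong[OF refl]) (rule same[OF _ that])
  obtain h j g where h: "find (%Q. teval (piece_h Q) (snd x) ~: V.M) (Fs ! s ! ?i) = Some (Piece h j g)"
  "Piece h j g : set (Fs ! s ! ?i)" "teval (vals h) (snd x) ~: V.M" using sel[OF G(1) s'] by blast
  have e: "ph s v = (j, map (%q. teval (vals q) (snd v) / teval (vals h) (snd v)) g)" if v: "v : {x, x', y, y'}" for v
  proof -
  have "find (%Q. teval (piece_h Q) (snd v) ~: V.M) (Fs ! s ! fst v) = Some (Piece h j g)"
  using v h(1) fnd[of v] ch by auto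
  then show ?thesis unfolding ph_def sel_def by simp
  qed
  show ?thesis
  proof (rule V.tangent_of_cong2[OF dl(1-3,5), where n = "length g"])
  fix l assume l: "l < length g"
  then have gl: "g ! l : insert h (set g)" by simp
  show "V.cong2 dl ep (snd (ph s x) ! l) (snd (ph s x') ! l) (snd (ph s y) ! l) (snd (ph s y') ! l)"
  using V.cong2_divide[OF dl(1,4) tev[OF h(2) gl] tev[OF h(2) insertI1] h(3)] l by (simp add: e)
  qed (simp_all add: e)
  qed
 qed
 have "card ?B <= fst f" using card_image_le[of "{..<fst f}" "%i. th ^ i"] by simp
 then have "p ^ card ?B <= p ^ fst f" using p(1) prime_gt_0_nat by (intro power_increasing) (auto simp: Suc_le_eq)
 then have cR: "card R <= p ^ fst f" using R(2) by linarith
 have cg: "finite (residue_dynamics.graph A ?K code Good ph ` {w. set w <= {..<length fs}}) &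
  card (residue_dynamics.graph A ?K code Good ph ` {w. set w <= {..<length fs}}) <= 2 ^ ((length Cs * ((card R + 1) ^ dmax) ^ 2) ^ 2)"
 proof (rule residue_dynamics.card_graphs[OF D _ R(1)])
  show "fst x < length Cs & length (snd x) <= dmax" if x: "x : Good" for x
  proof -
  note i = GoodD(1)[OF x]
  have "kCs d' ! fst x : set (kCs d')" using i charts_match(1)[OF m] by simp
  then have "dim (Cs ! fst x) <= dmax" using dm charts_match(2)[OF m i] by metis
  then show ?thesis using i GoodD(2)[OF x] by simp
  qed
  show "code a : R" if "a : A" "a : ?K" for a using that KB by (intro R(3)) auto
 qed
 have "(2::nat) ^ ((length Cs * ((card R + 1) ^ dmax) ^ 2) ^ 2) <= 2 ^ ((length Cs * ((p ^ fst f + 1) ^ dmax) ^ 2) ^ 2)"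
  using cR by (intro power_increasing power_mono mult_le_mono) auto
 then have "card (residue_dynamics.graph A ?K code Good ph ` {w. set w <= {..<length fs}}) <= 2 ^ ((length Cs * ((p ^ fst f + 1) ^ dmax) ^ 2) ^ 2)"
  using cg by linarith
 then show ?thesis using D ph pi cg
  by (intro exI[of _ A] exI[of _ code] exI[of _ Good] exI[of _ ph]) auto
qed

text \<open>The two primes are prime factors of \<open>N + 1\<close> and of \<open>N * N + N + 1\<close>.\<close>

lemma kbound_sound:
 assumes m: "match th d'" and th: "algebraic th" and f: "fwf f" "tval th (fterms f) = 0"
  and k: "kbound f d' B" and fin: "finite orb" and inj: "!!s. s < length fs ==> inj_on (F s) orb"
 shows "card orb <= B"
proof -
 obtain N dm l where N: "0 < N" "int N = l * fst (snd f)" "ALL C:set (kCs d'). fst C <= dm"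
  "orbit_bound N (fst f) (length (kCs d')) dm <= B" "ALL a:set (snd (kstart d')). EX k. N = k * (snd a + 1)"
  "ALL Ps:set (kFs d'). ALL Qs:set Ps. ALL q:set Qs. divides_denominators N (fst q) &
  (ALL g:set (snd (snd q)). divides_denominators N g)"
  "ALL Ps:set (kFs d'). ALL z:set (zip (kCs d') Ps). EX zs. map snd zs = snd (fst z) @ map fst (snd z) &
  kunit_cert (kzero f) (fst (fst z)) zs & (ALL y:set zs. divides_denominators N (fst y))"
  using k unfolding kbound_def by (elim exE conjE) blast
 let ?Q = "N * N + N + 1"
 obtain p where p: "prime p" "p dvd N + 1" using prime_factor_nat[of "N + 1"] N(1) by auto
 obtain q where q: "prime q" "q dvd ?Q" using prime_factor_nat[of ?Q] N(1) by auto
 have pN: "~ p dvd N" using p by (metis dvd_add_right_iff not_prime_unit)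
 have qN: "~ q dvd N"
 proof
  assume "q dvd N"
  then have "q dvd N * N + N" by simp
  then show False using q by (metis dvd_add_right_iff not_prime_unit)
 qed
 have pq: "p ~= q"
 proof
  assume "p = q"
  then have "p dvd N * (N + 1) + 1" using q(2) by (simp add: algebra_simps)
  moreover have "p dvd N * (N + 1)" using p(2) by (rule dvd_mult)
  ultimately show False using p(1) by (metis dvd_add_right_iff not_prime_unit)
 qed
 have le: "p <= ?Q" "q <= ?Q" using dvd_imp_le[OF p(2)] dvd_imp_le[OF q(2)] by simp_all
 define T where "T = (2::nat) ^ ((length Cs * ((?Q ^ fst f + 1) ^ dm) ^ 2) ^ 2)"
 have T: "(2::nat) ^ ((length Cs * ((r ^ fst f + 1) ^ dm) ^ 2) ^ 2) <= T" if "r <= ?Q" for r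
  unfolding T_def using that by (intro power_increasing power_mono mult_le_mono add_mono) auto
 obtain A1 and code1 :: "complex => complex => nat" and G1 \<phi>1 where 1: "residue_dynamics A1 p (adjoin th) code1 G1 \<phi>1 {..<length fs}"
  "!!s w. s : {..<length fs} ==> w : G1 ==> point_of (\<phi>1 s w) = F s (point_of w)" "point_of ` G1 = orb"
  "finite (residue_dynamics.graph A1 (adjoin th) code1 G1 \<phi>1 ` {w. set w <= {..<length fs}})"
  "card (residue_dynamics.graph A1 (adjoin th) code1 G1 \<phi>1 ` {w. set w <= {..<length fs}}) <= 2 ^ ((length Cs * ((p ^ fst f + 1) ^ dm) ^ 2) ^ 2)"
  using prime_dynamics[OF m th f fin p(1) pN N(2,3,5,6,7)] by (elim exE conjE) blast
 obtain A2 and code2 :: "complex => complex => nat" and G2 \<phi>2 where 2: "residue_dynamics A2 q (adjoin th) code2 G2 \<phi>2 {..<length fs}"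
  "!!s w. s : {..<length fs} ==> w : G2 ==> point_of (\<phi>2 s w) = F s (point_of w)" "point_of ` G2 = orb"
  "finite (residue_dynamics.graph A2 (adjoin th) code2 G2 \<phi>2 ` {w. set w <= {..<length fs}})"
  "card (residue_dynamics.graph A2 (adjoin th) code2 G2 \<phi>2 ` {w. set w <= {..<length fs}}) <= 2 ^ ((length Cs * ((q ^ fst f + 1) ^ dm) ^ 2) ^ 2)"
  using prime_dynamics[OF m th f fin q(1) qN N(2,3,5,6,7)] by (elim exE conjE) blast
 have "card orb <= T * T"
 proof (rule orbit_bound_two_primes[OF 1(1) 2(1) pq 1(2,3) 2(2,3) _ x0_orb _ 1(4) order_trans[OF 1(5) T[OF le(1)]] 2(4) order_trans[OF 2(5) T[OF le(2)]]])
  show "inj_on (F s) orb" if "s : {..<length fs}" for s using inj that by simp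
  show "EX w. set w <= {..<length fs} & fold F w x0 = y" if "y : orb" for y using that unfolding orb_def by blast
 qed simp_all
 also have "... = orbit_bound N (fst f) (length (kCs d')) dm"
  unfolding orbit_bound_def T_def charts_match(1)[OF m] by (simp add: power2_eq_square)
 finally show ?thesis using N(4) by linarith
qed

end

section \<open>The decision\<close>

context presented_problem
begin

lemma well_formed_nums: "well_formed_poly n g ==> c : pnums g ==> EX z. isolates c z"
 unfolding well_formed_poly_def pnums_def by auto

lemma numbers_isolated:
 assumes c: "c : dnums d"
 shows "EX z. isolates c z"
proof -
 have wf: "EX z. isolates c z" if "g : G" "c : pnums g" "ALL g:G. well_formed_poly n g" for g G n
  using that well_formed_nums by blast
 have C: "EX z. isolates c z" if "i < length Cs" "c : cnums (Cs ! i)" for i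
 proof -
  have "cnums C = \<Union>(pnums ` set (chart_eqs C))" for C by (cases C) simp
  then show ?thesis using that chart_facts(4)[OF that(1)] well_formed_nums by blast
 qed
 have K: "EX z. isolates c z" if ij: "i < length Cs" "j < length Cs" and cK: "c : onums (Os ! i ! j)" for i j
 proof -
  obtain C G H where O: "Os ! i ! j = Overlap C G H" by (cases "Os ! i ! j")
  obtain n E where CE: "C = Chart n E" by (cases C)
  obtain z where "overlap_coords i j C G H z" using overlap[OF ij O] by blast
  then have "ALL g:set E. well_formed_poly n g" "ALL g:set G \<union> set H. well_formed_poly n g"
  unfolding overlap_coords_def CE by auto
  then show ?thesis using cK well_formed_nums unfolding O CE onums.simps cnums.simps by blast
 qed
 have Q: "EX z. isolates c z" if s: "s < length fs" and i: "i < length Cs" and q: "q : set (Fs ! s ! i)" and cq: "c : qnums q" for s i q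
 proof -
  obtain h j g where qh: "q = Piece h j g" by (cases q)
  have "well_formed_poly (dim (Cs ! i)) h" "ALL q:set g. well_formed_poly (dim (Cs ! i)) q"
  using endo_pieces(2)[OF Fs_pres[OF s] i] q qh by blast+
  then show ?thesis using cq well_formed_nums unfolding qh qnums.simps by blast
 qed
 have lO: "length Os = length Cs" "!!i. i < length Cs ==> length (Os ! i) = length Cs" using PV unfolding presents_variety_def by auto
 have lF: "length Fs = length fs" "!!s. s < length fs ==> length (Fs ! s) = length Cs"
  using list_all2_lengthD[OF endo_pres] Fs_pres unfolding presents_endomorphism_def by auto
 consider (chart) E where "E : set Cs" "c : cnums E" | (overlap) v E where "v : set Os" "E : set v" "c : onums E"
  | (piece) Ps Qs q where "Ps : set Fs" "Qs : set Ps" "q : set Qs" "c : qnums q" | (given) "c : set a0"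
  using c unfolding d_def dnums.simps by blast
 then show ?thesis
 proof cases
  case chart
  then obtain i where "i < length Cs" "Cs ! i = E" by (metis in_set_conv_nth)
  then show ?thesis using C chart(2) by metis
 next
  case overlap
  then obtain i where i: "i < length Cs" "Os ! i = v" using lO(1) by (metis in_set_conv_nth)
  then obtain j where "j < length Cs" "Os ! i ! j = E" using lO(2) overlap(2) by (metis in_set_conv_nth)
  then show ?thesis using K[OF i(1)] overlap(3) by metis
 next
  case piece
  then obtain s where s: "s < length fs" "Fs ! s = Ps" using lF(1) by (metis in_set_conv_nth)
  then obtain i where "i < length Cs" "Fs ! s ! i = Qs" using lF(2) piece(2) by (metis in_set_conv_nth)
  then show ?thesis using Q[OF s(1)] piece(3,4) by metis
 next
  case given
  then show ?thesis using point unfolding presents_point_def by (metis in_set_conv_nth)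
 qed
qed

lemma evt_reading:
 assumes "evt Q"
 shows "EX th tu d'. Q th & reads (encode_problem d) tu d' & minimal_cert (fst tu) th & kzero (fst tu) = kz th & match th d'"
proof -
 have "evt (%th. algebraic th & num_value ` dnums d <= adjoin th)"
  by (rule evt_adjoin) (use finite_dnums numbers_isolated num_value_algebraic in auto)
 from evt_ex[OF evt_conj[OF assms this]] obtain th where th: "Q th" "algebraic th" "num_value ` dnums d <= adjoin th" by blast
 obtain tu d' where tu: "reads (encode_problem d) tu d'" "minimal_cert (fst tu) th" "match th d'"
  using reads_complete[OF th(2) numbers_isolated th(3)] by blast
 have "kzero (fst tu) = kz th" using minimal_cert_kzero[OF tu(2)] by blast
 then show ?thesis using th(1) tu by blast
qed

lemma reading_root:
 assumes "reads (encode_problem d) tu d'"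
 shows "EX th. algebraic th & fwf (fst tu) & tval th (fterms (fst tu)) = 0 & (ALL x. kzero (fst tu) x --> kval th x = 0) & match th d'"
 using reads_sound[OF assms numbers_isolated] kzero_sound by blast

lemma periodic_cert_iff: "periodic_cert (encode_problem d) \<longleftrightarrow> periodic X (set fs) x0"
proof
 assume "periodic_cert (encode_problem d)"
 then obtain tu d' where tu: "reads (encode_problem d) tu d'" "kper (kzero (fst tu)) d'" unfolding periodic_cert_def by blast
 obtain th where th: "match th d'" "!!x. kzero (fst tu) x ==> kval th x = 0" using reading_root[OF tu(1)] by blast
 show "periodic X (set fs) x0" unfolding periodic_iff by (rule kper_sound[OF th tu(2)])
next
 assume "periodic X (set fs) x0"
 then have "evt (%th. ALL d'. match th d' --> kper (kz th) d')" unfolding periodic_iff by (intro kper_complete) auto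
 from evt_reading[OF this] obtain th tu d' where e: "ALL d'. match th d' --> kper (kz th) d'"
  "reads (encode_problem d) tu d'" "kzero (fst tu) = kz th" "match th d'" by blast
 have "kper (kzero (fst tu)) d'" unfolding e(3) using e(1,4) by blast
 then show "periodic_cert (encode_problem d)" unfolding periodic_cert_def using e(2) by blast
qed

lemma nonperiodic_cert_iff: "nonperiodic_cert (encode_problem d) \<longleftrightarrow> ~ periodic X (set fs) x0"
proof
 assume "nonperiodic_cert (encode_problem d)"
 then consider (fold) tu d' where "reads (encode_problem d) tu d'" "kfold (kzero (fst tu)) d'"
  | (large) B tu d' tu' d'' where "reads (encode_problem d) tu d'" "kbound (fst tu) d' B"
  "reads (encode_problem d) tu' d''" "kmany (kzero (fst tu')) d'' B"
  unfolding nonperiodic_cert_def by blast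
 then show "~ periodic X (set fs) x0"
 proof cases
  case fold
  obtain th where th: "match th d'" "!!x. kzero (fst tu) x ==> kval th x = 0" using reading_root[OF fold(1)] by blast
  show ?thesis using kfold_sound[OF th fold(2)] unfolding periodic_iff by blast
 next
  case large
  obtain th where th: "algebraic th" "fwf (fst tu)" "tval th (fterms (fst tu)) = 0" "match th d'" using reading_root[OF large(1)] by blast
  obtain th' where th': "match th' d''" "!!x. kzero (fst tu') x ==> kval th' x = 0" using reading_root[OF large(3)] by blast
  show ?thesis
  proof
  assume "periodic X (set fs) x0"
  then have fin: "finite orb" and inj: "!!s. s < length fs ==> inj_on (F s) orb" unfolding periodic_iff by blast+
  show False using kbound_sound[OF th(4,1-3) large(2) fin inj] kmany_sound[OF th' large(4) fin] by simp
  qed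
 qed
next
 assume not: "~ periodic X (set fs) x0"
 show "nonperiodic_cert (encode_problem d)"
 proof (cases "\<forall>s<length fs. inj_on (F s) orb")
  case False
  then obtain s p p' where "s < length fs" "p : orb" "p' : orb" "p ~= p'" "F s p = F s p'" unfolding inj_on_def by blast
  from evt_reading[OF kfold_complete[OF this]] obtain th tu d' where e: "ALL d'. match th d' --> kfold (kz th) d'"
  "reads (encode_problem d) tu d'" "kzero (fst tu) = kz th" "match th d'" by blast
  have "kfold (kzero (fst tu)) d'" unfolding e(3) using e(1,4) by blast
  then show ?thesis unfolding nonperiodic_cert_def using e(2) by blast
 next
  case True
  then have inf: "infinite orb" using not unfolding periodic_iff by blast
  from evt_reading[OF kbound_complete] obtain th tu d' where e: "ALL d' f. match th d' --> minimal_cert f th --> (EX B. kbound f d' B)"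
  "reads (encode_problem d) tu d'" "minimal_cert (fst tu) th" "match th d'" by blast
  then obtain B where B: "kbound (fst tu) d' B" by blast
  obtain T where T: "finite T" "card T = Suc B" "T <= orb" using infinite_arbitrarily_large[OF inf, of "Suc B"] by blast
  have "B < card T" using T(2) by simp
  from evt_reading[OF kmany_complete[OF T(1,3) this]] obtain th' tu' d'' where e': "ALL d'. match th' d' --> kmany (kz th') d' B"
  "reads (encode_problem d) tu' d''" "kzero (fst tu') = kz th'" "match th' d''" by blast
  have "kmany (kzero (fst tu')) d'' B" unfolding e'(3) using e'(1,4) by blast
  then show ?thesis unfolding nonperiodic_cert_def using B e(2) e'(2) by blast
 qed
qed

end

theorem theorem1p4:
  shows "\<exists>A :: recf. \<forall>(V :: ('p, 's) space) S x d.
    variety V \<longrightarrow> finite S \<longrightarrow> (\<forall>f \<in> S. endomorphism V f) \<longrightarrow> x \<in> rational_points V \<longrightarrow>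
    presents d V S x \<longrightarrow>
    (\<forall>r. computes A [encode_problem d] r \<longleftrightarrow> r = (if periodic V S x then 1 else 0))"
proof -
 obtain A where A: "!!n. periodic_cert n ~= nonperiodic_cert n ==>
  ALL r. computes A [n] r \<longleftrightarrow> r = (if periodic_cert n then 1 else 0)"
  using decide_by_parallel_search[OF RE_periodic_cert RE_nonperiodic_cert] by blast
 have "ALL r. computes A [encode_problem d] r \<longleftrightarrow> r = (if periodic V S x then 1 else 0)"
  if V: "variety V" and S: "ALL f:S. endomorphism V f" and x: "x : rational_points V" and pr: "presents d V S x"
  for V :: "('p, 's) space" and S x d
 proof -
  obtain Cs Os Fs i a where d: "d = Problem Cs Os Fs i a" by (cases d)
  obtain U y fs where f: "presents_variety V U y Cs Os" "S = set fs" "list_all2 (presents_endomorphism V U y Cs) Fs fs"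
  "presents_point V U y Cs i a x" using pr unfolding d presents.simps by blast
  have "locally_ringed_space V" using V unfolding variety_def scheme_def by blast
  then interpret I: presented_problem V U y Cs Os Fs fs i a x
  by unfold_locales (use f S x in auto)
  have e: "periodic_cert (encode_problem d) \<longleftrightarrow> periodic V S x" "nonperiodic_cert (encode_problem d) \<longleftrightarrow> ~ periodic V S x"
  using I.periodic_cert_iff I.nonperiodic_cert_iff unfolding I.d_def d f(2) by blast+
  then show ?thesis using A[of "encode_problem d"] by simp
 qed
 then show ?thesis by blast
qed

end
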